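(* Let $p$ be a prime and $P$ a finite $p$-group. If $H^*(P)$ is reduced, and $V<P$ is a maximal elementary abelian $p$-subgroup, then $C_P(V)=V$, and thus $Out_0(C_P(V),V)$ is the trivial group.
   Context: $H^*(P)$ is the mod $p$ cohomology of $P$. It is called reduced if the product of restriction maps $H^*(P)\to\prod_V H^*(V)$ over all elementary abelian $p$-subgroups $V<P$ is injective (equivalently, $H^*(P)\to\mathcal{H}^*(P)=\lim_{V\in\mathcal{A}(P)}H^*(V)$ is monic, where $\mathcal{A}(P)$ is Quillen's category of elementary abelian $p$-subgroups with morphisms generated by inclusions and conjugations). $C_P(V)$ is the centralizer of $V$ in $P$. "Maximal" is with respect to inclusion among elementary abelian subgroups of $P$. For $V<Q$, $Out_0(Q,V)$ is the image in $Out(Q)=Aut(Q)/Inn(Q)$ of the group of automorphisms of $Q$ fixing $V$ pointwise. *)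

theory Defs
  imports "HOL-Algebra.Bij" "HOL-Algebra.Product_Groups" "HOL-Number_Theory.Residues"
begin

section \<open>Finite p-groups, elementary abelian subgroups and centralizers\<close>

definition finite_p_group :: "nat \<Rightarrow> ('a, 'b) monoid_scheme \<Rightarrow> bool" where
  "finite_p_group p G \<longleftrightarrow> group G \<and> finite (carrier G) \<and> (\<exists>n. order G = p ^ n)"

text \<open>The trivial subgroup counts as elementary abelian (of rank 0).\<close>

definition elementary_abelian_subgroups :: "nat \<Rightarrow> ('a, 'b) monoid_scheme \<Rightarrow> 'a set set" where
  "elementary_abelian_subgroups p G =
     {V. subgroup V G \<and> comm_group (G\<lparr>carrier := V\<rparr>) \<and> (\<forall>v\<in>V. v [^]\<^bsub>G\<^esub> p = \<one>\<^bsub>G\<^esub>)}"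

definition maximal_elementary_abelian :: "nat \<Rightarrow> ('a, 'b) monoid_scheme \<Rightarrow> 'a set \<Rightarrow> bool" where
  "maximal_elementary_abelian p G V \<longleftrightarrow>
     V \<in> elementary_abelian_subgroups p G \<and>
     (\<forall>W\<in>elementary_abelian_subgroups p G. V \<subseteq> W \<longrightarrow> W = V)"

definition centralizer :: "('a, 'b) monoid_scheme \<Rightarrow> 'a set \<Rightarrow> 'a set" where
  "centralizer G S = {g \<in> carrier G. \<forall>s\<in>S. g \<otimes>\<^bsub>G\<^esub> s = s \<otimes>\<^bsub>G\<^esub> g}"


section \<open>Outer automorphisms\<close>

definition Inn :: "('a, 'b) monoid_scheme \<Rightarrow> ('a \<Rightarrow> 'a) set" where
  "Inn Q = (\<lambda>g. \<lambda>x\<in>carrier Q. g \<otimes>\<^bsub>Q\<^esub> x \<otimes>\<^bsub>Q\<^esub> inv\<^bsub>Q\<^esub> g) ` carrier Q"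

definition Out :: "('a, 'b) monoid_scheme \<Rightarrow> ('a \<Rightarrow> 'a) set monoid" where
  "Out Q = AutoGroup Q Mod Inn Q"

definition Out0 :: "('a, 'b) monoid_scheme \<Rightarrow> 'a set \<Rightarrow> ('a \<Rightarrow> 'a) set monoid" where
  "Out0 Q V = (Out Q)\<lparr>carrier :=
     (\<lambda>f. Inn Q #>\<^bsub>AutoGroup Q\<^esub> f) ` {f \<in> carrier (AutoGroup Q). \<forall>v\<in>V. f v = v}\<rparr>"


section \<open>Group cohomology with trivial coefficients\<close>

text \<open>
  Cohomology of the inhomogeneous bar complex: an n-cochain of the group G with values in the
  trivial module R is a function on n-tuples of elements of G (lists of length n), taken to be
  extensional. All groups below are written multiplicatively, although the operation comes from
  addition in R.
\<close>

definition tuples :: "('a, 'b) monoid_scheme \<Rightarrow> nat \<Rightarrow> 'a list set" where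
  "tuples G n = {gs. length gs = n \<and> set gs \<subseteq> carrier G}"

definition cochains ::
    "('a, 'b) monoid_scheme \<Rightarrow> ('c, 'd) ring_scheme \<Rightarrow> nat \<Rightarrow> ('a list \<Rightarrow> 'c) monoid" where
  "cochains G R n = product_group (tuples G n) (\<lambda>_. add_monoid R)"

definition contract :: "('a, 'b) monoid_scheme \<Rightarrow> nat \<Rightarrow> 'a list \<Rightarrow> 'a list" where
  "contract G i gs = take i gs @ (gs ! i \<otimes>\<^bsub>G\<^esub> gs ! Suc i) # drop (i + 2) gs"

text \<open>
  With tuples indexed from 0, the differential is
  \[ (\delta f)(g_0,\dots,g_n) = f(g_1,\dots,g_n)
     + \sum_{i<n} (-1)^{i+1} f(g_0,\dots,g_i g_{i+1},\dots,g_n)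
     + (-1)^{n+1} f(g_0,\dots,g_{n-1}). \]
\<close>

definition coboundary ::
    "('a, 'b) monoid_scheme \<Rightarrow> ('c, 'd) ring_scheme \<Rightarrow> nat \<Rightarrow> ('a list \<Rightarrow> 'c) \<Rightarrow> 'a list \<Rightarrow> 'c" where
  "coboundary G R n f = (\<lambda>gs\<in>tuples G (Suc n).
     f (tl gs)
     \<oplus>\<^bsub>R\<^esub> (\<Oplus>\<^bsub>R\<^esub>i\<in>{..<n}. (\<ominus>\<^bsub>R\<^esub> \<one>\<^bsub>R\<^esub>) [^]\<^bsub>R\<^esub> Suc i \<otimes>\<^bsub>R\<^esub> f (contract G i gs))
     \<oplus>\<^bsub>R\<^esub> (\<ominus>\<^bsub>R\<^esub> \<one>\<^bsub>R\<^esub>) [^]\<^bsub>R\<^esub> Suc n \<otimes>\<^bsub>R\<^esub> f (butlast gs))"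

definition cocycles ::
    "('a, 'b) monoid_scheme \<Rightarrow> ('c, 'd) ring_scheme \<Rightarrow> nat \<Rightarrow> ('a list \<Rightarrow> 'c) monoid" where
  "cocycles G R n = (cochains G R n)
     \<lparr>carrier := kernel (cochains G R n) (cochains G R (Suc n)) (coboundary G R n)\<rparr>"

definition coboundaries ::
    "('a, 'b) monoid_scheme \<Rightarrow> ('c, 'd) ring_scheme \<Rightarrow> nat \<Rightarrow> ('a list \<Rightarrow> 'c) set" where
  "coboundaries G R n = (case n of
       0 \<Rightarrow> {\<one>\<^bsub>cochains G R 0\<^esub>}
     | Suc m \<Rightarrow> coboundary G R m ` carrier (cochains G R m))"

definition cohomology ::
    "('a, 'b) monoid_scheme \<Rightarrow> ('c, 'd) ring_scheme \<Rightarrow> nat \<Rightarrow> ('a list \<Rightarrow> 'c) set monoid" where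
  "cohomology G R n = cocycles G R n Mod coboundaries G R n"

definition cohomology_class ::
    "('a, 'b) monoid_scheme \<Rightarrow> ('c, 'd) ring_scheme \<Rightarrow> nat \<Rightarrow> ('a list \<Rightarrow> 'c) \<Rightarrow> ('a list \<Rightarrow> 'c) set" where
  "cohomology_class G R n f = coboundaries G R n #>\<^bsub>cocycles G R n\<^esub> f"

text \<open>
  Restriction to a subgroup H in degree n sends the class of a cocycle f to the class of f
  restricted to tuples in H. An element c of the cohomology group is a coset of cocycles, and
  the set of classes obtained from its representatives is a singleton.
\<close>

definition restriction ::
    "('a, 'b) monoid_scheme \<Rightarrow> ('c, 'd) ring_scheme \<Rightarrow> 'a set \<Rightarrow> nat
      \<Rightarrow> ('a list \<Rightarrow> 'c) set \<Rightarrow> ('a list \<Rightarrow> 'c) set" where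
  "restriction G R H n c =
     the_elem ((\<lambda>f. cohomology_class (G\<lparr>carrier := H\<rparr>) R n (restrict f (tuples (G\<lparr>carrier := H\<rparr>) n))) ` c)"


section \<open>Mod p cohomology\<close>

text \<open>The direct sum over all degrees of the cohomology groups with coefficients in the field
  of p elements; the cup product plays no role below and is not recorded.\<close>

definition mod_cohomology ::
    "nat \<Rightarrow> ('a, 'b) monoid_scheme \<Rightarrow> (nat \<Rightarrow> ('a list \<Rightarrow> int) set) monoid" where
  "mod_cohomology p G = sum_group UNIV (cohomology G (residue_ring (int p)))"

definition mod_restriction ::
    "nat \<Rightarrow> ('a, 'b) monoid_scheme \<Rightarrow> 'a set
      \<Rightarrow> (nat \<Rightarrow> ('a list \<Rightarrow> int) set) \<Rightarrow> nat \<Rightarrow> ('a list \<Rightarrow> int) set" where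
  "mod_restriction p G H x = (\<lambda>n. restriction G (residue_ring (int p)) H n (x n))"

definition reduced_mod_cohomology :: "nat \<Rightarrow> ('a, 'b) monoid_scheme \<Rightarrow> bool" where
  "reduced_mod_cohomology p G \<longleftrightarrow>
     inj_on (\<lambda>x. \<lambda>V\<in>elementary_abelian_subgroups p G. mod_restriction p G V x)
       (carrier (mod_cohomology p G))"

end

(* Suppose C = C_P(V) is larger than V. A nonzero class of P that vanishes on all elementary
   abelian subgroups is then obtained as a transfer from C. Let x : C -> Z/p be a character that
   kills V but not a given c. For U of index p in V, the central subgroup V/U of C/U has order p
   and acts freely on a simplicial sphere; the resulting Euler class of C/U, pulled back to C,
   restricts on V to a unit multiple of a power of a linear form with kernel U. Let b be the
   product of x and several such Euler classes. Since b vanishes on V, and by maximality V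
   contains all elements of order p of C, the double coset formula shows that the transfer of b
   vanishes on all elementary abelian subgroups.

   On C the transfer is a sum over the cosets tC. Those moved by V contribute nothing, and for
   the others t normalizes V and the contribution is the conjugate of b by t. A functional that
   pairs a cochain with the shuffle product of [c] and a cycle on V with polynomial coefficients
   kills coboundaries and sends this conjugate to x(t^-1 c t) times a product of powers of linear
   forms, one factor for each Euler class. Distinct cosets are distinguished by such powers, so by
   Artin's independence of characters some choice of the Euler classes makes the sum nonzero.

   Cochains are integer-valued homogeneous cochains on lists, considered modulo p. *)

theory Submission
  imports Defs "HOL-Algebra.Sylow" "HOL-Computational_Algebra.Computational_Algebra" "HOL-Number_Theory.Number_Theory"
begin

section \<open>Homogeneous cochains on lists\<close>

text \<open>No elementary abelian subgroup may see the transferred class, so it is detected through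
  the homomorphism (v, i) |-> v c^i from V x Z to C, which exists because V is central in C. This is
  why the single letter c is shuffled into a cycle on V. Classes of V need not extend to C. Euler
  classes live on C by construction, and their restrictions to V are still known. The cycle on V
  alternates the letters y^(p-1) and y, where y = sum beta_v v has augmentation zero, hence y^p = 0
  modulo p. It is the periodic cycle of the cyclic shifted subgroup generated by 1 + y. Evaluation
  on it is multiplicative on even classes, and a degree-two step of a linear form k gives (sum
  beta_v k(v))^p, one factor for each of the p letters y in a pair. Generic coefficients beta in
  \<open>int poly\<close> keep different forms apart. Being a p-group matters twice: such a group
  acts on the top cycles of the sphere trivially modulo p, and an element that conjugates a, of
  order p, to a power of a already centralizes a. The second fact separates the fixed cosets, as
  Artin's argument requires.\<close>

definition eqm :: "'k::comm_ring_1 \<Rightarrow> 'k \<Rightarrow> 'k \<Rightarrow> bool" where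
  "eqm P a b \<longleftrightarrow> P dvd (a - b)"

lemma eqm_refl [simp, intro!]: "eqm P a a"
  by (simp add: eqm_def)

lemma eqm_eq: "a = b \<Longrightarrow> eqm P a b"
  by simp

lemma eqm_sym: "eqm P a b \<Longrightarrow> eqm P b a"
  unfolding eqm_def using dvd_minus_iff[of P "a - b"] by simp

lemma eqm_trans [trans]: "eqm P a b \<Longrightarrow> eqm P b c \<Longrightarrow> eqm P a c"
  unfolding eqm_def using dvd_add[of P "a - b" "b - c"] by simp

lemma eqm_add: "eqm P a b \<Longrightarrow> eqm P c d \<Longrightarrow> eqm P (a + c) (b + d)"
  unfolding eqm_def using dvd_add[of P "a - b" "c - d"] by (simp add: algebra_simps)

lemma eqm_minus: "eqm P a b \<Longrightarrow> eqm P (- a) (- b)"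
  unfolding eqm_def using dvd_minus_iff[of P "a - b"] by simp

lemma eqm_diff: "eqm P a b \<Longrightarrow> eqm P c d \<Longrightarrow> eqm P (a - c) (b - d)"
  using eqm_add[of P a b "-c" "-d"] eqm_minus[of P c d] by simp

lemma eqm_mult: "eqm P a b \<Longrightarrow> eqm P c d \<Longrightarrow> eqm P (a * c) (b * d)"
proof -
  assume "eqm P a b" "eqm P c d"
  moreover have "a * c - b * d = (a - b) * c + b * (c - d)" by (simp add: algebra_simps)
  ultimately show ?thesis unfolding eqm_def by (metis dvd_add dvd_mult dvd_mult2)
qed

lemma eqm_power: "eqm P a b \<Longrightarrow> eqm P (a ^ n) (b ^ n)"
  by (induction n) (auto intro: eqm_mult)

lemma eqm_sum: "(\<And>i. i \<in> I \<Longrightarrow> eqm P (f i) (g i)) \<Longrightarrow> eqm P (sum f I) (sum g I)"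
  by (induction I rule: infinite_finite_induct) (auto intro: eqm_add)

lemma eqm_of_int:
  assumes "eqm (int p) a b"
  shows "eqm (of_nat p :: 'k::comm_ring_1) (of_int a) (of_int b)"
proof -
  obtain c where "a - b = int p * c" using assms by (auto simp: eqm_def dvd_def)
  then have "(of_int a - of_int b :: 'k) = of_nat p * of_int c"
    by (metis of_int_diff of_int_mult of_int_of_nat_eq)
  then show ?thesis by (simp add: eqm_def)
qed

lemma eqm_0_iff: "eqm P a 0 \<longleftrightarrow> P dvd a"
  by (simp add: eqm_def)

text \<open>The alternating sum over deleted entries (\<open>cobd_index\<close>), written so that
  deleting the head is split off, because the inductions on words proceed this way. On a one-element
  list the value is \<open>f []\<close>, so the complex is augmented.\<close>

fun cobd :: "('a list \<Rightarrow> 'k::comm_ring_1) \<Rightarrow> 'a list \<Rightarrow> 'k" where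
  "cobd f [] = 0"
| "cobd f (x # xs) = f xs - cobd (\<lambda>ys. f (x # ys)) xs"

lemma cobd_add: "cobd (\<lambda>xs. f xs + g xs) xs = cobd f xs + cobd g xs"
  by (induction xs arbitrary: f g) (auto simp: algebra_simps)

lemma cobd_diff: "cobd (\<lambda>xs. f xs - g xs) xs = cobd f xs - cobd g xs"
  by (induction xs arbitrary: f g) (auto simp: algebra_simps)

lemma cobd_minus: "cobd (\<lambda>xs. - g xs) xs = - cobd g xs"
  by (induction xs arbitrary: g) (auto simp: algebra_simps)

lemma cobd_cmult: "cobd (\<lambda>xs. c * f xs) xs = c * cobd f xs"
  by (induction xs arbitrary: f) (auto simp: algebra_simps)

lemma cobd_zero: "cobd (\<lambda>xs. 0) xs = 0"
  by (induction xs) auto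

lemma cobd_sum: "cobd (\<lambda>xs. \<Sum>i\<in>I. f i xs) xs = (\<Sum>i\<in>I. cobd (f i) xs)"
  by (induction I rule: infinite_finite_induct) (auto simp: cobd_zero cobd_add)

lemma cobd_of_int: "cobd (\<lambda>xs. of_int (f xs)) xs = of_int (cobd f xs)"
  by (induction xs arbitrary: f) auto

lemma cobd_cobd: "cobd (cobd f) xs = 0"
proof (induction xs arbitrary: f)
  case (Cons x xs)
  have "cobd (\<lambda>ys. cobd f (x # ys)) xs = cobd f xs - cobd (cobd (\<lambda>ys. f (x # ys))) xs"
    by (simp add: cobd_diff)
  then show ?case using Cons by simp
qed simp

lemma cobd_map: "cobd (\<lambda>ys. f (map \<phi> ys)) xs = cobd f (map \<phi> xs)"
proof (induction xs arbitrary: f)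
  case (Cons x xs)
  show ?case using Cons[of "\<lambda>ys. f (\<phi> x # ys)"] by simp
qed simp

lemma cobd_cong:
  assumes "set xs \<subseteq> A" and "length xs = Suc n"
    and "\<And>ys. set ys \<subseteq> A \<Longrightarrow> length ys = n \<Longrightarrow> eqm P (f ys) (g ys)"
  shows "eqm P (cobd f xs) (cobd g xs)"
  using assms
proof (induction xs arbitrary: f g n)
  case (Cons x xs)
  show ?case
  proof (cases n)
    case 0
    with Cons show ?thesis by simp
  next
    case (Suc k)
    have "eqm P (cobd (\<lambda>ys. f (x # ys)) xs) (cobd (\<lambda>ys. g (x # ys)) xs)"
      using Cons.prems Suc by (intro Cons.IH[where n = k]) auto
    moreover have "eqm P (f xs) (g xs)" using Cons.prems by simp
    ultimately show ?thesis by (auto intro: eqm_diff)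
  qed
qed simp

lemma cobd_cong_eq:
  assumes "set xs \<subseteq> A" and "length xs = Suc n"
    and "\<And>ys. set ys \<subseteq> A \<Longrightarrow> length ys = n \<Longrightarrow> f ys = g ys"
  shows "cobd f xs = cobd g xs"
  using cobd_cong[of xs A n 0 f g] assms by (simp add: eqm_def)

lemma cobd_index:
  "cobd f xs = (\<Sum>i<length xs. (- 1) ^ i * f (take i xs @ drop (Suc i) xs))"
proof (induction xs arbitrary: f)
  case (Cons x xs)
  have "cobd f (x # xs) = f xs - (\<Sum>i<length xs. (- 1) ^ i * f (x # take i xs @ drop (Suc i) xs))"
    using Cons by simp
  also have "\<dots> = (\<Sum>i<Suc (length xs). (- 1) ^ i * f (take i (x # xs) @ drop (Suc i) (x # xs)))"
    by (subst sum.lessThan_Suc_shift) (simp add: sum_negf)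
  finally show ?case by simp
qed simp

text \<open>The alternating sum over the simplices of a prism, which follow the list up to some
  vertex, repeat that vertex through phi and stay in the image of phi afterwards. It is the homotopy
  used whenever vertices are moved by a retraction.\<close>

fun prism :: "('a \<Rightarrow> 'a) \<Rightarrow> ('a list \<Rightarrow> 'k::comm_ring_1) \<Rightarrow> 'a list \<Rightarrow> 'k" where
  "prism \<phi> f [] = 0"
| "prism \<phi> f (x # xs) = f (x # \<phi> x # map \<phi> xs) - prism \<phi> (\<lambda>ys. f (x # ys)) xs"

lemma prism_diff: "prism \<phi> (\<lambda>xs. f xs - g xs) xs = prism \<phi> f xs - prism \<phi> g xs"
  by (induction xs arbitrary: f g) (auto simp: algebra_simps)

lemma prism_homotopy: "cobd (prism \<phi> f) xs + prism \<phi> (cobd f) xs = f (map \<phi> xs) - f xs"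
proof (induction xs arbitrary: f)
  case (Cons x xs)
  let ?f = "\<lambda>ys. f (x # ys)"
  have 1: "cobd (prism \<phi> f) (x # xs)
      = prism \<phi> f xs - (cobd (\<lambda>ys. f (x # \<phi> x # ys)) (map \<phi> xs) - cobd (prism \<phi> ?f) xs)"
    using cobd_map[of "\<lambda>ys. f (x # \<phi> x # ys)" \<phi> xs] by (simp add: cobd_diff)
  have 2: "prism \<phi> (cobd f) (x # xs)
     = f (\<phi> x # map \<phi> xs) - (f (x # map \<phi> xs) - cobd (\<lambda>ys. f (x # \<phi> x # ys)) (map \<phi> xs))
       - (prism \<phi> f xs - prism \<phi> (cobd ?f) xs)"
    by (simp add: prism_diff)
  show ?case using 1 2 Cons[of ?f] by (simp add: algebra_simps)
qed simp

lemma prism_cong: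
  assumes "set xs \<subseteq> A" and "length xs = n" and "\<phi> ` A \<subseteq> A"
    and "\<And>ys. set ys \<subseteq> A \<Longrightarrow> length ys = Suc n \<Longrightarrow> eqm P (f ys) (g ys)"
  shows "eqm P (prism \<phi> f xs) (prism \<phi> g xs)"
  using assms
proof (induction xs arbitrary: f g n)
  case (Cons x xs)
  then obtain k where k: "n = Suc k" by auto
  have "eqm P (prism \<phi> (\<lambda>ys. f (x # ys)) xs) (prism \<phi> (\<lambda>ys. g (x # ys)) xs)"
    using Cons.prems k by (intro Cons.IH[where n = k]) auto
  moreover have "eqm P (f (x # \<phi> x # map \<phi> xs)) (g (x # \<phi> x # map \<phi> xs))"
    using Cons.prems by (intro Cons.prems(4)) auto
  ultimately show ?case by (auto intro: eqm_diff)
qed simp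

lemma prism_zero: "prism \<phi> (\<lambda>xs. 0) xs = 0"
  by (induction xs) auto

lemma prism_map:
  assumes "set xs \<subseteq> A" and "\<And>x. x \<in> A \<Longrightarrow> \<phi> (\<tau> x) = \<tau> (\<phi> x)" and "\<phi> ` A \<subseteq> A"
  shows "prism \<phi> f (map \<tau> xs) = prism \<phi> (\<lambda>ys. f (map \<tau> ys)) xs"
  using assms(1)
proof (induction xs arbitrary: f)
  case (Cons x xs)
  have "map \<phi> (map \<tau> xs) = map \<tau> (map \<phi> xs)"
    using Cons.prems assms(2) by auto
  moreover have "\<phi> (\<tau> x) = \<tau> (\<phi> x)" using Cons.prems assms(2) by simp
  ultimately show ?case using Cons.IH Cons.prems by (simp del: map_map)
qed simp

text \<open>The Alexander-Whitney product: front face and back face share the vertex at position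
  a.\<close>

definition cup :: "nat \<Rightarrow> ('a list \<Rightarrow> 'k::comm_ring_1) \<Rightarrow> ('a list \<Rightarrow> 'k) \<Rightarrow> 'a list \<Rightarrow> 'k" where
  "cup a f g xs = f (take (Suc a) xs) * g (drop a xs)"

lemma cup_Suc: "cup (Suc a) f g (x # xs) = cup a (\<lambda>ys. f (x # ys)) g xs"
  by (simp add: cup_def)

lemma cobd_cup:
  "length xs \<ge> a + 2 \<Longrightarrow>
     cobd (cup a f g) xs = cup (Suc a) (cobd f) g xs + (- 1) ^ a * cup a f (cobd g) xs"
proof (induction a arbitrary: f xs)
  case 0
  then obtain x y ys where xs: "xs = x # y # ys"
    by (cases xs; cases "tl xs") auto
  have "cobd (\<lambda>zs. f [x] * g (x # zs)) (y # ys) = f [x] * cobd (\<lambda>zs. g (x # zs)) (y # ys)"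
    by (rule cobd_cmult)
  then show ?case by (simp add: xs cup_def algebra_simps)
next
  case (Suc a)
  then obtain x ys where xs: "xs = x # ys" and l: "length ys \<ge> a + 2"
    by (cases xs) auto
  have e: "take (Suc (Suc a)) ys \<noteq> []" using l by auto
  have "cobd (cup (Suc a) f g) xs = cup (Suc a) f g ys - cobd (cup a (\<lambda>zs. f (x # zs)) g) ys"
    by (simp add: xs cup_Suc)
  also have "\<dots> = cup (Suc a) f g ys - cup (Suc a) (cobd (\<lambda>zs. f (x # zs))) g ys
      - (- 1) ^ a * cup a (\<lambda>zs. f (x # zs)) (cobd g) ys"
    using Suc.IH[OF l] by simp
  also have "cup (Suc a) f g ys - cup (Suc a) (cobd (\<lambda>zs. f (x # zs))) g ys
      = cup (Suc (Suc a)) (cobd f) g xs"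
    by (simp add: cup_def xs algebra_simps)
  finally show ?case by (simp add: xs cup_Suc)
qed

section \<open>Evaluation of cochains on words of operators\<close>

text \<open>A letter acts on functions of one vertex like an element of a group ring acting from the
  right; EV evaluates a cochain on the chain that begins at g and takes one step for each
  letter. Consecutive letters with product zero give a cycle, as in the periodic resolution
  of a cyclic group.\<close>

fun EV :: "('a list \<Rightarrow> 'k::comm_ring_1) \<Rightarrow> 'a \<Rightarrow> (('a \<Rightarrow> 'k) \<Rightarrow> 'a \<Rightarrow> 'k) list \<Rightarrow> 'k" where
  "EV f g [] = f [g]"
| "EV f g (a # as) = a (\<lambda>h. EV (\<lambda>xs. f (g # xs)) h as) g"

definition lin :: "(('a \<Rightarrow> 'k::comm_ring_1) \<Rightarrow> 'a \<Rightarrow> 'k) \<Rightarrow> bool" where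
  "lin a \<longleftrightarrow> (\<forall>\<Phi> \<Psi>. a (\<lambda>h. \<Phi> h + \<Psi> h) = (\<lambda>h. a \<Phi> h + a \<Psi> h)) \<and>
     (\<forall>c \<Phi>. a (\<lambda>h. c * \<Phi> h) = (\<lambda>h. c * a \<Phi> h))"

lemma lin_add: "lin a \<Longrightarrow> a (\<lambda>h. \<Phi> h + \<Psi> h) g = a \<Phi> g + a \<Psi> g"
  and lin_cmult: "lin a \<Longrightarrow> a (\<lambda>h. c * \<Phi> h) g = c * a \<Phi> g"
  by (auto simp: lin_def)

lemma lin_zero: "lin a \<Longrightarrow> a (\<lambda>h. 0) g = 0"
  using lin_cmult[of a 0 "\<lambda>h. 0" g] by simp

lemma lin_minus: "lin a \<Longrightarrow> a (\<lambda>h. - \<Psi> h) g = - a \<Psi> g"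
  using lin_cmult[of a "-1" "\<Psi>" g] by simp

lemma lin_diff: "lin a \<Longrightarrow> a (\<lambda>h. \<Phi> h - \<Psi> h) g = a \<Phi> g - a \<Psi> g"
  using lin_add[of a \<Phi> "\<lambda>h. - \<Psi> h" g] lin_minus[of a \<Psi> g] by simp

lemma lin_sum: "lin a \<Longrightarrow> a (\<lambda>h. \<Sum>i\<in>I. \<Phi> i h) g = (\<Sum>i\<in>I. a (\<Phi> i) g)"
  by (induction I rule: infinite_finite_induct) (auto simp: lin_zero[of a] lin_add[of a])

lemma lin_comp: "lin a \<Longrightarrow> lin b \<Longrightarrow> lin (a \<circ> b)"
  by (simp add: lin_def)

lemma lin_funpow: "lin a \<Longrightarrow> lin (a ^^ n)"
  by (induction n) (simp_all add: lin_def)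

lemma EV_head: "(\<And>xs. f (g # xs) = f' (g # xs)) \<Longrightarrow> EV f g as = EV f' g as"
  by (cases as) auto

lemma EV_add: "\<forall>a\<in>set as. lin a \<Longrightarrow> EV (\<lambda>xs. f xs + f' xs) g as = EV f g as + EV f' g as"
proof (induction as arbitrary: f f' g)
  case (Cons a as)
  then show ?case by (simp add: lin_add[of a])
qed simp

lemma EV_cmult: "\<forall>a\<in>set as. lin a \<Longrightarrow> EV (\<lambda>xs. c * f xs) g as = c * EV f g as"
proof (induction as arbitrary: f g)
  case (Cons a as)
  then show ?case by (simp add: lin_cmult[of a])
qed simp

lemma EV_diff: "\<forall>a\<in>set as. lin a \<Longrightarrow> EV (\<lambda>xs. f xs - f' xs) g as = EV f g as - EV f' g as"
proof (induction as arbitrary: f f' g)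
  case (Cons a as)
  then show ?case by (simp add: lin_diff[of a])
qed simp

lemma EV_zero: "\<forall>a\<in>set as. lin a \<Longrightarrow> EV (\<lambda>xs. 0) g as = 0"
proof (induction as arbitrary: g)
  case (Cons a as)
  then show ?case by (simp add: lin_zero[of a])
qed simp

lemma EV_sum:
  "\<forall>a\<in>set as. lin a \<Longrightarrow> EV (\<lambda>xs. \<Sum>i\<in>I. f i xs) g as = (\<Sum>i\<in>I. EV (f i) g as)"
  by (induction I rule: infinite_finite_induct) (auto simp: EV_zero EV_add)

text \<open>The part of an evaluated coboundary in which the base vertex is kept; deleting the base
  vertex gives the other term of \<open>EV_cobd\<close>.\<close>

fun TT :: "('a list \<Rightarrow> 'k::comm_ring_1) \<Rightarrow> 'a \<Rightarrow> (('a \<Rightarrow> 'k) \<Rightarrow> 'a \<Rightarrow> 'k) list \<Rightarrow> 'k" where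
  "TT f g [] = 0"
| "TT f g (a # as) = a (\<lambda>h. EV (cobd (\<lambda>xs. f (g # xs))) h as) g"

lemma EV_cobd:
  assumes "\<forall>b\<in>set (a # as). lin b"
  shows "EV (cobd f) g (a # as) = a (\<lambda>h. EV f h as) g - TT f g (a # as)"
  using assms by (simp add: EV_diff lin_diff[of a])

text \<open>Deleting the vertex between the first two letters composes them, and deleting a later
  vertex leaves the first letter in place. Relations between neighbouring letters thereby become
  relations between faces.\<close>

lemma TT_step:
  assumes "\<forall>c\<in>set (a # b # as). lin c"
  shows "TT f g (a # b # as) = a (b (\<lambda>k. EV (\<lambda>xs. f (g # xs)) k as)) g
     - a (\<lambda>h. TT (\<lambda>xs. f (g # xs)) h (b # as)) g"
proof -
  have "TT f g (a # b # as) = a (\<lambda>h. EV (cobd (\<lambda>xs. f (g # xs))) h (b # as)) g" by simp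
  also have "\<dots> = a (\<lambda>h. b (\<lambda>k. EV (\<lambda>xs. f (g # xs)) k as) h - TT (\<lambda>xs. f (g # xs)) h (b # as)) g"
    using assms by (subst EV_cobd) auto
  also have "\<dots> = a (\<lambda>h. b (\<lambda>k. EV (\<lambda>xs. f (g # xs)) k as) h) g - a (\<lambda>h. TT (\<lambda>xs. f (g # xs)) h (b # as)) g"
    using assms by (subst lin_diff) auto
  finally show ?thesis by simp
qed

text \<open>The alternating sum over all positions at which the letter c can be inserted.\<close>

fun SH :: "(('a \<Rightarrow> 'k) \<Rightarrow> 'a \<Rightarrow> 'k) \<Rightarrow> ('a list \<Rightarrow> 'k::comm_ring_1) \<Rightarrow> 'a
    \<Rightarrow> (('a \<Rightarrow> 'k) \<Rightarrow> 'a \<Rightarrow> 'k) list \<Rightarrow> 'k" where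
  "SH c f g [] = EV f g [c]"
| "SH c f g (w # ws) = EV f g (c # w # ws) - w (\<lambda>h. SH c (\<lambda>xs. f (g # xs)) h ws) g"

lemma SH_diff:
  "lin c \<Longrightarrow> \<forall>a\<in>set as. lin a \<Longrightarrow> SH c (\<lambda>xs. f xs - f' xs) g as = SH c f g as - SH c f' g as"
proof (induction as arbitrary: f f' g)
  case Nil
  then show ?case using lin_diff[of c "\<lambda>h. f [g, h]" "\<lambda>h. f' [g, h]" g] by simp
next
  case (Cons a as)
  have "EV (\<lambda>xs. f xs - f' xs) g (c # a # as) = EV f g (c # a # as) - EV f' g (c # a # as)"
    by (rule EV_diff) (use Cons.prems in auto)
  then show ?case using Cons by (simp add: lin_diff[of a] del: EV.simps)
qed

lemma SH_sum:
  assumes "lin c" "\<forall>a\<in>set as. lin a"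
  shows "SH c (\<lambda>xs. \<Sum>i\<in>I. f i xs) g as = (\<Sum>i\<in>I. SH c (f i) g as)"
  using assms(2)
proof (induction as arbitrary: f g)
  case Nil
  show ?case using lin_sum[OF assms(1), of "\<lambda>i h. f i [g, h]" I g] by simp
next
  case (Cons a as)
  have "EV (\<lambda>xs. \<Sum>i\<in>I. f i xs) g (c # a # as) = (\<Sum>i\<in>I. EV (f i) g (c # a # as))"
    by (rule EV_sum) (use Cons.prems assms in auto)
  then show ?case using Cons by (simp add: lin_sum[of a] sum_subtractf del: EV.simps)
qed

section \<open>Equivariant letters, cycles and shuffles\<close>

locale letters =
  fixes P :: "'k::comm_ring_1" and B :: "'a set" and m :: "'a \<Rightarrow> 'a \<Rightarrow> 'a"
  assumes m_closed: "k \<in> B \<Longrightarrow> g \<in> B \<Longrightarrow> m k g \<in> B"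
    and m_trans: "g \<in> B \<Longrightarrow> h \<in> B \<Longrightarrow> \<exists>k\<in>B. h = m k g"
begin

text \<open>The model is a group ring acting on functions from the right, so that letters commute
  with left translation. The modulus P may also be 0, in which case congruences are
  equalities.\<close>

definition lop :: "(('a \<Rightarrow> 'k) \<Rightarrow> 'a \<Rightarrow> 'k) \<Rightarrow> bool" where
  "lop a \<longleftrightarrow> lin a \<and>
     (\<forall>\<Phi> \<Psi>. (\<forall>h\<in>B. eqm P (\<Phi> h) (\<Psi> h)) \<longrightarrow> (\<forall>g\<in>B. eqm P (a \<Phi> g) (a \<Psi> g))) \<and>
     (\<forall>\<Phi>. \<forall>k\<in>B. \<forall>g\<in>B. eqm P (a (\<lambda>h. \<Phi> (m k h)) g) (a \<Phi> (m k g)))"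

definition ann :: "(('a \<Rightarrow> 'k) \<Rightarrow> 'a \<Rightarrow> 'k) \<Rightarrow> (('a \<Rightarrow> 'k) \<Rightarrow> 'a \<Rightarrow> 'k) \<Rightarrow> bool" where
  "ann a b \<longleftrightarrow> (\<forall>\<Phi>. \<forall>g\<in>B. eqm P (a (b \<Phi>) g) 0)"

text \<open>Augmentation zero, in the picture of a group ring.\<close>

definition eps0 :: "(('a \<Rightarrow> 'k) \<Rightarrow> 'a \<Rightarrow> 'k) \<Rightarrow> bool" where
  "eps0 a \<longleftrightarrow> (\<forall>x. \<forall>g\<in>B. eqm P (a (\<lambda>_. x) g) 0)"

definition invf :: "nat \<Rightarrow> ('a list \<Rightarrow> 'k) \<Rightarrow> bool" where
  "invf n f \<longleftrightarrow> (\<forall>k\<in>B. \<forall>xs. set xs \<subseteq> B \<longrightarrow> length xs = n \<longrightarrow> eqm P (f (map (m k) xs)) (f xs))"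

lemma invfD: "invf n f \<Longrightarrow> k \<in> B \<Longrightarrow> set xs \<subseteq> B \<Longrightarrow> length xs = n \<Longrightarrow> eqm P (f (map (m k) xs)) (f xs)"
  by (auto simp: invf_def)

lemma lop_lin: "lop a \<Longrightarrow> lin a"
  by (simp add: lop_def)

lemma lop_cong: "lop a \<Longrightarrow> (\<And>h. h \<in> B \<Longrightarrow> eqm P (\<Phi> h) (\<Psi> h)) \<Longrightarrow> g \<in> B \<Longrightarrow> eqm P (a \<Phi> g) (a \<Psi> g)"
  by (simp add: lop_def)

lemma lop_equi: "lop a \<Longrightarrow> k \<in> B \<Longrightarrow> g \<in> B \<Longrightarrow> eqm P (a \<Phi> (m k g)) (a (\<lambda>h. \<Phi> (m k h)) g)"
  by (simp add: lop_def eqm_sym)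

lemma lop_zero: "lop a \<Longrightarrow> (\<And>h. h \<in> B \<Longrightarrow> eqm P (\<Phi> h) 0) \<Longrightarrow> g \<in> B \<Longrightarrow> eqm P (a \<Phi> g) 0"
  using lop_cong[of a \<Phi> "\<lambda>_. 0" g] by (simp add: lin_zero[of a] lop_lin)

lemma lopI:
  assumes "lin a" "\<And>\<Phi> \<Psi> g. (\<And>h. h \<in> B \<Longrightarrow> eqm P (\<Phi> h) (\<Psi> h)) \<Longrightarrow> g \<in> B \<Longrightarrow> eqm P (a \<Phi> g) (a \<Psi> g)"
    "\<And>\<Phi> k g. k \<in> B \<Longrightarrow> g \<in> B \<Longrightarrow> eqm P (a \<Phi> (m k g)) (a (\<lambda>h. \<Phi> (m k h)) g)"
  shows "lop a"
  using assms(1) unfolding lop_def by (intro conjI allI ballI impI assms(2) eqm_sym[OF assms(3)]) auto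

lemma lop_comp:
  assumes a: "lop a" and b: "lop b"
  shows "lop (a \<circ> b)"
proof (rule lopI)
  show "lin (a \<circ> b)" using a b by (simp add: lin_comp lop_lin)
  show "eqm P ((a \<circ> b) \<Phi> g) ((a \<circ> b) \<Psi> g)" if "\<And>h. h \<in> B \<Longrightarrow> eqm P (\<Phi> h) (\<Psi> h)" "g \<in> B" for \<Phi> \<Psi> g
    unfolding o_apply by (intro lop_cong[OF a] lop_cong[OF b] that)
  show "eqm P ((a \<circ> b) \<Phi> (m k g)) ((a \<circ> b) (\<lambda>h. \<Phi> (m k h)) g)" if "k \<in> B" "g \<in> B" for \<Phi> k g
  proof -
    have "eqm P (a (b \<Phi>) (m k g)) (a (\<lambda>h. b \<Phi> (m k h)) g)" by (rule lop_equi[OF a that])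
    also have "eqm P \<dots> (a (b (\<lambda>h. \<Phi> (m k h))) g)"
      by (rule lop_cong[OF a]) (use lop_equi[OF b \<open>k \<in> B\<close>] that in auto)
    finally show ?thesis by simp
  qed
qed

lemma lop_id: "lop id"
  by (rule lopI) (auto simp: lin_def)

lemma lop_funpow: "lop a \<Longrightarrow> lop (a ^^ n)"
proof (induction n)
  case 0
  then show ?case using lop_id by (simp add: id_def)
next
  case (Suc n)
  then show ?case using lop_comp[of a "a ^^ n"] by (simp add: comp_def)
qed

lemma EV_cong:
  assumes "\<forall>a\<in>set as. lop a" "g \<in> B"
    and "\<And>xs. set xs \<subseteq> B \<Longrightarrow> length xs = length as \<Longrightarrow> eqm P (f (g # xs)) (f' (g # xs))"
  shows "eqm P (EV f g as) (EV f' g as)"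
  using assms
proof (induction as arbitrary: f f' g)
  case (Cons a as)
  have "eqm P (a (\<lambda>h. EV (\<lambda>xs. f (g # xs)) h as) g) (a (\<lambda>h. EV (\<lambda>xs. f' (g # xs)) h as) g)"
  proof (rule lop_cong[of a])
    fix h assume "h \<in> B"
    then show "eqm P (EV (\<lambda>xs. f (g # xs)) h as) (EV (\<lambda>xs. f' (g # xs)) h as)"
      using Cons.prems by (intro Cons.IH) auto
  qed (use Cons.prems in auto)
  then show ?case by simp
qed simp

lemma EV_shift:
  assumes "\<forall>a\<in>set as. lop a" "g \<in> B" "k \<in> B"
  shows "eqm P (EV f (m k g) as) (EV (\<lambda>xs. f (map (m k) xs)) g as)"
  using assms
proof (induction as arbitrary: f g)
  case (Cons a as)
  let ?u = "\<lambda>xs. f (m k g # xs)"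
  have "eqm P (EV f (m k g) (a # as)) (a (\<lambda>h. EV ?u (m k h) as) g)"
    using Cons.prems lop_equi[of a k g "\<lambda>h. EV ?u h as"] by simp
  also have "eqm P \<dots> (a (\<lambda>h. EV (\<lambda>xs. ?u (map (m k) xs)) h as) g)"
    using Cons by (intro lop_cong[of a]) auto
  finally show ?case by simp
qed simp

text \<open>A change of base vertex is a left translation, which letters commute with and f
  absorbs.\<close>

lemma EV_inv:
  assumes "\<forall>a\<in>set as. lop a" "g \<in> B" "h \<in> B" "invf (Suc (length as)) f"
  shows "eqm P (EV f h as) (EV f g as)"
proof -
  obtain k where k: "k \<in> B" "h = m k g" using m_trans assms by blast
  have "eqm P (EV f h as) (EV (\<lambda>xs. f (map (m k) xs)) g as)"
    using assms k EV_shift by auto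
  also have "eqm P \<dots> (EV f g as)"
    using assms k by (intro EV_cong) (use invfD[OF assms(4) k(1), of "g # xs" for xs] in auto)
  finally show ?thesis .
qed

lemma SH_cong:
  assumes "lop c" "\<forall>a\<in>set as. lop a" "g \<in> B"
    and "\<And>xs. set xs \<subseteq> B \<Longrightarrow> length xs = Suc (length as) \<Longrightarrow> eqm P (f (g # xs)) (f' (g # xs))"
  shows "eqm P (SH c f g as) (SH c f' g as)"
  using assms
proof (induction as arbitrary: f f' g)
  case Nil
  then show ?case using EV_cong[of "[c]" g f f'] by simp
next
  case (Cons a as)
  have "eqm P (a (\<lambda>h. SH c (\<lambda>xs. f (g # xs)) h as) g) (a (\<lambda>h. SH c (\<lambda>xs. f' (g # xs)) h as) g)"
    using Cons.prems by (intro lop_cong[of a] Cons.IH) auto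
  moreover have "eqm P (EV f g (c # a # as)) (EV f' g (c # a # as))"
    using Cons.prems by (intro EV_cong) auto
  ultimately show ?case by (auto intro: eqm_diff simp del: EV.simps)
qed

lemma SH_shift:
  assumes "lop c" "\<forall>a\<in>set as. lop a" "g \<in> B" "k \<in> B"
  shows "eqm P (SH c f (m k g) as) (SH c (\<lambda>xs. f (map (m k) xs)) g as)"
  using assms
proof (induction as arbitrary: f g)
  case Nil
  then show ?case using EV_shift[of "[c]" g k f] by simp
next
  case (Cons a as)
  let ?u = "\<lambda>xs. f (m k g # xs)"
  have "eqm P (a (\<lambda>h. SH c ?u h as) (m k g)) (a (\<lambda>h. SH c ?u (m k h) as) g)"
    using Cons.prems by (intro lop_equi[of a]) auto
  also have "eqm P \<dots> (a (\<lambda>h. SH c (\<lambda>xs. ?u (map (m k) xs)) h as) g)"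
    using Cons by (intro lop_cong[of a]) auto
  finally have "eqm P (a (\<lambda>h. SH c ?u h as) (m k g)) (a (\<lambda>h. SH c (\<lambda>xs. ?u (map (m k) xs)) h as) g)" .
  moreover have "eqm P (EV f (m k g) (c # a # as)) (EV (\<lambda>xs. f (map (m k) xs)) g (c # a # as))"
    using Cons.prems by (intro EV_shift) auto
  ultimately show ?case by (auto intro: eqm_diff simp del: EV.simps)
qed

lemma SH_inv:
  assumes "lop c" "\<forall>a\<in>set as. lop a" "g \<in> B" "h \<in> B" "invf (Suc (Suc (length as))) f"
  shows "eqm P (SH c f h as) (SH c f g as)"
proof -
  obtain k where k: "k \<in> B" "h = m k g" using m_trans assms by blast
  have "eqm P (SH c f h as) (SH c (\<lambda>xs. f (map (m k) xs)) g as)"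
    using assms k SH_shift by auto
  also have "eqm P \<dots> (SH c f g as)"
    using assms k by (intro SH_cong) (use invfD[OF assms(5) k(1), of "g # xs" for xs] in auto)
  finally show ?thesis .
qed

text \<open>Inner faces compose neighbouring letters, which annihilate each other; the last face
  applies the final letter to a constant.\<close>

lemma TT_zero:
  assumes "\<forall>a\<in>set as. lop a" "successively ann as" "as \<noteq> []" "eps0 (last as)" "g \<in> B"
  shows "eqm P (TT f g as) 0"
  using assms
proof (induction as arbitrary: f g)
  case (Cons a as)
  show ?case
  proof (cases as)
    case Nil
    have "cobd (\<lambda>xs. f (g # xs)) [h] = f [g]" for h by simp
    then show ?thesis using Nil Cons.prems by (simp add: eps0_def)
  next
    case (Cons b bs)
    have "TT f g (a # b # bs) = a (b (\<lambda>k. EV (\<lambda>xs. f (g # xs)) k bs)) g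
       - a (\<lambda>h. TT (\<lambda>xs. f (g # xs)) h (b # bs)) g"
      using Cons.prems Cons by (intro TT_step) (auto simp: lop_lin)
    moreover have "eqm P (a (b (\<lambda>k. EV (\<lambda>xs. f (g # xs)) k bs)) g) 0"
      using Cons.prems Cons by (auto simp: ann_def)
    moreover have "eqm P (a (\<lambda>h. TT (\<lambda>xs. f (g # xs)) h (b # bs)) g) 0"
      using Cons.prems Cons Cons.IH by (intro lop_zero[of a]) auto
    ultimately show ?thesis using Cons eqm_diff by fastforce
  qed
qed simp

text \<open>Only the face between x and y survives. The sign counts the letters in front of
  it.\<close>

lemma TT_one:
  assumes "\<forall>a\<in>set (pre @ x # y # post). lop a" "successively ann (pre @ [x])"
    "successively ann (y # post)" "eps0 (last (y # post))" "g \<in> B"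
  shows "eqm P (TT f g (pre @ x # y # post)) ((- 1) ^ length pre * EV f g (pre @ (x \<circ> y) # post))"
  using assms
proof (induction pre arbitrary: f g)
  case Nil
  have "TT f g (x # y # post) = x (y (\<lambda>k. EV (\<lambda>xs. f (g # xs)) k post)) g
       - x (\<lambda>h. TT (\<lambda>xs. f (g # xs)) h (y # post)) g"
    using Nil by (intro TT_step) (auto simp: lop_lin)
  moreover have "eqm P (x (\<lambda>h. TT (\<lambda>xs. f (g # xs)) h (y # post)) g) 0"
    using Nil by (intro lop_zero[of x] TT_zero) auto
  ultimately show ?case
    using eqm_diff[OF eqm_refl[of P "x (y (\<lambda>k. EV (\<lambda>xs. f (g # xs)) k post)) g"]] by fastforce
next
  case (Cons a pre)
  obtain b bs where b: "pre @ x # y # post = b # bs" and hb: "hd (pre @ [x]) = b"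
    by (cases pre) auto
  have ab: "ann a b" using Cons.prems(2) hb by (cases pre) auto
  have "TT f g (a # b # bs) = a (b (\<lambda>k. EV (\<lambda>xs. f (g # xs)) k bs)) g
       - a (\<lambda>h. TT (\<lambda>xs. f (g # xs)) h (b # bs)) g"
    using Cons.prems b by (intro TT_step) (auto simp: lop_lin)
  moreover have "eqm P (a (b (\<lambda>k. EV (\<lambda>xs. f (g # xs)) k bs)) g) 0"
    using ab Cons.prems by (auto simp: ann_def)
  moreover have "eqm P (a (\<lambda>h. TT (\<lambda>xs. f (g # xs)) h (b # bs)) g)
      (a (\<lambda>h. (- 1) ^ length pre * EV (\<lambda>xs. f (g # xs)) h (pre @ (x \<circ> y) # post)) g)"
  proof (rule lop_cong[of a])
    fix h assume "h \<in> B"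
    then show "eqm P (TT (\<lambda>xs. f (g # xs)) h (b # bs)) ((- 1) ^ length pre * EV (\<lambda>xs. f (g # xs)) h (pre @ (x \<circ> y) # post))"
      unfolding b[symmetric] using Cons.prems by (intro Cons.IH) (auto simp: successively_Cons)
  qed (use Cons.prems in auto)
  ultimately have "eqm P (TT f g (a # b # bs))
     (0 - (a (\<lambda>h. (- 1) ^ length pre * EV (\<lambda>xs. f (g # xs)) h (pre @ (x \<circ> y) # post)) g))"
    using eqm_diff by metis
  moreover have "a (\<lambda>h. (- 1) ^ length pre * EV (\<lambda>xs. f (g # xs)) h (pre @ (x \<circ> y) # post)) g
      = (- 1) ^ length pre * EV f g ((a # pre) @ (x \<circ> y) # post)"
    using lin_cmult[of a "(- 1) ^ length pre" "\<lambda>h. EV (\<lambda>xs. f (g # xs)) h (pre @ (x \<circ> y) # post)" g] Cons.prems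
    by (simp add: lop_lin)
  ultimately show ?case using b by (simp add: comp_def del: EV.simps TT.simps)
qed

text \<open>With x and y kept apart, the word is a chain whose boundary is, up to sign, the word
  with x and y composed, so a cocycle vanishes on the latter. Letters can therefore be altered by
  such composites.\<close>

lemma EV_cobd_one:
  assumes "\<forall>a\<in>set (pre @ x # y # post). lop a" "successively ann (pre @ [x])"
    "successively ann (y # post)" "\<forall>a\<in>set (pre @ x # y # post). eps0 a" "g \<in> B"
    "invf (Suc (Suc (length pre + length post))) f"
    "\<And>xs. set xs \<subseteq> B \<Longrightarrow> length xs = Suc (Suc (Suc (length pre + length post))) \<Longrightarrow> eqm P (cobd f xs) 0"
  shows "eqm P (EV f g (pre @ (x \<circ> y) # post)) 0"
proof -
  obtain a as where a: "pre @ x # y # post = a # as" by (cases pre) auto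
  have len: "length as = Suc (length pre + length post)" using arg_cong[OF a, of length] by simp
  have la: "lop a" "eps0 a" using a assms by (auto dest!: arg_cong[of _ _ set])
  have ls: "\<forall>b\<in>set as. lop b" using a assms by (auto dest!: arg_cong[of _ _ set])
  have "eqm P (EV (cobd f) g (a # as)) (EV (\<lambda>xs. 0) g (a # as))"
    using len la ls assms(5) by (intro EV_cong) (use assms(7)[of "g # xs" for xs] in \<open>auto simp del: cobd.simps\<close>)
  then have 1: "eqm P (EV (cobd f) g (a # as)) 0"
    using EV_zero[of "a # as" g] la ls by (simp add: lop_lin)
  have 2: "EV (cobd f) g (a # as) = a (\<lambda>h. EV f h as) g - TT f g (a # as)"
    using la ls by (intro EV_cobd) (auto simp: lop_lin)
  \<comment> \<open>The face without base vertex: by invariance the remaining word has the same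
    value from every vertex, and the first letter kills constants.\<close>
  have "eqm P (a (\<lambda>h. EV f h as) g) (a (\<lambda>h. EV f g as) g)"
    using la ls assms len by (intro lop_cong[of a] EV_inv) auto
  also have "eqm P \<dots> 0" using la assms by (auto simp: eps0_def)
  finally have 3: "eqm P (a (\<lambda>h. EV f h as) g) 0" .
  have "eqm P (TT f g (a # as)) ((- 1) ^ length pre * EV f g (pre @ (x \<circ> y) # post))"
    unfolding a[symmetric] using assms by (intro TT_one) auto
  then have "eqm P ((- 1) ^ length pre * EV f g (pre @ (x \<circ> y) # post)) 0"
  proof -
    assume "eqm P (TT f g (a # as)) ((- 1) ^ length pre * EV f g (pre @ (x \<circ> y) # post))"
    then have "eqm P ((- 1) ^ length pre * EV f g (pre @ (x \<circ> y) # post)) (TT f g (a # as))"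
      by (rule eqm_sym)
    also have "TT f g (a # as) = a (\<lambda>h. EV f h as) g - EV (cobd f) g (a # as)" using 2 by simp
    also have "eqm P \<dots> (0 - 0)" by (rule eqm_diff[OF 3 1])
    finally show ?thesis by (simp add: comp_def)
  qed
  then have "P dvd (- 1) ^ length pre * ((- 1) ^ length pre * EV f g (pre @ (x \<circ> y) # post))"
    unfolding eqm_0_iff by (rule dvd_mult)
  moreover have "(- 1) ^ length pre * ((- 1) ^ length pre * t) = t" for t :: 'k
    by (simp flip: mult.assoc power_mult_distrib)
  ultimately show ?thesis by (simp only: eqm_0_iff)
qed

text \<open>Inserting c before and after a letter produces composites in both orders, which agree
  because c commutes with the letters and therefore cancel. What is left are the two ends: c
  composed with the first letter, and the face that deletes a final c, where c acts on a constant by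
  1.\<close>

lemma SH_TT:
  assumes "lop c" "\<And>\<Phi> g x. c (\<lambda>_. x) g = x" "\<forall>a\<in>set (w # ws). lop a" "successively ann (w # ws)"
    "eps0 (last (w # ws))" "\<And>a \<Phi> h. a \<in> set (w # ws) \<Longrightarrow> h \<in> B \<Longrightarrow> eqm P (a (c \<Phi>) h) (c (a \<Phi>) h)" "g \<in> B"
  shows "eqm P (w (\<lambda>h. SH c (cobd (\<lambda>xs. u (g # xs))) h ws) g)
     (EV u g ((c \<circ> w) # ws) - EV u g (w # ws))"
  using assms(3-)
proof (induction ws arbitrary: u g w)
  case Nil
  let ?u = "\<lambda>k. u [g, k]"
  have "(\<lambda>h. SH c (cobd (\<lambda>xs. u (g # xs))) h []) = (\<lambda>h. c ?u h - ?u h)"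
    using assms lin_diff[of c "\<lambda>k. u [g, k]"] by (simp add: lop_lin)
  then have "w (\<lambda>h. SH c (cobd (\<lambda>xs. u (g # xs))) h []) g = w (c ?u) g - w ?u g"
    using Nil by (simp add: lin_diff[of w] lop_lin)
  moreover have "eqm P (w (c ?u) g) (c (w ?u) g)" using Nil by auto
  ultimately show ?case by (auto intro: eqm_diff)
next
  case (Cons w2 ws)
  let ?u = "\<lambda>xs. u (g # xs)"
  have lins: "\<forall>a\<in>set (c # w # w2 # ws). lin a" using assms Cons.prems by (auto simp: lop_lin)
  have key: "eqm P (SH c (cobd ?u) h (w2 # ws))
     (c (\<lambda>k. EV ?u k (w2 # ws)) h - EV ?u h (w2 # ws) - w2 (\<lambda>k. SH c ?u k ws) h)" if h: "h \<in> B" for h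
  proof -
    have 1: "EV (cobd ?u) h (c # w2 # ws) = c (\<lambda>k. EV ?u k (w2 # ws)) h - TT ?u h (c # w2 # ws)"
      using lins by (intro EV_cobd) auto
    have 2: "TT ?u h (c # w2 # ws) = c (w2 (\<lambda>k. EV (\<lambda>xs. ?u (h # xs)) k ws)) h
        - c (\<lambda>k. TT (\<lambda>xs. ?u (h # xs)) k (w2 # ws)) h"
      using lins by (intro TT_step) auto
    have 3: "eqm P (c (\<lambda>k. TT (\<lambda>xs. ?u (h # xs)) k (w2 # ws)) h) 0"
      using assms Cons.prems h by (intro lop_zero[of c] TT_zero) (auto simp: successively_Cons)
    have 4: "w2 (\<lambda>k. SH c (\<lambda>xs. cobd ?u (h # xs)) k ws) h
       = w2 (\<lambda>k. SH c ?u k ws) h - w2 (\<lambda>k. SH c (cobd (\<lambda>xs. ?u (h # xs))) k ws) h"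
      using lins by (simp add: SH_diff lin_diff[of w2])
    have 5: "eqm P (w2 (\<lambda>k. SH c (cobd (\<lambda>xs. ?u (h # xs))) k ws) h)
       (EV ?u h ((c \<circ> w2) # ws) - EV ?u h (w2 # ws))"
      using Cons.prems h by (intro Cons.IH) (auto simp: successively_Cons)
    have 6: "EV ?u h ((c \<circ> w2) # ws) = c (w2 (\<lambda>k. EV (\<lambda>xs. ?u (h # xs)) k ws)) h" by simp
    have e: "SH c (cobd ?u) h (w2 # ws) - (c (\<lambda>k. EV ?u k (w2 # ws)) h - EV ?u h (w2 # ws) - w2 (\<lambda>k. SH c ?u k ws) h)
      = c (\<lambda>k. TT (\<lambda>xs. ?u (h # xs)) k (w2 # ws)) h +
       (w2 (\<lambda>k. SH c (cobd (\<lambda>xs. ?u (h # xs))) k ws) h - (EV ?u h ((c \<circ> w2) # ws) - EV ?u h (w2 # ws)))"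
      unfolding SH.simps 1 2 4 6 by (simp add: algebra_simps)
    show ?thesis using 3 5 unfolding eqm_def e by (auto intro: dvd_add)
  qed
  have "eqm P (w (\<lambda>h. SH c (cobd ?u) h (w2 # ws)) g)
     (w (\<lambda>h. c (\<lambda>k. EV ?u k (w2 # ws)) h - EV ?u h (w2 # ws) - w2 (\<lambda>k. SH c ?u k ws) h) g)"
    using Cons.prems key by (intro lop_cong[of w]) auto
  also have "w (\<lambda>h. c (\<lambda>k. EV ?u k (w2 # ws)) h - EV ?u h (w2 # ws) - w2 (\<lambda>k. SH c ?u k ws) h) g
     = w (c (\<lambda>k. EV ?u k (w2 # ws))) g - w (\<lambda>h. EV ?u h (w2 # ws)) g - w (w2 (\<lambda>k. SH c ?u k ws)) g"
    using lins by (simp add: lin_diff[of w] del: EV.simps)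
  also have "eqm P \<dots> (c (w (\<lambda>k. EV ?u k (w2 # ws))) g - w (\<lambda>h. EV ?u h (w2 # ws)) g - 0)"
  proof -
    have "eqm P (w (c (\<lambda>k. EV ?u k (w2 # ws))) g) (c (w (\<lambda>k. EV ?u k (w2 # ws))) g)"
      by (rule Cons.prems(4)) (use Cons.prems in auto)
    moreover have "eqm P (w (w2 (\<lambda>k. SH c ?u k ws)) g) 0"
      using Cons.prems by (simp add: ann_def)
    ultimately show ?thesis by (intro eqm_diff) auto
  qed
  also have "\<dots> = EV u g ((c \<circ> w) # w2 # ws) - EV u g (w # w2 # ws)" by simp
  finally show ?case .
qed

text \<open>The shuffle of the cycle [c] with a cycle is a cycle: the two ends left by
  \<open>SH_TT\<close> cancel against the faces at an initial c.\<close>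

lemma SH_cobd:
  assumes "lop c" "\<And>\<Phi> g x. c (\<lambda>_. x) g = x" "\<forall>a\<in>set (w # ws). lop a" "successively ann (w # ws)"
    "\<forall>a\<in>set (w # ws). eps0 a" "\<And>a \<Phi> h. a \<in> set (w # ws) \<Longrightarrow> h \<in> B \<Longrightarrow> eqm P (a (c \<Phi>) h) (c (a \<Phi>) h)" "g \<in> B"
    "invf (Suc (Suc (length ws))) u"
  shows "eqm P (SH c (cobd u) g (w # ws)) 0"
proof -
  have lins: "\<forall>a\<in>set (c # w # ws). lin a" using assms by (auto simp: lop_lin)
  have 1: "EV (cobd u) g (c # w # ws) = c (\<lambda>k. EV u k (w # ws)) g - TT u g (c # w # ws)"
    using lins by (intro EV_cobd) auto
  have 2: "TT u g (c # w # ws) = c (w (\<lambda>k. EV (\<lambda>xs. u (g # xs)) k ws)) g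
      - c (\<lambda>k. TT (\<lambda>xs. u (g # xs)) k (w # ws)) g"
    using lins by (intro TT_step) auto
  have 3: "eqm P (c (\<lambda>k. TT (\<lambda>xs. u (g # xs)) k (w # ws)) g) 0"
    using assms by (intro lop_zero[of c] TT_zero) auto
  have "eqm P (c (\<lambda>k. EV u k (w # ws)) g) (c (\<lambda>k. EV u g (w # ws)) g)"
    using assms by (intro lop_cong[of c] EV_inv) auto
  then have 4: "eqm P (c (\<lambda>k. EV u k (w # ws)) g) (EV u g (w # ws))"
    using assms(2) by (simp del: EV.simps)
  have 5: "w (\<lambda>h. SH c (\<lambda>xs. cobd u (g # xs)) h ws) g
     = w (\<lambda>h. SH c u h ws) g - w (\<lambda>h. SH c (cobd (\<lambda>xs. u (g # xs))) h ws) g"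
    using lins by (simp add: SH_diff lin_diff[of w])
  have "eqm P (w (\<lambda>h. SH c u h ws) g) (w (\<lambda>h. SH c u g ws) g)"
    using assms by (intro lop_cong[of w] SH_inv) auto
  also have "eqm P \<dots> 0" using assms by (simp add: eps0_def)
  finally have 6: "eqm P (w (\<lambda>h. SH c u h ws) g) 0" .
  have 7: "eqm P (w (\<lambda>h. SH c (cobd (\<lambda>xs. u (g # xs))) h ws) g)
     (EV u g ((c \<circ> w) # ws) - EV u g (w # ws))"
    using assms by (intro SH_TT) auto
  have 8: "EV u g ((c \<circ> w) # ws) = c (w (\<lambda>k. EV (\<lambda>xs. u (g # xs)) k ws)) g" by simp
  have e: "SH c (cobd u) g (w # ws) - 0 = (c (\<lambda>k. EV u k (w # ws)) g - EV u g (w # ws))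
     + c (\<lambda>k. TT (\<lambda>xs. u (g # xs)) k (w # ws)) g - w (\<lambda>h. SH c u h ws) g
     + (w (\<lambda>h. SH c (cobd (\<lambda>xs. u (g # xs))) h ws) g - (EV u g ((c \<circ> w) # ws) - EV u g (w # ws)))"
    unfolding SH.simps 1 2 5 8 by (simp add: algebra_simps)
  show ?thesis
    using dvd_add[OF dvd_diff[OF dvd_add[OF 4[unfolded eqm_def] 3[unfolded eqm_def]] 6[unfolded eqm_def]] 7[unfolded eqm_def]]
    unfolding eqm_def e by (simp only: diff_0_right)
qed

text \<open>The second factor starts where the first word ends, but by invariance its value may be
  taken from the fixed vertex g and pulled out as a scalar.\<close>

lemma EV_cup:
  assumes "\<forall>a\<in>set (as @ bs). lop a" "h \<in> B" "g \<in> B" "invf (Suc (length bs)) f'"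
  shows "eqm P (EV (cup (length as) f f') h (as @ bs)) (EV f h as * EV f' g bs)"
  using assms
proof (induction as arbitrary: f h)
  case Nil
  have "EV (cup 0 f f') h bs = EV (\<lambda>xs. f [h] * f' xs) h bs"
    by (rule EV_head) (simp add: cup_def)
  also have "\<dots> = f [h] * EV f' h bs" using Nil by (intro EV_cmult) (auto simp: lop_lin)
  finally show ?case using EV_inv[of bs g h f'] Nil by (auto intro: eqm_mult)
next
  case (Cons a as)
  have "EV (cup (length (a # as)) f f') h ((a # as) @ bs)
     = a (\<lambda>k. EV (cup (length as) (\<lambda>ys. f (h # ys)) f') k (as @ bs)) h"
    by (simp add: cup_Suc)
  also have "eqm P \<dots> (a (\<lambda>k. EV (\<lambda>ys. f (h # ys)) k as * EV f' g bs) h)"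
    using Cons by (intro lop_cong[of a]) auto
  also have "\<dots> = EV f h (a # as) * EV f' g bs"
    using Cons.prems lin_cmult[of a "EV f' g bs" "\<lambda>k. EV (\<lambda>ys. f (h # ys)) k as" h] by (simp add: mult.commute lop_lin)
  finally show ?case .
qed

end

section \<open>An Euler class for a central subgroup of prime order\<close>

definition alt :: "('a list \<Rightarrow> int) \<Rightarrow> bool" where
  "alt c \<longleftrightarrow> (\<forall>us x y vs. c (us @ x # y # vs) = - c (us @ y # x # vs))"

lemma altD: "alt c \<Longrightarrow> c (us @ x # y # vs) = - c (us @ y # x # vs)"
  unfolding alt_def by blast

lemma altI: "(\<And>us x y vs. c (us @ x # y # vs) = - c (us @ y # x # vs)) \<Longrightarrow> alt c"
  unfolding alt_def by blast

lemma alt_swap: "alt c \<Longrightarrow> c (x # y # vs) = - c (y # x # vs)"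
  using altD[of c "[]" x y vs] by simp

lemma alt_Cons: "alt c \<Longrightarrow> alt (\<lambda>xs. c (x # xs))"
  by (rule altI) (metis altD append_Cons)

lemma alt_append: "alt c \<Longrightarrow> alt (\<lambda>xs. c (us @ xs))"
  by (rule altI) (metis altD append_assoc)

lemma alt_front: "alt c \<Longrightarrow> c (us @ x # vs) = (- 1) ^ length us * c (x # us @ vs)"
proof (induction us arbitrary: c)
  case (Cons u us)
  have "c (u # us @ x # vs) = (- 1) ^ length us * c (u # x # us @ vs)"
    using Cons.IH[OF alt_Cons[OF Cons.prems], of u] .
  then show ?case using alt_swap[OF Cons.prems, of u x] by simp
qed simp

lemma alt_not_distinct:
  assumes "alt c" "\<not> distinct xs"
  shows "c xs = 0"
proof -
  obtain us y vs ws where xs: "xs = us @ [y] @ vs @ [y] @ ws"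
    using not_distinct_decomp[OF assms(2)] by blast
  have "alt (\<lambda>l. c (us @ y # l))" using alt_append[OF assms(1), of "us @ [y]"] by simp
  from alt_front[OF this, of vs y ws]
  have "c xs = (- 1) ^ length vs * c (us @ y # y # vs @ ws)" by (simp add: xs)
  also have "c (us @ y # y # vs @ ws) = 0" using altD[OF assms(1), of us y y "vs @ ws"] by simp
  finally show ?thesis by simp
qed

text \<open>The sign depends on the two lists and not on c; \<open>facet_sign\<close> relies on one
  sign common to all cycles.\<close>

lemma alt_perm:
  "mset xs = mset ys \<Longrightarrow> \<exists>s\<in>{1, -1 :: int}. \<forall>c. alt c \<longrightarrow> c ys = s * c xs"
proof (induction xs arbitrary: ys)
  case Nil
  then show ?case by auto
next
  case (Cons x xs)
  then have "x \<in> set ys" by (metis list.set_intros(1) set_mset_mset)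
  then obtain us vs where ys: "ys = us @ x # vs" by (meson split_list)
  with Cons.prems have "mset xs = mset (us @ vs)" by simp
  from Cons.IH[OF this] obtain s where s: "s \<in> {1, -1}" "\<And>c. alt c \<Longrightarrow> c (us @ vs) = s * c xs"
    by blast
  have "c ys = (- 1) ^ length us * s * c (x # xs)" if "alt c" for c
    using alt_front[OF that, of us x vs] s(2)[OF alt_Cons[OF that, of x]] by (simp add: ys)
  moreover have "(- 1) ^ length us * s \<in> {1, -1}"
    using s(1) by (cases "even (length us)") auto
  ultimately show ?case by blast
qed

text \<open>Exterior multiplication by the vertex a, that is, the cone with apex a.\<close>

fun wedge :: "'a \<Rightarrow> ('a list \<Rightarrow> int) \<Rightarrow> 'a list \<Rightarrow> int" where
  "wedge a c [] = 0"
| "wedge a c (x # xs) = (if x = a then c xs else 0) - wedge a (\<lambda>ys. c (x # ys)) xs"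

lemma wedge_zero: "wedge a (\<lambda>ys. 0) xs = 0"
  by (induction xs) auto

lemma wedge_uminus: "wedge a (\<lambda>ys. - c ys) xs = - wedge a c xs"
  by (induction xs arbitrary: c) auto

lemma wedge_add: "wedge a (\<lambda>ys. c ys + d ys) xs = wedge a c xs + wedge a d xs"
  by (induction xs arbitrary: c d) auto

lemma wedge_sum: "wedge a (\<lambda>ys. \<Sum>i\<in>I. c i ys) xs = (\<Sum>i\<in>I. wedge a (c i) xs)"
  by (induction I rule: infinite_finite_induct) (auto simp: wedge_zero wedge_add)

lemma wedge_alt: "alt c \<Longrightarrow> alt (wedge a c)"
proof -
  have "wedge a c (us @ x # y # vs) = - wedge a c (us @ y # x # vs)" if "alt c" for us x y vs
    using that
  proof (induction us arbitrary: c)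
    case Nil
    have "wedge a (\<lambda>ys. c (x # y # ys)) vs = - wedge a (\<lambda>ys. c (y # x # ys)) vs"
      by (subst alt_swap[OF Nil]) (rule wedge_uminus)
    then show ?case by simp
  next
    case (Cons u us)
    then show ?case using Cons.IH[OF alt_Cons[OF Cons.prems, of u]] altD[OF Cons.prems, of us x y vs] by simp
  qed
  then show "alt c \<Longrightarrow> alt (wedge a c)" by (intro altI)
qed

lemma wedge_supp: "wedge a c xs \<noteq> 0 \<Longrightarrow> \<exists>us vs. xs = us @ a # vs \<and> c (us @ vs) \<noteq> 0"
proof (induction xs arbitrary: c)
  case (Cons x xs)
  show ?case
  proof (cases "x = a \<and> c xs \<noteq> 0")
    case True
    then show ?thesis by (intro exI[of _ "[]"] exI[of _ xs]) auto
  next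
    case False
    with Cons.prems have "wedge a (\<lambda>ys. c (x # ys)) xs \<noteq> 0" by (auto split: if_splits)
    from Cons.IH[OF this] obtain us vs where "xs = us @ a # vs" "c (x # us @ vs) \<noteq> 0" by blast
    then show ?thesis by (intro exI[of _ "x # us"] exI[of _ vs]) auto
  qed
qed simp

context group
begin

lemma letters_carrier: "letters (carrier G) (\<otimes>)"
proof
  show "\<exists>k\<in>carrier G. h = k \<otimes> g" if "g \<in> carrier G" "h \<in> carrier G" for g h
    using that by (intro bexI[of _ "h \<otimes> inv g"]) (auto simp: m_assoc)
qed auto

end

section \<open>The sphere of faces and its chains\<close>

locale central_prime = group G for G (structure) +
  fixes p :: nat and z :: 'a
  assumes fin: "finite (carrier G)" and prime: "Factorial_Ring.prime p"
    and z_in [simp, intro]: "z \<in> carrier G" and z_pow: "z [^] p = \<one>" and z_one: "z \<noteq> \<one>"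
    and z_central: "g \<in> carrier G \<Longrightarrow> g \<otimes> z = z \<otimes> g"
begin

definition blk :: "'a \<Rightarrow> 'a set" where
  "blk x = (\<lambda>j. x \<otimes> z [^] j) ` {..<p}"

definition Blocks :: "'a set set" where
  "Blocks = blk ` carrier G"

text \<open>The faces form the join of the boundaries of the simplices spanned by the cosets of the
  subgroup generated by z, a sphere of dimension \<open>sdim - 1\<close>.\<close>

definition face :: "'a set \<Rightarrow> bool" where
  "face A \<longleftrightarrow> A \<subseteq> carrier G \<and> (\<forall>T\<in>Blocks. \<not> T \<subseteq> A)"

text \<open>Simplicial chains are alternating coefficient functions on ordered vertex lists. The
  index n counts vertices, so it exceeds the dimension by one, and n = 0 is the empty simplex of the
  augmented complex.\<close>

definition chain :: "nat \<Rightarrow> ('a list \<Rightarrow> int) \<Rightarrow> bool" where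
  "chain n c \<longleftrightarrow> alt c \<and> (\<forall>xs. c xs \<noteq> 0 \<longrightarrow> length xs = n \<and> face (set xs))"

text \<open>The simplicial boundary in terms of coefficients: the simplices with face ys are
  obtained by adding one vertex, placed in front by alternation.\<close>

definition bd :: "('a list \<Rightarrow> int) \<Rightarrow> 'a list \<Rightarrow> int" where
  "bd c ys = (\<Sum>x\<in>carrier G. c (x # ys))"

definition sdim :: nat where
  "sdim = card Blocks * (p - 1)"

lemma p_gt_1: "p > 1"
  using prime_gt_1_nat[OF prime] .

lemma z_pow_in [simp, intro]: "z [^] (j::nat) \<in> carrier G"
  by simp

lemma z_pow_mod: "z [^] (j mod p) = z [^] (j::nat)"
proof -
  have "z [^] j = z [^] (p * (j div p) + j mod p)" by simp
  also have "\<dots> = (z [^] p) [^] (j div p) \<otimes> z [^] (j mod p)"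
    by (simp add: nat_pow_mult nat_pow_pow)
  finally show ?thesis by (simp add: z_pow)
qed

lemma z_pow_eq_one: "z [^] (j::nat) = \<one> \<longleftrightarrow> p dvd j"
proof -
  have "ord z dvd p" using z_pow pow_eq_id[OF z_in] by auto
  moreover have "ord z \<noteq> 1" using z_one pow_eq_id[OF z_in, of 1] by auto
  ultimately have "ord z = p" using prime by (metis prime_nat_iff)
  then show ?thesis using pow_eq_id[OF z_in] by simp
qed

lemma z_pow_inj: "i < p \<Longrightarrow> j < p \<Longrightarrow> z [^] (i::nat) = z [^] (j::nat) \<Longrightarrow> i = j"
proof (induction i j rule: linorder_wlog)
  case (le i j)
  have "z [^] i \<otimes> z [^] (j - i) = z [^] (i + (j - i))"
    by (simp only: nat_pow_mult[OF z_in])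
  then have "z [^] i \<otimes> z [^] (j - i) = z [^] i \<otimes> \<one>"
    using le by simp
  then have "z [^] (j - i) = \<one>" by simp
  then have "p dvd j - i" by (simp add: z_pow_eq_one)
  then show ?case using le by (auto dest: dvd_imp_le)
qed auto

lemma z_pow_central: "g \<in> carrier G \<Longrightarrow> g \<otimes> z [^] (j::nat) = z [^] j \<otimes> g"
  by (induction j) (simp_all add: m_assoc[symmetric], metis m_assoc z_central z_in z_pow_in)

lemma blk_self: "x \<in> carrier G \<Longrightarrow> x \<in> blk x"
  using p_gt_1 unfolding blk_def by (intro image_eqI[of _ _ 0]) auto

lemma blk_iff: "x \<in> carrier G \<Longrightarrow> y \<in> blk x \<longleftrightarrow> (\<exists>j::nat. y = x \<otimes> z [^] j)"
proof
  assume "\<exists>j::nat. y = x \<otimes> z [^] j"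
  then obtain j :: nat where "y = x \<otimes> z [^] j" by blast
  then have "y = x \<otimes> z [^] (j mod p)" by (simp add: z_pow_mod)
  then show "y \<in> blk x" using p_gt_1 unfolding blk_def by auto
qed (auto simp: blk_def)

lemma blk_sub: "x \<in> carrier G \<Longrightarrow> blk x \<subseteq> carrier G"
  by (auto simp: blk_def)

lemma blk_sym: "x \<in> carrier G \<Longrightarrow> y \<in> blk x \<Longrightarrow> x \<in> blk y"
proof -
  assume x: "x \<in> carrier G" "y \<in> blk x"
  then obtain j where j: "j < p" "y = x \<otimes> z [^] j" by (auto simp: blk_def)
  then have "y \<otimes> z [^] (p - j) = x" using x
    by (simp add: m_assoc nat_pow_mult z_pow)
  moreover have "y \<in> carrier G" using x j by simp
  ultimately show ?thesis using blk_iff[of y x] by metis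
qed

lemma blk_eq: "x \<in> carrier G \<Longrightarrow> y \<in> blk x \<Longrightarrow> blk y = blk x"
proof -
  have sub: "blk y \<subseteq> blk x" if xy: "x \<in> carrier G" "y \<in> blk x" for x y
  proof
    fix w assume w: "w \<in> blk y"
    obtain i :: nat where i: "y = x \<otimes> z [^] i" using xy blk_iff[of x y] by blast
    then have "y \<in> carrier G" using xy by auto
    then obtain j :: nat where j: "w = y \<otimes> z [^] j" using w blk_iff[of y w] by blast
    have "w = x \<otimes> z [^] (i + j)" using i j xy by (simp add: m_assoc nat_pow_mult)
    then show "w \<in> blk x" using xy blk_iff[of x w] by blast
  qed
  assume x: "x \<in> carrier G" "y \<in> blk x"
  moreover have "y \<in> carrier G" using x blk_sub by blast
  ultimately show ?thesis using sub[of x y] sub[of y x] blk_sym by blast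
qed

lemma card_blk: "x \<in> carrier G \<Longrightarrow> card (blk x) = p"
proof -
  assume x: "x \<in> carrier G"
  have "inj_on (\<lambda>j. x \<otimes> z [^] j) {..<p}"
    by (rule inj_onI) (use x z_pow_inj in auto)
  then show ?thesis unfolding blk_def by (simp add: card_image)
qed

lemma Blocks_fin: "finite Blocks" and Block_fin: "T \<in> Blocks \<Longrightarrow> finite T"
  and Block_card: "T \<in> Blocks \<Longrightarrow> card T = p" and Block_sub: "T \<in> Blocks \<Longrightarrow> T \<subseteq> carrier G"
  using fin card_blk blk_sub by (auto simp: Blocks_def blk_def)

lemma Blocks_disj: "T \<in> Blocks \<Longrightarrow> U \<in> Blocks \<Longrightarrow> x \<in> T \<Longrightarrow> x \<in> U \<Longrightarrow> T = U"
  unfolding Blocks_def using blk_eq by blast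

lemma Blocks_Union: "\<Union>Blocks = carrier G"
  using blk_self blk_sub by (auto simp: Blocks_def)

lemma card_Int_Blocks: "A \<subseteq> carrier G \<Longrightarrow> card A = (\<Sum>T\<in>Blocks. card (A \<inter> T))"
proof -
  assume A: "A \<subseteq> carrier G"
  have "A = (\<Union>T\<in>Blocks. A \<inter> T)" using A Blocks_Union by blast
  then have "card A = card (\<Union>T\<in>Blocks. A \<inter> T)" by simp
  also have "\<dots> = (\<Sum>T\<in>Blocks. card (A \<inter> T))"
    using Blocks_fin Block_fin Blocks_disj by (intro card_UN_disjoint) blast+
  finally show ?thesis .
qed

lemma order_Blocks: "Coset.order G = p * card Blocks"
proof -
  have "card (carrier G) = (\<Sum>T\<in>Blocks. card (carrier G \<inter> T))" by (rule card_Int_Blocks) simp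
  also have "\<dots> = (\<Sum>T\<in>Blocks. p)"
    using Block_sub Block_card by (intro sum.cong) (auto simp: Int_absorb1)
  finally show ?thesis by (simp add: Coset.order_def)
qed

lemma face_sub: "face A \<Longrightarrow> A \<subseteq> carrier G"
  by (simp add: face_def)

lemma face_mono: "face A \<Longrightarrow> B \<subseteq> A \<Longrightarrow> face B"
  unfolding face_def by blast

lemma face_card: "face A \<Longrightarrow> T \<in> Blocks \<Longrightarrow> card (A \<inter> T) \<le> p - 1"
proof -
  assume a: "face A" "T \<in> Blocks"
  then have "A \<inter> T \<subset> T" unfolding face_def by blast
  then have "card (A \<inter> T) < card T" using Block_fin[OF a(2)] by (simp add: psubset_card_mono)
  then show ?thesis using Block_card[OF a(2)] by simp
qed

lemma chain_alt: "chain n c \<Longrightarrow> alt c"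
  and chain_len: "chain n c \<Longrightarrow> c xs \<noteq> 0 \<Longrightarrow> length xs = n"
  and chain_face: "chain n c \<Longrightarrow> c xs \<noteq> 0 \<Longrightarrow> face (set xs)"
  by (auto simp: chain_def)

lemma chain_add: "chain n c \<Longrightarrow> chain n d \<Longrightarrow> chain n (\<lambda>xs. c xs + d xs)"
proof -
  assume cd: "chain n c" "chain n d"
  have "alt (\<lambda>xs. c xs + d xs)"
    by (rule altI) (use altD[OF chain_alt[OF cd(1)]] altD[OF chain_alt[OF cd(2)]] in \<open>metis minus_add_distrib\<close>)
  moreover have "length xs = n \<and> face (set xs)" if "c xs + d xs \<noteq> 0" for xs
  proof -
    have "c xs \<noteq> 0 \<or> d xs \<noteq> 0" using that by auto
    then show ?thesis
      using chain_len[OF cd(1)] chain_len[OF cd(2)] chain_face[OF cd(1)] chain_face[OF cd(2)] by blast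
  qed
  ultimately show ?thesis unfolding chain_def by blast
qed

lemma chain_cmult: "chain n c \<Longrightarrow> chain n (\<lambda>xs. k * c xs)"
proof -
  assume c: "chain n c"
  have "alt (\<lambda>xs. k * c xs)"
    by (rule altI) (use altD[OF chain_alt[OF c]] in \<open>metis mult_minus_right\<close>)
  then show ?thesis using chain_len[OF c] chain_face[OF c] unfolding chain_def by (metis mult_zero_right)
qed

lemma chain_diff: "chain n c \<Longrightarrow> chain n d \<Longrightarrow> chain n (\<lambda>xs. c xs - d xs)"
  using chain_add[of n c "\<lambda>xs. (-1) * d xs"] chain_cmult[of n d "-1"] by simp

lemma chain_zero: "chain n (\<lambda>xs. 0)"
  by (simp add: chain_def alt_def)

lemma chain_sum: "(\<And>i. i \<in> I \<Longrightarrow> chain n (c i)) \<Longrightarrow> chain n (\<lambda>xs. \<Sum>i\<in>I. c i xs)"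
  by (induction I rule: infinite_finite_induct) (auto simp: chain_zero intro: chain_add)

lemma bd_add: "bd (\<lambda>xs. c xs + d xs) ys = bd c ys + bd d ys"
  and bd_diff: "bd (\<lambda>xs. c xs - d xs) ys = bd c ys - bd d ys"
  and bd_sum: "bd (\<lambda>xs. \<Sum>i\<in>I. c' i xs) ys = (\<Sum>i\<in>I. bd (c' i) ys)"
  by (auto simp: bd_def sum.distrib sum_subtractf intro: sum.swap)

lemma alt_bd: "alt c \<Longrightarrow> alt (bd c)"
proof (rule altI)
  fix us x y vs
  assume c: "alt c"
  have "c (w # us @ x # y # vs) = - c (w # us @ y # x # vs)" for w
    using altD[OF c, of "w # us" x y vs] by simp
  then show "bd c (us @ x # y # vs) = - bd c (us @ y # x # vs)"
    by (simp only: bd_def sum_negf)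
qed

lemma chain_bd: "chain (Suc n) c \<Longrightarrow> chain n (bd c)"
proof -
  assume c: "chain (Suc n) c"
  have "length ys = n \<and> face (set ys)" if "bd c ys \<noteq> 0" for ys
  proof -
    obtain x where "c (x # ys) \<noteq> 0" using \<open>bd c ys \<noteq> 0\<close> unfolding bd_def by (meson sum.neutral)
    then show ?thesis using chain_len[OF c] chain_face[OF c] face_mono[of "set (x # ys)" "set ys"] by fastforce
  qed
  then show ?thesis using chain_alt[OF c] by (auto simp: chain_def alt_bd)
qed

section \<open>Acyclicity of the sphere and its top cycles\<close>

lemma bd_bd: "alt c \<Longrightarrow> bd (bd c) ys = 0"
proof -
  assume c: "alt c"
  have "bd (bd c) ys = (\<Sum>x\<in>carrier G. \<Sum>y\<in>carrier G. c (y # x # ys))" by (simp add: bd_def)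
  also have "\<dots> = (\<Sum>x\<in>carrier G. \<Sum>y\<in>carrier G. - c (x # y # ys))"
    by (intro sum.cong refl alt_swap[OF c])
  also have "\<dots> = - (\<Sum>y\<in>carrier G. \<Sum>x\<in>carrier G. c (x # y # ys))"
    by (subst sum.swap) (simp add: sum_negf)
  finally show ?thesis by (simp add: bd_def)
qed

text \<open>Coning is a contracting homotopy on all alternating functions. It may leave the complex
  of faces, which is the difficulty that \<open>exact_step\<close> deals with.\<close>

lemma bd_wedge: "a \<in> carrier G \<Longrightarrow> bd (wedge a c) xs = c xs - wedge a (bd c) xs"
proof -
  assume a: "a \<in> carrier G"
  have "bd (wedge a c) xs = (\<Sum>x\<in>carrier G. if x = a then c xs else 0)
      - (\<Sum>x\<in>carrier G. wedge a (\<lambda>ys. c (x # ys)) xs)"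
    by (simp add: bd_def sum_subtractf)
  also have "(\<Sum>x\<in>carrier G. if x = a then c xs else 0) = c xs" using a fin by simp
  also have "(\<Sum>x\<in>carrier G. wedge a (\<lambda>ys. c (x # ys)) xs) = wedge a (bd c) xs"
    unfolding bd_def using wedge_sum[of a "\<lambda>x ys. c (x # ys)" "carrier G" xs] by simp
  finally show ?thesis .
qed

text \<open>The cosets in S are treated one at a time. A cycle is the boundary of its cone with apex
  a in T; subtracting the boundary of those simplices of the cone that are faces leaves the boundary
  of the others. A simplex of the cone that is not a face contains all of T, since without a it is a
  face, so deleting one vertex leaves at least p - 1 elements of T. That vertex lies in T, hence the
  cosets treated earlier lose nothing.\<close>

lemma exact_step:
  assumes "finite S" "S \<subseteq> Blocks" "chain n c" "\<And>ys. bd c ys = 0"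
  shows "\<exists>e c'. chain (Suc n) e \<and> chain n c' \<and> (\<forall>ys. c ys = bd e ys + c' ys) \<and> (\<forall>ys. bd c' ys = 0) \<and>
    (\<forall>xs. c' xs \<noteq> 0 \<longrightarrow> (\<forall>T\<in>S. p - 1 \<le> card (set xs \<inter> T)))"
  using assms(1,2)
proof (induction S)
  case empty
  then show ?case using assms chain_zero by (intro exI[of _ "\<lambda>xs. 0"] exI[of _ c]) (auto simp: bd_def)
next
  case (insert T S)
  then obtain e c' where e: "chain (Suc n) e" "chain n c'" "\<And>ys. c ys = bd e ys + c' ys" "\<And>ys. bd c' ys = 0"
    "\<And>xs U. c' xs \<noteq> 0 \<Longrightarrow> U \<in> S \<Longrightarrow> p - 1 \<le> card (set xs \<inter> U)" by (auto simp: Ball_def)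
  have TB: "T \<in> Blocks" using insert by simp
  then obtain a where a: "a \<in> T" using Block_card p_gt_1 by fastforce
  have aX: "a \<in> carrier G" using a TB Block_sub by blast
  let ?g = "wedge a c'"
  let ?h = "\<lambda>xs. if face (set xs) then ?g xs else 0"
  let ?c = "\<lambda>xs. c' xs - bd ?h xs"
  have altg: "alt ?g" by (rule wedge_alt[OF chain_alt[OF e(2)]])
  have supg: "\<exists>ys. set xs = Set.insert a (set ys) \<and> length xs = Suc n \<and> c' ys \<noteq> 0" if g: "?g xs \<noteq> 0" for xs
  proof -
    from wedge_supp[OF g] obtain us vs where uv: "xs = us @ a # vs" "c' (us @ vs) \<noteq> 0" by blast
    then show ?thesis using chain_len[OF e(2) uv(2)] by (intro exI[of _ "us @ vs"]) auto
  qed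
  have alth: "alt ?h"
  proof (rule altI)
    fix us vs :: "'a list" and x y
    have "set (us @ x # y # vs) = set (us @ y # x # vs)" by auto
    then show "?h (us @ x # y # vs) = - ?h (us @ y # x # vs)"
      using altD[OF altg, of us x y vs] by simp
  qed
  have h: "chain (Suc n) ?h"
    unfolding chain_def
  proof (intro conjI allI impI)
    fix xs assume "?h xs \<noteq> 0"
    then have "?g xs \<noteq> 0" "face (set xs)" by (auto split: if_splits)
    then show "length xs = Suc n" "face (set xs)" using supg by blast+
  qed (rule alth)
  have c: "chain n ?c" by (intro chain_diff e chain_bd h)
  have bdc: "bd ?c ys = 0" for ys using e(4) bd_bd[OF alth] by (simp add: bd_diff)
  have sat: "p - 1 \<le> card (set xs \<inter> U)" if x0: "?c xs \<noteq> 0" and U: "U \<in> Set.insert T S" for xs U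
  proof -
    have fx: "face (set xs)" using chain_face[OF c x0] .
    have "bd c' = (\<lambda>ys. 0)" using e(4) by auto
    then have "bd ?g xs = c' xs" using bd_wedge[OF aX, of c' xs] wedge_zero[of a xs] by simp
    then have "?c xs = bd (\<lambda>ys. ?g ys - ?h ys) xs" by (simp add: bd_diff)
    with x0 obtain x where x: "x \<in> carrier G" "?g (x # xs) - ?h (x # xs) \<noteq> 0"
      unfolding bd_def by (metis (no_types, lifting) sum.neutral)
    then have gx: "?g (x # xs) \<noteq> 0" and nf: "\<not> face (set (x # xs))" by (auto split: if_splits)
    obtain ys where ys: "set (x # xs) = Set.insert a (set ys)" "c' ys \<noteq> 0" using supg[OF gx] by blast
    have fy: "face (set ys)" using chain_face[OF e(2) ys(2)] .
    have sub: "set (x # xs) \<subseteq> carrier G" using x face_sub[OF fx] by auto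
    obtain T' where T': "T' \<in> Blocks" "T' \<subseteq> set (x # xs)" using nf sub unfolding face_def by blast
    have "\<not> T' \<subseteq> set ys" using T'(1) fy by (simp add: face_def)
    moreover have "T' \<subseteq> Set.insert a (set ys)" using T'(2) ys(1) by simp
    ultimately have "a \<in> T'" by blast
    then have T: "T \<subseteq> set (x # xs)" using Blocks_disj[OF TB T'(1) a] T' by simp
    have xT: "x \<in> T" using T TB fx unfolding face_def by auto
    show ?thesis
    proof (cases "U = T")
      case True
      have "T - {x} \<subseteq> set xs \<inter> T" using T by auto
      then have "card (T - {x}) \<le> card (set xs \<inter> T)" by (intro card_mono) auto
      then show ?thesis using True xT Block_card[OF TB] Block_fin[OF TB] by simp
    next
      case False
      then have US: "U \<in> S" using U by simp
      then have "x \<notin> U" using Blocks_disj[of U T x] insert.prems False xT by blast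
      then have "set ys \<inter> U \<subseteq> set xs \<inter> U" using ys by auto
      then have "card (set ys \<inter> U) \<le> card (set xs \<inter> U)" by (intro card_mono) auto
      then show ?thesis using e(5)[OF ys(2) US] by simp
    qed
  qed
  have "\<forall>ys. c ys = bd (\<lambda>xs. e xs + ?h xs) ys + ?c ys" using e(3) by (simp add: bd_add)
  then show ?case using bdc sat c chain_add[OF e(1) h]
    by (intro exI[of _ "\<lambda>xs. e xs + ?h xs"] exI[of _ ?c]) auto
qed

text \<open>A simplex with at least p - 1 vertices in every coset has at least \<open>sdim\<close>
  vertices, so below \<open>sdim\<close> the remainder of \<open>exact_step\<close> is zero.\<close>

lemma exact:
  assumes "chain n c" "\<And>ys. bd c ys = 0" "n < sdim"
  shows "\<exists>e. chain (Suc n) e \<and> bd e = c"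
proof -
  obtain e c' where e: "chain (Suc n) e" "chain n c'" "\<And>ys. c ys = bd e ys + c' ys"
    "\<And>xs T. c' xs \<noteq> 0 \<Longrightarrow> T \<in> Blocks \<Longrightarrow> p - 1 \<le> card (set xs \<inter> T)"
    using exact_step[OF Blocks_fin subset_refl assms(1,2)] by metis
  have "c' xs = 0" for xs
  proof (rule ccontr)
    assume x: "c' xs \<noteq> 0"
    have "sdim = (\<Sum>T\<in>Blocks. p - 1)" by (simp add: sdim_def)
    also have "\<dots> \<le> (\<Sum>T\<in>Blocks. card (set xs \<inter> T))" by (intro sum_mono e(4) x)
    also have "\<dots> = card (set xs)"
      using card_Int_Blocks face_sub chain_face[OF e(2) x] by simp
    also have "\<dots> \<le> n" using chain_len[OF e(2) x] card_length[of xs] by simp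
    finally show False using assms(3) by simp
  qed
  then show ?thesis using e by (intro exI[of _ e]) (auto simp: fun_eq_iff)
qed

definition facet :: "'a list \<Rightarrow> bool" where
  "facet xs \<longleftrightarrow> distinct xs \<and> length xs = sdim \<and> face (set xs)"

lemma facet_card: "facet xs \<Longrightarrow> T \<in> Blocks \<Longrightarrow> card (set xs \<inter> T) = p - 1"
proof (rule ccontr)
  assume x: "facet xs" "T \<in> Blocks" "card (set xs \<inter> T) \<noteq> p - 1"
  then have f: "face (set xs)" by (simp add: facet_def)
  have "card (set xs \<inter> T) < p - 1" using face_card[OF f x(2)] x(3) by simp
  then have "(\<Sum>T\<in>Blocks. card (set xs \<inter> T)) < (\<Sum>T\<in>Blocks. p - 1)"
    using x(2) face_card[OF f] Blocks_fin by (intro sum_strict_mono_ex1) auto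
  then have "card (set xs) < sdim" using card_Int_Blocks[OF face_sub[OF f]] by (simp add: sdim_def)
  then show False using x(1) distinct_card[of xs] by (simp add: facet_def)
qed

lemma facet_missing:
  assumes "facet xs" "T \<in> Blocks" "b \<in> T" "b \<notin> set xs"
  shows "T - set xs = {b}"
proof -
  have "card (T - set xs) = card T - card (set xs \<inter> T)"
    using Block_fin[OF assms(2)] by (simp add: card_Diff_subset_Int Int_commute)
  then have "card (T - set xs) = 1"
    using facet_card[OF assms(1,2)] Block_card[OF assms(2)] p_gt_1 by simp
  then obtain b' where "T - set xs = {b'}" by (meson card_1_singletonE)
  moreover have "b \<in> T - set xs" using assms by simp
  ultimately show ?thesis by simp
qed

text \<open>A top cycle is determined by one value. Any facet is turned into any other by exchanging
  one vertex of a coset at a time, and the common ridge of two neighbours lies in no third facet, so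
  the cycle condition at the ridge fixes the ratio of the two values.\<close>

lemma facet_sign:
  "facet xs \<Longrightarrow> facet ys \<Longrightarrow>
     \<exists>s\<in>{1, -1 :: int}. \<forall>c. chain sdim c \<longrightarrow> (\<forall>ws. bd c ws = 0) \<longrightarrow> c ys = s * c xs"
proof (induction "card (set ys - set xs)" arbitrary: xs rule: less_induct)
  case less
  show ?case
  proof (cases "set ys \<subseteq> set xs")
    case True
    have "card (set ys) = card (set xs)" using less.prems by (simp add: facet_def distinct_card)
    with True have "set ys = set xs" by (simp add: card_subset_eq)
    then have "mset xs = mset ys" using less.prems by (metis facet_def set_eq_iff_mset_eq_distinct)
    from alt_perm[OF this] show ?thesis using chain_alt by blast
  next
    case False
    then obtain b where b: "b \<in> set ys" "b \<notin> set xs" by blast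
    have fx: "face (set xs)" and fy: "face (set ys)" using less.prems by (auto simp: facet_def)
    then have "b \<in> carrier G" using b face_sub by blast
    then obtain T where T: "T \<in> Blocks" "b \<in> T" using Blocks_Union by blast
    obtain b' where b': "b' \<in> T" "b' \<notin> set ys" using fy T unfolding face_def by blast
    have Tx: "T - set xs = {b}" by (rule facet_missing[OF less.prems(1) T b(2)])
    have bx: "b' \<in> set xs" "b' \<noteq> b" using Tx b' b by auto
    obtain us vs where xs: "xs = us @ b' # vs" using bx by (meson split_list)
    let ?u = "us @ vs"
    let ?w = "b # ?u"
    have setx: "set xs = Set.insert b' (set ?u)" and ndu: "b' \<notin> set ?u" "distinct ?u"
      using xs less.prems by (auto simp: facet_def)
    have sw: "set ?w = Set.insert b (set xs - {b'})" using setx ndu by auto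
    have wf: "facet ?w"
      unfolding facet_def
    proof (intro conjI)
      show "distinct ?w" using ndu b setx by auto
      show "length ?w = sdim" using less.prems xs by (simp add: facet_def)
      have "\<not> U \<subseteq> set ?w" if "U \<in> Blocks" for U
      proof
        assume U: "U \<subseteq> set ?w"
        show False
        proof (cases "U = T")
          case True
          then show False using U b' bx sw by auto
        next
          case False
          then have "b \<notin> U" using Blocks_disj that T by blast
          then have "U \<subseteq> set xs" using U sw by auto
          then show False using fx that unfolding face_def by blast
        qed
      qed
      then show "face (set ?w)" using face_sub[OF fx] \<open>b \<in> carrier G\<close> sw unfolding face_def by auto
    qed
    have lt: "card (set ys - set ?w) < card (set ys - set xs)"
      using b b' sw by (intro psubset_card_mono) auto
    obtain s where s: "s \<in> {1, -1}" "\<And>c. chain sdim c \<Longrightarrow> (\<forall>ws. bd c ws = 0) \<Longrightarrow> c ys = s * c ?w"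
      using less.hyps[OF lt wf less.prems(2)] by blast
    have "c ys = - s * (- 1) ^ length us * c xs" if c: "chain sdim c" "\<forall>ws. bd c ws = 0" for c
    proof -
      \<comment> \<open>Apart from b and b', a vertex x added to the ridge would complete its own
        coset.\<close>
      have "c (x # ?u) = 0" if x: "x \<noteq> b" "x \<noteq> b'" "x \<in> carrier G" for x
      proof (rule ccontr)
        assume nz: "c (x # ?u) \<noteq> 0"
        have d: "distinct (x # ?u)" using nz alt_not_distinct chain_alt[OF c(1)] by blast
        have f: "face (set (x # ?u))" using chain_face[OF c(1) nz] .
        obtain U where U: "U \<in> Blocks" "x \<in> U" using x Blocks_Union by blast
        have xx: "x \<notin> set xs" using d x setx by auto
        have "U - set xs = {x}" by (rule facet_missing[OF less.prems(1) U xx])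
        moreover have "U \<noteq> T" using Tx xx U x by auto
        then have "b' \<notin> U" using Blocks_disj[OF U(1) T(1)] b' by blast
        ultimately have "U \<subseteq> set (x # ?u)" using setx by auto
        then show False using f U unfolding face_def by blast
      qed
      then have "bd c ?u = (\<Sum>x\<in>{b, b'}. c (x # ?u))"
        unfolding bd_def using fin \<open>b \<in> carrier G\<close> bx face_sub[OF fx]
        by (intro sum.mono_neutral_right) auto
      then have "c ?w = - c (b' # ?u)" using c(2) bx by simp
      moreover have "c xs = (- 1) ^ length us * c (b' # ?u)"
        unfolding xs by (rule alt_front[OF chain_alt[OF c(1)]])
      then have "(- 1) ^ length us * c xs = c (b' # ?u)"
        by (simp flip: mult.assoc power_mult_distrib)
      ultimately have "c ?w = - ((- 1) ^ length us * c xs)" by simp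
      then show ?thesis using s(2)[OF c] by simp
    qed
    moreover have "- s * (- 1) ^ length us \<in> {1, -1}"
      using s(1) by (cases "even (length us)") auto
    ultimately show ?thesis by blast
  qed
qed

text \<open>Remove one element from each coset.\<close>

lemma facet_exists: "\<exists>xs. facet xs"
proof -
  define r where "r T = (SOME x. x \<in> T)" for T :: "'a set"
  have r: "r T \<in> T" if "T \<in> Blocks" for T
    unfolding r_def using Block_card[OF that] p_gt_1 by (intro some_in_eq[THEN iffD2]) auto
  let ?A = "carrier G - r ` Blocks"
  have int: "?A \<inter> T = T - {r T}" if T: "T \<in> Blocks" for T
    using r Block_sub[OF T] Blocks_disj T by blast
  have "card ?A = (\<Sum>T\<in>Blocks. card (?A \<inter> T))" by (intro card_Int_Blocks) auto
  also have "\<dots> = (\<Sum>T\<in>Blocks. p - 1)"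
    using int r Block_card Block_fin by (intro sum.cong) auto
  finally have card: "card ?A = sdim" by (simp add: sdim_def)
  have "\<not> T \<subseteq> ?A" if "T \<in> Blocks" for T using r[OF that] that by blast
  then have "face ?A" by (auto simp: face_def)
  moreover obtain xs where "set xs = ?A" "distinct xs"
    using finite_distinct_list[of ?A] fin by auto
  ultimately show ?thesis using card distinct_card[of xs] by (auto simp: facet_def)
qed


section \<open>The equivariant map from the bar resolution and the Euler cocycle\<close>

definition tr :: "'a \<Rightarrow> ('a list \<Rightarrow> int) \<Rightarrow> 'a list \<Rightarrow> int" where
  "tr g c ys = (if set ys \<subseteq> carrier G then c (map (\<lambda>x. inv g \<otimes> x) ys) else 0)"

lemma map_mult_inv:
  "g \<in> carrier G \<Longrightarrow> set ys \<subseteq> carrier G \<Longrightarrow> map (\<lambda>x. inv g \<otimes> x) (map (\<lambda>x. g \<otimes> x) ys) = ys"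
  "g \<in> carrier G \<Longrightarrow> set ys \<subseteq> carrier G \<Longrightarrow> map (\<lambda>x. g \<otimes> x) (map (\<lambda>x. inv g \<otimes> x) ys) = ys"
  by (induction ys) (auto simp: m_assoc[symmetric])

lemma set_map_mult: "g \<in> carrier G \<Longrightarrow> set ys \<subseteq> carrier G \<Longrightarrow> set (map (\<lambda>x. g \<otimes> x) ys) \<subseteq> carrier G"
  by auto

lemma blk_mult: "g \<in> carrier G \<Longrightarrow> x \<in> carrier G \<Longrightarrow> (\<lambda>y. g \<otimes> y) ` blk x = blk (g \<otimes> x)"
  unfolding blk_def by (force simp: image_image m_assoc)

lemma face_mult: 
  assumes "g \<in> carrier G" "A \<subseteq> carrier G" "face ((\<lambda>x. g \<otimes> x) ` A)"
  shows "face A"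
  unfolding face_def
proof (intro conjI ballI notI)
  fix T assume T: "T \<in> Blocks" "T \<subseteq> A"
  then obtain x where x: "x \<in> carrier G" "T = blk x" by (auto simp: Blocks_def)
  then have "blk (g \<otimes> x) \<subseteq> (\<lambda>x. g \<otimes> x) ` A" using T blk_mult[OF assms(1) x(1)] by blast
  then show False using assms x unfolding face_def Blocks_def by blast
qed (rule assms)

lemma tr_chain: "g \<in> carrier G \<Longrightarrow> chain n c \<Longrightarrow> chain n (tr g c)"
proof -
  assume g: "g \<in> carrier G" and c: "chain n c"
  have "tr g c (us @ x # y # vs) = - tr g c (us @ y # x # vs)" for us x y vs
    using altD[OF chain_alt[OF c], of "map (\<lambda>x. inv g \<otimes> x) us" "inv g \<otimes> x" "inv g \<otimes> y" "map (\<lambda>x. inv g \<otimes> x) vs"]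
    by (auto simp: tr_def)
  then have "alt (tr g c)" by (rule altI)
  moreover have "length ys = n \<and> face (set ys)" if "tr g c ys \<noteq> 0" for ys
  proof -
    have 1: "set ys \<subseteq> carrier G" "c (map (\<lambda>x. inv g \<otimes> x) ys) \<noteq> 0"
      using that by (auto simp: tr_def split: if_splits)
    have "face (set (map (\<lambda>x. inv g \<otimes> x) ys))" using chain_face[OF c 1(2)] .
    then have "face (set ys)" using face_mult[of "inv g" "set ys"] g 1 by simp
    then show ?thesis using chain_len[OF c 1(2)] by simp
  qed
  ultimately show ?thesis by (simp add: chain_def)
qed

lemma tr_tr:
  assumes "g \<in> carrier G" "h \<in> carrier G"
  shows "tr g (tr h c) ys = tr (g \<otimes> h) c ys"
proof (cases "set ys \<subseteq> carrier G")
  case True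
  have "map (\<lambda>x. inv h \<otimes> x) (map (\<lambda>x. inv g \<otimes> x) ys) = map (\<lambda>x. inv (g \<otimes> h) \<otimes> x) ys"
    using assms True by (auto simp: inv_mult_group m_assoc)
  moreover have "set (map (\<lambda>x. inv g \<otimes> x) ys) \<subseteq> carrier G"
    using assms True by (intro set_map_mult) auto
  ultimately show ?thesis using True by (simp add: tr_def del: map_map)
qed (simp add: tr_def)

lemma tr_one: "chain n c \<Longrightarrow> tr \<one> c ys = c ys"
proof -
  assume c: "chain n c"
  show ?thesis
  proof (cases "set ys \<subseteq> carrier G")
    case True
    then have "map (\<lambda>x. inv \<one> \<otimes> x) ys = ys" by (intro map_idI) auto
    then show ?thesis using True by (simp add: tr_def)
  next
    case False
    then have "c ys = 0" using chain_face[OF c, of ys] face_sub by blast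
    then show ?thesis using False by (simp add: tr_def)
  qed
qed

lemma tr_bd: "g \<in> carrier G \<Longrightarrow> bd (tr g c) ys = tr g (bd c) ys"
proof -
  assume g: "g \<in> carrier G"
  have "bij_betw (\<lambda>x. inv g \<otimes> x) (carrier G) (carrier G)"
    by (rule bij_betwI[of _ _ _ "\<lambda>x. g \<otimes> x"]) (use g in \<open>auto simp: m_assoc[symmetric]\<close>)
  then have "(\<Sum>x\<in>carrier G. c ((inv g \<otimes> x) # zs)) = (\<Sum>x\<in>carrier G. c (x # zs))" for zs
    by (rule sum.reindex_bij_betw[of _ _ _ "\<lambda>x. c (x # zs)"])
  then show ?thesis by (simp add: tr_def bd_def)
qed

lemma tr_diff: "tr g (\<lambda>ys. c ys - d ys) ys = tr g c ys - tr g d ys"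
  by (auto simp: tr_def)

text \<open>An equivariant chain map from the homogeneous bar resolution to the chains of the
  sphere. A filling is chosen only for lists that begin with the unit and is then translated by the
  first entry, which makes the map equivariant by construction.\<close>

primrec th :: "nat \<Rightarrow> 'a list \<Rightarrow> 'a list \<Rightarrow> int" where
  "th 0 = (\<lambda>xs ys. if ys = [] then 1 else 0)"
| "th (Suc n) = (\<lambda>xs. tr (hd xs) (SOME e. chain (Suc n) e \<and>
      bd e = (\<lambda>ys. cobd (\<lambda>zs. th n zs ys) (\<one> # map (\<lambda>x. inv (hd xs) \<otimes> x) (tl xs)))))"

text \<open>The boundary to be filled is a cycle because the coboundary squares to zero. Fillings
  come from \<open>exact\<close>, which is where the bound \<open>sdim\<close> originates.\<close>

lemma th_props:
  "n \<le> sdim \<Longrightarrow>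
    (\<forall>xs. set xs \<subseteq> carrier G \<longrightarrow> length xs = n \<longrightarrow> chain n (th n xs) \<and>
       (\<forall>g\<in>carrier G. \<forall>ys. th n (map (\<lambda>x. g \<otimes> x) xs) ys = tr g (th n xs) ys) \<and>
       (n > 0 \<longrightarrow> (\<forall>ys. bd (th n xs) ys = cobd (\<lambda>zs. th (n - 1) zs ys) xs)))"
proof (induction n)
  case 0
  have "alt (\<lambda>ys. if ys = [] then 1 else 0)" by (rule altI) auto
  moreover have "T \<noteq> {}" if "T \<in> Blocks" for T using Block_card[OF that] p_gt_1 by auto
  ultimately have "chain 0 (th 0 [])" unfolding chain_def face_def by auto
  then show ?case by (auto simp: tr_def)
next
  case (Suc n)
  have IH: "chain n (th n xs)" "\<And>g ys. g \<in> carrier G \<Longrightarrow> th n (map (\<lambda>x. g \<otimes> x) xs) ys = tr g (th n xs) ys"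
    "\<And>ys. n > 0 \<Longrightarrow> bd (th n xs) ys = cobd (\<lambda>zs. th (n - 1) zs ys) xs"
    if "set xs \<subseteq> carrier G" "length xs = n" for xs
    using Suc that by auto
  define N where "N xs = \<one> # map (\<lambda>x. inv (hd xs) \<otimes> x) (tl xs)" for xs :: "'a list"
  define E where "E xs = (SOME e. chain (Suc n) e \<and> bd e = (\<lambda>ys. cobd (\<lambda>zs. th n zs ys) (N xs)))" for xs
  have thS: "th (Suc n) xs = tr (hd xs) (E xs)" for xs by (simp add: E_def N_def)
  have N: "set (N xs) \<subseteq> carrier G" "length (N xs) = Suc n" "map (\<lambda>x. hd xs \<otimes> x) (N xs) = xs"
    "hd xs \<in> carrier G"
    if xs: "set xs \<subseteq> carrier G" "length xs = Suc n" for xs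
  proof -
    obtain x ys where x: "xs = x # ys" using xs by (cases xs) auto
    show "hd xs \<in> carrier G" using x xs by simp
    show "set (N xs) \<subseteq> carrier G" using x xs unfolding N_def by auto
    show "length (N xs) = Suc n" using x xs unfolding N_def by simp
    show "map (\<lambda>x. hd xs \<otimes> x) (N xs) = xs" using x xs map_mult_inv(2)[of x ys] unfolding N_def by simp
  qed
  have E: "chain (Suc n) (E xs)" "bd (E xs) = (\<lambda>ys. cobd (\<lambda>zs. th n zs ys) (N xs))"
    if xs: "set xs \<subseteq> carrier G" "length xs = Suc n" for xs
  proof -
    let ?c = "\<lambda>ys. cobd (\<lambda>zs. th n zs ys) (N xs)"
    have del: "set (take i (N xs) @ drop (Suc i) (N xs)) \<subseteq> carrier G"
      "length (take i (N xs) @ drop (Suc i) (N xs)) = n" if "i < Suc n" for i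
      using N(1,2)[OF xs] that set_take_subset[of i "N xs"] set_drop_subset[of "Suc i" "N xs"] by auto
    have "chain n (\<lambda>ys. \<Sum>i<Suc n. (- 1) ^ i * th n (take i (N xs) @ drop (Suc i) (N xs)) ys)"
      by (intro chain_sum chain_cmult IH(1) del) auto
    then have "chain n ?c" by (simp add: cobd_index N(2)[OF xs])
    moreover have "bd ?c ys = 0" for ys
    proof -
      have "bd ?c ys = cobd (\<lambda>zs. bd (th n zs) ys) (N xs)"
        by (simp add: bd_def cobd_sum)
      also have "\<dots> = 0"
      proof (cases "n = 0")
        case True
        then show ?thesis by (simp add: bd_def cobd_zero)
      next
        case False
        have "cobd (\<lambda>zs. bd (th n zs) ys) (N xs) = cobd (cobd (\<lambda>zs. th (n - 1) zs ys)) (N xs)"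
          using N[OF xs] IH(3) False by (intro cobd_cong_eq[where A = "carrier G" and n = n]) auto
        then show ?thesis by (simp add: cobd_cobd)
      qed
      finally show ?thesis .
    qed
    ultimately have "\<exists>e. chain (Suc n) e \<and> bd e = ?c" using exact Suc.prems by simp
    from someI_ex[OF this] show "chain (Suc n) (E xs)" "bd (E xs) = ?c" by (auto simp: E_def)
  qed
  show ?case
  proof (intro allI impI conjI ballI)
    fix xs assume xs: "set xs \<subseteq> carrier G" "length xs = Suc n"
    show "chain (Suc n) (th (Suc n) xs)" unfolding thS by (intro tr_chain E N xs)
    show "th (Suc n) (map (\<lambda>x. g \<otimes> x) xs) ys = tr g (th (Suc n) xs) ys" if g: "g \<in> carrier G" for g ys
    proof -
      obtain x zs where x: "xs = x # zs" using xs by (cases xs) auto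
      have "N (map (\<lambda>x. g \<otimes> x) xs) = N xs"
      proof -
        have "inv (g \<otimes> x) \<otimes> (g \<otimes> y) = inv x \<otimes> y" if "y \<in> set zs" for y
        proof -
          have "x \<in> carrier G" "y \<in> carrier G" using x xs that by auto
          moreover have "inv g \<otimes> (g \<otimes> y) = y" using g calculation by (simp add: m_assoc[symmetric])
          ultimately show ?thesis using g by (simp add: inv_mult_group m_assoc)
        qed
        then show ?thesis using x by (simp add: N_def)
      qed
      then have "E (map (\<lambda>x. g \<otimes> x) xs) = E xs" by (simp add: E_def)
      then show ?thesis unfolding thS using x xs g by (simp add: tr_tr)
    qed
    show "bd (th (Suc n) xs) ys = cobd (\<lambda>zs. th (Suc n - 1) zs ys) xs" for ys
    proof -
      have "bd (th (Suc n) xs) ys = tr (hd xs) (\<lambda>ys. cobd (\<lambda>zs. th n zs ys) (N xs)) ys"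
        unfolding thS using N(4)[OF xs] E(2)[OF xs] by (simp add: tr_bd)
      also have "\<dots> = cobd (\<lambda>zs. tr (hd xs) (th n zs) ys) (N xs)"
        by (simp add: tr_def cobd_zero)
      also have "\<dots> = cobd (\<lambda>zs. th n (map (\<lambda>x. hd xs \<otimes> x) zs) ys) (N xs)"
        using N[OF xs] IH(2) by (intro cobd_cong_eq[where A = "carrier G" and n = n]) auto
      also have "\<dots> = cobd (\<lambda>zs. th n zs ys) xs" using N(3)[OF xs] cobd_map[of "\<lambda>zs. th n zs ys" "\<lambda>x. hd xs \<otimes> x" "N xs"] by simp
      finally show ?thesis by simp
    qed
  qed
qed

declare th.simps(2) [simp del]

lemma th_chain: "set xs \<subseteq> carrier G \<Longrightarrow> length xs = n \<Longrightarrow> n \<le> sdim \<Longrightarrow> chain n (th n xs)"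
  and th_tr: "set xs \<subseteq> carrier G \<Longrightarrow> length xs = n \<Longrightarrow> n \<le> sdim \<Longrightarrow> g \<in> carrier G \<Longrightarrow>
     th n (map (\<lambda>x. g \<otimes> x) xs) ys = tr g (th n xs) ys"
  and th_bd: "set xs \<subseteq> carrier G \<Longrightarrow> length xs = Suc n \<Longrightarrow> Suc n \<le> sdim \<Longrightarrow>
     bd (th (Suc n) xs) ys = cobd (\<lambda>zs. th n zs ys) xs"
  using th_props[of n] th_props[of "Suc n"] by auto

definition A0 :: "'a list" where
  "A0 = (SOME xs. facet xs)"

lemma A0: "facet A0"
  unfolding A0_def using facet_exists by (rule someI_ex)

text \<open>The obstruction to continuing the chain map beyond the top dimension. The coboundary of
  \<open>th sdim\<close> takes values in the top cycles, which are determined by their coefficient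
  at the facet \<open>A0\<close>.\<close>

definition euler :: "'a list \<Rightarrow> int" where
  "euler = cobd (\<lambda>zs. th sdim zs A0)"

lemma cobd_euler: "cobd euler xs = 0"
  by (simp add: euler_def cobd_cobd)

lemma facet_mult: "g \<in> carrier G \<Longrightarrow> facet xs \<Longrightarrow> facet (map (\<lambda>x. g \<otimes> x) xs)"
proof -
  assume g: "g \<in> carrier G" and f: "facet xs"
  then have s: "set xs \<subseteq> carrier G" using face_sub by (auto simp: facet_def)
  have "inj_on (\<lambda>x. g \<otimes> x) (set xs)" 
    by (rule inj_on_inverseI[of _ "\<lambda>x. inv g \<otimes> x"]) (use g s in \<open>auto simp: m_assoc[symmetric]\<close>)
  moreover have "face ((\<lambda>x. inv g \<otimes> x) ` ((\<lambda>x. g \<otimes> x) ` set xs))"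
  proof -
    have "(\<lambda>x. inv g \<otimes> x) ` ((\<lambda>x. g \<otimes> x) ` set xs) = set xs"
      using arg_cong[OF map_mult_inv(1)[OF g s], of set] by (simp add: image_image)
    then show ?thesis using f by (simp add: facet_def)
  qed
  then have "face ((\<lambda>x. g \<otimes> x) ` set xs)" 
    by (rule face_mult[of "inv g", rotated 2]) (use g s in auto)
  ultimately show ?thesis using f by (simp add: facet_def distinct_map)
qed

text \<open>By \<open>facet_sign\<close> the element g acts on all top cycles by one sign. If p is
  odd, the sign raised to the group order p^k is both itself and 1; if p = 2, signs disappear modulo
  p.\<close>

lemma cycle_sign:
  assumes order: "Coset.order G = p ^ k" and g: "g \<in> carrier G"
    and c: "chain sdim c" "\<And>ws. bd c ws = 0"
  shows "eqm (int p) (tr g c A0) (c A0)"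
proof -
  have A0s: "set A0 \<subseteq> carrier G" using A0 face_sub by (auto simp: facet_def)
  obtain s where s: "s \<in> {1, -1}"
    "\<And>c. chain sdim c \<Longrightarrow> (\<forall>ws. bd c ws = 0) \<Longrightarrow> c (map (\<lambda>x. inv g \<otimes> x) A0) = s * c A0"
    using facet_sign[OF A0 facet_mult[of "inv g", OF _ A0]] g by blast
  have step: "tr g c A0 = s * c A0" if "chain sdim c" "\<forall>ws. bd c ws = 0" for c
    using s(2)[OF that] A0s by (simp add: tr_def)
  show ?thesis
  proof (cases "p = 2")
    case True
    have "tr g c A0 = c A0 \<or> tr g c A0 = - c A0" using step[OF c(1)] c(2) s(1) by auto
    then show ?thesis using True by (auto simp: eqm_def)
  next
    case False
    then have "odd p" using prime prime_odd_nat p_gt_1 by force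
    have it: "tr (g [^] (j::nat)) c A0 = s ^ j * c A0" for j
    proof (induction j)
      case 0
      then show ?case using tr_one[OF c(1)] by simp
    next
      case (Suc j)
      have cj: "chain sdim (tr (g [^] j) c)" "\<forall>ws. bd (tr (g [^] j) c) ws = 0"
        using g c tr_chain[OF _ c(1)] by (auto simp: tr_bd tr_def)
      have "tr g (tr (g [^] j) c) A0 = s * (s ^ j * c A0)" using step[OF cj] Suc by simp
      moreover have "g \<otimes> g [^] j = g [^] Suc j" using g nat_pow_Suc2 by simp
      ultimately show ?case using g by (simp add: tr_tr)
    qed
    have "s ^ (p ^ k) = s" using s(1) \<open>odd p\<close> by auto
    moreover have "g [^] (p ^ k) = \<one>" using pow_order_eq_1[OF g] order by simp
    ultimately have "c A0 = s * c A0" using it[of "p ^ k"] tr_one[OF c(1)] by simp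
    moreover have "tr g c A0 = s * c A0" using step[OF c(1)] c(2) by blast
    ultimately have "tr g c A0 = c A0" by simp
    then show ?thesis by simp
  qed
qed

lemma euler_inv:
  assumes order: "Coset.order G = p ^ k" and g: "g \<in> carrier G"
    and xs: "set xs \<subseteq> carrier G" "length xs = Suc sdim"
  shows "eqm (int p) (euler (map (\<lambda>x. g \<otimes> x) xs)) (euler xs)"
proof -
  let ?c = "\<lambda>ys. cobd (\<lambda>zs. th sdim zs ys) xs"
  have del: "set (take i xs @ drop (Suc i) xs) \<subseteq> carrier G"
    "length (take i xs @ drop (Suc i) xs) = sdim" if "i < Suc sdim" for i
    using xs that set_take_subset[of i xs] set_drop_subset[of "Suc i" xs] by auto
  have "chain sdim (\<lambda>ys. \<Sum>i<Suc sdim. (- 1) ^ i * th sdim (take i xs @ drop (Suc i) xs) ys)"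
    by (intro chain_sum chain_cmult th_chain del) auto
  then have c: "chain sdim ?c" by (simp add: cobd_index xs)
  have bdc: "bd ?c ys = 0" for ys
  proof -
    have "bd ?c ys = cobd (\<lambda>zs. bd (th sdim zs) ys) xs"
      by (simp add: bd_def cobd_sum)
    also have "\<dots> = 0"
    proof (cases sdim)
      case 0
      then show ?thesis by (simp add: bd_def cobd_zero)
    next
      case (Suc n)
      have "cobd (\<lambda>zs. bd (th sdim zs) ys) xs = cobd (cobd (\<lambda>zs. th n zs ys)) xs"
        using xs Suc th_bd by (intro cobd_cong_eq[where A = "carrier G" and n = sdim]) auto
      then show ?thesis by (simp add: cobd_cobd)
    qed
    finally show ?thesis .
  qed
  have "euler (map (\<lambda>x. g \<otimes> x) xs) = cobd (\<lambda>zs. th sdim (map (\<lambda>x. g \<otimes> x) zs) A0) xs"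
    unfolding euler_def by (rule cobd_map[of "\<lambda>zs. th sdim zs A0", symmetric])
  also have "\<dots> = cobd (\<lambda>zs. tr g (th sdim zs) A0) xs"
    using xs g th_tr by (intro cobd_cong_eq[where A = "carrier G" and n = sdim]) auto
  also have "\<dots> = tr g ?c A0" by (simp add: tr_def cobd_zero)
  also have "eqm (int p) \<dots> (?c A0)" by (rule cycle_sign[OF order g c bdc])
  finally show ?thesis by (simp add: euler_def)
qed


section \<open>Freeness of the action of z on the faces\<close>

definition sh :: "nat \<Rightarrow> 'a set \<Rightarrow> 'a set" where
  "sh j A = (\<lambda>x. z [^] j \<otimes> x) ` A"

definition krep :: "'a set \<Rightarrow> 'a set" where
  "krep A = (SOME D. D \<in> (\<lambda>j. sh j A) ` {..<p})"

text \<open>The position of A in its orbit under the powers of z, counted from a chosen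
  representative. It serves as a coordinate in which z acts by adding 1 modulo p.\<close>

definition kk :: "'a set \<Rightarrow> nat" where
  "kk A = (SOME k. k < p \<and> sh k (krep A) = A)"

lemma sh_sh: "A \<subseteq> carrier G \<Longrightarrow> sh i (sh j A) = sh (i + j) A"
proof -
  assume "A \<subseteq> carrier G"
  then have "z [^] i \<otimes> (z [^] j \<otimes> x) = z [^] (i + j) \<otimes> x" if "x \<in> A" for x
    using that by (auto simp: nat_pow_mult[symmetric] m_assoc)
  then show ?thesis by (simp add: sh_def image_image)
qed

lemma sh_mod: "sh (j mod p) A = sh j A"
  by (simp add: sh_def z_pow_mod)

lemma sh_0: "A \<subseteq> carrier G \<Longrightarrow> sh 0 A = A"
  by (force simp: sh_def)

lemma sh_sub: "A \<subseteq> carrier G \<Longrightarrow> sh j A \<subseteq> carrier G"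
  by (auto simp: sh_def)

lemma sh_fix:
  assumes A: "A \<subseteq> carrier G" and j: "\<not> p dvd j" and fx: "sh j A = A"
  shows "sh i A = A"
proof -
  have "sh (n * j) A = A" for n
  proof (induction n)
    case (Suc n)
    have "sh (Suc n * j) A = sh j (sh (n * j) A)" by (simp only: sh_sh[OF A] mult_Suc)
    also have "\<dots> = A" by (simp only: Suc fx)
    finally show ?case .
  next
    case 0
    show ?case using sh_0[OF A] by simp
  qed
  moreover have "coprime j p" using prime_imp_coprime[OF prime j] coprime_commute by blast
  then obtain n where "[j * n = 1] (mod p)" using cong_solve_coprime_nat[of j p] by auto
  then have "[i * (j * n) = i * 1] (mod p)" by (intro cong_scalar_left)
  then have "(i * n * j) mod p = i mod p" by (simp add: cong_def ac_simps)
  moreover have "sh i A = sh (i * n * j) A"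
    using sh_mod[of "i * n * j" A] sh_mod[of i A] calculation by simp
  ultimately show ?thesis by simp
qed

text \<open>A face fixed by a nontrivial power of z is fixed by all of them, so with any vertex it
  would contain the whole coset of that vertex.\<close>

lemma sh_inj:
  assumes A: "face A" "A \<noteq> {}" and ij: "i < p" "j < p" "sh i A = sh j A"
  shows "i = j"
  using ij
proof (induction i j rule: linorder_wlog)
  case (le i j)
  show ?case
  proof (rule ccontr)
    assume "i \<noteq> j"
    then have nd: "\<not> p dvd j - i" using le by (auto dest: dvd_imp_le)
    have AG: "A \<subseteq> carrier G" using A face_sub by blast
    have "sh (p - i) (sh i A) = sh (p - i) (sh j A)" using le by simp
    moreover have "p - i + i = p" "p - i + j = p + (j - i)" using le by auto
    ultimately have "sh p A = sh (p + (j - i)) A" by (simp only: sh_sh[OF AG])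
    then have "A = sh (j - i) A" 
      using sh_mod[of p A] sh_mod[of "p + (j - i)" A] sh_mod[of "j - i" A] sh_0[OF AG] by simp
    then have *: "sh k A = A" for k using sh_fix[OF AG nd] by metis
    obtain x where x: "x \<in> A" using A by blast
    have "blk x \<subseteq> A"
    proof
      fix y assume "y \<in> blk x"
      then obtain k :: nat where "y = x \<otimes> z [^] k" by (auto simp: blk_def)
      then have "y \<in> sh k A" using x AG z_pow_central[of x k] by (auto simp: sh_def)
      then show "y \<in> A" using * by simp
    qed
    then show False using A x AG unfolding face_def Blocks_def by blast
  qed
next
  case (sym i j)
  then show ?case by simp
qed

lemma orb_sh: "A \<subseteq> carrier G \<Longrightarrow> (\<lambda>i. sh i (sh j A)) ` {..<p} = (\<lambda>i. sh i A) ` {..<p}"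
proof -
  assume A: "A \<subseteq> carrier G"
  have "sh i (sh j A) \<in> (\<lambda>i. sh i A) ` {..<p}" for i j
    unfolding sh_sh[OF A] using p_gt_1 sh_mod[of "i + j" A]
    by (intro image_eqI[of _ _ "(i + j) mod p"]) auto
  moreover have "sh i A \<in> (\<lambda>i. sh i (sh j A)) ` {..<p}" if "i < p" for i
  proof -
    define l where "l = (i + (p - j mod p)) mod p"
    have "(l + j) mod p = i"
    proof -
      have "(l + j) mod p = (i + (p - j mod p) + j mod p) mod p" unfolding l_def by (simp add: mod_simps)
      also have "i + (p - j mod p) + j mod p = i + p"
        using mod_less_divisor[of p j] p_gt_1 by linarith
      finally show ?thesis using that by simp
    qed
    then have "sh l (sh j A) = sh i A" using sh_sh[OF A] sh_mod by metis
    then show ?thesis using p_gt_1 by (intro image_eqI[of _ _ l]) (auto simp: l_def)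
  qed
  ultimately show ?thesis by blast
qed

lemma krep_sh: "A \<subseteq> carrier G \<Longrightarrow> krep (sh j A) = krep A"
  unfolding krep_def by (simp add: orb_sh)

lemma krep_in: "krep A \<in> (\<lambda>j. sh j A) ` {..<p}"
  unfolding krep_def using p_gt_1 by (intro someI_ex[of "\<lambda>D. D \<in> (\<lambda>j. sh j A) ` {..<p}"]) auto

lemma kk: "A \<subseteq> carrier G \<Longrightarrow> kk A < p \<and> sh (kk A) (krep A) = A"
proof -
  assume A: "A \<subseteq> carrier G"
  obtain j where j: "j < p" "krep A = sh j A" using krep_in[of A] by auto
  have "A = sh 0 A" using sh_0[OF A] by simp
  also have "\<dots> \<in> (\<lambda>i. sh i (sh j A)) ` {..<p}"
    unfolding orb_sh[OF A] using p_gt_1 by auto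
  finally have "\<exists>k. k < p \<and> sh k (krep A) = A" unfolding j by auto
  then show ?thesis unfolding kk_def by (rule someI_ex)
qed

lemma sh_face: "A \<subseteq> carrier G \<Longrightarrow> face (sh j A) \<Longrightarrow> face A"
  unfolding sh_def by (rule face_mult) auto

lemma kk_sh: "face (sh j A) \<Longrightarrow> A \<subseteq> carrier G \<Longrightarrow> A \<noteq> {} \<Longrightarrow> kk (sh j A) = (kk A + j) mod p"
proof -
  assume a: "face (sh j A)" "A \<subseteq> carrier G" "A \<noteq> {}"
  let ?D = "krep A"
  obtain i where i: "?D = sh i A" using krep_in[of A] by auto
  have D: "?D \<subseteq> carrier G" "?D \<noteq> {}" using i sh_sub[OF a(2)] a(3) by (auto simp: sh_def)
  have k: "kk A < p" "sh (kk A) ?D = A" using kk[OF a(2)] by auto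
  have k': "kk (sh j A) < p" "sh (kk (sh j A)) ?D = sh j A"
    using kk[OF sh_sub[OF a(2)], of j] krep_sh[OF a(2), of j] by auto
  have f: "face ?D" using sh_face[OF D(1), of "kk (sh j A)"] k' a by simp
  have "sh j A = sh (j + kk A) ?D" using sh_sh[OF D(1), of j "kk A"] k(2) by simp
  then have "sh (kk (sh j A)) ?D = sh ((kk A + j) mod p) ?D" using k'(2) by (simp add: sh_mod add.commute)
  then show ?thesis using sh_inj[OF f D(2)] k'(1) p_gt_1 by simp
qed

definition dS :: "('a list \<Rightarrow> int) \<Rightarrow> 'a list \<Rightarrow> int" where
  "dS c ys = tr z c ys - c ys"

definition dN :: "('a list \<Rightarrow> int) \<Rightarrow> 'a list \<Rightarrow> int" where
  "dN c ys = (\<Sum>j<p. tr (z [^] j) c ys)"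

lemma chain_dS: "chain n c \<Longrightarrow> chain n (dS c)"
  and chain_dN: "chain n c \<Longrightarrow> chain n (dN c)"
  unfolding dS_def[abs_def] dN_def[abs_def] by (auto intro!: chain_diff chain_sum tr_chain)

lemma bd_dS: "bd (dS c) ys = dS (bd c) ys"
  and bd_dN: "bd (dN c) ys = dN (bd c) ys"
  unfolding dS_def[abs_def] dN_def[abs_def] by (auto simp: bd_diff bd_sum tr_bd)

lemma set_inv_sh:
  assumes "set ys \<subseteq> carrier G"
  shows "sh j (set (map (\<lambda>x. inv (z [^] j) \<otimes> x) ys)) = set ys"
  using arg_cong[OF map_mult_inv(2)[OF z_pow_in assms], of set j] by (simp add: sh_def image_image)

lemma tr_pow_p: "tr (z [^] p) c ys = tr (z [^] (0::nat)) c ys"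
  by (simp add: z_pow)

text \<open>On a free module over the group ring of a cyclic group, the kernel of the norm is the
  image of z - 1. The preimage eta is minus the sum of the translates of c up to the position in the
  orbit, so that \<open>dS eta\<close> telescopes to c. The empty face, which z fixes, is excluded
  by n > 0.\<close>

lemma free_N:
  assumes c: "chain n c" "n > 0" "\<And>ys. int p dvd dN c ys"
  shows "\<exists>\<eta>. chain n \<eta> \<and> (\<forall>ys. eqm (int p) (c ys) (dS \<eta> ys))"
proof -
  define \<eta> where "\<eta> ys = - (\<Sum>i\<le>kk (set ys). tr (z [^] i) c ys)" for ys
  have trc: "chain n (tr (z [^] (i::nat)) c)" for i by (intro tr_chain c) auto
  have "\<eta> (us @ x # y # vs) = - \<eta> (us @ y # x # vs)" for us x y vs
  proof -
    have "set (us @ x # y # vs) = set (us @ y # x # vs)" by auto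
    moreover have "tr (z [^] (i::nat)) c (us @ x # y # vs) = - tr (z [^] i) c (us @ y # x # vs)" for i
      by (rule altD[OF chain_alt[OF trc]])
    ultimately show ?thesis unfolding \<eta>_def by (simp only: sum_negf)
  qed
  then have "alt \<eta>" by (rule altI)
  moreover have "length ys = n \<and> face (set ys)" if nz: "\<eta> ys \<noteq> 0" for ys
  proof -
    obtain i :: nat where "tr (z [^] i) c ys \<noteq> 0" using nz unfolding \<eta>_def
      by (metis (no_types, lifting) neg_equal_0_iff_equal sum.neutral)
    then show ?thesis using chain_len[OF trc] chain_face[OF trc] by blast
  qed
  ultimately have ch: "chain n \<eta>" by (simp add: chain_def)
  have "eqm (int p) (c ys) (dS \<eta> ys)" for ys
  proof (cases "length ys = n \<and> face (set ys)")
    case False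
    then have "c ys = 0" "dS \<eta> ys = 0"
      using chain_len[OF c(1)] chain_face[OF c(1)] chain_len[OF chain_dS[OF ch]] chain_face[OF chain_dS[OF ch]] by blast+
    then show ?thesis by simp
  next
    case True
    then have ys: "set ys \<subseteq> carrier G" "set ys \<noteq> {}" using face_sub c(2) by auto
    let ?y = "map (\<lambda>x. inv z \<otimes> x) ys"
    have y: "sh 1 (set ?y) = set ys" using set_inv_sh[OF ys(1), of 1] by simp
    have yG: "set ?y \<subseteq> carrier G" using ys by auto
    have k: "kk (set ys) = (kk (set ?y) + 1) mod p" "kk (set ?y) < p"
      using kk_sh[of 1 "set ?y"] y True yG ys kk[OF yG] by auto
    have shift: "tr (z [^] i) c ?y = tr (z [^] Suc i) c ys" for i :: nat
    proof -
      have "tr (z [^] i) c ?y = tr z (tr (z [^] i) c) ys" using ys by (simp add: tr_def)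
      also have "\<dots> = tr (z \<otimes> z [^] i) c ys" by (simp add: tr_tr)
      finally show ?thesis using nat_pow_Suc2[OF z_in] by simp
    qed
    have "tr z \<eta> ys = \<eta> ?y" using ys by (simp add: tr_def)
    also have "\<dots> = - (\<Sum>i\<le>kk (set ?y). tr (z [^] Suc i) c ys)" unfolding \<eta>_def by (simp only: shift)
    finally have 1: "dS \<eta> ys = (\<Sum>i\<le>kk (set ys). tr (z [^] i) c ys) - (\<Sum>i\<le>kk (set ?y). tr (z [^] Suc i) c ys)"
      by (simp add: dS_def \<eta>_def)
    have c0: "tr (z [^] (0::nat)) c ys = c ys" using tr_one[OF c(1)] by simp
    show ?thesis
    proof (cases "kk (set ?y) + 1 < p")
      case True
      then have "kk (set ys) = Suc (kk (set ?y))" using k by simp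
      then have "(\<Sum>i\<le>kk (set ys). tr (z [^] i) c ys)
          = tr (z [^] (0::nat)) c ys + (\<Sum>i\<le>kk (set ?y). tr (z [^] Suc i) c ys)"
        by (simp only: sum.atMost_Suc_shift)
      then show ?thesis using 1 c0 by simp
    next
      \<comment> \<open>At the wrap-around of the orbit the telescoping sum also picks up the full
        norm of c, which is zero modulo p.\<close>
      case False
      then have e: "Suc (kk (set ?y)) = p" using k by simp
      then have "kk (set ys) = 0" using k by simp
      then have "dS \<eta> ys = c ys - (\<Sum>i\<le>kk (set ?y). tr (z [^] Suc i) c ys)" using 1 c0 by simp
      moreover have "(\<Sum>i\<le>kk (set ?y). tr (z [^] Suc i) c ys) = dN c ys"
      proof -
        have "tr (z [^] (0::nat)) c ys + (\<Sum>i\<le>kk (set ?y). tr (z [^] Suc i) c ys) = (\<Sum>i\<le>p. tr (z [^] i) c ys)"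
          using e sum.atMost_Suc_shift[of "\<lambda>i. tr (z [^] i) c ys" "kk (set ?y)"] by simp
        also have "\<dots> = dN c ys + tr (z [^] p) c ys"
          unfolding dN_def by (simp add: lessThan_Suc_atMost[symmetric])
        finally show ?thesis by (simp add: tr_pow_p del: nat_pow_0)
      qed
      ultimately show ?thesis using c(3)[of ys] by (simp add: eqm_def)
    qed
  qed
  then show ?thesis using ch by blast
qed

text \<open>The companion of \<open>free_N\<close>: a chain invariant modulo p is the norm of its
  part at position 0 of every orbit.\<close>

lemma free_S:
  assumes c: "chain n c" "n > 0" "\<And>ys. int p dvd dS c ys"
  shows "\<exists>\<eta>. chain n \<eta> \<and> (\<forall>ys. eqm (int p) (c ys) (dN \<eta> ys))"
proof -
  define \<eta> where "\<eta> ys = (if kk (set ys) = 0 then c ys else 0)" for ys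
  have "\<eta> (us @ x # y # vs) = - \<eta> (us @ y # x # vs)" for us x y vs
  proof -
    have "set (us @ x # y # vs) = set (us @ y # x # vs)" by auto
    then show ?thesis unfolding \<eta>_def using altD[OF chain_alt[OF c(1)], of us x y vs] by simp
  qed
  then have "alt \<eta>" by (rule altI)
  moreover have "length ys = n \<and> face (set ys)" if "\<eta> ys \<noteq> 0" for ys
    using that chain_len[OF c(1), of ys] chain_face[OF c(1), of ys] by (simp add: \<eta>_def split: if_splits)
  ultimately have ch: "chain n \<eta>" unfolding chain_def by blast
  have per: "eqm (int p) (tr (z [^] (j::nat)) c ys) (c ys)" for j ys
  proof (induction j arbitrary: ys)
    case 0
    then show ?case using tr_one[OF c(1)] by simp
  next
    case (Suc j)
    have "tr (z [^] Suc j) c ys = tr z (tr (z [^] j) c) ys"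
      using nat_pow_Suc2[OF z_in] by (simp add: tr_tr)
    also have "eqm (int p) \<dots> (tr z c ys)" using Suc[of "map (\<lambda>x. inv z \<otimes> x) ys"] by (simp add: tr_def[of z])
    also have "eqm (int p) \<dots> (c ys)" using c(3)[of ys] by (simp add: dS_def eqm_def)
    finally show ?case .
  qed
  have "eqm (int p) (c ys) (dN \<eta> ys)" for ys
  proof (cases "length ys = n \<and> face (set ys)")
    case False
    then have "c ys = 0" "dN \<eta> ys = 0"
      using chain_len[OF c(1)] chain_face[OF c(1)] chain_len[OF chain_dN[OF ch]] chain_face[OF chain_dN[OF ch]] by blast+
    then show ?thesis by simp
  next
    case True
    then have ys: "set ys \<subseteq> carrier G" "set ys \<noteq> {}" using face_sub c(2) by auto
    let ?y = "\<lambda>j. map (\<lambda>x. inv (z [^] (j::nat)) \<otimes> x) ys"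
    have k: "kk (set ys) = (kk (set (?y j)) + j) mod p" "kk (set (?y j)) < p" for j
    proof -
      have yG: "set (?y j) \<subseteq> carrier G" using ys by auto
      show "kk (set ys) = (kk (set (?y j)) + j) mod p" "kk (set (?y j)) < p"
        using kk_sh[of j "set (?y j)"] set_inv_sh[OF ys(1), of j] True yG ys kk[OF yG] by auto
    qed
    have kz: "kk (set (?y j)) = 0 \<longleftrightarrow> j = kk (set ys)" if "j < p" for j
    proof
      assume j: "j = kk (set ys)"
      have "(kk (set (?y j)) + j) mod p = (0 + j) mod p" using k(1)[of j] j that by simp
      then show "kk (set (?y j)) = 0"
        using k(2)[of j] cong_add_rcancel_nat[of "kk (set (?y j))" j 0 p] by (simp add: cong_def)
    qed (use k(1)[of j] that in simp)
    have "dN \<eta> ys = (\<Sum>j<p. if j = kk (set ys) then tr (z [^] j) c ys else 0)"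
      unfolding dN_def using ys kz by (intro sum.cong) (auto simp: tr_def \<eta>_def)
    also have "\<dots> = tr (z [^] kk (set ys)) c ys" using kk[OF ys(1)] by simp
    finally show ?thesis using per eqm_sym by metis
  qed
  then show ?thesis using ch by blast
qed


section \<open>The Euler class on the subgroup generated by z\<close>

definition sZ :: "('a \<Rightarrow> 'k::comm_ring_1) \<Rightarrow> 'a \<Rightarrow> 'k" where
  "sZ \<Phi> g = \<Phi> (g \<otimes> z) - \<Phi> g"

definition nZ :: "('a \<Rightarrow> 'k::comm_ring_1) \<Rightarrow> 'a \<Rightarrow> 'k" where
  "nZ \<Phi> g = (\<Sum>j<p. \<Phi> (g \<otimes> z [^] j))"

text \<open>The generator of degree n in the periodic resolution of the subgroup generated by z, as
  a bar chain. Letters are added in front, so the last one is always z - 1, whose augmentation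
  vanishes even over the integers.\<close>

primrec wd :: "nat \<Rightarrow> (('a \<Rightarrow> 'k::comm_ring_1) \<Rightarrow> 'a \<Rightarrow> 'k) list" where
  "wd 0 = []"
| "wd (Suc n) = (if even n then sZ else nZ) # wd n"

lemma length_wd [simp]: "length (wd n) = n"
  by (induction n) auto

lemma sZ_lop: "letters.lop P (carrier G) (\<otimes>) sZ"
proof (rule letters.lopI[OF letters_carrier])
  show "lin sZ" by (auto simp: lin_def sZ_def fun_eq_iff algebra_simps)
qed (auto simp: sZ_def m_assoc intro!: eqm_diff)

lemma nZ_lop: "letters.lop P (carrier G) (\<otimes>) nZ"
proof (rule letters.lopI[OF letters_carrier])
  show "lin nZ" by (auto simp: lin_def nZ_def fun_eq_iff sum.distrib sum_distrib_left)
qed (auto simp: nZ_def m_assoc intro!: eqm_sum)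

lemma sum_shift_z: "(\<Sum>j<p. \<phi> (z [^] Suc j)) = (\<Sum>j<p. \<phi> (z [^] j))"
  for \<phi> :: "'a \<Rightarrow> 'k::comm_ring_1"
proof -
  have "(\<Sum>j<p. \<phi> (z [^] Suc j)) + \<phi> (z [^] (0::nat)) = (\<Sum>j<Suc p. \<phi> (z [^] j))"
    by (subst sum.lessThan_Suc_shift) simp
  also have "\<dots> = (\<Sum>j<p. \<phi> (z [^] j)) + \<phi> (z [^] p)" by simp
  finally show ?thesis by (simp add: z_pow)
qed

lemma sZ_nZ: "g \<in> carrier G \<Longrightarrow> sZ (nZ \<Phi>) g = 0"
  and nZ_sZ: "g \<in> carrier G \<Longrightarrow> nZ (sZ \<Phi>) g = 0"
proof -
  assume g: "g \<in> carrier G"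
  have 1: "z \<otimes> z [^] j = z [^] Suc j" "z [^] j \<otimes> z = z [^] Suc j" for j :: nat
    by (rule nat_pow_Suc2[OF z_in, symmetric], rule nat_pow_Suc[symmetric])
  show "sZ (nZ \<Phi>) g = 0"
    unfolding sZ_def nZ_def m_assoc[OF g z_in z_pow_in] 1 sum_shift_z[of "\<lambda>w. \<Phi> (g \<otimes> w)"] by (rule diff_self)
  show "nZ (sZ \<Phi>) g = 0"
    unfolding sZ_def nZ_def m_assoc[OF g z_pow_in z_in] 1 sum_subtractf sum_shift_z[of "\<lambda>w. \<Phi> (g \<otimes> w)"]
    by (rule diff_self)
qed

lemma last_wd: "n > 0 \<Longrightarrow> last (wd n) = sZ"
proof (induction n)
  case (Suc n)
  then show ?case by (cases n) auto
qed simp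

lemma wd_props:
  "\<forall>a\<in>set (wd n). letters.lop P (carrier G) (\<otimes>) a"
  "successively (letters.ann P (carrier G)) (wd n)"
  "n > 0 \<Longrightarrow> letters.eps0 P (carrier G) (last (wd n))"
proof -
  show "\<forall>a\<in>set (wd n). letters.lop P (carrier G) (\<otimes>) a"
    by (induction n) (auto simp: sZ_lop nZ_lop)
  have ann: "letters.ann P (carrier G) sZ nZ" "letters.ann P (carrier G) nZ sZ"
    by (auto simp: letters.ann_def[OF letters_carrier] sZ_nZ nZ_sZ)
  show "successively (letters.ann P (carrier G)) (wd n)"
  proof (induction n)
    case (Suc n)
    then show ?case using ann by (cases n) (auto simp: successively_Cons)
  qed simp
  show "letters.eps0 P (carrier G) (last (wd n))" if n: "n > 0"
    unfolding last_wd[OF n] by (simp add: letters.eps0_def[OF letters_carrier] sZ_def)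
qed

text \<open>The image in the sphere of the degree n generator of the periodic resolution.\<close>

definition T :: "nat \<Rightarrow> 'a list \<Rightarrow> int" where
  "T n ys = EV (\<lambda>xs. th (Suc n) xs ys) \<one> (wd n)"

lemma wd_lin: "\<forall>a\<in>set (wd n). lin a"
  using wd_props(1)[of n 0] letters.lop_lin[OF letters_carrier, of 0] by blast

lemma EV_cong0:
  assumes "h \<in> carrier G" "\<And>xs. set xs \<subseteq> carrier G \<Longrightarrow> length xs = Suc n \<Longrightarrow> f xs = f' xs"
  shows "EV f h (wd n) = EV f' h (wd n)"
  using letters.EV_cong[OF letters_carrier wd_props(1)[of n 0] assms(1), of f f'] assms
  by (simp add: eqm_def)

lemma EV_th:
  assumes h: "h \<in> carrier G" and n: "Suc n \<le> sdim"
  shows "EV (\<lambda>xs. th (Suc n) xs ys) h (wd n) = tr h (T n) ys"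
proof -
  have "eqm 0 (EV (\<lambda>xs. th (Suc n) xs ys) (h \<otimes> \<one>) (wd n))
      (EV (\<lambda>xs. th (Suc n) (map (\<lambda>x. h \<otimes> x) xs) ys) \<one> (wd n))"
    using h by (intro letters.EV_shift[OF letters_carrier wd_props(1)]) auto
  then have "EV (\<lambda>xs. th (Suc n) xs ys) h (wd n) = EV (\<lambda>xs. th (Suc n) (map (\<lambda>x. h \<otimes> x) xs) ys) \<one> (wd n)"
    using h by (simp add: eqm_def)
  also have "\<dots> = EV (\<lambda>xs. tr h (th (Suc n) xs) ys) \<one> (wd n)"
    using h n th_tr by (intro EV_cong0) auto
  also have "\<dots> = tr h (T n) ys"
    by (cases "set ys \<subseteq> carrier G") (simp_all add: tr_def T_def EV_zero[OF wd_lin])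
  finally show ?thesis .
qed

lemma T_chain: "Suc n \<le> sdim \<Longrightarrow> chain (Suc n) (T n)"
proof -
  assume n: "Suc n \<le> sdim"
  have th: "chain (Suc n) (th (Suc n) xs)" if "set xs \<subseteq> carrier G" "length xs = Suc n" for xs
    using th_chain[OF that n] .
  have "T n (us @ x # y # vs) = - T n (us @ y # x # vs)" for us x y vs
  proof -
    have "T n (us @ x # y # vs) = EV (\<lambda>xs. (-1) * th (Suc n) xs (us @ y # x # vs)) \<one> (wd n)"
      unfolding T_def using altD[OF chain_alt[OF th], of _ us x y vs] by (intro EV_cong0) auto
    also have "\<dots> = (-1) * T n (us @ y # x # vs)"
      unfolding T_def by (rule EV_cmult[OF wd_lin])
    finally show ?thesis by simp
  qed
  then have "alt (T n)" by (rule altI)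
  moreover have "length ys = Suc n \<and> face (set ys)" if nz: "T n ys \<noteq> 0" for ys
  proof (rule ccontr)
    assume "\<not> (length ys = Suc n \<and> face (set ys))"
    then have "th (Suc n) xs ys = 0" if "set xs \<subseteq> carrier G" "length xs = Suc n" for xs
      using chain_len[OF th[OF that], of ys] chain_face[OF th[OF that], of ys] by blast
    then have "T n ys = EV (\<lambda>xs. 0) \<one> (wd n)" unfolding T_def by (intro EV_cong0) auto
    then show False using nz by (simp add: EV_zero[OF wd_lin])
  qed
  ultimately show ?thesis by (simp add: chain_def)
qed

text \<open>With modulus 0, \<open>TT_zero\<close> says that every face except the one without base
  vertex vanishes exactly.\<close>

lemma EV_word:
  fixes f :: "'a list \<Rightarrow> 'k::comm_ring_1"
  assumes "h \<in> carrier G"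
  shows "EV (cobd f) h (wd (Suc n)) = (if even n then sZ else nZ) (\<lambda>h. EV f h (wd n)) h"
proof -
  have "EV (cobd f) h (wd (Suc n)) = (if even n then sZ else nZ) (\<lambda>h. EV f h (wd n)) h - TT f h (wd (Suc n))"
  proof -
    have lins: "\<forall>b\<in>set (wd (Suc n) :: (('a \<Rightarrow> 'k) \<Rightarrow> 'a \<Rightarrow> 'k) list). lin b" by (rule wd_lin)
    show ?thesis unfolding wd.simps by (rule EV_cobd[OF lins[unfolded wd.simps], of f h])
  qed
  moreover have "eqm 0 (TT f h (wd (Suc n))) 0"
    using assms by (intro letters.TT_zero[OF letters_carrier] wd_props) auto
  ultimately show ?thesis by (simp add: eqm_def)
qed

lemma letters_T:
  assumes "Suc n \<le> sdim"
  shows "sZ (\<lambda>h. EV (\<lambda>xs. th (Suc n) xs ys) h (wd n)) \<one> = dS (T n) ys"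
    "nZ (\<lambda>h. EV (\<lambda>xs. th (Suc n) xs ys) h (wd n)) \<one> = dN (T n) ys"
  using EV_th[OF _ assms] tr_one[OF T_chain[OF assms]]
  by (auto simp: sZ_def nZ_def dS_def dN_def)

lemma bd_T:
  assumes "Suc (Suc n) \<le> sdim"
  shows "bd (T (Suc n)) ys = (if even n then dS else dN) (T n) ys"
proof -
  have "bd (T (Suc n)) ys = EV (\<lambda>xs. bd (th (Suc (Suc n)) xs) ys) \<one> (wd (Suc n))"
    unfolding bd_def T_def by (rule EV_sum[OF wd_lin, symmetric])
  also have "\<dots> = EV (cobd (\<lambda>zs. th (Suc n) zs ys)) \<one> (wd (Suc n))"
    using assms th_bd by (intro EV_cong0) auto
  also have "\<dots> = (if even n then dS else dN) (T n) ys"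
    unfolding EV_word[OF one_closed] using letters_T assms by simp
  finally show ?thesis .
qed

lemma dN_dS: "chain n c \<Longrightarrow> dN (dS c) ys = 0"
proof -
  assume c: "chain n c"
  have "tr (z [^] j) (dS c) ys = tr (z [^] Suc j) c ys - tr (z [^] j) c ys" for j :: nat
  proof -
    have "tr (z [^] j) (dS c) ys = tr (z [^] j) (tr z c) ys - tr (z [^] j) c ys"
      unfolding dS_def[abs_def] by (rule tr_diff)
    then show ?thesis by (simp add: tr_tr)
  qed
  then show ?thesis
    unfolding dN_def using sum_shift_z[of "\<lambda>w. tr w c ys"] by (simp add: sum_subtractf del: nat_pow_Suc)
qed

text \<open>The value is the coefficient at \<open>A0\<close> of the norm of
  \<open>T (sdim - 1)\<close>, a top cycle; if p divides this coefficient, it divides all of them.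
  By freeness each \<open>T n\<close> is then, modulo p, a boundary plus an image of z - 1 or of the
  norm, for n descending to 0. There the augmentation of a norm is a multiple of p, whereas that of
  \<open>T 0\<close> is 1.\<close>

theorem euler_nonzero:
  assumes "even sdim" "sdim > 0"
  shows "\<not> int p dvd EV euler \<one> (wd sdim)"
proof
  assume dvd: "int p dvd EV euler \<one> (wd sdim)"
  obtain k where k: "sdim = Suc (Suc k)" "even k"
    using assms by (metis Suc_pred even_Suc gr0I odd_pos zero_less_Suc dvd_0_right)
  have ch: "chain (Suc n) (T n)" if "n \<le> Suc k" for n using that k by (intro T_chain) simp
  have "EV euler \<one> (wd (Suc (Suc k))) = dN (T (Suc k)) A0"
    unfolding euler_def EV_word[OF one_closed] using letters_T(2)[of "Suc k" A0] k by simp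
  then have dvd0: "int p dvd dN (T (Suc k)) A0" using dvd k by simp
  have cN: "chain sdim (dN (T (Suc k)))" unfolding k(1) by (intro chain_dN ch) simp
  have "bd (T (Suc k)) = dS (T k)" using bd_T[of k] k by (simp add: fun_eq_iff)
  then have bN: "bd (dN (T (Suc k))) ys = 0" for ys using dN_dS[OF ch[of k]] by (simp add: bd_dN)
  have dvdN: "int p dvd dN (T (Suc k)) ys" for ys
  proof (cases "facet ys")
    case True
    then show ?thesis using facet_sign[OF A0 True] cN bN dvd0 by force
  next
    case False
    then have "dN (T (Suc k)) ys = 0"
      using alt_not_distinct[OF chain_alt[OF cN], of ys] chain_len[OF cN, of ys] chain_face[OF cN, of ys]
      unfolding facet_def by blast
    then show ?thesis by simp
  qed
  have "\<exists>\<zeta> \<eta>. chain (Suc n) \<zeta> \<and> chain (Suc (Suc n)) \<eta> \<and>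
      (\<forall>ys. eqm (int p) (T n ys) (bd \<eta> ys + (if odd n then dS else dN) \<zeta> ys))" if "n \<le> Suc k" for n
    using that
  proof (induction n rule: inc_induct)
    case base
    obtain \<zeta> where "chain (Suc (Suc k)) \<zeta>" "\<And>ys. eqm (int p) (T (Suc k) ys) (dS \<zeta> ys)"
      using free_N[OF ch[of "Suc k"] _ dvdN] by auto
    then show ?case using k(2) chain_zero
      by (intro exI[of _ \<zeta>] exI[of _ "\<lambda>xs. 0"]) (auto simp: bd_def)
  next
    case (step n)
    then obtain \<zeta> \<eta> where h: "chain (Suc (Suc n)) \<zeta>" "chain (Suc (Suc (Suc n))) \<eta>"
      "\<And>ys. eqm (int p) (T (Suc n) ys) (bd \<eta> ys + (if even n then dS else dN) \<zeta> ys)" by auto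
    \<comment> \<open>The congruence one degree higher says that z - 1 or the norm kills c modulo p,
      so \<open>free_S\<close> or \<open>free_N\<close> applies to c.\<close>
    define c where "c ys = T n ys - bd \<zeta> ys" for ys
    have c: "chain (Suc n) c" unfolding c_def[abs_def]
      using step by (intro chain_diff ch chain_bd h) auto
    have "int p dvd (if even n then dS else dN) c ys" for ys
    proof -
      have "eqm (int p) (bd (T (Suc n)) ys) (bd (\<lambda>ys. bd \<eta> ys + (if even n then dS else dN) \<zeta> ys) ys)"
        unfolding bd_def[of "T (Suc n)"] bd_def[of "\<lambda>ys. bd \<eta> ys + _ ys"] by (intro eqm_sum h(3))
      also have "bd (\<lambda>ys. bd \<eta> ys + (if even n then dS else dN) \<zeta> ys) ys = (if even n then dS else dN) (bd \<zeta>) ys"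
        using bd_bd[OF chain_alt[OF h(2)]] by (simp add: bd_add bd_dS bd_dN)
      also have "bd (T (Suc n)) ys = (if even n then dS else dN) (T n) ys"
        using step k by (intro bd_T) simp
      finally show ?thesis
        by (cases "even n") (simp_all add: eqm_def dS_def dN_def c_def[abs_def] tr_diff sum_subtractf algebra_simps)
    qed
    then obtain \<zeta>' where "chain (Suc n) \<zeta>'" "\<And>ys. eqm (int p) (c ys) ((if odd n then dS else dN) \<zeta>' ys)"
      using free_S[OF c] free_N[OF c] by (cases "even n") auto
    moreover have "eqm (int p) (T n ys) (bd \<zeta> ys + w)" if "eqm (int p) (c ys) w" for ys w
      using that by (simp add: eqm_def c_def algebra_simps)
    ultimately show ?case using h(1) by (intro exI[of _ \<zeta>'] exI[of _ \<zeta>]) auto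
  qed
  from this[of 0] obtain \<zeta> \<eta> where h: "chain (Suc 0) \<zeta>" "chain (Suc (Suc 0)) \<eta>"
    "\<And>ys. eqm (int p) (T 0 ys) (bd \<eta> ys + dN \<zeta> ys)" by auto
  have "bd (T 0) [] = cobd (\<lambda>zs. th 0 zs []) [\<one>]"
    using th_bd[of "[\<one>]" 0 "[]"] k by (simp add: T_def bd_def)
  then have 1: "bd (T 0) [] = 1" by simp
  have "eqm (int p) (bd (T 0) []) (bd (\<lambda>ys. bd \<eta> ys + dN \<zeta> ys) [])"
    unfolding bd_def[of "T 0"] bd_def[of "\<lambda>ys. bd \<eta> ys + _ ys"] by (intro eqm_sum h(3))
  also have "bd (\<lambda>ys. bd \<eta> ys + dN \<zeta> ys) [] = int p * bd \<zeta> []"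
  proof -
    have "dN (bd \<zeta>) [] = int p * bd \<zeta> []" by (simp add: dN_def tr_def)
    then show ?thesis using bd_bd[OF chain_alt[OF h(2)]] by (simp add: bd_add bd_dN)
  qed
  finally have "int p dvd 1 - int p * bd \<zeta> []" using 1 by (simp add: eqm_def)
  then have "int p dvd (1 - int p * bd \<zeta> []) + int p * bd \<zeta> []" by (intro dvd_add) auto
  then have "int p dvd 1" by simp
  then show False using p_gt_1 by simp
qed

end

section \<open>Reduction modulo a prime number\<close>

lemma of_nat_dvd_binomial:
  assumes "Factorial_Ring.prime p" "0 < k" "k < p"
  shows "(of_nat p :: 'k::comm_ring_1) dvd of_nat (p choose k)"
proof -
  have "p dvd (p choose k)" using assms by (intro dvd_choose_prime) auto
  then show ?thesis by (metis dvd_def of_nat_mult)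
qed

lemma freshman_add:
  fixes a b :: "'k::comm_ring_1"
  assumes p: "Factorial_Ring.prime p"
  shows "eqm (of_nat p) ((a + b) ^ p) (a ^ p + b ^ p)"
proof -
  have p0: "p > 0" using p prime_gt_0_nat by blast
  let ?f = "\<lambda>k. of_nat (p choose k) * a ^ k * b ^ (p - k)"
  have "(a + b) ^ p = (\<Sum>k\<in>{..p}. ?f k)" by (rule binomial_ring)
  also have "{..p} = insert 0 (insert p {0<..<p})" using p0 by auto
  also have "sum ?f \<dots> = a ^ p + b ^ p + sum ?f {0<..<p}" using p0 by (simp add: algebra_simps)
  finally have "(a + b) ^ p - (a ^ p + b ^ p) = sum ?f {0<..<p}" by simp
  moreover have "of_nat p dvd sum ?f {0<..<p}"
    by (intro dvd_sum) (use of_nat_dvd_binomial[OF p, where ?'k = 'k] in \<open>auto simp: mult.assoc intro!: dvd_mult2\<close>)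
  ultimately show ?thesis by (simp add: eqm_def)
qed

lemma freshman_sum:
  fixes f :: "'i \<Rightarrow> 'k::comm_ring_1"
  assumes p: "Factorial_Ring.prime p"
  shows "eqm (of_nat p) ((\<Sum>i\<in>I. f i) ^ p) (\<Sum>i\<in>I. f i ^ p)"
proof (induction I rule: infinite_finite_induct)
  case (insert x F)
  have "eqm (of_nat p) ((f x + (\<Sum>i\<in>F. f i)) ^ p) (f x ^ p + (\<Sum>i\<in>F. f i) ^ p)"
    by (rule freshman_add[OF p])
  also have "eqm (of_nat p) \<dots> (f x ^ p + (\<Sum>i\<in>F. f i ^ p))" using insert by (intro eqm_add) auto
  finally show ?case using insert by simp
qed (use prime_gt_0_nat[OF p] in \<open>auto simp: zero_power\<close>)

lemma freshman_sum_power: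
  fixes f :: "'i \<Rightarrow> 'k::comm_ring_1"
  assumes p: "Factorial_Ring.prime p"
  shows "eqm (of_nat p) ((\<Sum>i\<in>I. f i) ^ (p ^ e)) (\<Sum>i\<in>I. f i ^ (p ^ e))"
proof (induction e)
  case (Suc e)
  have "eqm (of_nat p) (((\<Sum>i\<in>I. f i) ^ (p ^ e)) ^ p) ((\<Sum>i\<in>I. f i ^ (p ^ e)) ^ p)"
    by (rule eqm_power[OF Suc])
  also have "eqm (of_nat p) \<dots> (\<Sum>i\<in>I. (f i ^ (p ^ e)) ^ p)" by (rule freshman_sum[OF p])
  finally show ?case by (simp add: power_mult[symmetric] mult.commute)
qed simp

lemma freshman_diff_power:
  fixes a b :: "'k::comm_ring_1"
  assumes p: "Factorial_Ring.prime p"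
  shows "eqm (of_nat p) ((a - b) ^ (p ^ e)) (a ^ (p ^ e) - b ^ (p ^ e))"
proof -
  have "eqm (of_nat p) (((a - b) + b) ^ (p ^ e)) ((a - b) ^ (p ^ e) + b ^ (p ^ e))"
    using freshman_sum_power[OF p, of "\<lambda>x. if x then a - b else b" UNIV e] by (simp add: UNIV_bool add.commute)
  then show ?thesis by (auto simp: eqm_def algebra_simps dvd_diff_commute)
qed

lemma op_binomial:
  fixes A B :: "('a \<Rightarrow> 'k::comm_ring_1) \<Rightarrow> 'a \<Rightarrow> 'k"
  assumes A: "lin A" and B: "lin B" and AB: "\<And>\<Phi>. B (A \<Phi>) = A (B \<Phi>)"
  shows "((\<lambda>\<Phi> g. A \<Phi> g + B \<Phi> g) ^^ n) \<Phi> g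
    = (\<Sum>k\<le>n. of_nat (n choose k) * (A ^^ k) ((B ^^ (n - k)) \<Phi>) g)"
proof (induction n arbitrary: g)
  case (Suc n)
  let ?t = "\<lambda>k l. (A ^^ k) ((B ^^ l) \<Phi>)"
  let ?c = "\<lambda>n k. of_nat (n choose k) :: 'k"
  have comm: "B ((A ^^ k) \<Psi>) = (A ^^ k) (B \<Psi>)" for k \<Psi>
    by (induction k) (auto simp: AB)
  have Bt: "B (?t k l) = ?t k (Suc l)" for k l by (simp add: comm)
  have IH: "((\<lambda>\<Phi> g. A \<Phi> g + B \<Phi> g) ^^ n) \<Phi> = (\<lambda>g. \<Sum>k\<le>n. ?c n k * ?t k (n - k) g)"
    using Suc by auto
  have "((\<lambda>\<Phi> g. A \<Phi> g + B \<Phi> g) ^^ Suc n) \<Phi> g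
      = (\<Sum>k\<le>n. ?c n k * ?t (Suc k) (n - k) g) + (\<Sum>k\<le>n. ?c n k * ?t k (Suc (n - k)) g)"
    by (simp add: IH lin_sum[OF A] lin_sum[OF B] lin_cmult[OF A] lin_cmult[OF B] comm)
  also have "(\<Sum>k\<le>n. ?c n k * ?t k (Suc (n - k)) g) = (\<Sum>k\<le>Suc n. ?c n k * ?t k (Suc n - k) g)"
    by (simp add: Suc_diff_le binomial_eq_0)
  also have "\<dots> = ?t 0 (Suc n) g + (\<Sum>k\<le>n. ?c n (Suc k) * ?t (Suc k) (n - k) g)"
    by (subst sum.atMost_Suc_shift) (simp add: binomial_eq_0)
  also have "(\<Sum>k\<le>n. ?c n k * ?t (Suc k) (n - k) g) + (?t 0 (Suc n) g + (\<Sum>k\<le>n. ?c n (Suc k) * ?t (Suc k) (n - k) g))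
     = ?t 0 (Suc n) g + (\<Sum>k\<le>n. ?c (Suc n) (Suc k) * ?t (Suc k) (n - k) g)"
    by (simp add: sum.distrib[symmetric] algebra_simps)
  also have "\<dots> = (\<Sum>k\<le>Suc n. ?c (Suc n) k * ?t k (Suc n - k) g)"
    by (subst sum.atMost_Suc_shift) simp
  finally show ?case .
qed simp

lemma freshman_op_add:
  fixes A B :: "('a \<Rightarrow> 'k::comm_ring_1) \<Rightarrow> 'a \<Rightarrow> 'k"
  assumes p: "Factorial_Ring.prime p" and A: "lin A" and B: "lin B" and AB: "\<And>\<Phi>. B (A \<Phi>) = A (B \<Phi>)"
  shows "eqm (of_nat p) (((\<lambda>\<Phi> g. A \<Phi> g + B \<Phi> g) ^^ p) \<Phi> g) ((A ^^ p) \<Phi> g + (B ^^ p) \<Phi> g)"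
proof -
  have p0: "p > 0" using p prime_gt_0_nat by blast
  let ?f = "\<lambda>k. of_nat (p choose k) * (A ^^ k) ((B ^^ (p - k)) \<Phi>) g"
  have "((\<lambda>\<Phi> g. A \<Phi> g + B \<Phi> g) ^^ p) \<Phi> g = (\<Sum>k\<in>{..p}. ?f k)"
    by (rule op_binomial[OF A B AB])
  also have "{..p} = insert 0 (insert p {0<..<p})" using p0 by auto
  also have "sum ?f \<dots> = (A ^^ p) \<Phi> g + (B ^^ p) \<Phi> g + sum ?f {0<..<p}" using p0 by (simp add: algebra_simps)
  finally have "((\<lambda>\<Phi> g. A \<Phi> g + B \<Phi> g) ^^ p) \<Phi> g - ((A ^^ p) \<Phi> g + (B ^^ p) \<Phi> g) = sum ?f {0<..<p}" by simp
  moreover have "of_nat p dvd sum ?f {0<..<p}"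
    by (intro dvd_sum) (use of_nat_dvd_binomial[OF p, where ?'k = 'k] in \<open>auto intro!: dvd_mult2\<close>)
  ultimately show ?thesis by (simp add: eqm_def)
qed

text \<open>The Frobenius identity for commuting operators. Letters are functions and not elements
  of a commutative ring, so the binomial theorem for rings cannot be quoted.\<close>

lemma freshman_op_sum:
  fixes A :: "'i \<Rightarrow> ('a \<Rightarrow> 'k::comm_ring_1) \<Rightarrow> 'a \<Rightarrow> 'k"
  assumes p: "Factorial_Ring.prime p" and I: "finite I" and A: "\<And>i. i \<in> I \<Longrightarrow> lin (A i)"
    and comm: "\<And>i j \<Phi>. i \<in> I \<Longrightarrow> j \<in> I \<Longrightarrow> A i (A j \<Phi>) = A j (A i \<Phi>)"
  shows "eqm (of_nat p) (((\<lambda>\<Phi> g. \<Sum>i\<in>I. A i \<Phi> g) ^^ p) \<Phi> g) (\<Sum>i\<in>I. (A i ^^ p) \<Phi> g)"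
  using I A comm
proof (induction I arbitrary: g)
  case empty
  obtain k where "p = Suc k" using p prime_gt_0_nat[of p] by (cases p) auto
  then show ?case by simp
next
  case (insert x F)
  let ?S = "\<lambda>\<Phi> g. \<Sum>i\<in>F. A i \<Phi> g"
  have linS: "lin ?S" unfolding lin_def
    using insert.prems(1) by (auto simp: fun_eq_iff lin_add lin_cmult sum.distrib sum_distrib_left)
  have "?S (A x \<Psi>) = A x (?S \<Psi>)" for \<Psi>
    using insert.prems insert.hyps by (auto simp: fun_eq_iff lin_sum[OF insert.prems(1)[of x]])
  then have "eqm (of_nat p) (((\<lambda>\<Phi> g. A x \<Phi> g + ?S \<Phi> g) ^^ p) \<Phi> g) ((A x ^^ p) \<Phi> g + (?S ^^ p) \<Phi> g)"
    using insert.prems by (intro freshman_op_add[OF p _ linS]) auto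
  also have "eqm (of_nat p) \<dots> ((A x ^^ p) \<Phi> g + (\<Sum>i\<in>F. (A i ^^ p) \<Phi> g))"
    using insert by (intro eqm_add insert.IH) auto
  finally show ?case using insert.hyps by simp
qed

text \<open>Artin's shortening of a relation. Multiplying the coefficient of w by
  \<open>phi w i - phi w0 i\<close> removes w0 from the support and keeps w1, if i separates the
  two. The new sum is a combination of the sums for \<open>i # is\<close> and for \<open>is\<close>,
  so one of them is not divisible by P.\<close>

lemma artin_independence:
  fixes P :: "'k::comm_ring_1" and \<phi> :: "'w \<Rightarrow> 'i \<Rightarrow> 'k"
  assumes P: "prime_elem P" and W: "finite W"
    and sep: "\<And>w w'. w \<in> W \<Longrightarrow> w' \<in> W \<Longrightarrow> w \<noteq> w' \<Longrightarrow> \<exists>i\<in>I. \<not> eqm P (\<phi> w i) (\<phi> w' i)"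
    and "\<exists>w\<in>W. \<not> P dvd a w"
  shows "\<exists>is. set is \<subseteq> I \<and> \<not> P dvd (\<Sum>w\<in>W. a w * prod_list (map (\<phi> w) is))"
  using assms(4)
proof (induction "card {w\<in>W. \<not> P dvd a w}" arbitrary: a rule: less_induct)
  case less
  let ?S = "\<lambda>a. {w\<in>W. \<not> P dvd a w}"
  obtain w1 where w1: "w1 \<in> W" "\<not> P dvd a w1" using less.prems by blast
  show ?case
  proof (cases "?S a = {w1}")
    case True
    have "(\<Sum>w\<in>W. a w) = a w1 + (\<Sum>w\<in>W - {w1}. a w)" using W w1 by (simp add: sum.remove)
    moreover have "P dvd (\<Sum>w\<in>W - {w1}. a w)" using True by (intro dvd_sum) blast
    ultimately have "\<not> P dvd (\<Sum>w\<in>W. a w)" using w1 by (simp add: dvd_add_left_iff)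
    then show ?thesis by (intro exI[of _ "[]"]) simp
  next
    case False
    then obtain w0 where w0: "w0 \<in> W" "\<not> P dvd a w0" "w0 \<noteq> w1" using w1 by blast
    obtain i where i: "i \<in> I" "\<not> eqm P (\<phi> w1 i) (\<phi> w0 i)" using sep[OF w1(1) w0(1)] w0 by blast
    define a' where "a' w = a w * (\<phi> w i - \<phi> w0 i)" for w
    have nd: "\<not> P dvd a' w1" using w1 i P by (simp add: a'_def eqm_def prime_elem_dvd_mult_iff)
    have "w0 \<in> ?S a" "w0 \<notin> ?S a'" using w0 by (auto simp: a'_def)
    moreover have "?S a' \<subseteq> ?S a" by (auto simp: a'_def)
    ultimately have "?S a' \<subset> ?S a" by blast
    then have "card (?S a') < card (?S a)" using W by (intro psubset_card_mono) auto
    with nd obtain "is" where is': "set is \<subseteq> I" "\<not> P dvd (\<Sum>w\<in>W. a' w * prod_list (map (\<phi> w) is))"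
      using less.hyps[of a'] w1 by blast
    have e: "(\<Sum>w\<in>W. a' w * prod_list (map (\<phi> w) is))
       = (\<Sum>w\<in>W. a w * prod_list (map (\<phi> w) (i # is))) - \<phi> w0 i * (\<Sum>w\<in>W. a w * prod_list (map (\<phi> w) is))"
      by (simp add: a'_def algebra_simps sum_subtractf sum_distrib_left)
    show ?thesis
    proof (cases "P dvd (\<Sum>w\<in>W. a w * prod_list (map (\<phi> w) is))")
      case True
      then have "\<not> P dvd (\<Sum>w\<in>W. a w * prod_list (map (\<phi> w) (i # is)))"
        using is'(2) unfolding e by (metis dvd_diff dvd_mult)
      then show ?thesis using is'(1) i(1) by (intro exI[of _ "i # is"]) auto
    next
      case False
      then show ?thesis using is'(1) by blast
    qed
  qed
qed

section \<open>Powers of linear forms modulo p\<close>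

lemma of_nat_dvd_int_poly_iff: "(of_nat p :: int poly) dvd q \<longleftrightarrow> (\<forall>i. int p dvd coeff q i)"
  using const_poly_dvd_iff[of "int p" q] by (simp add: of_nat_poly)

lemma prime_elem_of_nat_int_poly:
  assumes "Factorial_Ring.prime p"
  shows "prime_elem (of_nat p :: int poly)"
proof -
  have "prime_elem (int p)" using assms by (intro prime_imp_prime_elem) simp
  then show ?thesis using prime_elem_const_poly_iff[of "int p"] by (simp add: of_nat_poly)
qed

lemma nat_power_prime_power:
  assumes p: "Factorial_Ring.prime p"
  shows "eqm (of_nat p :: 'k::comm_ring_1) (of_nat k ^ (p ^ e)) (of_nat k)"
proof -
  have "eqm (of_nat p :: 'k) (of_nat k ^ p) (of_nat k)" for k
  proof (induction k)
    case 0
    then show ?case using prime_gt_0_nat[OF p] by (simp add: zero_power)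
  next
    case (Suc k)
    have "eqm (of_nat p :: 'k) ((of_nat k + 1) ^ p) (of_nat k ^ p + 1 ^ p)"
      by (rule freshman_add[OF p])
    also have "eqm (of_nat p) \<dots> (of_nat k + 1)" using Suc by (intro eqm_add) auto
    finally show ?case by (simp add: add.commute)
  qed
  note 1 = this
  show ?thesis
  proof (induction e)
    case (Suc e)
    have "eqm (of_nat p :: 'k) ((of_nat k ^ (p ^ e)) ^ p) (of_nat k ^ p)" by (rule eqm_power[OF Suc])
    also have "eqm (of_nat p) \<dots> (of_nat k)" by (rule 1)
    finally show ?case by (simp add: power_mult[symmetric] mult.commute)
  qed simp
qed

text \<open>The exponents \<open>idx u + p ^ e * idx v\<close> are pairwise distinct once \<open>p ^ e\<close> exceeds
  all \<open>idx v\<close>, so comparing coefficients of \<open>B A\<^sup>Q = A B\<^sup>Q\<close> shows that A and B are proportional.\<close>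

lemma linear_form_powers_distinct:
  fixes a b :: "'v \<Rightarrow> nat" and idx :: "'v \<Rightarrow> nat"
  assumes p: "Factorial_Ring.prime p" and I: "finite I" and idx: "inj_on idx I"
    and v0: "v0 \<in> I" "a v0 = 0" "b v0 = 1" and w0: "w0 \<in> I" "\<not> p dvd a w0"
    and n: "2 * n = p ^ r * (p - 1)"
  defines "A \<equiv> (\<Sum>v\<in>I. monom (int (a v)) (idx v))"
    and "B \<equiv> (\<Sum>v\<in>I. monom (int (b v)) (idx v))"
  shows "\<not> eqm (of_nat p :: int poly) (A ^ n) (B ^ n)"
proof
  let ?P = "of_nat p :: int poly"
  assume e: "eqm ?P (A ^ n) (B ^ n)"
  have p2: "p \<ge> 2" using p prime_ge_2_nat by blast
  define e0 where "e0 = (\<Sum>v\<in>I. idx v) + 1"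
  define Q where "Q = p ^ e0"
  have Q: "idx v < Q" if "v \<in> I" for v
  proof -
    have "idx v \<le> (\<Sum>v\<in>I. idx v)" using I that by (intro member_le_sum) auto
    also have "\<dots> < 2 ^ e0" unfolding e0_def using less_exp[of "(\<Sum>v\<in>I. idx v) + 1"] by simp
    also have "\<dots> \<le> Q" unfolding Q_def using p2 by (intro power_mono) auto
    finally show ?thesis .
  qed
  have "int p - 1 dvd int p ^ e0 - 1" using power_diff_1_eq[of "int p" e0] by simp
  moreover have "int p - 1 = int (p - 1)" "int p ^ e0 - 1 = int (Q - 1)"
    unfolding Q_def using p2 by (simp_all add: of_nat_diff)
  ultimately have "p - 1 dvd Q - 1" by (metis int_dvd_int_iff)
  then obtain c where c: "Q - 1 = (p - 1) * c" by (auto simp: dvd_def)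
  \<comment> \<open>The exponent 2c is chosen so that n * 2c = (Q - 1) * p^r. The factor p^r is then
    cancelled, since Frobenius is injective modulo p.\<close>
  have "eqm ?P ((A ^ n) ^ (2 * c)) ((B ^ n) ^ (2 * c))" by (rule eqm_power[OF e])
  moreover have "(X ^ n) ^ (2 * c) = (X ^ (Q - 1)) ^ (p ^ r)" for X :: "int poly"
  proof -
    have "n * (2 * c) = (Q - 1) * p ^ r" using n c by (metis mult.assoc mult.commute)
    then show ?thesis by (simp only: power_mult[symmetric])
  qed
  ultimately have "eqm ?P ((A ^ (Q - 1)) ^ (p ^ r)) ((B ^ (Q - 1)) ^ (p ^ r))" by simp
  then have "eqm ?P ((A ^ (Q - 1)) ^ (p ^ r) - (B ^ (Q - 1)) ^ (p ^ r)) 0" by (simp add: eqm_def)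
  with freshman_diff_power[OF p] have "eqm ?P ((A ^ (Q - 1) - B ^ (Q - 1)) ^ (p ^ r)) 0"
    by (rule eqm_trans)
  then have "?P dvd A ^ (Q - 1) - B ^ (Q - 1)"
    unfolding eqm_0_iff by (rule prime_elem_dvd_power[OF prime_elem_of_nat_int_poly[OF p]])
  then have 1: "?P dvd A * B * (A ^ (Q - 1) - B ^ (Q - 1))" by simp
  have "Q > 0" unfolding Q_def using p2 by simp
  then have XQ: "X * X ^ (Q - 1) = X ^ Q" for X :: "int poly" by (cases Q) auto
  have "A * B * (A ^ (Q - 1) - B ^ (Q - 1)) = B * (A * A ^ (Q - 1)) - A * (B * B ^ (Q - 1))"
    by (simp add: algebra_simps)
  also have "\<dots> = B * A ^ Q - A * B ^ Q" by (simp only: XQ)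
  finally have 2: "eqm ?P (B * A ^ Q) (A * B ^ Q)" using 1 by (simp only: eqm_def)
  have pw: "eqm ?P ((\<Sum>v\<in>I. monom (int (f v)) (idx v)) ^ Q) (\<Sum>v\<in>I. monom (int (f v)) (idx v * Q))"
    for f :: "'v \<Rightarrow> nat"
  proof -
    have "eqm ?P ((\<Sum>v\<in>I. monom (int (f v)) (idx v)) ^ Q) (\<Sum>v\<in>I. monom (int (f v)) (idx v) ^ Q)"
      unfolding Q_def by (rule freshman_sum_power[OF p])
    also have "eqm ?P \<dots> (\<Sum>v\<in>I. monom (int (f v)) (idx v * Q))"
    proof (rule eqm_sum)
      fix v
      have "eqm (of_nat p :: int) (of_nat (f v) ^ Q) (of_nat (f v))"
        unfolding Q_def by (rule nat_power_prime_power[OF p])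
      then have "?P dvd monom (int (f v) ^ Q - int (f v)) (idx v * Q)"
        unfolding of_nat_dvd_int_poly_iff by (auto simp: eqm_def)
      then show "eqm ?P (monom (int (f v)) (idx v) ^ Q) (monom (int (f v)) (idx v * Q))"
        by (simp add: eqm_def monom_power diff_monom)
    qed
    finally show ?thesis .
  qed
  have "eqm ?P (B * (\<Sum>v\<in>I. monom (int (a v)) (idx v * Q))) (B * A ^ Q)"
    unfolding A_def by (intro eqm_mult eqm_sym[OF pw]) auto
  also note 2
  also have "eqm ?P (A * B ^ Q) (A * (\<Sum>v\<in>I. monom (int (b v)) (idx v * Q)))"
    unfolding B_def by (intro eqm_mult pw) auto
  finally have 3: "int p dvd coeff (B * (\<Sum>v\<in>I. monom (int (a v)) (idx v * Q))) N
      - coeff (A * (\<Sum>v\<in>I. monom (int (b v)) (idx v * Q))) N" for N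
    unfolding eqm_def of_nat_dvd_int_poly_iff by simp
  have co: "coeff ((\<Sum>v\<in>I. monom (int (f v)) (idx v)) * (\<Sum>v\<in>I. monom (int (g v)) (idx v * Q))) (idx v0 + idx w0 * Q)
      = int (f v0) * int (g w0)" for f g :: "'v \<Rightarrow> nat"
  proof -
    have u: "idx u + idx v * Q = idx v0 + idx w0 * Q \<longleftrightarrow> u = v0 \<and> v = w0" if "u \<in> I" "v \<in> I" for u v
    proof
      assume e: "idx u + idx v * Q = idx v0 + idx w0 * Q"
      have "idx u = (idx u + idx v * Q) mod Q" "idx v0 = (idx v0 + idx w0 * Q) mod Q"
        using Q v0 that by auto
      then have "idx u = idx v0" using e by simp
      moreover from this e have "idx v = idx w0" using \<open>Q > 0\<close> by simp
      ultimately show "u = v0 \<and> v = w0" using idx that v0 w0 by (auto dest: inj_onD)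
    qed auto
    have "coeff ((\<Sum>v\<in>I. monom (int (f v)) (idx v)) * (\<Sum>v\<in>I. monom (int (g v)) (idx v * Q))) (idx v0 + idx w0 * Q)
      = (\<Sum>u\<in>I. \<Sum>v\<in>I. if idx u + idx v * Q = idx v0 + idx w0 * Q then int (f u) * int (g v) else 0)"
      by (simp add: sum_product mult_monom coeff_sum)
    also have "\<dots> = (\<Sum>u\<in>I. \<Sum>v\<in>I. if v = w0 then (if u = v0 then int (f u) * int (g v) else 0) else 0)"
      using u by (intro sum.cong) auto
    also have "\<dots> = int (f v0) * int (g w0)" using I v0 w0 by simp
    finally show ?thesis .
  qed
  \<comment> \<open>At the exponent \<open>idx v0 + idx w0 * Q\<close> one side has the coefficient
    \<open>b v0 * a w0\<close>, which is \<open>a w0\<close>, and the other has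
    \<open>a v0 * b w0\<close>, which is 0.\<close>
  have "int p dvd int (a w0)"
    using 3[of "idx v0 + idx w0 * Q"] v0 unfolding A_def B_def co by simp
  then show False using w0 by simp
qed

section \<open>Letters given by polynomials in z\<close>

context central_prime
begin

text \<open>The group ring element obtained by substituting z for the variable of q. Relations
  between letters become congruences of polynomials modulo z^p - 1 and p.\<close>

definition act :: "'k::comm_ring_1 poly \<Rightarrow> ('a \<Rightarrow> 'k) \<Rightarrow> 'a \<Rightarrow> 'k" where
  "act q \<Phi> g = (\<Sum>i\<le>degree q. coeff q i * \<Phi> (g \<otimes> z [^] i))"

lemma act_altdef: "degree q \<le> n \<Longrightarrow> act q \<Phi> g = (\<Sum>i\<le>n. coeff q i * \<Phi> (g \<otimes> z [^] i))"
  unfolding act_def by (rule sum.mono_neutral_left) (auto simp: coeff_eq_0)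

lemma act_add: "act (q + r) \<Phi> g = act q \<Phi> g + act r \<Phi> g"
proof -
  let ?n = "max (degree q) (degree r)"
  show ?thesis using degree_add_le_max[of q r]
    by (simp add: act_altdef[of _ ?n] algebra_simps sum.distrib)
qed

lemma act_smult: "act (smult c q) \<Phi> g = c * act q \<Phi> g"
  by (simp add: act_altdef[of _ "degree q"] degree_smult_le sum_distrib_left mult.assoc)

lemma act_0 [simp]: "act 0 \<Phi> g = 0"
  by (simp add: act_def)

lemma act_minus: "act (- q) \<Phi> g = - act q \<Phi> g"
  using act_smult[of "-1" q] by simp

lemma act_diff: "act (q - r) \<Phi> g = act q \<Phi> g - act r \<Phi> g"
  using act_add[of q "- r"] by (simp add: act_minus)

lemma act_sum: "act (\<Sum>i\<in>I. q i) \<Phi> g = (\<Sum>i\<in>I. act (q i) \<Phi> g)"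
  by (induction I rule: infinite_finite_induct) (auto simp: act_add)

lemma act_pCons: "g \<in> carrier G \<Longrightarrow> act (pCons c q) \<Phi> g = c * \<Phi> g + act q \<Phi> (g \<otimes> z)"
proof -
  assume g: "g \<in> carrier G"
  have "act (pCons c q) \<Phi> g = (\<Sum>i\<le>Suc (degree q). coeff (pCons c q) i * \<Phi> (g \<otimes> z [^] i))"
    by (rule act_altdef[OF degree_pCons_le])
  also have "\<dots> = c * \<Phi> g + (\<Sum>i\<le>degree q. coeff q i * \<Phi> (g \<otimes> z [^] Suc i))"
    using g by (subst sum.atMost_Suc_shift) simp
  also have "(\<Sum>i\<le>degree q. coeff q i * \<Phi> (g \<otimes> z [^] Suc i)) = act q \<Phi> (g \<otimes> z)"
  proof -
    have "g \<otimes> z [^] Suc i = g \<otimes> z \<otimes> z [^] i" for i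
      using g nat_pow_Suc2[OF z_in, of i] m_assoc[OF g z_in z_pow_in[of i]] by simp
    then show ?thesis by (simp only: act_def)
  qed
  finally show ?thesis .
qed

lemma act_mult: "g \<in> carrier G \<Longrightarrow> act (q * r) \<Phi> g = act q (act r \<Phi>) g"
proof (induction q arbitrary: g)
  case (pCons c q)
  have "act (pCons c q * r) \<Phi> g = c * act r \<Phi> g + act (pCons 0 (q * r)) \<Phi> g"
    by (simp add: act_add act_smult)
  also have "act (pCons 0 (q * r)) \<Phi> g = act (q * r) \<Phi> (g \<otimes> z)"
    using pCons.prems by (simp add: act_pCons)
  finally show ?case using pCons by (simp add: act_pCons)
qed simp

lemma act_monom: "g \<in> carrier G \<Longrightarrow> act (monom c n) \<Phi> g = c * \<Phi> (g \<otimes> z [^] n)"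
  by (simp add: act_altdef[of _ n] degree_monom_le if_distrib[of "\<lambda>x. x * _"] cong: if_cong)

lemma act_lop: "letters.lop P (carrier G) (\<otimes>) (act q)"
proof (rule letters.lopI[OF letters_carrier])
  show "lin (act q)"
    by (auto simp: lin_def act_def fun_eq_iff algebra_simps sum.distrib sum_distrib_left)
qed (auto simp: act_def m_assoc intro!: eqm_sum eqm_mult)

definition pS :: "'k::comm_ring_1 poly" where "pS = [:-1, 1:]"
definition pN :: "'k::comm_ring_1 poly" where "pN = (\<Sum>j<p. monom 1 j)"

lemma act_pS: "g \<in> carrier G \<Longrightarrow> act pS \<Phi> g = sZ \<Phi> g"
  by (simp add: pS_def sZ_def act_pCons)

lemma act_pN: "g \<in> carrier G \<Longrightarrow> act pN \<Phi> g = nZ \<Phi> g"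
  by (simp add: pN_def nZ_def act_sum act_monom)

lemma act_const: "poly q 1 = 0 \<Longrightarrow> act q (\<lambda>_. x) g = 0"
  by (simp add: act_def sum_distrib_right[symmetric] poly_altdef)

lemma geometric_pS: "(\<Sum>j<n. monom 1 j) * pS = (monom 1 n - 1 :: 'k::comm_ring_1 poly)"
proof -
  have "(\<Sum>j<n. monom 1 j) * pS = (\<Sum>j<n. monom (1::'k) (Suc j) - monom 1 j)"
    unfolding pS_def sum_distrib_right
    by (intro sum.cong) (auto simp: algebra_simps monom_Suc)
  also have "\<dots> = monom 1 n - monom 1 0" by (rule sum_lessThan_telescope)
  finally show ?thesis by simp
qed

lemma pN_pS: "pN * pS = (monom 1 p - 1 :: 'k::comm_ring_1 poly)"
  unfolding pN_def by (rule geometric_pS)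

lemma act_cyclic: "g \<in> carrier G \<Longrightarrow> act ((monom 1 p - 1) * w) \<Phi> g = 0"
  by (simp add: act_mult act_diff act_monom one_pCons act_pCons z_pow)

lemma act_dvd: "of_nat p dvd q \<Longrightarrow> g \<in> carrier G \<Longrightarrow> eqm (of_nat p) (act q \<Phi> g) (0::'k::comm_ring_1)"
proof -
  assume "of_nat p dvd q" and g: "g \<in> carrier G"
  then obtain r where "q = of_nat p * r" by (auto simp: dvd_def)
  then have "q = smult (of_nat p) r" by (simp add: of_nat_poly)
  then show ?thesis by (simp add: act_smult eqm_0_iff)
qed

lemma dvd_coeff_iff: "(of_nat p :: 'k::idom poly) dvd q \<longleftrightarrow> (\<forall>i. of_nat p dvd coeff q i)"
  using const_poly_dvd_iff[of "of_nat p :: 'k" q] by (simp add: of_nat_poly)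

text \<open>The constant coefficient -1 of \<open>pS\<close> is a unit, so divisibility by p passes
  from each coefficient of q to the next.\<close>

lemma pS_cancel: "of_nat p dvd pS * q \<Longrightarrow> (of_nat p :: 'k::idom poly) dvd q"
proof -
  assume a: "of_nat p dvd pS * q"
  have c: "coeff (pS * q) 0 = - coeff q 0" "coeff (pS * q) (Suc i) = coeff q i - coeff q (Suc i)" for i
    by (simp_all add: pS_def)
  have "of_nat p dvd coeff q i" for i
  proof (induction i)
    case 0
    have "of_nat p dvd coeff (pS * q) 0" using a unfolding dvd_coeff_iff by blast
    then show ?case by (simp add: c)
  next
    case (Suc i)
    have "of_nat p dvd coeff (pS * q) (Suc i)" using a unfolding dvd_coeff_iff by blast
    then have "of_nat p dvd coeff q i - coeff (pS * q) (Suc i)" using Suc by (intro dvd_diff) auto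
    then show ?case by (simp add: c)
  qed
  then show ?thesis by (simp add: dvd_coeff_iff)
qed

lemma pS_power_p: "eqm (of_nat p) (pS ^ p) (monom 1 p - 1 :: 'k::comm_ring_1 poly)"
proof -
  have "pS = (monom 1 1 - 1 :: 'k poly)" by (simp add: pS_def monom_Suc one_pCons)
  then show ?thesis
    using freshman_diff_power[OF prime, of "monom 1 1 :: 'k poly" 1 1] by (simp add: monom_power)
qed

text \<open>Both sides multiplied by z - 1 equal z^p - 1 modulo p, and z - 1 may be
  cancelled.\<close>

lemma pS_power: "eqm (of_nat p) (pS ^ (p - 1)) (pN :: 'k::idom poly)"
proof -
  have "pS * (pS ^ (p - 1) - pN) = (pS ^ p - (monom 1 p - 1) :: 'k poly)"
    using p_gt_1 pN_pS[where ?'k = 'k] by (cases p) (simp_all add: algebra_simps)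
  then have "of_nat p dvd pS * (pS ^ (p - 1) - pN :: 'k poly)"
    using pS_power_p[where ?'k = 'k] by (simp add: eqm_def)
  then show ?thesis unfolding eqm_def by (rule pS_cancel)
qed

end

context letters
begin

lemma EV_replace:
  assumes "\<forall>x\<in>set pre. lop x" "g \<in> B" "\<And>\<Phi> h. h \<in> B \<Longrightarrow> eqm P (a \<Phi> h) (b \<Phi> h)"
  shows "eqm P (EV f g (pre @ a # post)) (EV f g (pre @ b # post))"
  using assms(1,2)
proof (induction pre arbitrary: f g)
  case (Cons c pre)
  have "eqm P (c (\<lambda>h. EV (\<lambda>xs. f (g # xs)) h (pre @ a # post)) g)
     (c (\<lambda>h. EV (\<lambda>xs. f (g # xs)) h (pre @ b # post)) g)"
    using Cons by (intro lop_cong[of c]) auto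
  then show ?case by simp
qed (use assms(3) in auto)

end

lemma EV_linear_letter:
  "\<forall>x\<in>set pre. lin x \<Longrightarrow>
    EV f g (pre @ (\<lambda>\<Phi> h. c * a \<Phi> h + b \<Phi> h) # post) = c * EV f g (pre @ a # post) + EV f g (pre @ b # post)"
proof (induction pre arbitrary: f g)
  case (Cons x pre)
  then show ?case by (simp add: lin_add[of x] lin_cmult[of x])
qed simp

context central_prime
begin

definition ns :: "nat \<Rightarrow> (('a \<Rightarrow> 'k::comm_ring_1) \<Rightarrow> 'a \<Rightarrow> 'k) list" where
  "ns j = concat (replicate j [nZ, sZ])"

text \<open>For q divisible by z - 1 this is a second periodic cycle: q^p is zero modulo p and z^p -
  1, so q^(p-1) and q replace the norm and z - 1.\<close>

definition qword :: "'k::comm_ring_1 poly \<Rightarrow> nat \<Rightarrow> (('a \<Rightarrow> 'k) \<Rightarrow> 'a \<Rightarrow> 'k) list" where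
  "qword q M = concat (replicate M [act (q ^ (p - 1)), act q])"

lemma ns_Suc: "ns (Suc j) = nZ # sZ # ns j"
  by (simp add: ns_def)

lemma ns_Suc': "ns (Suc j) = ns j @ [nZ, sZ]"
proof (induction j)
  case (Suc j)
  then show ?case using ns_Suc by (metis append_Cons)
qed (simp add: ns_def)

lemma wd_ns: "wd (2 * j) = ns j"
proof (induction j)
  case (Suc j)
  then show ?case by (simp add: ns_Suc)
qed (simp add: ns_def)

lemma qword_Suc: "qword q (Suc M) = act (q ^ (p - 1)) # act q # qword q M"
  by (simp add: qword_def)

lemma length_ns [simp]: "length (ns j) = 2 * j" and length_qword [simp]: "length (qword q M) = 2 * M"
  by (induction j; simp add: ns_def) (induction M; simp add: qword_def)

lemma ns_lop: "\<forall>a\<in>set (ns j). letters.lop P (carrier G) (\<otimes>) a"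
  by (auto simp: ns_def sZ_lop nZ_lop)

lemma qword_lop: "\<forall>a\<in>set (qword q M). letters.lop P (carrier G) (\<otimes>) a"
  by (auto simp: qword_def act_lop)

lemma ann_act:
  fixes a b w :: "'k::comm_ring_1 poly"
  assumes "eqm (of_nat p) (a * b) ((monom 1 p - 1) * w)"
  shows "letters.ann (of_nat p) (carrier G) (act a) (act b)"
  unfolding letters.ann_def[OF letters_carrier]
proof (intro allI ballI)
  fix \<Phi> g assume g: "g \<in> carrier G"
  have "act a (act b \<Phi>) g = act (a * b - (monom 1 p - 1) * w) \<Phi> g + act ((monom 1 p - 1) * w) \<Phi> g"
    using g by (simp add: act_mult act_diff)
  also have "eqm (of_nat p) \<dots> (0 + 0)"
    using assms g by (intro eqm_add act_dvd eqm_eq act_cyclic) (auto simp: eqm_def)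
  finally show "eqm (of_nat p) (act a (act b \<Phi>) g) 0" by simp
qed

lemma eps0_letters:
  "letters.eps0 (of_nat p) (carrier G) (sZ :: ('a \<Rightarrow> 'k::comm_ring_1) \<Rightarrow> 'a \<Rightarrow> 'k)"
  "letters.eps0 (of_nat p) (carrier G) (nZ :: ('a \<Rightarrow> 'k::comm_ring_1) \<Rightarrow> 'a \<Rightarrow> 'k)"
  "poly q 1 = 0 \<Longrightarrow> letters.eps0 P (carrier G) (act q)"
  by (auto simp: letters.eps0_def[OF letters_carrier] sZ_def nZ_def act_const eqm_0_iff)

lemma poly_decomp: "\<exists>w. u = [:poly u 1:] + pS * w" for u :: "'k::comm_ring_1 poly"
proof -
  have "poly (u - [:poly u 1:]) 1 = 0" by simp
  then have "[:-1, 1:] dvd u - [:poly u 1:]" by (simp only: poly_eq_0_iff_dvd)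
  then obtain w where "u - [:poly u 1:] = pS * w" by (auto simp: dvd_def pS_def)
  then show ?thesis by (metis add.commute diff_add_cancel)
qed

lemma successively_ns: "successively (letters.ann P (carrier G)) (ns j)"
  using wd_props(2)[of P "2 * j"] by (simp add: wd_ns)

text \<open>Modulo p the letter is the norm times u^(p-1). The norm kills multiples of z - 1, so
  only the value of u at 1 remains.\<close>

lemma act_power_letter:
  fixes u :: "'k::idom poly"
  assumes g: "g \<in> carrier G"
  shows "eqm (of_nat p) (act ((pS * u) ^ (p - 1)) \<Phi> g) (poly u 1 ^ (p - 1) * nZ \<Phi> g)"
proof -
  obtain w where w: "u ^ (p - 1) = [:poly (u ^ (p - 1)) 1:] + pS * w" using poly_decomp by blast
  have "eqm (of_nat p) (pS ^ (p - 1) * u ^ (p - 1)) (pN * u ^ (p - 1))"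
    by (intro eqm_mult pS_power) auto
  also have "pN * u ^ (p - 1) = pN * ([:poly (u ^ (p - 1)) 1:] + pS * w)" by (subst w) rule
  also have "\<dots> = smult (poly u 1 ^ (p - 1)) pN + (monom 1 p - 1) * w"
    by (simp add: algebra_simps pN_pS[symmetric] poly_power)
  finally have "of_nat p dvd (pS * u) ^ (p - 1) - (smult (poly u 1 ^ (p - 1)) pN + (monom 1 p - 1) * w)"
    by (simp add: power_mult_distrib eqm_def)
  from act_dvd[OF this g, of \<Phi>]
  have "eqm (of_nat p) (act ((pS * u) ^ (p - 1)) \<Phi> g - (poly u 1 ^ (p - 1) * nZ \<Phi> g)) 0"
    using g by (simp add: act_diff act_add act_smult act_pN act_cyclic del: of_nat_poly)
  then show ?thesis by (simp add: eqm_def)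
qed

text \<open>The leading letter is an arbitrary multiple of z - 1, the form in which a correction
  term precedes the word in \<open>EV_qword\<close>. Its product with (pS u)^(p-1) contains (z -
  1)^p.\<close>

lemma successively_qword:
  fixes u w :: "'k::idom poly"
  shows "successively (letters.ann (of_nat p) (carrier G)) (act (pS * w) # qword (pS * u) M)"
proof -
  have pp: "(pS * u) * (pS * u) ^ (p - 1) = (pS * u) ^ p" "(pS * u) ^ (p - 1) * (pS * u) = (pS * u) ^ p"
    using p_gt_1 by (cases p; simp add: mult.commute)+
  have sp: "pS * w * (pS * u) ^ (p - 1) = pS ^ p * (w * u ^ (p - 1))"
    using p_gt_1 by (cases p) (simp_all add: power_mult_distrib algebra_simps)
  have "eqm (of_nat p) ((pS * u) ^ p) ((monom 1 p - 1) * u ^ p)"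
    unfolding power_mult_distrib by (intro eqm_mult pS_power_p) auto
  then have a: "letters.ann (of_nat p) (carrier G) (act (pS * u)) (act ((pS * u) ^ (p - 1)))"
    "letters.ann (of_nat p) (carrier G) (act ((pS * u) ^ (p - 1))) (act (pS * u))"
    by (auto intro!: ann_act simp only: pp)
  have b: "letters.ann (of_nat p) (carrier G) (act (pS * w)) (act ((pS * u) ^ (p - 1)))" for w
  proof (rule ann_act)
    have "pS * w * (pS * u) ^ (p - 1) = pS ^ p * (w * u ^ (p - 1))"
      using p_gt_1 by (cases p) (simp_all add: power_mult_distrib algebra_simps)
    then show "eqm (of_nat p) (pS * w * (pS * u) ^ (p - 1)) ((monom 1 p - 1) * (w * u ^ (p - 1)))"
      by (simp only:) (intro eqm_mult pS_power_p eqm_refl)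
  qed
  show ?thesis
  proof (induction M arbitrary: w)
    case 0
    then show ?case by (simp add: qword_def)
  next
    case (Suc M)
    then show ?case using a b by (simp add: qword_Suc)
  qed
qed

text \<open>Pairs are replaced from the left, and \<open>ns j\<close> holds those already replaced.
  With kappa = u(1), the letter q^(p-1) acts as kappa^(p-1) times the norm, and q is kappa (z - 1)
  plus a composite of two multiples of z - 1 on which the cocycle vanishes by
  \<open>EV_cobd_one\<close>. Each pair thus contributes kappa^p.\<close>

lemma EV_qword:
  fixes f :: "'a list \<Rightarrow> 'k::idom"
  assumes g: "g \<in> carrier G"
    and inv: "letters.invf (of_nat p) (carrier G) (\<otimes>) (Suc (2 * (j + M))) f"
    and coc: "\<And>xs. set xs \<subseteq> carrier G \<Longrightarrow> length xs = Suc (Suc (2 * (j + M))) \<Longrightarrow> eqm (of_nat p) (cobd f xs) 0"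
  shows "eqm (of_nat p) (EV f g (ns j @ qword (pS * u) M)) (poly u 1 ^ (p * M) * EV f g (ns (j + M)))"
  using inv coc
proof (induction M arbitrary: j)
  case 0
  then show ?case by (simp add: qword_def)
next
  case (Suc M)
  let ?P = "of_nat p :: 'k" and ?\<kappa> = "poly u 1" and ?q = "pS * u"
  obtain w where w: "u = [:?\<kappa>:] + pS * w" using poly_decomp by blast
  have pre: "\<forall>x\<in>set (ns j @ [nZ]). letters.lop ?P (carrier G) (\<otimes>) x"
    using ns_lop by (auto simp: nZ_lop)
  have prelin2: "\<forall>x\<in>set (ns j :: (('a \<Rightarrow> 'k) \<Rightarrow> 'a \<Rightarrow> 'k) list). lin x"
    by (rule wd_lin[of "2 * j", unfolded wd_ns])
  moreover have "lin (nZ :: ('a \<Rightarrow> 'k) \<Rightarrow> 'a \<Rightarrow> 'k)"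
    by (auto simp: lin_def nZ_def fun_eq_iff sum.distrib sum_distrib_left)
  ultimately have prelin1: "\<forall>x\<in>set (ns j @ [nZ :: ('a \<Rightarrow> 'k) \<Rightarrow> 'a \<Rightarrow> 'k]). lin x" by simp
  note prelin = prelin1 prelin2
  have "eqm ?P (EV f g (ns j @ act (?q ^ (p - 1)) # act ?q # qword ?q M))
      (EV f g (ns j @ (\<lambda>\<Phi> h. ?\<kappa> ^ (p - 1) * nZ \<Phi> h + 0) # act ?q # qword ?q M))"
    using g ns_lop act_power_letter by (intro letters.EV_replace[OF letters_carrier]) auto
  also have "EV f g (ns j @ (\<lambda>\<Phi> h. ?\<kappa> ^ (p - 1) * nZ \<Phi> h + 0) # act ?q # qword ?q M)
     = ?\<kappa> ^ (p - 1) * EV f g (ns j @ nZ # act ?q # qword ?q M)"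
  proof -
    have z: "EV f g (ns j @ (\<lambda>\<Phi> h. 0) # post) = 0" for post
      using EV_linear_letter[OF prelin(2), of f g "-1" "\<lambda>\<Phi> h. 0" "\<lambda>\<Phi> h. 0" post] by simp
    show ?thesis
      using EV_linear_letter[OF prelin(2), of f g "?\<kappa> ^ (p - 1)" nZ "\<lambda>\<Phi> h. 0"] z by simp
  qed
  also have "EV f g (ns j @ nZ # act ?q # qword ?q M) = EV f g ((ns j @ [nZ]) @ act ?q # qword ?q M)" by simp
  also have "eqm ?P (?\<kappa> ^ (p - 1) * \<dots>)
     (?\<kappa> ^ (p - 1) * EV f g ((ns j @ [nZ]) @ (\<lambda>\<Phi> h. ?\<kappa> * sZ \<Phi> h + (sZ \<circ> act (pS * w)) \<Phi> h) # qword ?q M))"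
  proof (intro eqm_mult eqm_refl letters.EV_replace[OF letters_carrier pre g])
    fix \<Phi> h assume h: "h \<in> carrier G"
    have "pS * u = smult ?\<kappa> pS + pS * (pS * w)" by (subst w) (simp add: algebra_simps)
    then show "eqm ?P (act ?q \<Phi> h) (?\<kappa> * sZ \<Phi> h + (sZ \<circ> act (pS * w)) \<Phi> h)"
      using h act_mult[OF h, of pS "pS * w"] by (simp add: act_add act_smult act_pS)
  qed
  also have "EV f g ((ns j @ [nZ]) @ (\<lambda>\<Phi> h. ?\<kappa> * sZ \<Phi> h + (sZ \<circ> act (pS * w)) \<Phi> h) # qword ?q M)
    = ?\<kappa> * EV f g ((ns j @ [nZ]) @ sZ # qword ?q M) + EV f g ((ns j @ [nZ]) @ (sZ \<circ> act (pS * w)) # qword ?q M)"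
    by (rule EV_linear_letter[OF prelin(1)])
  also have "eqm ?P (?\<kappa> ^ (p - 1) * \<dots>) (?\<kappa> ^ (p - 1) * (?\<kappa> * EV f g (ns (Suc j) @ qword ?q M) + 0))"
  proof (intro eqm_mult eqm_add eqm_refl)
    show "eqm ?P (EV f g ((ns j @ [nZ]) @ sZ # qword ?q M)) (EV f g (ns (Suc j) @ qword ?q M))"
      by (simp add: ns_Suc')
    show "eqm ?P (EV f g ((ns j @ [nZ]) @ (sZ \<circ> act (pS * w)) # qword ?q M)) 0"
    proof (rule letters.EV_cobd_one[OF letters_carrier])
      show "\<forall>a\<in>set ((ns j @ [nZ]) @ sZ # act (pS * w) # qword ?q M). letters.lop ?P (carrier G) (\<otimes>) a"
        using pre qword_lop by (auto simp: sZ_lop act_lop)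
      show "successively (letters.ann ?P (carrier G)) ((ns j @ [nZ]) @ [sZ])"
        using successively_ns[of ?P "Suc j"] by (simp add: ns_Suc')
      show "successively (letters.ann ?P (carrier G)) (act (pS * w) # qword ?q M)"
        by (rule successively_qword)
      have "poly (pS * r) 1 = 0" "poly ((pS * r) ^ (p - 1)) 1 = 0" for r :: "'k poly"
        using p_gt_1 by (simp_all add: pS_def poly_power)
      then show "\<forall>a\<in>set ((ns j @ [nZ]) @ sZ # act (pS * w) # qword ?q M). letters.eps0 ?P (carrier G) a"
        by (auto simp: ns_def qword_def intro: eps0_letters)
    qed (use Suc.prems g in auto)
  qed
  also have "\<dots> = ?\<kappa> ^ p * EV f g (ns (Suc j) @ qword ?q M)"
    using p_gt_1 by (cases p) (simp_all add: mult.assoc)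
  also have "eqm ?P \<dots> (?\<kappa> ^ p * (?\<kappa> ^ (p * M) * EV f g (ns (Suc j + M))))"
    using Suc.prems by (intro eqm_mult eqm_refl Suc.IH) auto
  finally show ?case by (simp add: qword_Suc power_add algebra_simps)
qed

lemma EV_of_int: "EV (\<lambda>xs. of_int (f xs) :: 'k::comm_ring_1) g (wd n) = of_int (EV f g (wd n))"
  by (induction n arbitrary: f g) (auto simp: sZ_def nZ_def)

text \<open>Because the coefficients sum to zero, q = (z - 1) u with u a combination of geometric
  sums, and u(1) is the derivative of q at 1.\<close>

lemma euler_eval:
  fixes \<beta> :: "'v \<Rightarrow> 'k::idom" and k :: "'v \<Rightarrow> nat"
  assumes order: "Coset.order G = p ^ n" and M: "sdim = 2 * M" and \<beta>: "(\<Sum>v\<in>I. \<beta> v) = 0"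
  defines "q \<equiv> (\<Sum>v\<in>I. smult (\<beta> v) (monom 1 (k v)))"
  shows "eqm (of_nat p) (EV (\<lambda>xs. of_int (euler xs)) \<one> (qword q M))
    ((\<Sum>v\<in>I. \<beta> v * of_nat (k v)) ^ (p * M) * of_int (EV euler \<one> (wd sdim)))"
proof -
  define u where "u = (\<Sum>v\<in>I. smult (\<beta> v) (\<Sum>j<k v. monom 1 j))"
  have "pS * u = (\<Sum>v\<in>I. smult (\<beta> v) ((\<Sum>j<k v. monom 1 j) * pS))"
    unfolding u_def by (simp add: sum_distrib_left mult.commute)
  also have "\<dots> = q - (\<Sum>v\<in>I. smult (\<beta> v) 1)"
    unfolding geometric_pS q_def by (simp add: smult_diff_right sum_subtractf)
  also have "(\<Sum>v\<in>I. smult (\<beta> v) 1) = smult (\<Sum>v\<in>I. \<beta> v) 1"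
    by (induction I rule: infinite_finite_induct) (simp_all add: smult_add_left one_pCons)
  finally have q: "q = pS * u" using \<beta> by simp
  have u1: "poly u 1 = (\<Sum>v\<in>I. \<beta> v * of_nat (k v))"
    by (simp add: u_def poly_sum poly_monom)
  have "eqm (of_nat p) (EV (\<lambda>xs. of_int (euler xs) :: 'k) \<one> (ns 0 @ qword (pS * u) M))
     (poly u 1 ^ (p * M) * EV (\<lambda>xs. of_int (euler xs)) \<one> (ns (0 + M)))"
  proof (rule EV_qword)
    show "letters.invf (of_nat p) (carrier G) (\<otimes>) (Suc (2 * (0 + M))) (\<lambda>xs. of_int (euler xs) :: 'k)"
      unfolding letters.invf_def[OF letters_carrier] using euler_inv[OF order] M by (auto intro: eqm_of_int)
    show "eqm (of_nat p) (cobd (\<lambda>xs. of_int (euler xs) :: 'k) xs) 0" for xs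
      by (simp add: cobd_of_int cobd_euler)
  qed auto
  moreover have "EV (\<lambda>xs. of_int (euler xs)) \<one> (ns M) = (of_int (EV euler \<one> (wd sdim)) :: 'k)"
    unfolding wd_ns[symmetric] M by (rule EV_of_int)
  ultimately show ?thesis unfolding q u1 by (simp add: ns_def)
qed

end

section \<open>Transfer of homogeneous cocycles\<close>

context group
begin

text \<open>The cohomology of every subgroup H is computed by cochains on all of G that are
  invariant under H alone, which is possible because H acts freely on G. Restriction to a smaller
  subgroup then changes only the invariance condition and not the cochain.\<close>

definition inv_on :: "nat \<Rightarrow> 'a set \<Rightarrow> nat \<Rightarrow> ('a list \<Rightarrow> int) \<Rightarrow> bool" where
  "inv_on p H n u \<longleftrightarrow> (\<forall>h\<in>H. \<forall>xs. set xs \<subseteq> carrier G \<longrightarrow> length xs = n \<longrightarrow>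
     eqm (int p) (u (map (\<lambda>x. h \<otimes> x) xs)) (u xs))"

definition cocyc :: "nat \<Rightarrow> nat \<Rightarrow> ('a list \<Rightarrow> int) \<Rightarrow> bool" where
  "cocyc p n u \<longleftrightarrow> (\<forall>xs. set xs \<subseteq> carrier G \<longrightarrow> length xs = Suc n \<longrightarrow> eqm (int p) (cobd u xs) 0)"

definition cobdry :: "nat \<Rightarrow> 'a set \<Rightarrow> nat \<Rightarrow> ('a list \<Rightarrow> int) \<Rightarrow> bool" where
  "cobdry p H n f \<longleftrightarrow> (\<exists>u. inv_on p H n u \<and>
     (\<forall>xs. set xs \<subseteq> carrier G \<longrightarrow> length xs = Suc n \<longrightarrow> eqm (int p) (f xs) (cobd u xs)))"

lemma inv_onD: "inv_on p H n u \<Longrightarrow> h \<in> H \<Longrightarrow> set xs \<subseteq> carrier G \<Longrightarrow> length xs = n \<Longrightarrow>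
    eqm (int p) (u (map (\<lambda>x. h \<otimes> x) xs)) (u xs)"
  by (auto simp: inv_on_def)

lemma cocycD: "cocyc p n u \<Longrightarrow> set xs \<subseteq> carrier G \<Longrightarrow> length xs = Suc n \<Longrightarrow> eqm (int p) (cobd u xs) 0"
  by (auto simp: cocyc_def)

lemma inv_on_mono: "inv_on p H n u \<Longrightarrow> K \<subseteq> H \<Longrightarrow> inv_on p K n u"
  by (auto simp: inv_on_def)

lemma cobdry_add: "cobdry p H n f \<Longrightarrow> cobdry p H n g \<Longrightarrow> cobdry p H n (\<lambda>xs. f xs + g xs)"
proof -
  assume "cobdry p H n f" "cobdry p H n g"
  then obtain u v where u: "inv_on p H n u" "\<And>xs. set xs \<subseteq> carrier G \<Longrightarrow> length xs = Suc n \<Longrightarrow> eqm (int p) (f xs) (cobd u xs)"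
    and v: "inv_on p H n v" "\<And>xs. set xs \<subseteq> carrier G \<Longrightarrow> length xs = Suc n \<Longrightarrow> eqm (int p) (g xs) (cobd v xs)"
    unfolding cobdry_def by blast
  have "inv_on p H n (\<lambda>xs. u xs + v xs)"
    unfolding inv_on_def by (intro ballI allI impI eqm_add inv_onD[OF u(1)] inv_onD[OF v(1)])
  then show ?thesis unfolding cobdry_def
    by (intro exI[of _ "\<lambda>xs. u xs + v xs"] conjI allI impI) (auto simp: cobd_add intro: eqm_add u v)
qed

lemma cobdry_cong:
  "cobdry p H n f \<Longrightarrow> (\<And>xs. set xs \<subseteq> carrier G \<Longrightarrow> length xs = Suc n \<Longrightarrow> eqm (int p) (g xs) (f xs)) \<Longrightarrow> cobdry p H n g"
  unfolding cobdry_def by (metis eqm_trans)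

lemma map_translate: "h \<in> carrier G \<Longrightarrow> set xs \<subseteq> carrier G \<Longrightarrow> set (map (\<lambda>x. h \<otimes> x) xs) \<subseteq> carrier G"
  by auto

lemma map_translate_mult:
  "g \<in> carrier G \<Longrightarrow> h \<in> carrier G \<Longrightarrow> set xs \<subseteq> carrier G \<Longrightarrow>
     map (\<lambda>x. g \<otimes> x) (map (\<lambda>x. h \<otimes> x) xs) = map (\<lambda>x. g \<otimes> h \<otimes> x) xs"
  by (induction xs) (auto simp: m_assoc)

lemma map_translate_one: "set xs \<subseteq> carrier G \<Longrightarrow> map (\<lambda>x. \<one> \<otimes> x) xs = xs"
  by (induction xs) auto

lemma cocyc_translate:
  assumes "cocyc p n u" "g \<in> carrier G"
  shows "cocyc p n (\<lambda>xs. u (map (\<lambda>x. g \<otimes> x) xs))"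
  unfolding cocyc_def cobd_map
  by (intro allI impI cocycD[OF assms(1)] map_translate[OF assms(2)]) auto

text \<open>The prism homotopy of an H-equivariant vertex map sends H-invariant cochains to
  H-invariant cochains.\<close>

lemma cobdry_retract:
  assumes \<phi>: "\<And>x. x \<in> carrier G \<Longrightarrow> \<phi> x \<in> carrier G"
    and equi: "\<And>h x. h \<in> H \<Longrightarrow> x \<in> carrier G \<Longrightarrow> \<phi> (h \<otimes> x) = h \<otimes> \<phi> x"
    and u: "inv_on p H (Suc n) u" "cocyc p (Suc n) u" and H: "H \<subseteq> carrier G"
  shows "cobdry p H n (\<lambda>xs. u (map \<phi> xs) - u xs)"
  unfolding cobdry_def
proof (intro exI[of _ "prism \<phi> u"] conjI allI impI)
  show "inv_on p H n (prism \<phi> u)"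
    unfolding inv_on_def
  proof (intro ballI allI impI)
    fix h xs assume h: "h \<in> H" and xs: "set xs \<subseteq> carrier G" "length xs = n"
    have "prism \<phi> u (map (\<lambda>x. h \<otimes> x) xs) = prism \<phi> (\<lambda>ys. u (map (\<lambda>x. h \<otimes> x) ys)) xs"
      using xs \<phi> equi[OF h] by (intro prism_map[of _ "carrier G"]) auto
    also have "eqm (int p) \<dots> (prism \<phi> u xs)"
      using xs \<phi> inv_onD[OF u(1) h] by (intro prism_cong[of _ "carrier G" n]) auto
    finally show "eqm (int p) (prism \<phi> u (map (\<lambda>x. h \<otimes> x) xs)) (prism \<phi> u xs)" .
  qed
next
  fix xs assume xs: "set xs \<subseteq> carrier G" "length xs = Suc n"
  have "eqm (int p) (prism \<phi> (cobd u) xs) (prism \<phi> (\<lambda>_. 0) xs)"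
    using xs \<phi> cocycD[OF u(2)] by (intro prism_cong[of _ "carrier G" "Suc n"]) auto
  then have "eqm (int p) (cobd (prism \<phi> u) xs + prism \<phi> (cobd u) xs) (cobd (prism \<phi> u) xs + 0)"
    by (intro eqm_add) (auto simp: prism_zero)
  then show "eqm (int p) (u (map \<phi> xs) - u xs) (cobd (prism \<phi> u) xs)"
    by (simp add: prism_homotopy)
qed

text \<open>A passage from stabilizers to H in the manner of Shapiro's lemma. The primitives
  \<open>u s\<close> are invariant under stabilizers only and are unrelated along an orbit; taking
  them at one representative and transporting them makes their sum H-invariant. The remainders
  \<open>a s\<close>, transported likewise, become the equivariant family A.\<close>

lemma orbit_sum_cobdry:
  fixes act :: "'a \<Rightarrow> 'i \<Rightarrow> 'i" and b u a :: "'i \<Rightarrow> 'a list \<Rightarrow> int"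
  assumes H: "subgroup H G" and S: "finite S"
    and act: "\<And>h s. h \<in> H \<Longrightarrow> s \<in> S \<Longrightarrow> act h s \<in> S" "\<And>s. s \<in> S \<Longrightarrow> act \<one> s = s"
      "\<And>g h s. g \<in> H \<Longrightarrow> h \<in> H \<Longrightarrow> s \<in> S \<Longrightarrow> act (g \<otimes> h) s = act g (act h s)"
    and b: "\<And>h s xs. h \<in> H \<Longrightarrow> s \<in> S \<Longrightarrow> set xs \<subseteq> carrier G \<Longrightarrow> length xs = Suc n \<Longrightarrow>
      eqm (int p) (b (act h s) (map (\<lambda>x. h \<otimes> x) xs)) (b s xs)"
    and u: "\<And>s. s \<in> S \<Longrightarrow> inv_on p {h\<in>H. act h s = s} n (u s)"
    and a: "\<And>s. s \<in> S \<Longrightarrow> inv_on p {h\<in>H. act h s = s} (Suc n) (a s)"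
    and e: "\<And>s xs. s \<in> S \<Longrightarrow> set xs \<subseteq> carrier G \<Longrightarrow> length xs = Suc n \<Longrightarrow>
      eqm (int p) (b s xs) (cobd (u s) xs + a s xs)"
  obtains A where "cobdry p H n (\<lambda>xs. (\<Sum>s\<in>S. b s xs) - (\<Sum>s\<in>S. A s xs))"
    and "\<And>h s xs. h \<in> H \<Longrightarrow> s \<in> S \<Longrightarrow> set xs \<subseteq> carrier G \<Longrightarrow> length xs = Suc n \<Longrightarrow>
      eqm (int p) (A (act h s) (map (\<lambda>x. h \<otimes> x) xs)) (A s xs)"
    and "\<And>s. s \<in> S \<Longrightarrow> \<exists>h\<in>H. \<exists>r\<in>S. A s = (\<lambda>xs. a r (map (\<lambda>x. inv h \<otimes> x) xs))"
proof -
  have HG: "h \<in> carrier G" if "h \<in> H" for h using subgroup.mem_carrier[OF H that] .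
  have Hinv: "inv h \<in> H" if "h \<in> H" for h using subgroup.m_inv_closed[OF H that] .
  have Hm: "g \<otimes> h \<in> H" if "g \<in> H" "h \<in> H" for g h using subgroup.m_closed[OF H that] .
  define rep where "rep s = (SOME r. r \<in> (\<lambda>h. act h s) ` H)" for s
  define hh where "hh s = (SOME h. h \<in> H \<and> act h (rep s) = s)" for s
  have orb: "(\<lambda>k. act k (act h s)) ` H = (\<lambda>k. act k s) ` H" if h: "h \<in> H" and s: "s \<in> S" for h s
  proof
    show "(\<lambda>k. act k (act h s)) ` H \<subseteq> (\<lambda>k. act k s) ` H"
      using act(3)[OF _ h s] Hm[OF _ h] by force
    show "(\<lambda>k. act k s) ` H \<subseteq> (\<lambda>k. act k (act h s)) ` H"
    proof
      fix r assume "r \<in> (\<lambda>k. act k s) ` H"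
      then obtain k where k: "k \<in> H" "r = act k s" by blast
      have "act (k \<otimes> inv h) (act h s) = act (k \<otimes> inv h \<otimes> h) s"
        using act(3)[of "k \<otimes> inv h" h s] Hm[OF k(1) Hinv[OF h]] h s by simp
      also have "k \<otimes> inv h \<otimes> h = k" using HG[OF k(1)] HG[OF h] by (simp add: m_assoc)
      finally show "r \<in> (\<lambda>k. act k (act h s)) ` H" using k Hm[OF k(1) Hinv[OF h]]
        by (intro image_eqI[of _ _ "k \<otimes> inv h"]) auto
    qed
  qed
  have rep_in: "rep s \<in> (\<lambda>h. act h s) ` H" for s
    unfolding rep_def using subgroup.one_closed[OF H] by (intro someI_ex[of "\<lambda>r. r \<in> (\<lambda>h. act h s) ` H"]) auto
  have repS: "rep s \<in> S" if "s \<in> S" for s using rep_in[of s] act(1) that by auto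
  have rep_act: "rep (act h s) = rep s" if "h \<in> H" "s \<in> S" for h s
    unfolding rep_def by (simp add: orb that)
  have hh: "hh s \<in> H \<and> act (hh s) (rep s) = s" if s: "s \<in> S" for s
  proof -
    obtain h where h: "h \<in> H" "rep s = act h s" using rep_in[of s] by auto
    have "act (inv h) (rep s) = s"
      using act(3)[of "inv h" h s] act(2)[OF s] h Hinv HG s by simp
    then have "\<exists>h. h \<in> H \<and> act h (rep s) = s" using h Hinv by blast
    then show ?thesis unfolding hh_def by (rule someI_ex)
  qed
  define tw where "tw w s xs = w (rep s) (map (\<lambda>x. inv (hh s) \<otimes> x) xs)" for w :: "'i \<Rightarrow> 'a list \<Rightarrow> int" and s xs
  have tw_inv: "eqm (int p) (tw w (act h s) (map (\<lambda>x. h \<otimes> x) xs)) (tw w s xs)"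
    if w: "\<And>s. s \<in> S \<Longrightarrow> inv_on p {h\<in>H. act h s = s} m (w s)" and h: "h \<in> H" and s: "s \<in> S"
      and xs: "set xs \<subseteq> carrier G" "length xs = m" for w h s xs m
  proof -
    let ?t = "act h s" and ?r = "rep s"
    have ts: "?t \<in> S" using act(1) h s by blast
    \<comment> \<open>k compares two ways of reaching \<open>act h s\<close> from the
      representative; it stabilizes the representative, so w does not see it.\<close>
    define k where "k = inv (hh ?t) \<otimes> h \<otimes> hh s"
    have hs: "hh s \<in> H" "act (hh s) ?r = s" and ht: "hh ?t \<in> H" "act (hh ?t) ?r = ?t"
      using hh[OF s] hh[OF ts] rep_act[OF h s] by auto
    have g: "hh s \<in> carrier G" "hh ?t \<in> carrier G" "h \<in> carrier G" using HG hs ht h by auto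
    have kH: "k \<in> H" unfolding k_def by (intro Hm Hinv ht hs h)
    have "act k ?r = act (inv (hh ?t) \<otimes> h) s"
      unfolding k_def using act(3)[of "inv (hh ?t) \<otimes> h" "hh s" ?r] Hm Hinv ht hs h repS[OF s] by simp
    also have "\<dots> = act (inv (hh ?t)) ?t"
      using act(3)[of "inv (hh ?t)" h s] Hinv ht h s by simp
    also have "\<dots> = act (inv (hh ?t) \<otimes> hh ?t) ?r"
      using act(3)[of "inv (hh ?t)" "hh ?t" ?r] Hinv ht repS[OF s] by simp
    also have "\<dots> = ?r" using g act(2) repS[OF s] by simp
    finally have kr: "act k ?r = ?r" .
    have kg: "k \<in> carrier G" using HG kH .
    have "k \<otimes> inv (hh s) = inv (hh ?t) \<otimes> h" unfolding k_def using g by (simp add: m_assoc)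
    then have "map (\<lambda>x. inv (hh ?t) \<otimes> x) (map (\<lambda>x. h \<otimes> x) xs) = map (\<lambda>x. k \<otimes> x) (map (\<lambda>x. inv (hh s) \<otimes> x) xs)"
      using g kg xs by (simp only: map_translate_mult inv_closed)
    then have "tw w ?t (map (\<lambda>x. h \<otimes> x) xs) = w ?r (map (\<lambda>x. k \<otimes> x) (map (\<lambda>x. inv (hh s) \<otimes> x) xs))"
      unfolding tw_def rep_act[OF h s] by (simp only:)
    also have "eqm (int p) \<dots> (w ?r (map (\<lambda>x. inv (hh s) \<otimes> x) xs))"
      using xs g kH kr by (intro inv_onD[OF w[OF repS[OF s]]] map_translate) auto
    finally show ?thesis by (simp add: tw_def)
  qed
  have reindex: "(\<Sum>s\<in>S. F (act h s)) = (\<Sum>s\<in>S. F s)" if h: "h \<in> H" for F :: "'i \<Rightarrow> int" and h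
  proof (rule sum.reindex_bij_betw)
    have "act (inv h) (act h s) = s" "act h (act (inv h) s) = s" if s: "s \<in> S" for s
      using act(3)[of "inv h" h s] act(3)[of h "inv h" s] act(2)[OF s] h Hinv HG s by auto
    then show "bij_betw (act h) S S" using act(1) h Hinv by (intro bij_betwI[of _ _ _ "act (inv h)"]) auto
  qed
  define U where "U xs = (\<Sum>s\<in>S. tw u s xs)" for xs
  have U: "inv_on p H n U"
    unfolding inv_on_def
  proof (intro ballI allI impI)
    fix h xs assume h: "h \<in> H" and xs: "set xs \<subseteq> carrier G" "length xs = n"
    have "U (map (\<lambda>x. h \<otimes> x) xs) = (\<Sum>s\<in>S. tw u (act h s) (map (\<lambda>x. h \<otimes> x) xs))"
      unfolding U_def by (rule reindex[OF h, symmetric])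
    also have "eqm (int p) \<dots> (U xs)"
      unfolding U_def by (intro eqm_sum tw_inv[OF u h _ xs])
    finally show "eqm (int p) (U (map (\<lambda>x. h \<otimes> x) xs)) (U xs)" .
  qed
  have be: "eqm (int p) (b s xs) (cobd (tw u s) xs + tw a s xs)"
    if s: "s \<in> S" and xs: "set xs \<subseteq> carrier G" "length xs = Suc n" for s xs
  proof -
    let ?y = "map (\<lambda>x. inv (hh s) \<otimes> x) xs"
    have hs: "hh s \<in> H" "act (hh s) (rep s) = s" using hh[OF s] by auto
    have y: "set ?y \<subseteq> carrier G" "length ?y = Suc n" using xs HG[OF hs(1)] by auto
    have "map (\<lambda>x. hh s \<otimes> x) ?y = xs"
      using xs HG[OF hs(1)] by (simp add: map_translate_mult map_translate_one del: map_map)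
    then have "b s xs = b (act (hh s) (rep s)) (map (\<lambda>x. hh s \<otimes> x) ?y)" using hs by simp
    also have "eqm (int p) \<dots> (b (rep s) ?y)" by (intro b hs repS s y)
    also have "eqm (int p) \<dots> (cobd (u (rep s)) ?y + a (rep s) ?y)" by (intro e repS s y)
    also have "\<dots> = cobd (tw u s) xs + tw a s xs"
      unfolding tw_def[abs_def] cobd_map by simp
    finally show ?thesis .
  qed
  show thesis
  proof (rule that[of "tw a"])
    show "cobdry p H n (\<lambda>xs. (\<Sum>s\<in>S. b s xs) - (\<Sum>s\<in>S. tw a s xs))"
      unfolding cobdry_def
    proof (intro exI[of _ U] conjI U allI impI)
      fix xs assume xs: "set xs \<subseteq> carrier G" "length xs = Suc n"
      have "eqm (int p) (\<Sum>s\<in>S. b s xs) (\<Sum>s\<in>S. cobd (tw u s) xs + tw a s xs)"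
        by (intro eqm_sum be xs)
      then show "eqm (int p) ((\<Sum>s\<in>S. b s xs) - (\<Sum>s\<in>S. tw a s xs)) (cobd U xs)"
        unfolding U_def[abs_def] cobd_sum by (simp add: eqm_def sum.distrib algebra_simps)
    qed
    show "eqm (int p) (tw a (act h s) (map (\<lambda>x. h \<otimes> x) xs)) (tw a s xs)"
      if "h \<in> H" "s \<in> S" "set xs \<subseteq> carrier G" "length xs = Suc n" for h s xs
      by (rule tw_inv[OF a that])
    show "\<exists>h\<in>H. \<exists>r\<in>S. tw a s = (\<lambda>xs. a r (map (\<lambda>x. inv h \<otimes> x) xs))" if "s \<in> S" for s
      using hh[OF that] repS[OF that] unfolding tw_def[abs_def] by blast
  qed
qed

end

text \<open>As p is prime and g moves every point, all orbits have exactly p elements, and F is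
  constant on each modulo p.\<close>

lemma sum_free_orbits:
  fixes F :: "'i \<Rightarrow> int"
  assumes p: "Factorial_Ring.prime p" and S: "finite S"
    and g: "\<And>s. s \<in> S \<Longrightarrow> g s \<in> S" "\<And>s. s \<in> S \<Longrightarrow> (g ^^ p) s = s" "\<And>s. s \<in> S \<Longrightarrow> g s \<noteq> s"
    and F: "\<And>s. s \<in> S \<Longrightarrow> eqm (int p) (F (g s)) (F s)"
  shows "eqm (int p) (\<Sum>s\<in>S. F s) 0"
  using S g F
proof (induction "card S" arbitrary: S rule: less_induct)
  case less
  have p0: "p > 0" using p prime_gt_0_nat by blast
  show ?case
  proof (cases "S = {}")
    case False
    then obtain s where s: "s \<in> S" by blast
    let ?O = "(\<lambda>j. (g ^^ j) s) ` {..<p}"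
    have gS: "(g ^^ j) t \<in> S" if "t \<in> S" for j t using that less.prems(2) by (induction j) auto
    have gp: "(g ^^ (k * p)) t = t" if t: "t \<in> S" for k t
      by (induction k) (auto simp: funpow_add less.prems(3)[OF t])
    have inj: "inj_on (\<lambda>j. (g ^^ j) s) {..<p}"
    proof -
      have "i = j" if "i \<le> j" "j < p" "(g ^^ i) s = (g ^^ j) s" for i j
      proof (rule ccontr)
        assume "i \<noteq> j"
        then have ij: "i < j" using that by simp
        define d where "d = j - i"
        have "(g ^^ (p - i)) ((g ^^ i) s) = (g ^^ (p - i)) ((g ^^ j) s)" using that by simp
        moreover have "(g ^^ (p - i)) ((g ^^ i) s) = s"
        proof -
          have "p - i + i = p" using that by simp
          then show ?thesis using less.prems(3)[OF s] by (metis comp_apply funpow_add)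
        qed
        moreover have "(g ^^ (p - i)) ((g ^^ j) s) = (g ^^ d) ((g ^^ p) s)"
        proof -
          have "p - i + j = d + p" using that by (simp add: d_def)
          then show ?thesis by (metis comp_apply funpow_add)
        qed
        ultimately have d: "(g ^^ d) s = s" using less.prems(3)[OF s] by simp
        then have dk: "(g ^^ (k * d)) s = s" for k by (induction k) (auto simp: funpow_add)
        have "\<not> p dvd d" using ij that by (auto simp: d_def dest: dvd_imp_le)
        then have "coprime d p" using p prime_imp_coprime coprime_commute by blast
        then obtain k where "[d * k = 1] (mod p)" using cong_solve_coprime_nat[of d p] by auto
        then have "d * k mod p = 1" using prime_gt_1_nat[OF p] by (simp add: cong_def)
        then have e: "k * d = 1 + (d * k div p) * p"
          by (metis add.commute mult.commute mult_div_mod_eq)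
        have "s = (g ^^ (k * d)) s" by (simp add: dk)
        also have "\<dots> = (g ^^ 1) ((g ^^ ((d * k div p) * p)) s)" unfolding e by (simp only: funpow_add comp_apply)
        also have "\<dots> = g s" by (simp add: gp[OF s])
        finally show False using less.prems(4)[OF s] by simp
      qed
      then show ?thesis by (intro inj_onI) (metis lessThan_iff linorder_linear)
    qed
    have FO: "eqm (int p) (F ((g ^^ j) s)) (F s)" for j
    proof (induction j)
      case (Suc j)
      have "eqm (int p) (F (g ((g ^^ j) s))) (F ((g ^^ j) s))" by (rule less.prems(5)[OF gS[OF s]])
      then show ?case using Suc by (auto intro: eqm_trans)
    qed simp
    have "(\<Sum>t\<in>?O. F t) = (\<Sum>j<p. F ((g ^^ j) s))" by (simp add: sum.reindex[OF inj])
    also have "eqm (int p) \<dots> (\<Sum>j<p. F s)" by (intro eqm_sum FO)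
    also have "eqm (int p) \<dots> 0" by (simp add: eqm_0_iff)
    finally have 1: "eqm (int p) (\<Sum>t\<in>?O. F t) 0" .
    have OS: "?O \<subseteq> S" using gS[OF s] by auto
    have cl: "g t \<in> S - ?O" if t: "t \<in> S - ?O" for t
    proof -
      have "t \<in> ?O" if gt: "g t \<in> ?O"
      proof -
        obtain j where j: "g t = (g ^^ j) s" using gt by blast
        have "t = (g ^^ p) t" using less.prems(3) t by simp
        also have "\<dots> = (g ^^ (p - 1)) (g t)" using p0 by (cases p) (simp_all add: funpow_swap1)
        also have "\<dots> = (g ^^ (p - 1 + j)) s" by (simp add: j funpow_add)
        also have "\<dots> = (g ^^ ((p - 1 + j) mod p)) ((g ^^ (((p - 1 + j) div p) * p)) s)"
          by (metis comp_apply funpow_add mod_div_mult_eq)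
        also have "\<dots> = (g ^^ ((p - 1 + j) mod p)) s" by (simp add: gp[OF s])
        finally show "t \<in> ?O" using p0 by auto
      qed
      then show ?thesis using t less.prems(2) by blast
    qed
    have "?O \<noteq> {}" using p0 by auto
    then have "card (S - ?O) < card S" using OS less.prems(1) by (intro psubset_card_mono) auto
    then have 2: "eqm (int p) (\<Sum>t\<in>S - ?O. F t) 0"
      using less.prems cl by (intro less.hyps) auto
    have "(\<Sum>s\<in>S. F s) = (\<Sum>t\<in>S - ?O. F t) + (\<Sum>t\<in>?O. F t)"
      using OS less.prems(1) by (intro sum.subset_diff) auto
    then show ?thesis using eqm_add[OF 2 1] by simp
  qed simp
qed

section \<open>Equivariant retractions\<close>

context group
begin

text \<open>Each x is divided by a chosen element of its right coset. Choosing the unit in H itself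
  makes the map the identity there.\<close>

lemma subgroup_retraction:
  assumes H: "subgroup H G"
  obtains \<rho> where "\<And>x. x \<in> carrier G \<Longrightarrow> \<rho> x \<in> H" "\<And>h x. h \<in> H \<Longrightarrow> x \<in> carrier G \<Longrightarrow> \<rho> (h \<otimes> x) = h \<otimes> \<rho> x"
    "\<And>h. h \<in> H \<Longrightarrow> \<rho> h = h"
proof -
  have HG: "h \<in> carrier G" if "h \<in> H" for h using subgroup.mem_carrier[OF H that] .
  define s where "s S = (if S = H then \<one> else SOME y. y \<in> S)" for S
  define \<rho> where "\<rho> x = x \<otimes> inv (s (H #> x))" for x
  have s: "s (H #> x) \<in> H #> x" if x: "x \<in> carrier G" for x
  proof (cases "H #> x = H")
    case True
    then show ?thesis using subgroup.one_closed[OF H] by (simp add: s_def)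
  next
    case False
    then show ?thesis unfolding s_def using rcos_self[OF x H] by (auto intro: someI)
  qed
  have cos: "H #> (h \<otimes> x) = H #> x" if "h \<in> H" "x \<in> carrier G" for h x
    using that HG subgroup.subset[OF H] by (simp add: coset_mult_assoc[symmetric] subgroup.rcos_const[OF H is_group])
  have sG: "s (H #> x) \<in> carrier G" if "x \<in> carrier G" for x
    using s[OF that] r_coset_subset_G[OF subgroup.subset[OF H] that] by blast
  show thesis
  proof (rule that[of \<rho>])
    fix x assume x: "x \<in> carrier G"
    obtain h where h: "h \<in> H" "s (H #> x) = h \<otimes> x" using s[OF x] by (auto simp: r_coset_def)
    then have "\<rho> x = inv h" unfolding \<rho>_def using x HG by (simp add: inv_mult_group m_assoc[symmetric])
    then show "\<rho> x \<in> H" using subgroup.m_inv_closed[OF H h(1)] by simp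
  next
    fix h x assume h: "h \<in> H" and x: "x \<in> carrier G"
    show "\<rho> (h \<otimes> x) = h \<otimes> \<rho> x" unfolding \<rho>_def cos[OF h x] using HG[OF h] x sG[OF x] by (simp add: m_assoc)
  next
    fix h assume h: "h \<in> H"
    show "\<rho> h = h" unfolding \<rho>_def s_def using HG[OF h] subgroup.rcos_const[OF H is_group h] by simp
  qed
qed

lemma subgroup_pow: "subgroup D G \<Longrightarrow> v \<in> D \<Longrightarrow> v [^] (k::nat) \<in> D"
  by (induction k) (auto simp: subgroup.one_closed subgroup.m_closed)

lemma coprime_pow_mem:
  fixes k q :: nat
  assumes D: "subgroup D G" and v: "v \<in> carrier G" "v [^] k \<in> D" "v [^] q \<in> D" and co: "coprime k q"
  shows "v \<in> D"
proof (cases "q = 0")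
  case True
  then show ?thesis using co v by simp
next
  case q: False
  obtain m where m: "[k * m = 1] (mod q)" using cong_solve_coprime_nat[OF co] by auto
  show ?thesis
  proof (cases "q = 1")
    case True
    then show ?thesis using v by simp
  next
    case False
    have "k * m = q * (k * m div q) + 1" using m q False by (metis cong_def mod_less mult_div_mod_eq nat_neq_iff less_one)
    then have "(v [^] k) [^] m = v [^] (q * (k * m div q) + 1)" using v by (simp only: nat_pow_pow)
    also have "\<dots> = (v [^] q) [^] (k * m div q) \<otimes> v" using v(1) by (simp add: nat_pow_pow)
    finally have e: "(v [^] k) [^] m = (v [^] q) [^] (k * m div q) \<otimes> v" .
    have qm: "(v [^] q) [^] (k * m div q) \<in> D" "(v [^] k) [^] m \<in> D" using subgroup_pow[OF D] v by blast+
    have "v = inv ((v [^] q) [^] (k * m div q)) \<otimes> ((v [^] k) [^] m)"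
      unfolding e using v(1) by (simp add: m_assoc[symmetric])
    then show ?thesis using D qm subgroup.m_inv_closed subgroup.m_closed by metis
  qed
qed

lemma prime_pow_mem:
  fixes k p :: nat
  assumes p: "Factorial_Ring.prime p" and D: "subgroup D G" and v: "v \<in> carrier G" "v [^] p = \<one>"
    and k: "\<not> p dvd k" "v [^] k \<in> D"
  shows "v \<in> D"
proof (rule coprime_pow_mem[OF D v(1) k(2)])
  show "v [^] p \<in> D" using v(2) subgroup.one_closed[OF D] by simp
  show "coprime k p" using k(1) p prime_imp_coprime coprime_commute by blast
qed

text \<open>D and v generate a direct product, which acts freely on G from the left. In each orbit
  \<open>cl x\<close> a point s is chosen, and phi sends x to the element of <v> x that lies in D s.
  It is unique because D meets <v> trivially, p being prime. Hence phi forgets the direction of v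
  and is still D-equivariant.\<close>

lemma commuting_retraction:
  fixes p :: nat
  assumes p: "Factorial_Ring.prime p" and D: "subgroup D G" and v: "v \<in> carrier G" "v [^] p = \<one>" "v \<notin> D"
    and comm: "\<And>d. d \<in> D \<Longrightarrow> v \<otimes> d = d \<otimes> v"
  obtains \<phi> where "\<And>x. x \<in> carrier G \<Longrightarrow> \<phi> x \<in> carrier G" "\<And>d x. d \<in> D \<Longrightarrow> x \<in> carrier G \<Longrightarrow> \<phi> (d \<otimes> x) = d \<otimes> \<phi> x"
    "\<And>x. x \<in> carrier G \<Longrightarrow> \<phi> (v \<otimes> x) = \<phi> x"
proof -
  have DG: "d \<in> carrier G" if "d \<in> D" for d using subgroup.mem_carrier[OF D that] .
  have Dm: "d \<otimes> e \<in> D" "inv d \<in> D" if "d \<in> D" "e \<in> D" for d e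
    using subgroup.m_closed[OF D that] subgroup.m_inv_closed[OF D that(1)] by auto
  have p0: "p > 0" using prime_gt_0_nat[OF p] .
  have commj: "v [^] (j::nat) \<otimes> d = d \<otimes> v [^] j" if "d \<in> D" for j d
  proof (induction j)
    case (Suc j)
    have "v [^] Suc j \<otimes> d = v [^] j \<otimes> (v \<otimes> d)" using v DG[OF that] by (simp add: m_assoc)
    also have "\<dots> = (v [^] j \<otimes> d) \<otimes> v" using v DG[OF that] comm[OF that] by (simp add: m_assoc)
    also have "\<dots> = d \<otimes> v [^] Suc j" using v DG[OF that] Suc by (simp add: m_assoc)
    finally show ?case .
  qed (use DG that in simp)
  define cl where "cl x = {y. \<exists>d\<in>D. \<exists>j::nat. y = d \<otimes> (v [^] j \<otimes> x)}" for x
  define s where "s x = (SOME y. y \<in> cl x)" for x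
  define Q where "Q x y \<longleftrightarrow> (\<exists>j::nat. y = v [^] j \<otimes> x) \<and> (\<exists>d\<in>D. d \<otimes> y = s x)" for x y
  have uniq: "y = y'" if x: "x \<in> carrier G" and y: "Q x y" "Q x y'" for x y y'
  proof -
    obtain i j :: nat and d e where h: "y = v [^] i \<otimes> x" "y' = v [^] j \<otimes> x" "d \<in> D" "e \<in> D"
      "d \<otimes> y = s x" "e \<otimes> y' = s x" using y unfolding Q_def by blast
    have g: "v [^] i \<in> carrier G" "v [^] j \<in> carrier G" "d \<in> carrier G" "e \<in> carrier G"
      using v h DG by auto
    have "(d \<otimes> v [^] i) \<otimes> x = (e \<otimes> v [^] j) \<otimes> x" using h x g by (simp add: m_assoc)
    then have "d \<otimes> v [^] i = e \<otimes> v [^] j" using x g by simp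
    then have "inv e \<otimes> (d \<otimes> v [^] i) = v [^] j" using g by (simp add: m_assoc[symmetric])
    then have "(inv e \<otimes> d) \<otimes> v [^] i = v [^] j" using g by (simp add: m_assoc)
    then have "(inv e \<otimes> d) \<otimes> (v [^] i \<otimes> v [^] ((p - 1) * i)) = v [^] j \<otimes> v [^] ((p - 1) * i)"
      using g v by (simp add: m_assoc[symmetric])
    moreover have "v [^] i \<otimes> v [^] ((p - 1) * i) = \<one>"
    proof -
      have "i + (p - 1) * i = p * i" using p0 by (cases p) auto
      then have "v [^] i \<otimes> v [^] ((p - 1) * i) = (v [^] p) [^] i"
        by (simp only: nat_pow_mult[OF v(1)] nat_pow_pow[OF v(1)])
      then show ?thesis using v by simp
    qed
    ultimately have "v [^] (j + (p - 1) * i) = inv e \<otimes> d"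
      using g v(1) by (simp add: nat_pow_mult)
    then have k: "v [^] (j + (p - 1) * i) \<in> D"
      using Dm(1)[OF Dm(2)[OF h(4) h(4)] h(3)] by simp
    then have "p dvd j + (p - 1) * i" using prime_pow_mem[OF p D v(1,2)] v(3) by blast
    then obtain c where c: "j + (p - 1) * i = p * c" by (auto simp: dvd_def)
    have "v [^] j \<otimes> v [^] ((p - 1) * i) = (v [^] p) [^] c"
      by (simp only: nat_pow_mult[OF v(1)] nat_pow_pow[OF v(1)] c)
    then have "v [^] j \<otimes> v [^] ((p - 1) * i) = v [^] i \<otimes> v [^] ((p - 1) * i)"
      using v \<open>v [^] i \<otimes> v [^] ((p - 1) * i) = \<one>\<close> by simp
    then have "v [^] j = v [^] i" using v by simp
    then show "y = y'" using h by simp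
  qed
  have clne: "s x \<in> cl x" if "x \<in> carrier G" for x
  proof -
    have "\<one> \<otimes> (v [^] (0::nat) \<otimes> x) \<in> cl x" unfolding cl_def using subgroup.one_closed[OF D] by blast
    then show ?thesis unfolding s_def by (rule someI)
  qed
  have ex: "\<exists>y. Q x y" if x: "x \<in> carrier G" for x
  proof -
    obtain d j where "d \<in> D" "s x = d \<otimes> (v [^] (j::nat) \<otimes> x)"
      using clne[OF x] unfolding cl_def by blast
    then have "Q x (v [^] j \<otimes> x)" unfolding Q_def by auto
    then show ?thesis by blast
  qed
  have clI: "y \<in> cl x" if "y = d \<otimes> (v [^] (j::nat) \<otimes> x)" "d \<in> D" for x y d j
    using that unfolding cl_def by blast
  have clE: "\<exists>d\<in>D. \<exists>j::nat. y = d \<otimes> (v [^] j \<otimes> x)" if "y \<in> cl x" for x y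
    using that unfolding cl_def by blast
  have clv: "cl (v \<otimes> x) = cl x" if x: "x \<in> carrier G" for x
  proof
    have 1: "v [^] j \<otimes> (v \<otimes> x) = v [^] Suc j \<otimes> x" for j :: nat using v x by (simp add: m_assoc)
    then show "cl (v \<otimes> x) \<subseteq> cl x" unfolding cl_def by (simp only: 1) blast
    have "v [^] j \<otimes> x = v [^] (j + (p - 1)) \<otimes> (v \<otimes> x)" for j :: nat
    proof -
      have "Suc (j + (p - 1)) = j + p" using p0 by simp
      then have "v [^] Suc (j + (p - 1)) = v [^] j" using v by (simp only: nat_pow_mult[OF v(1), symmetric]) simp
      then show ?thesis unfolding 1 by simp
    qed
    then show "cl x \<subseteq> cl (v \<otimes> x)" using clE[of _ x] clI[of _ _ _ "v \<otimes> x"] by (metis subsetI)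
  qed
  have cld: "cl (d \<otimes> x) = cl x" if x: "x \<in> carrier G" and d: "d \<in> D" for x d
  proof
    have 1: "e \<otimes> (v [^] j \<otimes> (d \<otimes> x)) = (e \<otimes> d) \<otimes> (v [^] j \<otimes> x)" if e: "e \<in> D" for e and j :: nat
    proof -
      have "v [^] j \<otimes> (d \<otimes> x) = d \<otimes> (v [^] j \<otimes> x)"
        using commj[OF d, of j] v x DG[OF d] by (simp add: m_assoc[symmetric])
      then show ?thesis using v x DG[OF d] DG[OF e] by (simp add: m_assoc)
    qed
    then show "cl (d \<otimes> x) \<subseteq> cl x" using clE[of _ "d \<otimes> x"] clI[of _ _ _ x] Dm(1)[OF _ d] by (metis subsetI)
    have "e \<otimes> (v [^] j \<otimes> x) = (e \<otimes> inv d) \<otimes> (v [^] j \<otimes> (d \<otimes> x))" if e: "e \<in> D" for e and j :: nat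
      using 1[of "e \<otimes> inv d" j] Dm e d DG by (simp add: m_assoc)
    then show "cl x \<subseteq> cl (d \<otimes> x)"
      using clE[of _ x] clI[of _ _ _ "d \<otimes> x"] Dm(1)[OF _ Dm(2)[OF d d]] by (metis subsetI)
  qed
  define \<phi> where "\<phi> x = (SOME y. Q x y)" for x
  have \<phi>: "Q x (\<phi> x)" if "x \<in> carrier G" for x
    unfolding \<phi>_def using ex[OF that] by (rule someI_ex)
  show thesis
  proof (rule that[of \<phi>])
    fix x assume x: "x \<in> carrier G"
    show phiG: "\<phi> x \<in> carrier G" using \<phi>[OF x] v x unfolding Q_def by auto
    obtain j :: nat and d where jd: "\<phi> x = v [^] j \<otimes> x" "d \<in> D" "d \<otimes> \<phi> x = s x"
      using \<phi>[OF x] unfolding Q_def by blast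
    have "v [^] (j + (p - 1)) \<otimes> (v \<otimes> x) = v [^] (j + (p - 1) + 1) \<otimes> x"
      using v x by (simp add: m_assoc)
    also have "j + (p - 1) + 1 = j + p" using p0 by simp
    also have "v [^] (j + p) = v [^] j" using v by (simp add: nat_pow_mult[symmetric])
    finally have "Q (v \<otimes> x) (\<phi> x)" unfolding Q_def s_def clv[OF x] using jd
      by (auto simp: s_def intro!: exI[of _ "j + (p - 1)"])
    then show "\<phi> (v \<otimes> x) = \<phi> x" using uniq[of "v \<otimes> x"] \<phi>[of "v \<otimes> x"] v x by blast
    fix e assume e: "e \<in> D"
    have 1: "e \<otimes> \<phi> x = v [^] j \<otimes> (e \<otimes> x)"
      using jd(1) commj[OF e, of j] v x DG[OF e] by (simp add: m_assoc[symmetric])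
    have 2: "(d \<otimes> inv e) \<otimes> (e \<otimes> \<phi> x) = s x"
    proof -
      have "(d \<otimes> inv e) \<otimes> (e \<otimes> \<phi> x) = d \<otimes> ((inv e \<otimes> e) \<otimes> \<phi> x)"
        using DG[OF jd(2)] DG[OF e] phiG by (simp only: m_assoc m_closed inv_closed)
      then show ?thesis using DG[OF jd(2)] DG[OF e] phiG jd(3) by simp
    qed
    have "Q (e \<otimes> x) (e \<otimes> \<phi> x)"
      unfolding Q_def s_def cld[OF x e] using 1 2 Dm(1)[OF jd(2) Dm(2)[OF e e]] by (auto simp: s_def)
    then show "\<phi> (e \<otimes> x) = e \<otimes> \<phi> x" using uniq[of "e \<otimes> x"] \<phi>[of "e \<otimes> x"] DG[OF e] x by blast
  qed
qed

end

section \<open>The transfer and its double coset formula\<close>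

locale coset_family = group G for G (structure) +
  fixes p :: nat and C :: "'a set" and n :: nat and b :: "'a list \<Rightarrow> int"
  assumes fin: "finite (carrier G)" and prime: "Factorial_Ring.prime p" and C: "subgroup C G"
    and b_inv: "inv_on p C (Suc n) b" and b_coc: "cocyc p (Suc n) b"
begin

definition Cos :: "'a set set" where "Cos = (\<lambda>t. t <#\<^bsub>G\<^esub> C) ` carrier G"

definition rp :: "'a set \<Rightarrow> 'a" where "rp S = (SOME t. t \<in> S)"

text \<open>The conjugate of b that belongs to the coset S. By \<open>fam_eq\<close> the invariance
  of b under C makes the chosen representative irrelevant modulo p.\<close>

definition fam :: "'a set \<Rightarrow> 'a list \<Rightarrow> int" where
  "fam S xs = b (map (\<lambda>x. inv (rp S) \<otimes> x) xs)"

lemma CG: "c \<in> C \<Longrightarrow> c \<in> carrier G"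
  using subgroup.mem_carrier[OF C] .

lemma Cos_fin: "finite Cos"
  using fin by (simp add: Cos_def)

lemma rp_Cos: "S \<in> Cos \<Longrightarrow> rp S \<in> carrier G \<and> S = rp S <#\<^bsub>G\<^esub> C"
proof -
  assume "S \<in> Cos"
  then obtain t where t: "t \<in> carrier G" "S = t <#\<^bsub>G\<^esub> C" by (auto simp: Cos_def)
  have "t \<in> S" using t subgroup.one_closed[OF C] by (force simp: l_coset_def)
  then have "rp S \<in> t <#\<^bsub>G\<^esub> C" unfolding rp_def t(2)[symmetric] by (rule someI)
  then obtain c where c: "c \<in> C" "rp S = t \<otimes> c" by (auto simp: l_coset_def)
  have "rp S <#\<^bsub>G\<^esub> C = t <#\<^bsub>G\<^esub> (c <#\<^bsub>G\<^esub> C)"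
    using c t CG subgroup.subset[OF C] by (simp add: lcos_m_assoc)
  also have "c <#\<^bsub>G\<^esub> C = C" using coset_join3[OF CG[OF c(1)] C c(1)] .
  finally show ?thesis using c t CG by simp
qed

lemma lcos_eq_iff: "t \<in> carrier G \<Longrightarrow> u \<in> carrier G \<Longrightarrow> t <#\<^bsub>G\<^esub> C = u <#\<^bsub>G\<^esub> C \<longleftrightarrow> inv t \<otimes> u \<in> C"
proof
  assume t: "t \<in> carrier G" "u \<in> carrier G" and e: "t <#\<^bsub>G\<^esub> C = u <#\<^bsub>G\<^esub> C"
  have "u \<otimes> \<one> \<in> u <#\<^bsub>G\<^esub> C" using subgroup.one_closed[OF C] unfolding l_coset_def by blast
  then have "u \<in> t <#\<^bsub>G\<^esub> C" using t e by simp
  then obtain c where c: "c \<in> C" "u = t \<otimes> c" by (auto simp: l_coset_def)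
  then have "inv t \<otimes> u = c" using t CG by (simp add: m_assoc[symmetric])
  then show "inv t \<otimes> u \<in> C" using c by simp
next
  assume t: "t \<in> carrier G" "u \<in> carrier G" and c: "inv t \<otimes> u \<in> C"
  have "u <#\<^bsub>G\<^esub> C = (t \<otimes> (inv t \<otimes> u)) <#\<^bsub>G\<^esub> C" using t by (simp add: m_assoc[symmetric])
  also have "\<dots> = t <#\<^bsub>G\<^esub> ((inv t \<otimes> u) <#\<^bsub>G\<^esub> C)" using t subgroup.subset[OF C] by (simp add: lcos_m_assoc)
  also have "(inv t \<otimes> u) <#\<^bsub>G\<^esub> C = C" using coset_join3[OF CG[OF c] C c] .
  finally show "t <#\<^bsub>G\<^esub> C = u <#\<^bsub>G\<^esub> C" by simp
qed

lemma fam_eq: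
  assumes t: "t \<in> carrier G" and xs: "set xs \<subseteq> carrier G" "length xs = Suc n"
  shows "eqm (int p) (fam (t <#\<^bsub>G\<^esub> C) xs) (b (map (\<lambda>x. inv t \<otimes> x) xs))"
proof -
  let ?s = "rp (t <#\<^bsub>G\<^esub> C)"
  have s: "?s \<in> carrier G" "?s <#\<^bsub>G\<^esub> C = t <#\<^bsub>G\<^esub> C" using rp_Cos[of "t <#\<^bsub>G\<^esub> C"] t by (auto simp: Cos_def)
  have c: "inv ?s \<otimes> t \<in> C" using s t by (simp add: lcos_eq_iff[symmetric])
  have "inv ?s \<otimes> t \<otimes> inv t = inv ?s" using s t by (simp add: m_assoc)
  then have "map (\<lambda>x. inv ?s \<otimes> x) xs = map (\<lambda>x. inv ?s \<otimes> t \<otimes> x) (map (\<lambda>x. inv t \<otimes> x) xs)"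
    using xs s t by (simp only: map_translate_mult inv_closed m_closed)
  then have "fam (t <#\<^bsub>G\<^esub> C) xs = b (map (\<lambda>x. inv ?s \<otimes> t \<otimes> x) (map (\<lambda>x. inv t \<otimes> x) xs))"
    unfolding fam_def by (simp only:)
  also have "eqm (int p) \<dots> (b (map (\<lambda>x. inv t \<otimes> x) xs))"
    using xs t by (intro inv_onD[OF b_inv c] map_translate) auto
  finally show ?thesis .
qed

lemma act_Cos: "h \<in> carrier G \<Longrightarrow> S \<in> Cos \<Longrightarrow> h <#\<^bsub>G\<^esub> S \<in> Cos"
  and act_one: "S \<in> Cos \<Longrightarrow> \<one> <#\<^bsub>G\<^esub> S = S"
  and act_mult: "g \<in> carrier G \<Longrightarrow> h \<in> carrier G \<Longrightarrow> S \<in> Cos \<Longrightarrow> (g \<otimes> h) <#\<^bsub>G\<^esub> S = g <#\<^bsub>G\<^esub> (h <#\<^bsub>G\<^esub> S)"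
proof -
  have sub: "S \<subseteq> carrier G" if "S \<in> Cos" for S
    using that l_coset_subset_G[OF subgroup.subset[OF C]] by (auto simp: Cos_def)
  show "\<one> <#\<^bsub>G\<^esub> S = S" if "S \<in> Cos" using sub[OF that] by (rule lcos_mult_one)
  show "(g \<otimes> h) <#\<^bsub>G\<^esub> S = g <#\<^bsub>G\<^esub> (h <#\<^bsub>G\<^esub> S)" if "g \<in> carrier G" "h \<in> carrier G" "S \<in> Cos"
    using lcos_m_assoc[OF sub[OF that(3)] that(1,2)] by simp
  show "h <#\<^bsub>G\<^esub> S \<in> Cos" if "h \<in> carrier G" "S \<in> Cos"
    using that subgroup.subset[OF C] by (auto simp: Cos_def lcos_m_assoc)
qed

lemma fam_act:
  assumes h: "h \<in> carrier G" and S: "S \<in> Cos" and xs: "set xs \<subseteq> carrier G" "length xs = Suc n"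
  shows "eqm (int p) (fam (h <#\<^bsub>G\<^esub> S) (map (\<lambda>x. h \<otimes> x) xs)) (fam S xs)"
proof -
  have t: "rp S \<in> carrier G" "S = rp S <#\<^bsub>G\<^esub> C" using rp_Cos[OF S] by auto
  have "h <#\<^bsub>G\<^esub> S = (h \<otimes> rp S) <#\<^bsub>G\<^esub> C"
    using h t(1) subgroup.subset[OF C] by (subst t(2)) (simp add: lcos_m_assoc)
  then have "eqm (int p) (fam (h <#\<^bsub>G\<^esub> S) (map (\<lambda>x. h \<otimes> x) xs)) (b (map (\<lambda>x. inv (h \<otimes> rp S) \<otimes> x) (map (\<lambda>x. h \<otimes> x) xs)))"
    using fam_eq[of "h \<otimes> rp S" "map (\<lambda>x. h \<otimes> x) xs"] h t xs map_translate[OF h xs(1)] by simp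
  also have "map (\<lambda>x. inv (h \<otimes> rp S) \<otimes> x) (map (\<lambda>x. h \<otimes> x) xs) = map (\<lambda>x. inv (rp S) \<otimes> x) xs"
  proof -
    have "inv (h \<otimes> rp S) \<otimes> h = inv (rp S)" using h t by (simp add: inv_mult_group m_assoc)
    then show ?thesis using h t xs by (simp only: map_translate_mult inv_closed m_closed)
  qed
  finally show ?thesis by (simp add: fam_def)
qed

lemma fam_coc: "S \<in> Cos \<Longrightarrow> cocyc p (Suc n) (fam S)"
  unfolding fam_def[abs_def] using rp_Cos by (intro cocyc_translate[OF b_coc]) auto

lemma fam_inv: "S \<in> Cos \<Longrightarrow> H \<subseteq> carrier G \<Longrightarrow> inv_on p {h\<in>H. h <#\<^bsub>G\<^esub> S = S} (Suc n) (fam S)"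
  unfolding inv_on_def
proof (intro ballI allI impI)
  fix h xs assume S: "S \<in> Cos" "H \<subseteq> carrier G" and h: "h \<in> {h\<in>H. h <#\<^bsub>G\<^esub> S = S}"
    and xs: "set xs \<subseteq> carrier G" "length xs = Suc n"
  have "h \<in> carrier G" "h <#\<^bsub>G\<^esub> S = S" using h S by auto
  then show "eqm (int p) (fam S (map (\<lambda>x. h \<otimes> x) xs)) (fam S xs)" using fam_act[of h S xs] S xs by simp
qed

definition trf :: "'a list \<Rightarrow> int" where "trf xs = (\<Sum>S\<in>Cos. fam S xs)"

lemma trf_inv: "inv_on p (carrier G) (Suc n) trf"
  unfolding inv_on_def
proof (intro ballI allI impI)
  fix h xs assume h: "h \<in> carrier G" and xs: "set xs \<subseteq> carrier G" "length xs = Suc n"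
  have "inv h <#\<^bsub>G\<^esub> (h <#\<^bsub>G\<^esub> S) = S" "h <#\<^bsub>G\<^esub> (inv h <#\<^bsub>G\<^esub> S) = S" if "S \<in> Cos" for S
    using act_mult[of "inv h" h S] act_mult[of h "inv h" S] act_one[OF that] h that by auto
  then have "bij_betw (\<lambda>S. h <#\<^bsub>G\<^esub> S) Cos Cos"
    using act_Cos h by (intro bij_betwI[of _ _ _ "\<lambda>S. inv h <#\<^bsub>G\<^esub> S"]) auto
  then have "trf (map (\<lambda>x. h \<otimes> x) xs) = (\<Sum>S\<in>Cos. fam (h <#\<^bsub>G\<^esub> S) (map (\<lambda>x. h \<otimes> x) xs))"
    unfolding trf_def by (rule sum.reindex_bij_betw[symmetric])
  also have "eqm (int p) \<dots> (trf xs)" unfolding trf_def by (intro eqm_sum fam_act h xs)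
  finally show "eqm (int p) (trf (map (\<lambda>x. h \<otimes> x) xs)) (trf xs)" .
qed

lemma trf_coc: "cocyc p (Suc n) trf"
  unfolding cocyc_def trf_def[abs_def] cobd_sum
proof (intro allI impI)
  fix xs assume "set xs \<subseteq> carrier G" "length xs = Suc (Suc n)"
  then have "eqm (int p) (\<Sum>S\<in>Cos. cobd (fam S) xs) (\<Sum>S\<in>Cos. 0)"
    by (intro eqm_sum cocycD[OF fam_coc])
  then show "eqm (int p) (\<Sum>S\<in>Cos. cobd (fam S) xs) 0" by simp
qed

text \<open>The stabilizer in E of the coset tC is conjugated by t into C, hence into V, where b is
  a coboundary. So \<open>orbit_sum_cobdry\<close> applies with zero remainders.\<close>

lemma trf_restrict_cobdry:
  assumes E: "subgroup E G" and V: "subgroup V G" "V \<subseteq> C" and bV: "cobdry p V n b"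
    and EV: "\<And>t e. t \<in> carrier G \<Longrightarrow> e \<in> E \<Longrightarrow> inv t \<otimes> e \<otimes> t \<in> C \<Longrightarrow> inv t \<otimes> e \<otimes> t \<in> V"
  shows "cobdry p E n trf"
proof -
  have EG: "e \<in> carrier G" if "e \<in> E" for e using subgroup.mem_carrier[OF E that] .
  obtain u where u: "inv_on p V n u" "\<And>xs. set xs \<subseteq> carrier G \<Longrightarrow> length xs = Suc n \<Longrightarrow> eqm (int p) (b xs) (cobd u xs)"
    using bV unfolding cobdry_def by blast
  define us where "us S xs = u (map (\<lambda>x. inv (rp S) \<otimes> x) xs)" for S xs
  obtain A where c: "cobdry p E n (\<lambda>xs. (\<Sum>S\<in>Cos. fam S xs) - (\<Sum>S\<in>Cos. A S xs))"
    and A: "\<And>S. S \<in> Cos \<Longrightarrow> \<exists>h\<in>E. \<exists>r\<in>Cos. A S = (\<lambda>xs. (0::int))"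
  proof (rule orbit_sum_cobdry[OF E Cos_fin, of "\<lambda>h S. h <#\<^bsub>G\<^esub> S" n p fam us "\<lambda>_ _. 0"])
    show "inv_on p {h \<in> E. h <#\<^bsub>G\<^esub> S = S} n (us S)" if S: "S \<in> Cos" for S
      unfolding inv_on_def
    proof (intro ballI allI impI)
      fix h xs assume h: "h \<in> {h \<in> E. h <#\<^bsub>G\<^esub> S = S}" and xs: "set xs \<subseteq> carrier G" "length xs = n"
      have t: "rp S \<in> carrier G" "S = rp S <#\<^bsub>G\<^esub> C" using rp_Cos[OF S] by auto
      have hG: "h \<in> carrier G" using h EG by simp
      have "(h \<otimes> rp S) <#\<^bsub>G\<^esub> C = rp S <#\<^bsub>G\<^esub> C"
      proof -
        have "(h \<otimes> rp S) <#\<^bsub>G\<^esub> C = h <#\<^bsub>G\<^esub> (rp S <#\<^bsub>G\<^esub> C)"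
          using hG t(1) subgroup.subset[OF C] by (simp add: lcos_m_assoc)
        also have "\<dots> = h <#\<^bsub>G\<^esub> S" by (simp only: t(2)[symmetric])
        also have "\<dots> = rp S <#\<^bsub>G\<^esub> C" using h t(2) by simp
        finally show ?thesis .
      qed
      then have "inv (rp S) \<otimes> (h \<otimes> rp S) \<in> C" using t hG lcos_eq_iff[of "rp S" "h \<otimes> rp S"] by simp
      then have k: "inv (rp S) \<otimes> h \<otimes> rp S \<in> V" using EV[of "rp S" h] t hG h by (simp add: m_assoc)
      have "inv (rp S) \<otimes> h \<otimes> rp S \<otimes> inv (rp S) = inv (rp S) \<otimes> h" using t hG by (simp add: m_assoc)
      then have "map (\<lambda>x. inv (rp S) \<otimes> x) (map (\<lambda>x. h \<otimes> x) xs)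
          = map (\<lambda>x. inv (rp S) \<otimes> h \<otimes> rp S \<otimes> x) (map (\<lambda>x. inv (rp S) \<otimes> x) xs)"
        using t hG xs by (simp only: map_translate_mult inv_closed m_closed)
      then have "us S (map (\<lambda>x. h \<otimes> x) xs) = u (map (\<lambda>x. inv (rp S) \<otimes> h \<otimes> rp S \<otimes> x) (map (\<lambda>x. inv (rp S) \<otimes> x) xs))"
        unfolding us_def by (simp only:)
      also have "eqm (int p) \<dots> (us S xs)" unfolding us_def
        using xs t by (intro inv_onD[OF u(1) k] map_translate) auto
      finally show "eqm (int p) (us S (map (\<lambda>x. h \<otimes> x) xs)) (us S xs)" .
    qed
    show "eqm (int p) (fam S xs) (cobd (us S) xs + 0)"
      if "S \<in> Cos" "set xs \<subseteq> carrier G" "length xs = Suc n" for S xs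
      unfolding us_def[abs_def] cobd_map fam_def using that rp_Cos[OF that(1)] map_translate
      by (simp del: map_map) (intro u(2); auto)
  qed (use EG act_Cos act_one act_mult fam_act in \<open>auto simp: inv_on_def\<close>)
  have "A S xs = 0" if "S \<in> Cos" for S xs using A[OF that] by auto
  then have "(\<Sum>S\<in>Cos. A S xs) = 0" for xs by (simp add: sum.neutral)
  then have "trf = (\<lambda>xs. (\<Sum>S\<in>Cos. fam S xs) - (\<Sum>S\<in>Cos. A S xs))"
    unfolding trf_def[abs_def] by simp
  with c show ?thesis by (simp only:)
qed

text \<open>Since v moves s, it lies outside the stabilizer of s in C, and
  \<open>commuting_retraction\<close> replaces \<open>fam s\<close> by a cohomologous cochain that
  ignores translation by v.\<close>

lemma moved_cobdry:
  assumes v: "v \<in> C" "v [^] p = \<one>" "\<And>c. c \<in> C \<Longrightarrow> v \<otimes> c = c \<otimes> v"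
    and S: "S \<subseteq> Cos" "\<And>h s. h \<in> C \<Longrightarrow> s \<in> S \<Longrightarrow> h <#\<^bsub>G\<^esub> s \<in> S" and moved: "\<And>s. s \<in> S \<Longrightarrow> v <#\<^bsub>G\<^esub> s \<noteq> s"
  shows "cobdry p C n (\<lambda>xs. \<Sum>s\<in>S. fam s xs)"
proof -
  let ?D = "\<lambda>s. {h\<in>C. h <#\<^bsub>G\<^esub> s = s}"
  have finS: "finite S" using S(1) Cos_fin finite_subset by blast
  have vG: "v \<in> carrier G" using v CG by blast
  have D: "subgroup (?D s) G" if s: "s \<in> S" for s
  proof (rule subgroupI)
    show "?D s \<subseteq> carrier G" using CG by blast
    have "\<one> \<in> ?D s" using subgroup.one_closed[OF C] act_one[of s] S(1) s by auto
    then show "?D s \<noteq> {}" by blast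
    fix a assume a: "a \<in> ?D s"
    have "inv a <#\<^bsub>G\<^esub> (a <#\<^bsub>G\<^esub> s) = s"
      using act_mult[of "inv a" a s] act_one[of s] a CG S(1) s by auto
    then show "inv a \<in> ?D s" using a subgroup.m_inv_closed[OF C] by auto
    fix c assume c: "c \<in> ?D s"
    show "a \<otimes> c \<in> ?D s" using a c act_mult[of a c s] CG S(1) s subgroup.m_closed[OF C] by auto
  qed
  define good where "good s \<phi> \<longleftrightarrow> (\<forall>x\<in>carrier G. \<phi> x \<in> carrier G) \<and>
      (\<forall>d\<in>?D s. \<forall>x\<in>carrier G. \<phi> (d \<otimes> x) = d \<otimes> \<phi> x) \<and> (\<forall>x\<in>carrier G. \<phi> (v \<otimes> x) = \<phi> x)" for s \<phi>
  have "\<exists>\<phi>. good s \<phi>" if s: "s \<in> S" for s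
  proof -
    have nd: "v \<notin> ?D s" using moved[OF s] by simp
    have cm: "v \<otimes> d = d \<otimes> v" if "d \<in> ?D s" for d using v(3) that by blast
    show ?thesis
    proof (rule commuting_retraction[OF prime D[OF s] vG v(2) nd cm])
      fix \<phi> assume "\<And>x. x \<in> carrier G \<Longrightarrow> \<phi> x \<in> carrier G"
        "\<And>d x. d \<in> ?D s \<Longrightarrow> x \<in> carrier G \<Longrightarrow> \<phi> (d \<otimes> x) = d \<otimes> \<phi> x"
        "\<And>x. x \<in> carrier G \<Longrightarrow> \<phi> (v \<otimes> x) = \<phi> x"
      then show ?thesis unfolding good_def by (intro exI[of _ \<phi>] conjI ballI)
    qed
  qed
  then obtain \<phi> where good: "\<And>s. s \<in> S \<Longrightarrow> good s (\<phi> s)" by metis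
  have \<phi>: "\<And>s x. s \<in> S \<Longrightarrow> x \<in> carrier G \<Longrightarrow> \<phi> s x \<in> carrier G"
    "\<And>s d x. s \<in> S \<Longrightarrow> d \<in> ?D s \<Longrightarrow> x \<in> carrier G \<Longrightarrow> \<phi> s (d \<otimes> x) = d \<otimes> \<phi> s x"
    "\<And>s x. s \<in> S \<Longrightarrow> x \<in> carrier G \<Longrightarrow> \<phi> s (v \<otimes> x) = \<phi> s x"
    using good unfolding good_def by blast+
  define a where "a s xs = fam s (map (\<phi> s) xs)" for s xs
  have SC: "s \<in> Cos" if "s \<in> S" for s using S(1) that by blast
  have rc: "cobdry p (?D s) n (\<lambda>xs. fam s (map (\<phi> s) xs) - fam s xs)" if s: "s \<in> S" for s
  proof -
    have "C \<subseteq> carrier G" using CG by blast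
    note i = fam_inv[OF SC[OF s] this]
    show ?thesis by (rule cobdry_retract[OF \<phi>(1)[OF s] \<phi>(2)[OF s] i fam_coc[OF SC[OF s]]]) (use CG in auto)
  qed
  define wit where "wit s w \<longleftrightarrow> inv_on p (?D s) n w \<and> (\<forall>xs. set xs \<subseteq> carrier G \<longrightarrow> length xs = Suc n \<longrightarrow>
      eqm (int p) (fam s (map (\<phi> s) xs) - fam s xs) (cobd w xs))" for s w
  have "\<exists>w. wit s w" if "s \<in> S" for s using rc[OF that] unfolding cobdry_def wit_def by blast
  then obtain w where wit: "\<And>s. s \<in> S \<Longrightarrow> wit s (w s)" by metis
  have w: "\<And>s. s \<in> S \<Longrightarrow> inv_on p (?D s) n (w s)"
    "\<And>s xs. s \<in> S \<Longrightarrow> set xs \<subseteq> carrier G \<Longrightarrow> length xs = Suc n \<Longrightarrow>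
      eqm (int p) (fam s (map (\<phi> s) xs) - fam s xs) (cobd (w s) xs)"
    using wit unfolding wit_def by blast+
  have a_inv: "inv_on p (?D s) (Suc n) (a s)" if s: "s \<in> S" for s
    unfolding inv_on_def
  proof (intro ballI allI impI)
    fix h xs assume h: "h \<in> ?D s" and xs: "set xs \<subseteq> carrier G" "length xs = Suc n"
    have "map (\<phi> s) (map (\<lambda>x. h \<otimes> x) xs) = map (\<lambda>x. h \<otimes> x) (map (\<phi> s) xs)"
      using \<phi>(2)[OF s h] xs by auto
    then have "a s (map (\<lambda>x. h \<otimes> x) xs) = fam s (map (\<lambda>x. h \<otimes> x) (map (\<phi> s) xs))"
      unfolding a_def by (simp only:)
    also have "eqm (int p) \<dots> (a s xs)" unfolding a_def
      using \<phi>(1)[OF s] xs CG by (intro inv_onD[OF fam_inv[OF SC[OF s], of C] h]) auto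
    finally show "eqm (int p) (a s (map (\<lambda>x. h \<otimes> x) xs)) (a s xs)" .
  qed
  obtain A where A: "cobdry p C n (\<lambda>xs. (\<Sum>s\<in>S. fam s xs) - (\<Sum>s\<in>S. A s xs))"
    "\<And>h s xs. h \<in> C \<Longrightarrow> s \<in> S \<Longrightarrow> set xs \<subseteq> carrier G \<Longrightarrow> length xs = Suc n \<Longrightarrow>
      eqm (int p) (A (h <#\<^bsub>G\<^esub> s) (map (\<lambda>x. h \<otimes> x) xs)) (A s xs)"
    "\<And>s. s \<in> S \<Longrightarrow> \<exists>h\<in>C. \<exists>r\<in>S. A s = (\<lambda>xs. a r (map (\<lambda>x. inv h \<otimes> x) xs))"
  proof (rule orbit_sum_cobdry[OF C finS, of "\<lambda>h S. h <#\<^bsub>G\<^esub> S" n p fam "\<lambda>s xs. - w s xs" a])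
    show "inv_on p (?D s) n (\<lambda>xs. - w s xs)" if "s \<in> S" for s
      using w(1)[OF that] unfolding inv_on_def by (auto intro: eqm_minus)
    show "eqm (int p) (fam s xs) (cobd (\<lambda>xs. - w s xs) xs + a s xs)"
      if "s \<in> S" "set xs \<subseteq> carrier G" "length xs = Suc n" for s xs
      using eqm_sym[OF w(2)[OF that]] unfolding a_def cobd_minus eqm_def
      by (metis (no_types, lifting) add.commute diff_diff_eq2 diff_minus_eq_add minus_diff_eq dvd_minus_iff)
  qed (use S act_one act_mult fam_act CG SC a_inv in \<open>auto simp: subset_iff\<close>)
  \<comment> \<open>As the remainders ignore translation by v, their equivariance says that A takes
    the same value on s and on its translate by v. The orbits of v are free, so the sum vanishes
    modulo p.\<close>
  have "eqm (int p) (\<Sum>s\<in>S. A s xs) 0" if xs: "set xs \<subseteq> carrier G" "length xs = Suc n" for xs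
  proof (rule sum_free_orbits[OF prime finS, of "\<lambda>s. v <#\<^bsub>G\<^esub> s"])
    show "v <#\<^bsub>G\<^esub> s \<in> S" "v <#\<^bsub>G\<^esub> s \<noteq> s" if "s \<in> S" for s using S(2)[OF v(1) that] moved[OF that] by auto
    show "((\<lambda>s. v <#\<^bsub>G\<^esub> s) ^^ p) s = s" if s: "s \<in> S" for s
    proof -
      have "((\<lambda>s. v <#\<^bsub>G\<^esub> s) ^^ j) s = v [^] j <#\<^bsub>G\<^esub> s" for j
      proof (induction j)
        case 0
        then show ?case using act_one[OF SC[OF s]] by simp
      next
        case (Suc j)
        have "v [^] Suc j = v \<otimes> v [^] j" using nat_pow_Suc2[OF vG] .
        then show ?case using Suc act_mult[of v "v [^] j" s] vG SC[OF s] by simp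
      qed
      then show ?thesis using v(2) act_one[OF SC[OF s]] by simp
    qed
    show "eqm (int p) (A (v <#\<^bsub>G\<^esub> s) xs) (A s xs)" if s: "s \<in> S" for s
    proof -
      have vs: "v <#\<^bsub>G\<^esub> s \<in> S" using S(2)[OF v(1) s] .
      obtain h r where h: "h \<in> C" "r \<in> S" "A (v <#\<^bsub>G\<^esub> s) = (\<lambda>xs. a r (map (\<lambda>x. inv h \<otimes> x) xs))"
        using A(3)[OF vs] by blast
      have hG: "inv h \<in> carrier G" using CG h by simp
      have "inv h \<otimes> v = v \<otimes> inv h" using v(3)[OF subgroup.m_inv_closed[OF C h(1)]] by simp
      then have e: "map (\<lambda>x. inv h \<otimes> x) (map (\<lambda>x. v \<otimes> x) xs) = map (\<lambda>x. v \<otimes> x) (map (\<lambda>x. inv h \<otimes> x) xs)"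
        using hG vG xs by (simp only: map_translate_mult)
      have "map (\<phi> r) (map (\<lambda>x. v \<otimes> x) ys) = map (\<phi> r) ys" if "set ys \<subseteq> carrier G" for ys
        using \<phi>(3)[OF h(2)] that by auto
      then have "a r (map (\<lambda>x. v \<otimes> x) (map (\<lambda>x. inv h \<otimes> x) xs)) = a r (map (\<lambda>x. inv h \<otimes> x) xs)"
        unfolding a_def using map_translate[OF hG xs(1)] by (simp only:)
      then have "A (v <#\<^bsub>G\<^esub> s) (map (\<lambda>x. v \<otimes> x) xs) = A (v <#\<^bsub>G\<^esub> s) xs" unfolding h(3) by (simp only: e)
      then show ?thesis using A(2)[OF v(1) s xs] by simp
    qed
  qed
  then show ?thesis
    by (intro cobdry_cong[OF A(1)]) (auto simp: eqm_def)
qed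

text \<open>Each moved coset is counted at the first element of V that moves it. The resulting
  classes \<open>?T\<close> are stable under C because V is central in C.\<close>

lemma moved_part_cobdry:
  assumes V: "finite V" "V \<subseteq> C" "\<And>v. v \<in> V \<Longrightarrow> v [^] p = \<one>" "\<And>v c. v \<in> V \<Longrightarrow> c \<in> C \<Longrightarrow> v \<otimes> c = c \<otimes> v"
  shows "cobdry p C n (\<lambda>xs. \<Sum>s\<in>{s\<in>Cos. \<exists>v\<in>V. v <#\<^bsub>G\<^esub> s \<noteq> s}. fam s xs)"
  using V
proof (induction V)
  case empty
  have "inv_on p C n (\<lambda>_. 0)" by (auto simp: inv_on_def)
  then show ?case unfolding cobdry_def by (intro exI[of _ "\<lambda>_. 0"]) (auto simp: cobd_zero)
next
  case (insert v V)
  let ?S = "{s\<in>Cos. \<exists>v\<in>V. v <#\<^bsub>G\<^esub> s \<noteq> s}" and ?T = "{s\<in>Cos. (\<forall>v\<in>V. v <#\<^bsub>G\<^esub> s = s) \<and> v <#\<^bsub>G\<^esub> s \<noteq> s}"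
  have "cobdry p C n (\<lambda>xs. \<Sum>s\<in>?T. fam s xs)"
  proof (rule moved_cobdry[of v])
    fix h s assume h: "h \<in> C" and s: "s \<in> ?T"
    have c: "u <#\<^bsub>G\<^esub> (h <#\<^bsub>G\<^esub> s) = h <#\<^bsub>G\<^esub> (u <#\<^bsub>G\<^esub> s)" if "u \<in> Set.insert v V" for u
    proof -
      have "u \<in> C" "u \<otimes> h = h \<otimes> u" using insert.prems that h by auto
      then show ?thesis using act_mult[of u h s] act_mult[of h u s] CG h s by auto
    qed
    have hG: "h \<in> carrier G" and vG: "v \<in> carrier G" and sC: "s \<in> Cos"
      using CG h insert.prems s by auto
    have il: "inv h <#\<^bsub>G\<^esub> (h <#\<^bsub>G\<^esub> t) = t" if "t \<in> Cos" for t
      using act_mult[of "inv h" h t] act_one[OF that] hG that by simp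
    have "v <#\<^bsub>G\<^esub> (h <#\<^bsub>G\<^esub> s) \<noteq> h <#\<^bsub>G\<^esub> s"
    proof
      assume "v <#\<^bsub>G\<^esub> (h <#\<^bsub>G\<^esub> s) = h <#\<^bsub>G\<^esub> s"
      then have "h <#\<^bsub>G\<^esub> (v <#\<^bsub>G\<^esub> s) = h <#\<^bsub>G\<^esub> s" using c[of v] by simp
      then have "v <#\<^bsub>G\<^esub> s = s" using il[OF sC] il[OF act_Cos[OF vG sC]] by metis
      then show False using s by simp
    qed
    moreover have "u <#\<^bsub>G\<^esub> (h <#\<^bsub>G\<^esub> s) = h <#\<^bsub>G\<^esub> s" if "u \<in> V" for u
      using c[of u] s that by simp
    ultimately show "h <#\<^bsub>G\<^esub> s \<in> ?T" using act_Cos[OF hG sC] by blast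
  qed (use insert.prems in \<open>blast+\<close>)
  moreover have "cobdry p C n (\<lambda>xs. \<Sum>s\<in>?S. fam s xs)"
    by (rule insert.IH; use insert.prems in blast)
  ultimately have 1: "cobdry p C n (\<lambda>xs. (\<Sum>s\<in>?S. fam s xs) + (\<Sum>s\<in>?T. fam s xs))"
    by (rule cobdry_add[rotated])
  have "?S \<inter> ?T = {}" by blast
  then have "(\<Sum>s\<in>?S \<union> ?T. fam s xs) = (\<Sum>s\<in>?S. fam s xs) + (\<Sum>s\<in>?T. fam s xs)" for xs
    using Cos_fin by (intro sum.union_disjoint) simp_all
  moreover have "?S \<union> ?T = {s\<in>Cos. \<exists>u\<in>Set.insert v V. u <#\<^bsub>G\<^esub> s \<noteq> s}" by blast
  ultimately show ?case using 1 by simp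
qed

end

section \<open>Characters and Euler classes of a finite p-group\<close>

context group
begin

lemma pow_order: "finite (carrier G) \<Longrightarrow> v \<in> carrier G \<Longrightarrow> v [^] Coset.order G = \<one>"
  using pow_order_eq_1 by simp

lemma rcos_pow_eqD:
  assumes D: "subgroup D G" and g: "g \<in> carrier G" and h: "h \<in> carrier G" and ij: "i \<le> j"
    and e: "D #> (g \<otimes> h [^] (i::nat)) = D #> (g \<otimes> h [^] j)"
  shows "(g \<otimes> h \<otimes> inv g) [^] (j - i) \<in> D"
proof -
  have p: "(g \<otimes> h \<otimes> inv g) [^] k = g \<otimes> h [^] k \<otimes> inv g" for k :: nat
  proof (induction k)
    case (Suc k)
    have "(g \<otimes> h \<otimes> inv g) [^] Suc k = (g \<otimes> h [^] k \<otimes> inv g) \<otimes> (g \<otimes> h \<otimes> inv g)"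
      using Suc by simp
    also have "\<dots> = g \<otimes> h [^] k \<otimes> (inv g \<otimes> g) \<otimes> (h \<otimes> inv g)"
      using g h by (simp only: m_assoc m_closed inv_closed nat_pow_closed)
    also have "\<dots> = g \<otimes> h [^] Suc k \<otimes> inv g" using g h by (simp add: m_assoc)
    finally show ?case .
  qed (use g in simp)
  have "g \<otimes> h [^] j \<in> D #> (g \<otimes> h [^] i)" unfolding e using g h by (intro rcos_self D) auto
  then obtain d where d: "d \<in> D" "g \<otimes> h [^] j = d \<otimes> (g \<otimes> h [^] i)" by (auto simp: r_coset_def)
  have dG: "d \<in> carrier G" using subgroup.mem_carrier[OF D d(1)] .
  have "h [^] j = h [^] (j - i) \<otimes> h [^] i" using h ij by (simp add: nat_pow_mult)
  then have "(g \<otimes> h [^] (j - i)) \<otimes> h [^] i = (d \<otimes> g) \<otimes> h [^] i" using d(2) g h dG by (simp add: m_assoc)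
  then have "g \<otimes> h [^] (j - i) = d \<otimes> g" using g h dG by simp
  then have "g \<otimes> h [^] (j - i) \<otimes> inv g = d" using g dG by (simp add: m_assoc)
  then show ?thesis using p d(1) by simp
qed

lemma coprime_less_prime_power:
  fixes p :: nat
  shows "Factorial_Ring.prime p \<Longrightarrow> 0 < k \<Longrightarrow> k < p \<Longrightarrow> coprime k (p ^ m)"
  by (metis coprime_commute coprime_power_right_iff nat_dvd_not_less prime_imp_coprime)

text \<open>If a conjugate of h by g left M, then M and the cosets M g h^i for i < p would be p + 1
  distinct cosets.\<close>

lemma index_p_normal:
  assumes fin: "finite (carrier G)" and p: "Factorial_Ring.prime p" and order: "Coset.order G = p ^ n"
    and M: "subgroup M G" "card (rcosets M) = p"
  shows "M \<lhd> G"
proof -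
  have "g \<otimes> h \<otimes> inv g \<in> M" if g: "g \<in> carrier G" and h: "h \<in> M" for g h
  proof (rule ccontr)
    assume nin: "g \<otimes> h \<otimes> inv g \<notin> M"
    have hG: "h \<in> carrier G" using subgroup.mem_carrier[OF M(1) h] .
    have gM: "g \<notin> M" using nin h M(1) by (meson subgroup.m_closed subgroup.m_inv_closed)
    let ?f = "\<lambda>i. M #> (g \<otimes> h [^] (i::nat))"
    have neq: "?f i \<noteq> ?f j" if ij: "i < j" "j < p" for i j
    proof
      assume "?f i = ?f j"
      then have "(g \<otimes> h \<otimes> inv g) [^] (j - i) \<in> M" using ij by (intro rcos_pow_eqD[OF M(1) g hG]) auto
      moreover have "(g \<otimes> h \<otimes> inv g) [^] (p ^ n) \<in> M"
        using pow_order[OF fin, of "g \<otimes> h \<otimes> inv g"] g hG subgroup.one_closed[OF M(1)] order by simp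
      moreover have "coprime (j - i) (p ^ n)" using ij by (intro coprime_less_prime_power p) auto
      ultimately have "g \<otimes> h \<otimes> inv g \<in> M" using g hG coprime_pow_mem[OF M(1), of "g \<otimes> h \<otimes> inv g" "j - i" "p ^ n"] by simp
      then show False using nin by simp
    qed
    have "inj_on ?f {..<p}"
    proof (rule inj_onI)
      fix i j assume "i \<in> {..<p}" "j \<in> {..<p}" "?f i = ?f j"
      then show "i = j" using neq[of i j] neq[of j i] by (cases i j rule: linorder_cases) auto
    qed
    moreover have "M \<notin> ?f ` {..<p}"
    proof
      assume "M \<in> ?f ` {..<p}"
      then obtain i :: nat where "M = M #> (g \<otimes> h [^] i)" by auto
      moreover have "g \<otimes> h [^] i \<in> M #> (g \<otimes> h [^] i)" using g hG by (intro rcos_self M) auto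
      ultimately have a: "g \<otimes> h [^] i \<in> M" by simp
      have "g = (g \<otimes> h [^] i) \<otimes> inv (h [^] i)" using g hG by (simp add: m_assoc)
      then have "g \<in> M" using subgroup_pow[OF M(1) h] a M(1) by (metis subgroup.m_closed subgroup.m_inv_closed)
      then show False using gM by simp
    qed
    ultimately have c: "card (Set.insert M (?f ` {..<p})) = Suc p" by (simp add: card_image)
    have MG: "M \<subseteq> carrier G" using subgroup.subset[OF M(1)] .
    have "M #> \<one> \<in> rcosets M" using rcosetsI[OF MG one_closed] .
    then have Mr: "M \<in> rcosets M" by (simp only: coset_mult_one[OF MG])
    have "?f i \<in> rcosets M" for i using rcosetsI[OF MG, of "g \<otimes> h [^] i"] g hG by simp
    then have sub: "Set.insert M (?f ` {..<p}) \<subseteq> rcosets M" using Mr by blast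
    have "finite (rcosets M)" using M(2) prime_gt_0_nat[OF p] by (intro card_ge_0_finite) simp
    then show False using card_mono[OF _ sub] M(2) c by simp
  qed
  then show ?thesis using M(1) normal_inv_iff by blast
qed

text \<open>A subgroup of order p^n exists by Sylow's theorem and is normal of index p; X reads off
  the exponent of a generator of the quotient.\<close>

lemma p_group_character:
  assumes fin: "finite (carrier G)" and p: "Factorial_Ring.prime p" and order: "Coset.order G = p ^ Suc n"
  obtains X :: "'a \<Rightarrow> int" and c where "\<And>g h. g \<in> carrier G \<Longrightarrow> h \<in> carrier G \<Longrightarrow> eqm (int p) (X (g \<otimes> h)) (X g + X h)"
    and "c \<in> carrier G" "\<not> int p dvd X c"
proof -
  have p0: "p > 0" using prime_gt_0_nat[OF p] .
  obtain M where M: "subgroup M G" "card M = p ^ n"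
    using sylow_thm[OF p is_group, of n p] order fin by (auto simp: mult.commute)
  have "card (rcosets M) * p ^ n = p * p ^ n"
    using lagrange[OF M(1)] M(2) order by simp
  then have index: "card (rcosets M) = p" using p0 by simp
  interpret M: normal M G by (rule index_p_normal[OF fin p order M(1) index])
  have MG: "M \<subseteq> carrier G" using subgroup.subset[OF M(1)] .
  have "M \<noteq> carrier G"
    using M(2) order p0 prime_gt_1_nat[OF p] by (auto simp: Coset.order_def)
  then obtain c where c: "c \<in> carrier G" "c \<notin> M" using MG by blast
  let ?f = "\<lambda>i::nat. M #> c [^] i"
  have D: "p dvd j - i" if "?f i = ?f j" "i \<le> j" for i j
  proof (rule ccontr)
    assume nd: "\<not> p dvd j - i"
    have "(\<one> \<otimes> c \<otimes> inv \<one>) [^] (j - i) \<in> M" using that c by (intro rcos_pow_eqD[OF M(1)]) auto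
    then have "c [^] (j - i) \<in> M" using c by simp
    moreover have "c [^] (p ^ Suc n) \<in> M"
      using pow_order[OF fin, of c] c subgroup.one_closed[OF M(1)] order by simp
    moreover have "coprime (j - i) (p ^ Suc n)"
      using nd p by (metis coprime_commute coprime_power_right_iff prime_imp_coprime)
    ultimately show False using coprime_pow_mem[OF M(1), of c "j - i" "p ^ Suc n"] c by auto
  qed
  have E: "eqm (int p) (int i) (int j)" if "?f i = ?f j" for i j
  proof (cases "i \<le> j")
    case True
    have "int p dvd int j - int i" unfolding of_nat_diff[OF True, symmetric] using D[OF that True] by simp
    then show ?thesis unfolding eqm_def by (simp add: dvd_diff_commute)
  next
    case False
    then have ji: "j \<le> i" by simp
    show ?thesis unfolding eqm_def of_nat_diff[OF ji, symmetric] using D[OF that[symmetric] ji] by simp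
  qed
  have "inj_on ?f {..<p}"
  proof (rule inj_onI)
    fix i j assume ij: "i \<in> {..<p}" "j \<in> {..<p}" "?f i = ?f j"
    show "i = j"
    proof (cases i j rule: linorder_cases)
      case less
      then have "p dvd j - i" "0 < j - i" "j - i < p" using D[of i j] ij by auto
      then show ?thesis using nat_dvd_not_less by blast
    next
      case greater
      then have "p dvd i - j" "0 < i - j" "i - j < p" using D[of j i] ij by auto
      then show ?thesis using nat_dvd_not_less by blast
    qed
  qed
  moreover have "?f ` {..<p} \<subseteq> rcosets M" using c rcosetsI[OF MG] by auto
  moreover have finR: "finite (rcosets M)" using index p0 by (intro card_ge_0_finite) simp
  ultimately have "?f ` {..<p} = rcosets M" using index by (intro card_subset_eq) (auto simp: card_image)
  then have "\<exists>i. M #> g = ?f i" if "g \<in> carrier G" for g using rcosetsI[OF MG that] by auto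
  then obtain X where X: "\<And>g. g \<in> carrier G \<Longrightarrow> M #> g = ?f (X g)" by metis
  show thesis
  proof (rule that[of "\<lambda>g. int (X g)" c])
    fix g h assume g: "g \<in> carrier G" "h \<in> carrier G"
    have "?f (X (g \<otimes> h)) = M #> (g \<otimes> h)" using X[symmetric] g by simp
    also have "\<dots> = (M #> g) <#> (M #> h)" using g by (simp add: M.rcos_sum)
    also have "\<dots> = ?f (X g) <#> ?f (X h)" by (simp only: X[OF g(1)] X[OF g(2)])
    also have "\<dots> = ?f (X g + X h)" using c by (simp add: M.rcos_sum nat_pow_mult)
    finally show "eqm (int p) (int (X (g \<otimes> h))) (int (X g) + int (X h))" using E[of "X (g \<otimes> h)" "X g + X h"] by simp
  next
    have "?f (X c) = M #> c" using X[OF c(1)] by (rule sym)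
    then have "?f (X c) = ?f 1" using c by simp
    then have "eqm (int p) (int (X c)) (int 1)" by (rule E)
    moreover have "\<not> int p dvd 1" using prime_gt_1_nat[OF p] by simp
    ultimately show "\<not> int p dvd int (X c)"
      unfolding eqm_def by (metis dvd_diff_right_iff of_nat_1)
  qed (use c in auto)
qed

lemma powers_subgroup:
  assumes U: "subgroup U G" and b: "b \<in> carrier G" "b [^] (p::nat) \<in> U" "p > 0"
    and comm: "\<And>u. u \<in> U \<Longrightarrow> u \<otimes> b = b \<otimes> u"
  shows "subgroup {u \<otimes> b [^] i |u i::nat. u \<in> U} G"
proof -
  have UG: "u \<in> carrier G" if "u \<in> U" for u using subgroup.mem_carrier[OF U that] .
  have cm: "b [^] i \<otimes> u = u \<otimes> b [^] i" if "u \<in> U" for u and i :: nat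
  proof (induction i)
    case (Suc i)
    have "b [^] Suc i \<otimes> u = b [^] i \<otimes> (u \<otimes> b)" using comm[OF that] UG[OF that] b(1) by (simp add: m_assoc)
    also have "\<dots> = u \<otimes> b [^] Suc i" using Suc UG[OF that] b(1) by (simp add: m_assoc[symmetric])
    finally show ?case .
  qed (use UG[OF that] in simp)
  show ?thesis
  proof (rule subgroupI)
    show "{u \<otimes> b [^] i |u i::nat. u \<in> U} \<subseteq> carrier G" using UG b by auto
    show "{u \<otimes> b [^] i |u i::nat. u \<in> U} \<noteq> {}" using subgroup.one_closed[OF U] by blast
  next
    fix x assume "x \<in> {u \<otimes> b [^] i |u i::nat. u \<in> U}"
    then obtain u and i :: nat where u: "u \<in> U" "x = u \<otimes> b [^] i" by blast
    let ?y = "(inv u \<otimes> inv ((b [^] p) [^] i)) \<otimes> b [^] ((p - 1) * i)"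
    have yU: "inv u \<otimes> inv ((b [^] p) [^] i) \<in> U"
      using u U subgroup_pow[OF U b(2)] by (meson subgroup.m_closed subgroup.m_inv_closed)
    have "(p - 1) * i + i = p * i" using b(3) by (cases p) (auto simp: algebra_simps)
    then have e: "b [^] ((p - 1) * i) \<otimes> b [^] i = (b [^] p) [^] i" using b(1) by (simp add: nat_pow_mult nat_pow_pow)
    have "?y \<otimes> x = inv u \<otimes> inv ((b [^] p) [^] i) \<otimes> (b [^] ((p - 1) * i) \<otimes> b [^] i) \<otimes> u"
      unfolding u(2) using cm[OF u(1), of i] UG[OF u(1)] b(1) by (simp add: m_assoc)
    also have "\<dots> = \<one>" unfolding e using UG[OF u(1)] b(1) by (simp add: m_assoc)
    finally have "inv x = ?y" using UG[OF u(1)] b(1) u(2) by (intro inv_equality) auto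
    then show "inv x \<in> {u \<otimes> b [^] i |u i::nat. u \<in> U}" using yU by blast
  next
    fix x y assume "x \<in> {u \<otimes> b [^] i |u i::nat. u \<in> U}" "y \<in> {u \<otimes> b [^] i |u i::nat. u \<in> U}"
    then obtain u w and i j :: nat where u: "u \<in> U" "x = u \<otimes> b [^] i" and w: "w \<in> U" "y = w \<otimes> b [^] j" by blast
    have "x \<otimes> y = u \<otimes> (b [^] i \<otimes> w) \<otimes> b [^] j" unfolding u w using u(1) w(1) UG b(1) by (simp add: m_assoc)
    also have "\<dots> = (u \<otimes> w) \<otimes> b [^] (i + j)" unfolding cm[OF w(1)] using u(1) w(1) UG b(1) by (simp add: m_assoc nat_pow_mult)
    finally show "x \<otimes> y \<in> {u \<otimes> b [^] i |u i::nat. u \<in> U}" using subgroup.m_closed[OF U u(1) w(1)] by blast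
  qed
qed

text \<open>U is maximal among the subgroups of V that contain a but not b. For v outside U,
  maximality gives b = u v^j with j prime to p, which can be solved for v.\<close>

lemma separating_subgroup:
  fixes p :: nat
  assumes fin: "finite (carrier G)" and p: "Factorial_Ring.prime p" and V: "subgroup V G"
    and Vc: "\<And>v w. v \<in> V \<Longrightarrow> w \<in> V \<Longrightarrow> v \<otimes> w = w \<otimes> v" and Vp: "\<And>v. v \<in> V \<Longrightarrow> v [^] p = \<one>"
    and a: "a \<in> V" and b: "b \<in> V" "\<And>j::nat. b \<noteq> a [^] j"
  obtains U where "subgroup U G" "U \<subseteq> V" "a \<in> U" "b \<notin> U" "\<And>v. v \<in> V \<Longrightarrow> \<exists>i<p. \<exists>u\<in>U. v = u \<otimes> b [^] i"
proof -
  have p0: "p > 0" using prime_gt_0_nat[OF p] .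
  have VG: "v \<in> carrier G" if "v \<in> V" for v using subgroup.mem_carrier[OF V that] .
  define \<U> where "\<U> = {U. subgroup U G \<and> U \<subseteq> V \<and> a \<in> U \<and> b \<notin> U}"
  have ext: "subgroup {u \<otimes> w [^] i |u i::nat. u \<in> U} G \<and> {u \<otimes> w [^] i |u i::nat. u \<in> U} \<subseteq> V \<and>
      U \<subseteq> {u \<otimes> w [^] i |u i::nat. u \<in> U} \<and> w \<in> {u \<otimes> w [^] i |u i::nat. u \<in> U}"
    if U: "subgroup U G" "U \<subseteq> V" and w: "w \<in> V" for U w
  proof (intro conjI subsetI)
    show "subgroup {u \<otimes> w [^] i |u i::nat. u \<in> U} G"
      using U w VG Vc Vp p0 subgroup.one_closed by (intro powers_subgroup[of U w p]) auto
    fix x assume "x \<in> {u \<otimes> w [^] i |u i::nat. u \<in> U}"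
    then show "x \<in> V" using U w subgroup_pow[OF V] subgroup.m_closed[OF V] by auto
  next
    fix x assume x: "x \<in> U"
    then have "x = x \<otimes> w [^] (0::nat)" using U VG by auto
    then show "x \<in> {u \<otimes> w [^] i |u i::nat. u \<in> U}" using x by blast
  next
    have "w = \<one> \<otimes> w [^] (1::nat)" using w VG by simp
    then show "w \<in> {u \<otimes> w [^] i |u i::nat. u \<in> U}" using subgroup.one_closed[OF U(1)] by blast
  qed
  have one: "subgroup {\<one>} G" by (rule triv_subgroup)
  have "{\<one> \<otimes> a [^] i |i::nat. True} = {u \<otimes> a [^] i |u i::nat. u \<in> {\<one>}}" by auto
  moreover have "b \<notin> {u \<otimes> a [^] i |u i::nat. u \<in> {\<one>}}" using b(2) VG[OF a] by auto
  ultimately have "{u \<otimes> a [^] i |u i::nat. u \<in> {\<one>}} \<in> \<U>"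
    using ext[OF one _ a] subgroup.one_closed[OF V] unfolding \<U>_def by blast
  moreover have "finite \<U>"
    using finite_subset[OF _ finite_Pow_iff[THEN iffD2, OF fin], of \<U>] VG unfolding \<U>_def by blast
  ultimately obtain U where U: "U \<in> \<U>" "\<And>W. W \<in> \<U> \<Longrightarrow> U \<subseteq> W \<Longrightarrow> W = U"
    using finite_has_maximal[of \<U>] by blast
  have U1: "subgroup U G" "U \<subseteq> V" "a \<in> U" "b \<notin> U" using U(1) unfolding \<U>_def by auto
  have "\<exists>i<p. \<exists>u\<in>U. v = u \<otimes> b [^] i" if v: "v \<in> V" for v
  proof -
    let ?D = "{u \<otimes> b [^] i |u i::nat. u \<in> U}"
    note D = ext[OF U1(1,2) b(1)]
    have "v \<in> ?D"
    proof (cases "v \<in> U")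
      case True
      then show ?thesis using D by blast
    next
      case False
      let ?W = "{u \<otimes> v [^] i |u i::nat. u \<in> U}"
      note W = ext[OF U1(1,2) v]
      have "b \<in> ?W"
      proof (rule ccontr)
        assume "b \<notin> ?W"
        then have "?W = U" using W U1 by (intro U(2)) (auto simp: \<U>_def)
        then show False using W False by blast
      qed
      then obtain u and j :: nat where u: "u \<in> U" "b = u \<otimes> v [^] j" by blast
      have uG: "u \<in> carrier G" using U1 VG u by blast
      have nd: "\<not> p dvd j"
      proof
        assume "p dvd j"
        then obtain i where "j = p * i" by (auto simp: dvd_def)
        then have "v [^] j = \<one>" using Vp[OF v] VG[OF v] by (simp add: nat_pow_pow[symmetric])
        then show False using u U1(4) uG by simp
      qed
      have Ds: "subgroup ?D G" using D by blast
      have vj: "v [^] j = inv u \<otimes> b" using u(2) uG VG[OF v] by (simp add: m_assoc[symmetric])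
      have "inv u \<in> ?D" "b \<in> ?D" using D subgroup.m_inv_closed[OF U1(1) u(1)] by blast+
      then have "v [^] j \<in> ?D" unfolding vj by (rule subgroup.m_closed[OF Ds])
      then show ?thesis by (rule prime_pow_mem[OF p Ds VG[OF v] Vp[OF v] nd])
    qed
    then obtain u and i :: nat where u: "u \<in> U" "v = u \<otimes> b [^] i" by blast
    have "b [^] i = b [^] (p * (i div p) + i mod p)" by simp
    also have "\<dots> = (b [^] p) [^] (i div p) \<otimes> b [^] (i mod p)"
      using VG[OF b(1)] by (simp only: nat_pow_mult nat_pow_pow)
    also have "\<dots> = b [^] (i mod p)" using Vp[OF b(1)] VG[OF b(1)] by simp
    finally show ?thesis using u p0 by (intro exI[of _ "i mod p"] conjI bexI[of _ u]) auto
  qed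
  then show thesis using that U1 by blast
qed

end

section \<open>Detection of products of Euler classes\<close>

context letters
begin

text \<open>Naturality: a vertex map that intertwines the letters of two words carries one
  evaluation to the other.\<close>

lemma EV_push:
  assumes "list_all2 (\<lambda>a a'. lop a \<and> (\<forall>\<Phi>. \<forall>g\<in>B. eqm P (a (\<lambda>h. \<Phi> (\<psi> h)) g) (a' \<Phi> (\<psi> g)))) as as'" "g \<in> B"
  shows "eqm P (EV (\<lambda>xs. f (map \<psi> xs)) g as) (EV f (\<psi> g) as')"
  using assms
proof (induction as as' arbitrary: f g rule: list_all2_induct)
  case (Cons a as a' as')
  have IH: "eqm P (EV (\<lambda>xs. f (\<psi> g # map \<psi> xs)) h as) (EV (\<lambda>xs. f (\<psi> g # xs)) (\<psi> h) as')" if "h \<in> B" for h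
    using Cons.IH[where f = "\<lambda>xs. f (\<psi> g # xs)" and g = h] that by simp
  have "eqm P (a (\<lambda>h. EV (\<lambda>xs. f (\<psi> g # map \<psi> xs)) h as) g) (a (\<lambda>h. EV (\<lambda>xs. f (\<psi> g # xs)) (\<psi> h) as') g)"
    using Cons.hyps Cons.prems IH by (intro lop_cong[of a]) auto
  also have "eqm P \<dots> (a' (\<lambda>k. EV (\<lambda>xs. f (\<psi> g # xs)) k as') (\<psi> g))"
    using bspec[OF spec[OF conjunct2[OF Cons.hyps(1)], of "\<lambda>k. EV (\<lambda>xs. f (\<psi> g # xs)) k as'"] Cons.prems] .
  finally show ?case by simp
qed simp

end

text \<open>A factor is stored with half of its degree, so all factors are even; their words then
  consist of whole pairs of letters.\<close>

primrec prodc :: "(nat \<times> ('a list \<Rightarrow> int)) list \<Rightarrow> 'a list \<Rightarrow> int" where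
  "prodc [] = (\<lambda>_. 1)"
| "prodc (d # ds) = cup (2 * fst d) (snd d) (prodc ds)"

abbreviation deg :: "(nat \<times> ('a list \<Rightarrow> int)) list \<Rightarrow> nat" where
  "deg ds \<equiv> sum_list (map fst ds)"

lemma prodc_map: "prodc ds (map \<tau> xs) = prodc (map (\<lambda>d. (fst d, \<lambda>ys. snd d (map \<tau> ys))) ds) xs"
  by (induction ds arbitrary: xs) (simp_all add: cup_def take_map drop_map)

lemma set_take_drop: "set xs \<subseteq> A \<Longrightarrow> set (take i xs) \<subseteq> A" "set xs \<subseteq> A \<Longrightarrow> set (drop i xs) \<subseteq> A"
  by (meson order_trans set_take_subset set_drop_subset)+

context group
begin

lemma prodc_inv:
  "\<forall>d\<in>set ds. inv_on p H (Suc (2 * fst d)) (snd d) \<Longrightarrow> inv_on p H (Suc (2 * deg ds)) (prodc ds)"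
proof (induction ds)
  case Nil
  then show ?case by (simp add: inv_on_def)
next
  case (Cons d ds)
  show ?case unfolding inv_on_def
  proof (intro ballI allI impI)
    fix h xs assume h: "h \<in> H" and xs: "set xs \<subseteq> carrier G" "length xs = Suc (2 * deg (d # ds))"
    have "eqm (int p) (snd d (map (\<lambda>x. h \<otimes> x) (take (Suc (2 * fst d)) xs))) (snd d (take (Suc (2 * fst d)) xs))"
      using Cons.prems xs by (intro inv_onD[OF _ h] set_take_drop) auto
    moreover have "eqm (int p) (prodc ds (map (\<lambda>x. h \<otimes> x) (drop (2 * fst d) xs))) (prodc ds (drop (2 * fst d) xs))"
      using xs Cons.prems by (intro inv_onD[OF Cons.IH h] set_take_drop) auto
    ultimately show "eqm (int p) (prodc (d # ds) (map (\<lambda>x. h \<otimes> x) xs)) (prodc (d # ds) xs)"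
      by (simp add: cup_def take_map drop_map eqm_mult)
  qed
qed

lemma cup_coc:
  assumes "cocyc p (Suc a) f" "cocyc p (Suc b) g"
  shows "cocyc p (Suc (a + b)) (cup a f g)"
  unfolding cocyc_def
proof (intro allI impI)
  fix xs assume xs: "set xs \<subseteq> carrier G" "length xs = Suc (Suc (a + b))"
  have 1: "eqm (int p) (cobd f (take (Suc (Suc a)) xs)) 0" using xs by (intro cocycD[OF assms(1)] set_take_drop) auto
  have 2: "eqm (int p) (cobd g (drop a xs)) 0" using xs by (intro cocycD[OF assms(2)] set_take_drop) auto
  have "cobd (cup a f g) xs = cobd f (take (Suc (Suc a)) xs) * g (drop (Suc a) xs)
      + (- 1) ^ a * (f (take (Suc a) xs) * cobd g (drop a xs))"
    using xs by (subst cobd_cup) (auto simp: cup_def)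
  then show "eqm (int p) (cobd (cup a f g) xs) 0"
    using 1 2 unfolding eqm_0_iff by (simp add: dvd_add dvd_mult dvd_mult2)
qed

lemma prodc_coc:
  "\<forall>d\<in>set ds. cocyc p (Suc (2 * fst d)) (snd d) \<Longrightarrow> cocyc p (Suc (2 * deg ds)) (prodc ds)"
proof (induction ds)
  case Nil
  have "cobd (\<lambda>_. 1::int) xs = 0" if "length xs = Suc (Suc 0)" for xs :: "'a list"
    using that by (auto simp: length_Suc_conv)
  then show ?case by (simp add: cocyc_def)
next
  case (Cons d ds)
  then show ?case using cup_coc[of p "2 * fst d" "snd d" "2 * deg ds" "prodc ds"] by (simp add: distrib_left)
qed

text \<open>The cup product of r with the degree-one cocycle of the character X, in homogeneous
  form.\<close>

definition xcup :: "('a \<Rightarrow> int) \<Rightarrow> ('a list \<Rightarrow> int) \<Rightarrow> 'a list \<Rightarrow> int" where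
  "xcup X r = cup 1 (\<lambda>ys. X (inv (ys ! 0) \<otimes> ys ! 1)) r"

lemma inv_mult_cancel: "h \<in> carrier G \<Longrightarrow> x \<in> carrier G \<Longrightarrow> y \<in> carrier G \<Longrightarrow> inv (h \<otimes> x) \<otimes> (h \<otimes> y) = inv x \<otimes> y"
proof -
  assume c: "h \<in> carrier G" "x \<in> carrier G" "y \<in> carrier G"
  then have "inv (h \<otimes> x) \<otimes> (h \<otimes> y) = inv x \<otimes> (inv h \<otimes> h) \<otimes> y"
    by (simp only: inv_mult_group m_assoc m_closed inv_closed)
  then show ?thesis using c by simp
qed

lemma xcup_simp: "xcup X r (x # y # zs) = X (inv x \<otimes> y) * r (y # zs)"
  by (simp add: xcup_def cup_def)

lemma xcup_inv:
  assumes "H \<subseteq> carrier G" "inv_on p H (Suc m) r"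
  shows "inv_on p H (Suc (Suc m)) (xcup X r)"
  unfolding inv_on_def
proof (intro ballI allI impI)
  fix h xs assume h: "h \<in> H" and xs: "set xs \<subseteq> carrier G" "length xs = Suc (Suc m)"
  obtain x y zs where e: "xs = x # y # zs" using xs(2) by (auto simp: length_Suc_conv)
  have "inv (h \<otimes> x) \<otimes> (h \<otimes> y) = inv x \<otimes> y" using assms(1) h xs e by (intro inv_mult_cancel) auto
  then show "eqm (int p) (xcup X r (map (\<lambda>x. h \<otimes> x) xs)) (xcup X r xs)"
    using inv_onD[OF assms(2) h, of "y # zs"] xs unfolding e by (auto simp: xcup_simp intro!: eqm_mult)
qed

lemma xcup_coc:
  assumes X: "\<And>g h. g \<in> carrier G \<Longrightarrow> h \<in> carrier G \<Longrightarrow> eqm (int p) (X (g \<otimes> h)) (X g + X h)"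
    and r: "cocyc p (Suc m) r"
  shows "cocyc p (Suc (Suc m)) (xcup X r)"
proof -
  have "cocyc p (Suc 1) (\<lambda>ys. X (inv (ys ! 0) \<otimes> ys ! 1))"
    unfolding cocyc_def
  proof (intro allI impI)
    fix xs assume xs: "set xs \<subseteq> carrier G" "length xs = Suc (Suc 1)"
    then obtain x y z where e: "xs = [x, y, z]" by (auto simp: length_Suc_conv)
    have c: "x \<in> carrier G" "y \<in> carrier G" "z \<in> carrier G" using xs e by auto
    have "(inv x \<otimes> y) \<otimes> (inv y \<otimes> z) = inv x \<otimes> (y \<otimes> inv y) \<otimes> z"
      using c by (simp only: m_assoc m_closed inv_closed)
    also have "\<dots> = inv x \<otimes> z" using c by simp
    finally have "eqm (int p) (X (inv x \<otimes> z)) (X (inv x \<otimes> y) + X (inv y \<otimes> z))"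
      using X[of "inv x \<otimes> y" "inv y \<otimes> z"] c by simp
    then have "int p dvd - (X (inv x \<otimes> z) - (X (inv x \<otimes> y) + X (inv y \<otimes> z)))"
      unfolding eqm_def dvd_minus_iff .
    then show "eqm (int p) (cobd (\<lambda>ys. X (inv (ys ! 0) \<otimes> ys ! 1)) xs) 0"
      unfolding e eqm_0_iff by (simp add: algebra_simps)
  qed
  then show ?thesis unfolding xcup_def using cup_coc[OF _ r, of 1] by simp
qed

end

section \<open>Evaluation on words in the group ring of V\<close>

locale central_elementary = group G for G (structure) +
  fixes p :: nat and n :: nat and V :: "'a set"
  assumes fin: "finite (carrier G)" and prime: "Factorial_Ring.prime p" and order: "Coset.order G = p ^ n"
    and V: "subgroup V G" and V_central: "v \<in> V \<Longrightarrow> g \<in> carrier G \<Longrightarrow> v \<otimes> g = g \<otimes> v"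
    and V_pow: "v \<in> V \<Longrightarrow> v [^] p = \<one>" and V_proper: "V \<noteq> carrier G"
begin

lemma VG: "v \<in> V \<Longrightarrow> v \<in> carrier G"
  using subgroup.mem_carrier[OF V] .

lemma finV: "finite V"
  using finite_subset[OF subgroup.subset[OF V] fin] .

lemma V_swap: "g \<in> carrier G \<Longrightarrow> h \<in> carrier G \<Longrightarrow> v \<in> V \<Longrightarrow> g \<otimes> v \<otimes> h = g \<otimes> h \<otimes> v"
  using V_central[of v h] VG by (simp add: m_assoc)

text \<open>Right multiplication by sum beta_v v. The test for membership in the carrier makes the
  single summands commute as operators on all functions, the form required by
  \<open>freshman_op_sum\<close>.\<close>

definition nu :: "('a \<Rightarrow> 'k::comm_ring_1) \<Rightarrow> ('a \<Rightarrow> 'k) \<Rightarrow> 'a \<Rightarrow> 'k" where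
  "nu \<beta> \<Phi> g = (\<Sum>v\<in>V. if g \<in> carrier G then \<beta> v * \<Phi> (g \<otimes> v) else 0)"

lemma nu_lin: "lin (nu \<beta>)"
  unfolding lin_def nu_def fun_eq_iff
  by (auto simp: sum.distrib[symmetric] sum_distrib_left algebra_simps intro!: sum.cong)

lemma nu_lop: "letters.lop P (carrier G) (\<otimes>) (nu \<beta>)"
  by (rule letters.lopI[OF letters_carrier nu_lin]) (auto simp: nu_def m_assoc VG intro!: eqm_sum eqm_mult)

text \<open>Frobenius in the commutative group ring of V: the p-th power is sum beta_v^p v^p, that
  is, (sum beta_v)^p times the unit, because V has exponent p.\<close>

lemma nu_pow_p:
  fixes \<beta> :: "'a \<Rightarrow> 'k::comm_ring_1"
  assumes "(\<Sum>v\<in>V. \<beta> v) = 0"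
  shows "eqm (of_nat p) ((nu \<beta> ^^ p) \<Phi> g) 0"
proof -
  have p0: "p \<noteq> 0" using prime_gt_0_nat[OF prime] by simp
  define A where "A v \<Phi> g = (if g \<in> carrier G then \<beta> v * \<Phi> (g \<otimes> v) else 0)" for v and \<Phi> :: "'a \<Rightarrow> 'k" and g
  have nuA: "nu \<beta> = (\<lambda>\<Phi> g. \<Sum>v\<in>V. A v \<Phi> g)" by (simp add: fun_eq_iff nu_def A_def)
  have lin: "lin (A v)" for v unfolding lin_def A_def by (auto simp: fun_eq_iff algebra_simps)
  have comm: "A v (A w \<Phi>) = A w (A v \<Phi>)" if "v \<in> V" "w \<in> V" for v w \<Phi>
    unfolding A_def fun_eq_iff using that V_swap VG by (auto simp: algebra_simps)
  have Apow: "(A v ^^ Suc j) \<Phi> g = (if g \<in> carrier G then \<beta> v ^ Suc j * \<Phi> (g \<otimes> v [^] Suc j) else 0)"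
    if v: "v \<in> V" for v j g
  proof (induction j arbitrary: g)
    case 0
    then show ?case using VG[OF v] by (simp add: A_def)
  next
    case (Suc j)
    have e: "v \<otimes> v [^] Suc j = v [^] Suc (Suc j)" using nat_pow_Suc2[OF VG[OF v], of "Suc j"] by simp
    have g: "g \<otimes> v \<otimes> v [^] Suc j = g \<otimes> v [^] Suc (Suc j)" if "g \<in> carrier G"
      using that VG[OF v] e by (simp add: m_assoc del: nat_pow_Suc)
    have "(A v ^^ Suc (Suc j)) \<Phi> g = A v ((A v ^^ Suc j) \<Phi>) g" by simp
    also have "\<dots> = (if g \<in> carrier G then \<beta> v * (A v ^^ Suc j) \<Phi> (g \<otimes> v) else 0)" by (simp only: A_def)
    also have "\<dots> = (if g \<in> carrier G then \<beta> v ^ Suc (Suc j) * \<Phi> (g \<otimes> v [^] Suc (Suc j)) else 0)"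
      unfolding Suc using VG[OF v] g by (simp add: mult.assoc del: nat_pow_Suc)
    finally show ?case .
  qed
  obtain j where j: "p = Suc j" using p0 by (cases p) auto
  have "eqm (of_nat p) ((nu \<beta> ^^ p) \<Phi> g) (\<Sum>v\<in>V. (A v ^^ p) \<Phi> g)"
    unfolding nuA using freshman_op_sum[OF prime finV, of A \<Phi> g] lin comm by simp
  also have "(\<Sum>v\<in>V. (A v ^^ p) \<Phi> g) = (\<Sum>v\<in>V. if g \<in> carrier G then \<beta> v ^ p * \<Phi> g else 0)"
    using V_pow unfolding j by (intro sum.cong refl) (auto simp: Apow simp del: nat_pow_Suc funpow.simps)
  also have "\<dots> = (if g \<in> carrier G then (\<Sum>v\<in>V. \<beta> v ^ p) * \<Phi> g else 0)" by (simp add: sum_distrib_right)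
  also have "eqm (of_nat p) \<dots> 0"
  proof -
    have "eqm (of_nat p) ((\<Sum>v\<in>V. \<beta> v) ^ p) (\<Sum>v\<in>V. \<beta> v ^ p)" by (rule freshman_sum[OF prime])
    then have "of_nat p dvd (\<Sum>v\<in>V. \<beta> v ^ p)" using assms p0 by (simp add: eqm_def power_0_left)
    then show ?thesis by (simp add: eqm_0_iff)
  qed
  finally show ?thesis .
qed

lemma nu_const: "(\<Sum>v\<in>V. \<beta> v) = 0 \<Longrightarrow> nu \<beta> (\<lambda>_. x) = (\<lambda>_. 0)"
  unfolding nu_def fun_eq_iff
proof
  fix g assume "(\<Sum>v\<in>V. \<beta> v) = 0"
  then show "(\<Sum>v\<in>V. if g \<in> carrier G then \<beta> v * x else 0) = 0"
    by (cases "g \<in> carrier G") (simp_all add: sum_distrib_right[symmetric])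
qed

lemma nu_pow_local:
  assumes "\<And>v. v \<in> V \<Longrightarrow> eqm P (\<Phi> v) 0" "v \<in> V"
  shows "eqm P ((nu \<beta> ^^ j) \<Phi> v) 0"
  using assms(2)
proof (induction j arbitrary: v)
  case (Suc j)
  have "P dvd (nu \<beta> ^^ j) \<Phi> (v \<otimes> w)" if "w \<in> V" for w
    using Suc.IH[OF subgroup.m_closed[OF V Suc.prems that]] by (simp add: eqm_0_iff)
  then show ?case using VG[OF Suc.prems] by (simp add: eqm_0_iff nu_def[of \<beta> "(nu \<beta> ^^ j) \<Phi>"] dvd_sum)
qed (use assms(1) in simp)

lemma nu_pow_trans:
  assumes c: "c \<in> carrier G" and g: "g \<in> carrier G"
  shows "(nu \<beta> ^^ j) (\<lambda>h. \<Phi> (h \<otimes> c)) g = (nu \<beta> ^^ j) \<Phi> (g \<otimes> c)"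
  using g
proof (induction j arbitrary: g)
  case (Suc j)
  have "(nu \<beta> ^^ j) (\<lambda>h. \<Phi> (h \<otimes> c)) (g \<otimes> w) = (nu \<beta> ^^ j) \<Phi> (g \<otimes> c \<otimes> w)" if "w \<in> V" for w
    using Suc.IH[of "g \<otimes> w"] VG[OF that] Suc.prems V_swap[OF Suc.prems c that] by simp
  then show ?case using Suc.prems c by (simp add: nu_def[of \<beta> "(nu \<beta> ^^ j) _"])
qed simp

text \<open>The analogue of \<open>qword\<close> for an element of the group ring of V. Passing to a
  quotient in which V becomes cyclic turns the one into the other.\<close>

definition mword :: "('a \<Rightarrow> 'k::comm_ring_1) \<Rightarrow> nat \<Rightarrow> (('a \<Rightarrow> 'k) \<Rightarrow> 'a \<Rightarrow> 'k) list" where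
  "mword \<beta> M = concat (replicate M [nu \<beta> ^^ (p - 1), nu \<beta>])"

lemma mword_0 [simp]: "mword \<beta> 0 = []"
  and mword_Suc: "mword \<beta> (Suc M) = (nu \<beta> ^^ (p - 1)) # nu \<beta> # mword \<beta> M"
  and mword_add: "mword \<beta> (M + N) = mword \<beta> M @ mword \<beta> N"
  by (simp_all add: mword_def replicate_add)

lemma length_mword [simp]: "length (mword \<beta> M) = 2 * M"
  by (induction M) (simp_all add: mword_Suc)

lemma mword_lop: "\<forall>a\<in>set (mword \<beta> M). letters.lop P (carrier G) (\<otimes>) a"
  by (auto simp: mword_def nu_lop intro: letters.lop_funpow[OF letters_carrier nu_lop])

lemma mword_eps0:
  assumes "(\<Sum>v\<in>V. \<beta> v) = 0"
  shows "\<forall>a\<in>set (mword \<beta> M). letters.eps0 P (carrier G) a"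
proof -
  obtain q where q: "p - 1 = Suc q" using prime_gt_1_nat[OF prime] by (cases "p - 1") auto
  have "(nu \<beta> ^^ Suc q) (\<lambda>_. x) g = 0" for x g
    unfolding funpow_Suc_right comp_apply nu_const[OF assms] by (rule lin_zero[OF lin_funpow[OF nu_lin]])
  then show ?thesis unfolding letters.eps0_def[OF letters_carrier] mword_def q
    by (auto simp: nu_const[OF assms] simp del: funpow.simps)
qed

lemma mword_ann:
  assumes "(\<Sum>v\<in>V. \<beta> v) = 0"
  shows "successively (letters.ann (of_nat p) (carrier G)) (mword \<beta> M)"
proof -
  have p: "p = Suc (p - 1)" using prime_gt_0_nat[OF prime] by simp
  have 1: "letters.ann (of_nat p) (carrier G) (nu \<beta>) (nu \<beta> ^^ (p - 1))"
    unfolding letters.ann_def[OF letters_carrier]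
    using nu_pow_p[OF assms] by (subst (asm) p) simp
  have 2: "letters.ann (of_nat p) (carrier G) (nu \<beta> ^^ (p - 1)) (nu \<beta>)"
    unfolding letters.ann_def[OF letters_carrier]
    using nu_pow_p[OF assms] by (subst (asm) p) (simp add: funpow_swap1)
  have "successively (letters.ann (of_nat p) (carrier G)) (nu \<beta> # mword \<beta> M)"
    by (induction M) (use 1 2 in \<open>simp_all add: mword_Suc\<close>)
  then show ?thesis by (cases "mword \<beta> M = []") (auto simp: successively_Cons)
qed

text \<open>The word is a cycle, and c commutes with its letters because V is central, so
  \<open>SH_cobd\<close> applies.\<close>

lemma SH_cobdry:
  fixes \<beta> :: "'a \<Rightarrow> 'k::comm_ring_1"
  assumes \<beta>: "(\<Sum>v\<in>V. \<beta> v) = 0" and c: "c \<in> carrier G" and f: "cobdry p (carrier G) (Suc (2 * L)) f"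
  shows "eqm (of_nat p) (SH (\<lambda>\<Phi> g. \<Phi> (g \<otimes> c)) (\<lambda>xs. of_int (f xs)) \<one> (mword \<beta> L)) 0"
proof -
  let ?T = "\<lambda>\<Phi> g. \<Phi> (g \<otimes> c) :: 'k"
  obtain u where u: "inv_on p (carrier G) (Suc (2 * L)) u"
    "\<And>xs. set xs \<subseteq> carrier G \<Longrightarrow> length xs = Suc (Suc (2 * L)) \<Longrightarrow> eqm (int p) (f xs) (cobd u xs)"
    using f unfolding cobdry_def by blast
  have T: "letters.lop (of_nat p) (carrier G) (\<otimes>) ?T"
    by (rule letters.lopI[OF letters_carrier]) (use c in \<open>auto simp: lin_def m_assoc\<close>)
  have "eqm (of_nat p) (SH ?T (\<lambda>xs. of_int (f xs)) \<one> (mword \<beta> L)) (SH ?T (cobd (\<lambda>xs. of_int (u xs))) \<one> (mword \<beta> L))"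
  proof (rule letters.SH_cong[OF letters_carrier T mword_lop])
    fix xs assume "set xs \<subseteq> carrier G" "length xs = Suc (length (mword \<beta> L))"
    then show "eqm (of_nat p) (of_int (f (\<one> # xs))) (cobd (\<lambda>xs. of_int (u xs)) (\<one> # xs))"
      unfolding cobd_of_int by (intro eqm_of_int u(2)) auto
  qed simp
  also have "eqm (of_nat p) \<dots> 0"
  proof (cases L)
    \<comment> \<open>With no letters the value is u [c] - u [1], which invariance makes
      zero.\<close>
    case 0
    have "eqm (int p) (u (map (\<lambda>x. c \<otimes> x) [\<one>])) (u [\<one>])" using u(1) c 0 by (intro inv_onD[OF u(1)]) auto
    then have "eqm (of_nat p :: 'k) (of_int (u [c])) (of_int (u [\<one>]))" using c by (intro eqm_of_int) simp
    then show ?thesis using 0 c by (simp add: eqm_def)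
  next
    case (Suc M)
    have comm: "a (?T \<Phi>) h = ?T (a \<Phi>) h" if a: "a \<in> set (mword \<beta> L)" and h: "h \<in> carrier G" for a \<Phi> h
    proof -
      have "a = nu \<beta> ^^ (p - 1) \<or> a = nu \<beta> ^^ 1" using a by (auto simp: mword_def split: if_splits)
      then obtain j where "a = nu \<beta> ^^ j" by blast
      then show ?thesis using nu_pow_trans[OF c h] by simp
    qed
    show ?thesis unfolding Suc mword_Suc
    proof (rule letters.SH_cobd[OF letters_carrier T])
      show "letters.invf (of_nat p) (carrier G) (\<otimes>) (Suc (Suc (length (nu \<beta> # mword \<beta> M)))) (\<lambda>xs. of_int (u xs) :: 'k)"
        unfolding letters.invf_def[OF letters_carrier] using inv_onD[OF u(1)] Suc by (auto intro!: eqm_of_int)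
      show "\<forall>a\<in>set ((nu \<beta> ^^ (p - 1)) # nu \<beta> # mword \<beta> M). letters.lop (of_nat p) (carrier G) (\<otimes>) a"
        unfolding mword_Suc[symmetric] by (rule mword_lop)
      show "\<forall>a\<in>set ((nu \<beta> ^^ (p - 1)) # nu \<beta> # mword \<beta> M). letters.eps0 (of_nat p) (carrier G) a"
        unfolding mword_Suc[symmetric] by (rule mword_eps0[OF \<beta>])
      show "successively (letters.ann (of_nat p) (carrier G)) ((nu \<beta> ^^ (p - 1)) # nu \<beta> # mword \<beta> M)"
        unfolding mword_Suc[symmetric] by (rule mword_ann[OF \<beta>])
      show "eqm (of_nat p) (a (?T \<Phi>) h) (?T (a \<Phi>) h)"
        if "a \<in> set ((nu \<beta> ^^ (p - 1)) # nu \<beta> # mword \<beta> M)" "h \<in> carrier G" for a \<Phi> h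
        using comm[OF that[unfolded mword_Suc[symmetric] Suc[symmetric]]] by (rule eqm_eq)
    qed simp_all
  qed
  finally show ?thesis .
qed

text \<open>Only the insertion of c at the front contributes. In all other terms the first edge of
  the chain joins two elements of V, where X vanishes.\<close>

lemma SH_xcup:
  fixes \<beta> :: "'a \<Rightarrow> 'k::comm_ring_1"
  assumes c: "c \<in> carrier G" and X: "\<And>v. v \<in> V \<Longrightarrow> eqm (int p) (X v) 0"
    and r: "inv_on p (carrier G) (Suc (2 * L)) r"
  shows "eqm (of_nat p) (SH (\<lambda>\<Phi> g. \<Phi> (g \<otimes> c)) (\<lambda>xs. of_int (xcup X r xs)) \<one> (mword \<beta> L))
    (of_int (X c) * EV (\<lambda>xs. of_int (r xs)) \<one> (mword \<beta> L))"
proof -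
  let ?T = "\<lambda>\<Phi> g. \<Phi> (g \<otimes> c) :: 'k" and ?f = "\<lambda>xs. of_int (xcup X r xs) :: 'k"
  let ?\<xi> = "\<lambda>ys. of_int (X (inv (ys ! 0) \<otimes> ys ! 1)) :: 'k" and ?R = "\<lambda>xs. of_int (r xs) :: 'k"
  have T: "letters.lop (of_nat p) (carrier G) (\<otimes>) ?T"
    by (rule letters.lopI[OF letters_carrier]) (use c in \<open>auto simp: lin_def m_assoc\<close>)
  have R: "letters.invf (of_nat p) (carrier G) (\<otimes>) (Suc (length (mword \<beta> L))) ?R"
    unfolding letters.invf_def[OF letters_carrier] using inv_onD[OF r] by (auto intro!: eqm_of_int)
  have f: "?f = cup (length [?T]) ?\<xi> ?R" by (simp add: fun_eq_iff xcup_def cup_def)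
  have "eqm (of_nat p) (EV ?f \<one> ([?T] @ mword \<beta> L)) (EV ?\<xi> \<one> [?T] * EV ?R \<one> (mword \<beta> L))"
    unfolding f using T mword_lop by (intro letters.EV_cup[OF letters_carrier _ _ _ R]) auto
  then have E: "eqm (of_nat p) (EV ?f \<one> (?T # mword \<beta> L)) (of_int (X c) * EV ?R \<one> (mword \<beta> L))"
    using c by simp
  show ?thesis
  proof (cases L)
    case 0
    then show ?thesis using E by simp
  next
    case (Suc M)
    let ?ws = "nu \<beta> # mword \<beta> M"
    have wsl: "\<forall>a\<in>set ?ws. letters.lop (of_nat p) (carrier G) (\<otimes>) a" using mword_lop nu_lop by auto
    have SH0: "eqm (of_nat p) (SH ?T (\<lambda>xs. ?f (\<one> # xs)) h ?ws) 0" if h: "h \<in> V" for h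
    proof -
      have "eqm (of_nat p) (SH ?T (\<lambda>xs. ?f (\<one> # xs)) h ?ws) (SH ?T (\<lambda>xs. \<Sum>i\<in>({}::nat set). 0) h ?ws)"
      proof (rule letters.SH_cong[OF letters_carrier T wsl VG[OF h]])
        fix xs
        have "?f (\<one> # h # xs) = of_int (X h) * of_int (r (h # xs))" using VG[OF h] by (simp add: xcup_simp)
        moreover have "eqm (of_nat p :: 'k) (of_int (X h)) (of_int 0)" by (rule eqm_of_int[OF X[OF h]])
        ultimately show "eqm (of_nat p) (?f (\<one> # h # xs)) (\<Sum>i\<in>({}::nat set). 0)"
          by (simp add: eqm_0_iff del: of_int_0) (simp add: eqm_0_iff dvd_mult2)
      qed
      also have "SH ?T (\<lambda>xs. \<Sum>i\<in>({}::nat set). 0) h ?ws = (\<Sum>i\<in>({}::nat set). SH ?T (\<lambda>xs. 0) h ?ws)"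
        using T wsl letters.lop_lin[OF letters_carrier] by (intro SH_sum) blast+
      finally show ?thesis by simp
    qed
    have "eqm (of_nat p) ((nu \<beta> ^^ (p - 1)) (\<lambda>h. SH ?T (\<lambda>xs. ?f (\<one> # xs)) h ?ws) \<one>) 0"
      by (rule nu_pow_local[OF SH0 subgroup.one_closed[OF V]])
    from eqm_diff[OF E this] show ?thesis unfolding Suc mword_Suc by (simp del: EV.simps add: SH.simps)
  qed
qed

lemma EV_prodc:
  fixes \<beta> :: "'a \<Rightarrow> 'k::comm_ring_1"
  shows "\<forall>d\<in>set ds. inv_on p (carrier G) (Suc (2 * fst d)) (snd d) \<Longrightarrow>
    eqm (of_nat p) (EV (\<lambda>xs. of_int (prodc ds xs)) \<one> (mword \<beta> (deg ds)))
      (prod_list (map (\<lambda>d. EV (\<lambda>xs. of_int (snd d xs)) \<one> (mword \<beta> (fst d))) ds))"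
proof (induction ds)
  case (Cons d ds)
  let ?e = "\<lambda>xs. of_int (snd d xs) :: 'k" and ?R = "\<lambda>xs. of_int (prodc ds xs) :: 'k"
  have "inv_on p (carrier G) (Suc (2 * deg ds)) (prodc ds)" using Cons.prems by (intro prodc_inv) auto
  then have R: "letters.invf (of_nat p) (carrier G) (\<otimes>) (Suc (length (mword \<beta> (deg ds)))) ?R"
    unfolding letters.invf_def[OF letters_carrier] using inv_onD by (auto intro!: eqm_of_int)
  have "(\<lambda>xs. of_int (prodc (d # ds) xs) :: 'k) = cup (length (mword \<beta> (fst d))) ?e ?R" by (simp add: fun_eq_iff cup_def)
  then have "EV (\<lambda>xs. of_int (prodc (d # ds) xs)) \<one> (mword \<beta> (deg (d # ds)))
      = EV (cup (length (mword \<beta> (fst d))) ?e ?R) \<one> (mword \<beta> (fst d) @ mword \<beta> (deg ds))"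
    by (simp add: mword_add)
  also have "eqm (of_nat p) \<dots> (EV ?e \<one> (mword \<beta> (fst d)) * EV ?R \<one> (mword \<beta> (deg ds)))"
    using mword_lop by (intro letters.EV_cup[OF letters_carrier _ _ _ R]) auto
  also have "eqm (of_nat p) \<dots> (EV ?e \<one> (mword \<beta> (fst d)) *
      prod_list (map (\<lambda>d. EV (\<lambda>xs. of_int (snd d xs)) \<one> (mword \<beta> (fst d))) ds))"
    using Cons by (intro eqm_mult) auto
  finally show ?case by simp
qed simp

text \<open>One Euler class for the pair (a, b), in one predicate so that a choice over all pairs
  can be made. M is half the degree and epsilon the unit from \<open>euler_nonzero\<close>; k
  represents a linear form on V by natural numbers. The clause on tau evaluates the conjugates of
  the class, since the transfer is a sum of conjugates.\<close>

definition sepdat :: "'a \<Rightarrow> 'a \<Rightarrow> ('a list \<Rightarrow> int) \<Rightarrow> nat \<Rightarrow> nat \<Rightarrow> int \<Rightarrow> ('a \<Rightarrow> nat) \<Rightarrow> bool" where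
  "sepdat a b e M r \<epsilon> k \<longleftrightarrow> inv_on p (carrier G) (Suc (2 * M)) e \<and> cocyc p (Suc (2 * M)) e \<and>
     2 * (p * M) = p ^ r * (p - 1) \<and> \<not> int p dvd \<epsilon> \<and> k a = 0 \<and> k b = 1 \<and> k \<one> = 0 \<and>
     (\<forall>\<tau> \<beta>. \<tau> \<in> hom G G \<longrightarrow> \<tau> ` V \<subseteq> V \<longrightarrow> (\<Sum>v\<in>V. \<beta> v) = (0 :: int poly) \<longrightarrow>
       eqm (of_nat p) (EV (\<lambda>xs. of_int (e (map \<tau> xs))) \<one> (mword \<beta> M))
         ((\<Sum>v\<in>V. \<beta> v * of_nat (k (\<tau> v))) ^ (p * M) * of_int \<epsilon>))"

text \<open>The pair dictates the form: its kernel U contains a, and b has the value 1. Modulo U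
  every v in V becomes z^(k v), so the word over V turns into \<open>qword\<close> and
  \<open>euler_eval\<close> computes it.\<close>

lemma separating_class:
  assumes a: "a \<in> V" and b: "b \<in> V" "\<And>j::nat. b \<noteq> a [^] j"
  obtains e M r \<epsilon> k where "sepdat a b e M r \<epsilon> k"
proof -
  have Vc: "v \<otimes> w = w \<otimes> v" if "v \<in> V" "w \<in> V" for v w using V_central[OF that(1) VG[OF that(2)]] .
  obtain U where U: "subgroup U G" "U \<subseteq> V" "a \<in> U" "b \<notin> U" "\<And>v. v \<in> V \<Longrightarrow> \<exists>i<p. \<exists>u\<in>U. v = u \<otimes> b [^] i"
    by (rule separating_subgroup[OF fin prime V Vc V_pow a b]) (assumption | rule that)+
  have UG: "u \<in> carrier G" if "u \<in> U" for u using U(2) VG that by blast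
  have bG: "b \<in> carrier G" using VG[OF b(1)] .
  have "x \<otimes> h \<otimes> inv x \<in> U" if "x \<in> carrier G" "h \<in> U" for x h
  proof -
    have "x \<otimes> h = h \<otimes> x" using V_central[of h x] U(2) that by auto
    then show ?thesis using that UG by (simp add: m_assoc)
  qed
  then interpret U: normal U G using U(1) normal_inv_iff by blast
  define Q where "Q = G Mod U"
  define \<psi> where "\<psi> x = U #> x" for x
  define z where "z = \<psi> b"
  have cQ: "carrier Q = \<psi> ` carrier G" by (auto simp: Q_def carrier_FactGroup \<psi>_def)
  have \<psi>m: "\<psi> x \<otimes>\<^bsub>Q\<^esub> \<psi> y = \<psi> (x \<otimes> y)" if "x \<in> carrier G" "y \<in> carrier G" for x y
    using that by (simp add: Q_def \<psi>_def U.rcos_sum)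
  have \<psi>p: "\<psi> x [^]\<^bsub>Q\<^esub> (j::nat) = \<psi> (x [^] j)" if "x \<in> carrier G" for x j
    using U.FactGroup_pow[OF that, of j] by (simp add: Q_def \<psi>_def)
  have \<psi>U: "\<psi> x = \<one>\<^bsub>Q\<^esub> \<longleftrightarrow> x \<in> U" if "x \<in> carrier G" for x
    using coset_join1[OF _ that U(1)] coset_join2[OF that U(1)] by (auto simp: Q_def \<psi>_def)
  have \<psi>1: "\<psi> \<one> = \<one>\<^bsub>Q\<^esub>" using \<psi>U subgroup.one_closed[OF U(1)] by simp
  interpret Q: central_prime Q p z
  proof (intro central_prime.intro central_prime_axioms.intro)
    show "group Q" unfolding Q_def by (rule U.factorgroup_is_group)
    show "finite (carrier Q)" using fin by (simp add: cQ)
    show "z \<in> carrier Q" using bG by (simp add: cQ z_def)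
    show "z [^]\<^bsub>Q\<^esub> p = \<one>\<^bsub>Q\<^esub>" using \<psi>p[OF bG] V_pow[OF b(1)] \<psi>1 by (simp add: z_def)
    show "z \<noteq> \<one>\<^bsub>Q\<^esub>" using \<psi>U[OF bG] U(4) by (simp add: z_def)
    show "g \<otimes>\<^bsub>Q\<^esub> z = z \<otimes>\<^bsub>Q\<^esub> g" if "g \<in> carrier Q" for g
      using that \<psi>m bG V_central[OF b(1)] by (auto simp: cQ z_def)
  qed (rule prime)
  have "card (carrier Q) dvd p ^ n"
    using lagrange[OF U(1)] order by (metis Q_def FactGroup_def dvd_triv_left partial_object.select_convs(1))
  then obtain r where r: "Coset.order Q = p ^ r" using divides_primepow_nat[OF prime] by (auto simp: Coset.order_def)
  have p1: "p > 1" by (rule prime_gt_1_nat[OF prime])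
  have "r \<noteq> 0"
  proof
    assume "r = 0"
    have "p * card Q.Blocks = 1" using Q.order_Blocks[unfolded r \<open>r = 0\<close>] by (simp only: power_0)
    then show False using p1 by (metis less_irrefl nat_mult_eq_1_iff)
  qed
  then obtain s where s: "r = Suc s" by (cases r) auto
  then have cB: "card Q.Blocks = p ^ s" using Q.order_Blocks[unfolded r s] p1 by simp
  \<comment> \<open>Otherwise G/U would have order p and G would be V. With s > 0 the degree p^s (p
    - 1) is even for p = 2 as well.\<close>
  have "s \<noteq> 0"
  proof
    assume "s = 0"
    then have "card (carrier Q) = p" using r s by (simp add: Coset.order_def)
    then have blk: "Q.blk \<one>\<^bsub>Q\<^esub> = carrier Q"
      using Q.blk_sub[OF Q.one_closed] Q.card_blk[OF Q.one_closed] Q.fin by (intro card_subset_eq) auto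
    have "g \<in> V" if g: "g \<in> carrier G" for g
    proof -
      have "\<psi> g \<in> Q.blk \<one>\<^bsub>Q\<^esub>" unfolding blk cQ using g by simp
      then obtain j :: nat where "\<psi> g = \<one>\<^bsub>Q\<^esub> \<otimes>\<^bsub>Q\<^esub> z [^]\<^bsub>Q\<^esub> j" by (auto simp: Q.blk_def)
      then have "\<psi> g = \<psi> (b [^] j)" using \<psi>p[OF bG] bG by (simp add: z_def cQ)
      then have "g \<in> U #> b [^] j" using rcos_self[OF g U(1)] by (simp add: \<psi>_def)
      then obtain u where "u \<in> U" "g = u \<otimes> b [^] j" by (auto simp: r_coset_def)
      then show ?thesis using U(2) subgroup_pow[OF V b(1)] subgroup.m_closed[OF V] by blast
    qed
    then show False using V_proper VG by blast
  qed
  then have "even Q.sdim" and pos: "Q.sdim > 0" using p1 by (auto simp: Q.sdim_def cB)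
  then obtain M where M: "Q.sdim = 2 * M" by (auto elim: evenE)
  define e where "e xs = Q.euler (map \<psi> xs)" for xs
  \<comment> \<open>Taking the least exponent gives the values 0 on U and 1 at b exactly, and not
    just modulo p.\<close>
  define k :: "'a \<Rightarrow> nat" where "k v = (LEAST i. \<exists>u\<in>U. v = u \<otimes> b [^] i)" for v
  have k0: "k v = 0" if "v \<in> U" for v
    unfolding k_def using that UG by (intro Least_eq_0) auto
  have kz: "\<psi> v = z [^]\<^bsub>Q\<^esub> k v" if "v \<in> V" for v
  proof -
    have "\<exists>i. \<exists>u\<in>U. v = u \<otimes> b [^] (i::nat)" using U(5)[OF that] by blast
    then have "\<exists>u\<in>U. v = u \<otimes> b [^] k v" unfolding k_def by (rule LeastI_ex)
    then obtain u where u: "u \<in> U" "v = u \<otimes> b [^] k v" by blast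
    have "\<psi> v = \<psi> u \<otimes>\<^bsub>Q\<^esub> \<psi> (b [^] k v)" using u \<psi>m[of u "b [^] k v"] UG bG by simp
    also have "\<dots> = \<psi> (b [^] k v)" using \<psi>U[of u] u UG bG by (simp add: cQ)
    finally show ?thesis using \<psi>p[OF bG] by (simp add: z_def)
  qed
  have kb: "k b = 1"
  proof -
    have "\<exists>u\<in>U. b = u \<otimes> b [^] (1::nat)" using bG subgroup.one_closed[OF U(1)] by (intro bexI[of _ \<one>]) auto
    then have "k b \<le> 1" unfolding k_def by (rule Least_le)
    moreover have "k b \<noteq> 0"
    proof
      assume "k b = 0"
      then have "z = z [^]\<^bsub>Q\<^esub> (0::nat)" using kz[OF b(1)] unfolding z_def by (simp only:)
      then show False using Q.z_one Q.nat_pow_0 by metis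
    qed
    ultimately show ?thesis by simp
  qed
  have \<psi>t: "map \<psi> (map (\<lambda>x. h \<otimes> x) xs) = map (\<lambda>y. \<psi> h \<otimes>\<^bsub>Q\<^esub> y) (map \<psi> xs)"
    if "h \<in> carrier G" "set xs \<subseteq> carrier G" for h xs using that \<psi>m by auto
  have "sepdat a b e M r (EV Q.euler \<one>\<^bsub>Q\<^esub> (Q.wd Q.sdim)) k"
    unfolding sepdat_def
  proof (intro conjI allI impI)
    show "inv_on p (carrier G) (Suc (2 * M)) e"
      unfolding inv_on_def e_def
    proof (intro ballI allI impI)
      fix h xs assume h: "h \<in> carrier G" and xs: "set xs \<subseteq> carrier G" "length xs = Suc (2 * M)"
      show "eqm (int p) (Q.euler (map \<psi> (map (\<lambda>x. h \<otimes> x) xs))) (Q.euler (map \<psi> xs))"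
        unfolding \<psi>t[OF h xs(1)] using h xs M by (intro Q.euler_inv[OF r]) (auto simp: cQ)
    qed
    show "cocyc p (Suc (2 * M)) e" unfolding cocyc_def e_def[abs_def] cobd_map by (simp add: Q.cobd_euler)
    have "2 * (p * M) = p * Q.sdim" using M by simp
    then show "2 * (p * M) = p ^ r * (p - 1)" by (simp add: Q.sdim_def cB s)
    show "\<not> int p dvd EV Q.euler \<one>\<^bsub>Q\<^esub> (Q.wd Q.sdim)" using M pos by (intro Q.euler_nonzero) auto
    show "k a = 0" "k b = 1" "k \<one> = 0" using k0 U(3) kb subgroup.one_closed[OF U(1)] by auto
  next
    fix \<tau> and \<beta> :: "'a \<Rightarrow> int poly"
    assume \<tau>: "\<tau> \<in> hom G G" "\<tau> ` V \<subseteq> V" and \<beta>: "(\<Sum>v\<in>V. \<beta> v) = 0"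
    define q where "q = (\<Sum>v\<in>V. smult (\<beta> v) (monom 1 (k (\<tau> v))))"
    let ?\<psi> = "\<lambda>x. \<psi> (\<tau> x)"
    have \<tau>G: "\<tau> x \<in> carrier G" if "x \<in> carrier G" for x using \<tau>(1) that by (auto simp: hom_def)
    have \<psi>Q: "?\<psi> g \<in> carrier Q" if "g \<in> carrier G" for g using that \<tau>G by (simp add: cQ)
    have nu1: "nu \<beta> (\<lambda>h. \<Phi> (?\<psi> h)) g = Q.act q \<Phi> (?\<psi> g)" if g: "g \<in> carrier G" for \<Phi> g
    proof -
      have "?\<psi> (g \<otimes> v) = ?\<psi> g \<otimes>\<^bsub>Q\<^esub> z [^]\<^bsub>Q\<^esub> k (\<tau> v)" if v: "v \<in> V" for v
      proof -
        have "\<tau> (g \<otimes> v) = \<tau> g \<otimes> \<tau> v" using \<tau>(1) g VG[OF v] by (simp add: hom_def)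
        then show ?thesis using \<psi>m[OF \<tau>G[OF g] \<tau>G[OF VG[OF v]]] kz[of "\<tau> v"] \<tau>(2) v by auto
      qed
      then show ?thesis unfolding q_def Q.act_sum Q.act_smult nu_def
        using g \<psi>Q[OF g] by (intro sum.cong) (auto simp: Q.act_monom)
    qed
    have nuj: "(nu \<beta> ^^ j) (\<lambda>h. \<Phi> (?\<psi> h)) g = Q.act (q ^ j) \<Phi> (?\<psi> g)" if g: "g \<in> carrier G" for \<Phi> g j
      using g
    proof (induction j arbitrary: g)
      case 0
      then show ?case using Q.act_monom[OF \<psi>Q[OF 0], of 1 0 \<Phi>] \<psi>Q[OF 0] by simp
    next
      case (Suc j)
      have "(nu \<beta> ^^ Suc j) (\<lambda>h. \<Phi> (?\<psi> h)) g = nu \<beta> (\<lambda>h. Q.act (q ^ j) \<Phi> (?\<psi> h)) g"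
        using Suc VG by (simp add: nu_def[of \<beta> "(nu \<beta> ^^ j) _"] nu_def[of \<beta> "\<lambda>h. Q.act (q ^ j) \<Phi> (?\<psi> h)"])
      also have "\<dots> = Q.act (q ^ Suc j) \<Phi> (?\<psi> g)"
        using nu1[OF Suc.prems, of "Q.act (q ^ j) \<Phi>"] Q.act_mult[OF \<psi>Q[OF Suc.prems], of q "q ^ j" \<Phi>] by simp
      finally show ?case .
    qed
    have "list_all2 (\<lambda>a a'. letters.lop (of_nat p) (carrier G) (\<otimes>) a \<and>
        (\<forall>\<Phi>. \<forall>g\<in>carrier G. eqm (of_nat p) (a (\<lambda>h. \<Phi> (?\<psi> h)) g) (a' \<Phi> (?\<psi> g)))) (mword \<beta> M) (Q.qword q M)"
      by (induction M) (use nu1 nuj in \<open>simp_all add: mword_Suc Q.qword_def nu_lop letters.lop_funpow[OF letters_carrier nu_lop]\<close>)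
    then have "eqm (of_nat p) (EV (\<lambda>xs. of_int (Q.euler (map ?\<psi> xs))) \<one> (mword \<beta> M))
        (EV (\<lambda>xs. of_int (Q.euler xs)) (?\<psi> \<one>) (Q.qword q M))"
      by (rule letters.EV_push[OF letters_carrier]) simp
    also have "?\<psi> \<one> = \<one>\<^bsub>Q\<^esub>" using hom_one[OF \<tau>(1) is_group is_group] \<psi>1 by simp
    also have "eqm (of_nat p) (EV (\<lambda>xs. of_int (Q.euler xs)) \<one>\<^bsub>Q\<^esub> (Q.qword q M))
        ((\<Sum>v\<in>V. \<beta> v * of_nat (k (\<tau> v))) ^ (p * M) * of_int (EV Q.euler \<one>\<^bsub>Q\<^esub> (Q.wd Q.sdim)))"
      unfolding q_def by (rule Q.euler_eval[OF r M \<beta>])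
    finally show "eqm (of_nat p) (EV (\<lambda>xs. of_int (e (map \<tau> xs))) \<one> (mword \<beta> M))
        ((\<Sum>v\<in>V. \<beta> v * of_nat (k (\<tau> v))) ^ (p * M) * of_int (EV Q.euler \<one>\<^bsub>Q\<^esub> (Q.wd Q.sdim)))"
      by (simp add: e_def comp_def)
  qed
  then show thesis by (rule that)
qed

text \<open>On a product of Euler classes the evaluation is a product of the values
  \<open>phi w i\<close>, so the claim is Artin independence of the functions i |->
  \<open>phi w i\<close>.\<close>

lemma classes_independent:
  fixes \<tau> :: "'w \<Rightarrow> 'a \<Rightarrow> 'a" and x :: "'w \<Rightarrow> int"
  assumes W: "finite W" and \<tau>: "\<And>w. w \<in> W \<Longrightarrow> \<tau> w \<in> hom G G" "\<And>w. w \<in> W \<Longrightarrow> \<tau> w ` V = V"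
    and sep: "\<And>w w'. w \<in> W \<Longrightarrow> w' \<in> W \<Longrightarrow> w \<noteq> w' \<Longrightarrow> \<exists>v\<in>V. \<forall>j::nat. \<tau> w' v \<noteq> \<tau> w v [^] j"
    and x: "\<exists>w\<in>W. \<not> int p dvd x w"
  obtains ds and \<beta> :: "'a \<Rightarrow> int poly" where
    "\<forall>d\<in>set ds. inv_on p (carrier G) (Suc (2 * fst d)) (snd d) \<and> cocyc p (Suc (2 * fst d)) (snd d)"
    "(\<Sum>v\<in>V. \<beta> v) = 0"
    "\<not> of_nat p dvd (\<Sum>w\<in>W. of_int (x w) * EV (\<lambda>xs. of_int (prodc ds (map (\<tau> w) xs))) \<one> (mword \<beta> (deg ds)))"
proof -
  have oneV: "\<one> \<in> V" by (rule subgroup.one_closed[OF V])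
  obtain idx :: "'a \<Rightarrow> nat" where idx: "inj_on idx V"
    using finite_imp_inj_to_nat_seg[OF finV] by blast
  \<comment> \<open>Different elements of V receive different powers of the variable; the
    coefficient at the unit brings the augmentation to zero.\<close>
  define \<beta> where "\<beta> v = (if v = \<one> then - (\<Sum>u\<in>V - {\<one>}. monom 1 (idx u)) else monom (1::int) (idx v))" for v
  have \<beta>0: "(\<Sum>v\<in>V. \<beta> v) = 0"
  proof -
    have "(\<Sum>v\<in>V. \<beta> v) = \<beta> \<one> + (\<Sum>v\<in>V - {\<one>}. \<beta> v)" by (rule sum.remove[OF finV oneV])
    also have "(\<Sum>v\<in>V - {\<one>}. \<beta> v) = (\<Sum>u\<in>V - {\<one>}. monom 1 (idx u))" by (intro sum.cong) (auto simp: \<beta>_def)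
    finally show ?thesis by (simp add: \<beta>_def)
  qed
  define I where "I = {(a, b). a \<in> V \<and> b \<in> V \<and> (\<forall>j::nat. b \<noteq> a [^] j)}"
  have "\<exists>e M r \<epsilon> k. sepdat (fst i) (snd i) e M r \<epsilon> k" if "i \<in> I" for i
  proof -
    have "fst i \<in> V" "snd i \<in> V" "\<And>j::nat. snd i \<noteq> fst i [^] j" using that by (auto simp: I_def)
    then show ?thesis by (rule separating_class) blast
  qed
  then have "\<forall>i\<in>I. \<exists>D. case D of (e, M, r, \<epsilon>, k) \<Rightarrow> sepdat (fst i) (snd i) e M r \<epsilon> k" by auto
  then obtain D0 where D0: "\<forall>i\<in>I. case D0 i of (e, M, r, \<epsilon>, k) \<Rightarrow> sepdat (fst i) (snd i) e M r \<epsilon> k"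
    using bchoice[of I "\<lambda>i D. case D of (e, M, r, \<epsilon>, k) \<Rightarrow> sepdat (fst i) (snd i) e M r \<epsilon> k"] by blast
  define e where "e i = fst (D0 i)" for i
  define M where "M i = fst (snd (D0 i))" for i
  define r where "r i = fst (snd (snd (D0 i)))" for i
  define \<epsilon> where "\<epsilon> i = fst (snd (snd (snd (D0 i))))" for i
  define k where "k i = snd (snd (snd (snd (D0 i))))" for i
  have D: "sepdat (fst i) (snd i) (e i) (M i) (r i) (\<epsilon> i) (k i)" if "i \<in> I" for i
    using bspec[OF D0 that] by (simp add: e_def M_def r_def \<epsilon>_def k_def split_beta)
  define F where "F w i = (\<Sum>v\<in>V - {\<one>}. monom (int (k i (\<tau> w v))) (idx v))" for w i
  define \<phi> where "\<phi> w i = F w i ^ (p * M i) * of_int (\<epsilon> i)" for w i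
  have \<tau>1: "\<tau> w \<one> = \<one>" if "w \<in> W" for w using hom_one[OF \<tau>(1)[OF that] is_group is_group] .
  have F: "(\<Sum>v\<in>V. \<beta> v * of_nat (k i (\<tau> w v))) = F w i" if "w \<in> W" "i \<in> I" for w i
  proof -
    have "k i \<one> = 0" using D[OF that(2)] by (simp add: sepdat_def)
    then have "(\<Sum>v\<in>V. \<beta> v * of_nat (k i (\<tau> w v))) = (\<Sum>v\<in>V - {\<one>}. \<beta> v * of_nat (k i (\<tau> w v)))"
      using \<tau>1[OF that(1)] by (subst sum.remove[OF finV oneV]) simp
    also have "\<dots> = F w i" unfolding F_def
    proof (intro sum.cong refl)
      fix v assume "v \<in> V - {\<one>}"
      moreover have "of_nat j * monom 1 m = monom (int j) m" for j m by (simp add: of_nat_poly smult_monom)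
      ultimately show "\<beta> v * of_nat (k i (\<tau> w v)) = monom (int (k i (\<tau> w v))) (idx v)"
        by (simp add: \<beta>_def mult.commute[of "monom 1 _"])
    qed
    finally show ?thesis .
  qed
  let ?P = "of_nat p :: int poly"
  have prP: "prime_elem ?P" by (rule prime_elem_of_nat_int_poly[OF prime])
  have dvdP: "?P dvd of_int y \<longleftrightarrow> int p dvd y" for y
    by (auto simp: of_nat_dvd_int_poly_iff of_int_poly coeff_pCons split: nat.splits)
  have "\<exists>is. set is \<subseteq> I \<and> \<not> ?P dvd (\<Sum>w\<in>W. of_int (x w) * prod_list (map (\<phi> w) is))"
  proof (rule artin_independence[OF prP W])
    show "\<exists>w\<in>W. \<not> ?P dvd of_int (x w)" using x by (simp add: dvdP)
  next
    fix w w' assume w: "w \<in> W" "w' \<in> W" "w \<noteq> w'"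
    obtain v where v: "v \<in> V" "\<And>j::nat. \<tau> w' v \<noteq> \<tau> w v [^] j" using sep[OF w] by blast
    \<comment> \<open>For this pair the coefficient at v is 0 in the form of w and 1 in the form of
      w'. The preimage u of \<open>tau w' v\<close> under \<open>tau w\<close> supplies a
      coefficient 1 in the form of w.\<close>
    let ?i = "(\<tau> w v, \<tau> w' v)"
    have iI: "?i \<in> I" using v \<tau>(2) w by (auto simp: I_def)
    have d: "2 * (p * M ?i) = p ^ r ?i * (p - 1)" "\<not> int p dvd \<epsilon> ?i" "k ?i (\<tau> w v) = 0" "k ?i (\<tau> w' v) = 1" "k ?i \<one> = 0"
      using D[OF iI] by (simp_all add: sepdat_def)
    have v1: "v \<noteq> \<one>" using v(2)[of 0] \<tau>1[OF w(2)] by auto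
    have "\<tau> w' v \<in> \<tau> w ` V" using \<tau>(2) w v(1) by blast
    then obtain u where u: "u \<in> V" "\<tau> w u = \<tau> w' v" by auto
    then have "u \<noteq> \<one>" using d(4,5) \<tau>1[OF w(1)] by auto
    then have "\<not> eqm ?P (F w ?i ^ (p * M ?i)) (F w' ?i ^ (p * M ?i))"
      unfolding F_def using finV idx v v1 u d prime_gt_1_nat[OF prime] by (intro linear_form_powers_distinct[OF prime, of _ _ v _ _ u _ "r ?i"]) (auto intro: inj_on_subset)
    then have "\<not> ?P dvd (F w ?i ^ (p * M ?i) - F w' ?i ^ (p * M ?i)) * of_int (\<epsilon> ?i)"
      using prime_elem_dvd_multD[OF prP] d(2) dvdP unfolding eqm_def by blast
    then have "\<not> eqm ?P (\<phi> w ?i) (\<phi> w' ?i)" unfolding \<phi>_def eqm_def by (simp add: left_diff_distrib)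
    then show "\<exists>i\<in>I. \<not> eqm ?P (\<phi> w i) (\<phi> w' i)" using iI by blast
  qed
  then obtain js where js: "set js \<subseteq> I" "\<not> ?P dvd (\<Sum>w\<in>W. of_int (x w) * prod_list (map (\<phi> w) js))" by blast
  define ds where "ds = map (\<lambda>i. (M i, e i)) js"
  have dsp: "\<forall>d\<in>set ds. inv_on p (carrier G) (Suc (2 * fst d)) (snd d) \<and> cocyc p (Suc (2 * fst d)) (snd d)"
    using js(1) D by (auto simp: ds_def sepdat_def)
  have "eqm ?P (EV (\<lambda>xs. of_int (prodc ds (map (\<tau> w) xs))) \<one> (mword \<beta> (deg ds))) (prod_list (map (\<phi> w) js))"
    if w: "w \<in> W" for w
  proof -
    let ?ds = "map (\<lambda>d. (fst d, \<lambda>ys. snd d (map (\<tau> w) ys))) ds"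
    have \<tau>G: "\<tau> w y \<in> carrier G" if "y \<in> carrier G" for y using \<tau>(1)[OF w] that by (auto simp: hom_def)
    have tr: "map (\<tau> w) (map (\<lambda>y. h \<otimes> y) xs) = map (\<lambda>y. \<tau> w h \<otimes> y) (map (\<tau> w) xs)"
      if "h \<in> carrier G" "set xs \<subseteq> carrier G" for h xs
      using \<tau>(1)[OF w] that by (auto simp: hom_def subset_iff)
    have "inv_on p (carrier G) (Suc (2 * fst d)) (\<lambda>ys. snd d (map (\<tau> w) ys))" if d: "d \<in> set ds" for d
      unfolding inv_on_def
    proof (intro ballI allI impI)
      fix h xs assume h: "h \<in> carrier G" and xs: "set xs \<subseteq> carrier G" "length xs = Suc (2 * fst d)"
      have iv: "inv_on p (carrier G) (Suc (2 * fst d)) (snd d)" using dsp d by blast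
      show "eqm (int p) (snd d (map (\<tau> w) (map (\<lambda>y. h \<otimes> y) xs))) (snd d (map (\<tau> w) xs))"
        unfolding tr[OF h xs(1)] using \<tau>G h xs by (intro inv_onD[OF iv]) auto
    qed
    then have "eqm ?P (EV (\<lambda>xs. of_int (prodc ?ds xs)) \<one> (mword \<beta> (deg ?ds)))
        (prod_list (map (\<lambda>d. EV (\<lambda>xs. of_int (snd d xs)) \<one> (mword \<beta> (fst d))) ?ds))"
      by (intro EV_prodc) auto
    also have "deg ?ds = deg ds" by (simp add: comp_def)
    also have "prod_list (map (\<lambda>d. EV (\<lambda>xs. of_int (snd d xs)) \<one> (mword \<beta> (fst d))) ?ds)
        = prod_list (map (\<lambda>i. EV (\<lambda>xs. of_int (e i (map (\<tau> w) xs))) \<one> (mword \<beta> (M i))) js)"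
      by (simp add: ds_def comp_def)
    also have "eqm ?P \<dots> (prod_list (map (\<phi> w) js))"
      using js(1)
    proof (induction js)
      case (Cons i ks)
      have "eqm ?P (EV (\<lambda>xs. of_int (e i (map (\<tau> w) xs))) \<one> (mword \<beta> (M i))) (\<phi> w i)"
      proof -
        have i: "i \<in> I" using Cons.prems by simp
        have "\<forall>\<tau> \<beta>. \<tau> \<in> hom G G \<longrightarrow> \<tau> ` V \<subseteq> V \<longrightarrow> (\<Sum>v\<in>V. \<beta> v) = (0 :: int poly) \<longrightarrow>
          eqm (of_nat p) (EV (\<lambda>xs. of_int (e i (map \<tau> xs))) \<one> (mword \<beta> (M i)))
            ((\<Sum>v\<in>V. \<beta> v * of_nat (k i (\<tau> v))) ^ (p * M i) * of_int (\<epsilon> i))"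
          using D[OF i] unfolding sepdat_def by (elim conjE)
        from this[rule_format, OF \<tau>(1)[OF w] eq_refl[OF \<tau>(2)[OF w]] \<beta>0]
        show ?thesis unfolding F[OF w i] \<phi>_def .
      qed
      then show ?case using Cons by (auto intro: eqm_mult)
    qed simp
    finally show ?thesis by (simp only: prodc_map)
  qed
  then have e: "eqm ?P (\<Sum>w\<in>W. of_int (x w) * EV (\<lambda>xs. of_int (prodc ds (map (\<tau> w) xs))) \<one> (mword \<beta> (deg ds)))
      (\<Sum>w\<in>W. of_int (x w) * prod_list (map (\<phi> w) js))"
    by (intro eqm_sum eqm_mult eqm_refl)
  show thesis
  proof (rule that[OF dsp \<beta>0])
    show "\<not> ?P dvd (\<Sum>w\<in>W. of_int (x w) * EV (\<lambda>xs. of_int (prodc ds (map (\<tau> w) xs))) \<one> (mword \<beta> (deg ds)))"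
      using js(2) eqm_trans[OF eqm_sym[OF e]] unfolding eqm_0_iff[symmetric] by blast
  qed
qed

end

section \<open>The character and the value of the functional on a transfer\<close>

context central_elementary
begin

text \<open>A character of the nontrivial p-group G/V, inflated to G.\<close>

lemma character:
  obtains X :: "'a \<Rightarrow> int" and c where "\<And>g h. g \<in> carrier G \<Longrightarrow> h \<in> carrier G \<Longrightarrow> eqm (int p) (X (g \<otimes> h)) (X g + X h)"
    and "\<And>v. v \<in> V \<Longrightarrow> eqm (int p) (X v) 0" and "c \<in> carrier G" "\<not> int p dvd X c"
proof -
  have "x \<otimes> h \<otimes> inv x \<in> V" if "x \<in> carrier G" "h \<in> V" for x h
  proof -
    have "x \<otimes> h = h \<otimes> x" using V_central[of h x] that by simp
    then show ?thesis using that VG by (simp add: m_assoc)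
  qed
  then interpret N: normal V G using V normal_inv_iff by blast
  define Q where "Q = G Mod V"
  have cQ: "carrier Q = (\<lambda>x. V #> x) ` carrier G" by (auto simp: Q_def carrier_FactGroup)
  have Qr: "carrier Q = rcosets V" by (simp add: Q_def FactGroup_def)
  have lag: "card (carrier Q) * card V = p ^ n" using lagrange[OF V] order by (simp add: Qr)
  then obtain r where r: "Coset.order Q = p ^ r"
    using divides_primepow_nat[OF prime, of "card (carrier Q)" n] by (metis Coset.order_def dvd_triv_left)
  have "r \<noteq> 0"
  proof
    assume "r = 0"
    then have "card V = card (carrier G)" using lag r order by (simp add: Coset.order_def)
    then show False using V_proper card_subset_eq[OF fin subgroup.subset[OF V]] by simp
  qed
  then obtain s where s: "r = Suc s" by (cases r) auto
  interpret Q: group Q unfolding Q_def by (rule N.factorgroup_is_group)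
  have finQ: "finite (carrier Q)" using fin by (simp add: cQ)
  obtain X :: "'a set \<Rightarrow> int" and c where X: "\<And>g h. g \<in> carrier Q \<Longrightarrow> h \<in> carrier Q \<Longrightarrow> eqm (int p) (X (g \<otimes>\<^bsub>Q\<^esub> h)) (X g + X h)"
    and c: "c \<in> carrier Q" "\<not> int p dvd X c"
    by (rule Q.p_group_character[OF finQ prime r[unfolded s]]) (assumption | rule that)+
  obtain c' where c': "c' \<in> carrier G" "c = V #> c'" using c(1) cQ by auto
  show thesis
  proof (rule that[of "\<lambda>g. X (V #> g)" c'])
    fix g h assume g: "g \<in> carrier G" "h \<in> carrier G"
    have "V #> (g \<otimes> h) = (V #> g) \<otimes>\<^bsub>Q\<^esub> (V #> h)" using g by (simp add: Q_def N.rcos_sum)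
    then show "eqm (int p) (X (V #> (g \<otimes> h))) (X (V #> g) + X (V #> h))" using X[of "V #> g" "V #> h"] g by (simp add: cQ)
  next
    fix v assume v: "v \<in> V"
    have e: "V #> v = \<one>\<^bsub>Q\<^esub>" using coset_join2[OF VG[OF v] V v] by (simp add: Q_def)
    have "eqm (int p) (X \<one>\<^bsub>Q\<^esub>) (X \<one>\<^bsub>Q\<^esub> + X \<one>\<^bsub>Q\<^esub>)" using X[OF Q.one_closed Q.one_closed] by simp
    then have "eqm (int p) (X \<one>\<^bsub>Q\<^esub>) 0" by (simp add: eqm_def)
    then show "eqm (int p) (X (V #> v)) 0" unfolding e .
  qed (use c c' in auto)
qed

lemma SH_xcup_hom:
  fixes \<beta> :: "'a \<Rightarrow> 'k::comm_ring_1"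
  assumes \<tau>: "\<tau> \<in> hom G G" "\<tau> ` V \<subseteq> V" and c: "c \<in> carrier G" and X: "\<And>v. v \<in> V \<Longrightarrow> eqm (int p) (X v) 0"
    and r: "inv_on p (carrier G) (Suc (2 * L)) r"
  shows "eqm (of_nat p) (SH (\<lambda>\<Phi> g. \<Phi> (g \<otimes> c)) (\<lambda>xs. of_int (xcup X r (map \<tau> xs))) \<one> (mword \<beta> L))
    (of_int (X (\<tau> c)) * EV (\<lambda>xs. of_int (r (map \<tau> xs))) \<one> (mword \<beta> L))"
proof -
  let ?T = "\<lambda>\<Phi> g. \<Phi> (g \<otimes> c) :: 'k" and ?X = "\<lambda>y. X (\<tau> y)" and ?r = "\<lambda>xs. r (map \<tau> xs)"
  interpret \<tau>: group_hom G G \<tau> using \<tau>(1) by (simp add: group_hom_def group_hom_axioms_def)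
  have T: "letters.lop (of_nat p) (carrier G) (\<otimes>) ?T"
    by (rule letters.lopI[OF letters_carrier]) (use c in \<open>auto simp: lin_def m_assoc\<close>)
  have tr: "map \<tau> (map (\<lambda>y. h \<otimes> y) xs) = map (\<lambda>y. \<tau> h \<otimes> y) (map \<tau> xs)"
    if "h \<in> carrier G" "set xs \<subseteq> carrier G" for h xs using that by auto
  have iv: "inv_on p (carrier G) (Suc (2 * L)) ?r"
    unfolding inv_on_def
  proof (intro ballI allI impI)
    fix h xs assume h: "h \<in> carrier G" and xs: "set xs \<subseteq> carrier G" "length xs = Suc (2 * L)"
    show "eqm (int p) (r (map \<tau> (map (\<lambda>y. h \<otimes> y) xs))) (r (map \<tau> xs))"
      unfolding tr[OF h xs(1)] using h xs by (intro inv_onD[OF r]) auto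
  qed
  have "eqm (of_nat p) (SH ?T (\<lambda>xs. of_int (xcup X r (map \<tau> xs))) \<one> (mword \<beta> L))
      (SH ?T (\<lambda>xs. of_int (xcup ?X ?r xs)) \<one> (mword \<beta> L))"
  proof (rule letters.SH_cong[OF letters_carrier T mword_lop])
    fix xs assume xs: "set xs \<subseteq> carrier G" "length xs = Suc (length (mword \<beta> L))"
    then obtain y ys where "xs = y # ys" by (cases xs) auto
    then show "eqm (of_nat p :: 'k) (of_int (xcup X r (map \<tau> (\<one> # xs)))) (of_int (xcup ?X ?r (\<one> # xs)))"
      using xs by (simp add: xcup_simp)
  qed simp
  also have "eqm (of_nat p) \<dots> (of_int (X (\<tau> c)) * EV (\<lambda>xs. of_int (?r xs)) \<one> (mword \<beta> L))"
    using X \<tau>(2) by (intro SH_xcup[OF c _ iv]) auto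
  finally show ?thesis .
qed

text \<open>The functional is applied to the sum of conjugates of \<open>xcup X r\<close>: it kills
  the coboundary, and \<open>SH_xcup_hom\<close> evaluates each summand.\<close>

lemma transfer_det:
  fixes \<beta> :: "'a \<Rightarrow> 'k::comm_ring_1"
  assumes \<tau>: "\<And>w. w \<in> W \<Longrightarrow> \<tau> w \<in> hom G G" "\<And>w. w \<in> W \<Longrightarrow> \<tau> w ` V \<subseteq> V"
    and \<beta>: "(\<Sum>v\<in>V. \<beta> v) = 0" and c: "c \<in> carrier G" and X: "\<And>v. v \<in> V \<Longrightarrow> eqm (int p) (X v) 0"
    and r: "inv_on p (carrier G) (Suc (2 * L)) r"
    and cob: "cobdry p (carrier G) (Suc (2 * L)) (\<lambda>xs. \<Sum>w\<in>W. xcup X r (map (\<tau> w) xs))"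
  shows "of_nat p dvd (\<Sum>w\<in>W. of_int (X (\<tau> w c)) * EV (\<lambda>xs. of_int (r (map (\<tau> w) xs))) \<one> (mword \<beta> L))"
proof -
  let ?T = "\<lambda>\<Phi> g. \<Phi> (g \<otimes> c) :: 'k"
  have "lin ?T" by (simp add: lin_def)
  moreover have "\<forall>a\<in>set (mword \<beta> L). lin a"
    using mword_lop[of \<beta> L "of_nat p"] letters.lop_lin[OF letters_carrier] by blast
  ultimately have "SH ?T (\<lambda>xs. \<Sum>w\<in>W. of_int (xcup X r (map (\<tau> w) xs))) \<one> (mword \<beta> L)
      = (\<Sum>w\<in>W. SH ?T (\<lambda>xs. of_int (xcup X r (map (\<tau> w) xs))) \<one> (mword \<beta> L))" by (rule SH_sum)
  also have "eqm (of_nat p) \<dots> (\<Sum>w\<in>W. of_int (X (\<tau> w c)) * EV (\<lambda>xs. of_int (r (map (\<tau> w) xs))) \<one> (mword \<beta> L))"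
    by (intro eqm_sum SH_xcup_hom \<tau> c X r)
  finally have 1: "eqm (of_nat p) (SH ?T (\<lambda>xs. \<Sum>w\<in>W. of_int (xcup X r (map (\<tau> w) xs))) \<one> (mword \<beta> L))
      (\<Sum>w\<in>W. of_int (X (\<tau> w c)) * EV (\<lambda>xs. of_int (r (map (\<tau> w) xs))) \<one> (mword \<beta> L))" .
  have "eqm (of_nat p) (SH ?T (\<lambda>xs. of_int (\<Sum>w\<in>W. xcup X r (map (\<tau> w) xs))) \<one> (mword \<beta> L)) 0"
    by (rule SH_cobdry[OF \<beta> c cob])
  then have "eqm (of_nat p) (SH ?T (\<lambda>xs. \<Sum>w\<in>W. of_int (xcup X r (map (\<tau> w) xs))) \<one> (mword \<beta> L)) 0"
    by (simp only: of_int_sum)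
  from eqm_trans[OF eqm_sym[OF 1] this] show ?thesis by (simp add: eqm_0_iff)
qed

end

section \<open>Conjugation in p-groups and the undetected class\<close>

context group
begin

lemma cobdry_minus: "cobdry p H n f \<Longrightarrow> cobdry p H n (\<lambda>xs. - f xs)"
proof -
  assume "cobdry p H n f"
  then obtain u where u: "inv_on p H n u" "\<And>xs. set xs \<subseteq> carrier G \<Longrightarrow> length xs = Suc n \<Longrightarrow> eqm (int p) (f xs) (cobd u xs)"
    unfolding cobdry_def by blast
  have "inv_on p H n (\<lambda>xs. - u xs)" using u(1) by (auto simp: inv_on_def intro: eqm_minus)
  then show ?thesis unfolding cobdry_def using u(2)
    by (intro exI[of _ "\<lambda>xs. - u xs"] conjI allI impI) (auto simp: cobd_minus intro: eqm_minus)
qed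

lemma cobdry_zero: "cobdry p H n (\<lambda>_. 0)"
  unfolding cobdry_def by (intro exI[of _ "\<lambda>_. 0"]) (auto simp: inv_on_def cobd_zero)

lemma cobdry_sum: "(\<And>i. i \<in> I \<Longrightarrow> cobdry p H n (f i)) \<Longrightarrow> cobdry p H n (\<lambda>xs. \<Sum>i\<in>I. f i xs)"
proof (induction I rule: infinite_finite_induct)
  case (insert i I)
  have "cobdry p H n (\<lambda>xs. f i xs + (\<Sum>i\<in>I. f i xs))" using insert by (intro cobdry_add) auto
  then show ?case using insert.hyps by simp
qed (simp_all add: cobdry_zero)

lemma cobdry_mono: "cobdry p H n f \<Longrightarrow> K \<subseteq> H \<Longrightarrow> cobdry p K n f"
  unfolding cobdry_def using inv_on_mono by blast

lemma conj_mult: "g \<in> carrier G \<Longrightarrow> x \<in> carrier G \<Longrightarrow> y \<in> carrier G \<Longrightarrow>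
    inv g \<otimes> (x \<otimes> y) \<otimes> g = (inv g \<otimes> x \<otimes> g) \<otimes> (inv g \<otimes> y \<otimes> g)"
proof -
  assume c: "g \<in> carrier G" "x \<in> carrier G" "y \<in> carrier G"
  have "(inv g \<otimes> x \<otimes> g) \<otimes> (inv g \<otimes> y \<otimes> g) = inv g \<otimes> x \<otimes> (g \<otimes> inv g) \<otimes> y \<otimes> g"
    using c by (simp only: m_assoc m_closed inv_closed)
  then show ?thesis using c by (simp add: m_assoc)
qed

lemma conj_cancel: "g \<in> carrier G \<Longrightarrow> x \<in> carrier G \<Longrightarrow> g \<otimes> (inv g \<otimes> x \<otimes> g) \<otimes> inv g = x"
proof -
  assume g: "g \<in> carrier G" "x \<in> carrier G"
  have "g \<otimes> (inv g \<otimes> x \<otimes> g) \<otimes> inv g = (g \<otimes> inv g) \<otimes> x \<otimes> (g \<otimes> inv g)"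
    using g by (simp only: m_assoc m_closed inv_closed)
  then show ?thesis using g by simp
qed

lemma conj_conj: "g \<in> carrier G \<Longrightarrow> h \<in> carrier G \<Longrightarrow> x \<in> carrier G \<Longrightarrow>
    (inv h \<otimes> g) \<otimes> (inv g \<otimes> x \<otimes> g) \<otimes> (inv g \<otimes> h) = inv h \<otimes> x \<otimes> h"
proof -
  assume g: "g \<in> carrier G" "h \<in> carrier G" "x \<in> carrier G"
  have "(inv h \<otimes> g) \<otimes> (inv g \<otimes> x \<otimes> g) \<otimes> (inv g \<otimes> h) = inv h \<otimes> (g \<otimes> (inv g \<otimes> x \<otimes> g) \<otimes> inv g) \<otimes> h"
    using g by (simp only: m_assoc m_closed inv_closed)
  then show ?thesis by (simp only: conj_cancel[OF g(1,3)])
qed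

lemma conj_swap: "g \<in> carrier G \<Longrightarrow> x \<in> carrier G \<Longrightarrow> g \<otimes> (inv g \<otimes> x \<otimes> g) = x \<otimes> g"
proof -
  assume g: "g \<in> carrier G" "x \<in> carrier G"
  have "g \<otimes> (inv g \<otimes> x \<otimes> g) = (g \<otimes> inv g) \<otimes> x \<otimes> g"
    using g by (simp only: m_assoc m_closed inv_closed)
  then show ?thesis using g by simp
qed

lemma conj_pow: "g \<in> carrier G \<Longrightarrow> x \<in> carrier G \<Longrightarrow> (inv g \<otimes> x \<otimes> g) [^] (j::nat) = inv g \<otimes> x [^] j \<otimes> g"
proof (induction j)
  case (Suc j)
  then show ?case using conj_mult[of g "x [^] j" x] by simp
qed simp

lemma pow_mod: "a \<in> carrier G \<Longrightarrow> a [^] (p::nat) = \<one> \<Longrightarrow> a [^] (k mod p) = a [^] k"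
proof -
  assume a: "a \<in> carrier G" "a [^] p = \<one>"
  have "a [^] k = a [^] (p * (k div p) + k mod p)" by simp
  also have "\<dots> = (a [^] p) [^] (k div p) \<otimes> a [^] (k mod p)" using a(1) by (simp only: nat_pow_mult nat_pow_pow)
  finally show ?thesis using a by simp
qed

text \<open>An element of a p-group acts on a normalized subgroup of order p by an automorphism of
  p-power order, and the only such automorphism is the identity.\<close>

lemma p_group_conj_power:
  fixes p :: nat
  assumes fin: "finite (carrier G)" and p: "Factorial_Ring.prime p" and order: "Coset.order G = p ^ n"
    and a: "a \<in> carrier G" "a [^] p = \<one>" and g: "g \<in> carrier G" and j: "inv g \<otimes> a \<otimes> g = a [^] (j::nat)"
  shows "inv g \<otimes> a \<otimes> g = a"
proof -
  have it: "inv (g [^] i) \<otimes> a \<otimes> g [^] i = a [^] (j ^ i)" for i :: nat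
  proof (induction i)
    case (Suc i)
    have "inv (g [^] Suc i) \<otimes> a \<otimes> g [^] Suc i = inv g \<otimes> (inv (g [^] i) \<otimes> a \<otimes> g [^] i) \<otimes> g"
      using g a by (simp add: inv_mult_group m_assoc)
    also have "\<dots> = inv g \<otimes> a [^] (j ^ i) \<otimes> g" by (simp only: Suc)
    also have "\<dots> = a [^] (j ^ Suc i)" using conj_pow[OF g a(1), of "j ^ i"] a(1) unfolding j by (simp add: nat_pow_pow)
    finally show ?case .
  qed (use a in simp)
  \<comment> \<open>Fermat: g^(p^n) = 1 conjugates a to a^(j^(p^n)), and this exponent is j modulo
    p, so a^j = a.\<close>
  have "int p dvd int (j ^ (p ^ n)) - int j"
    using nat_power_prime_power[OF p, of j n, where ?'k = int] by (simp add: eqm_def)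
  then have "j ^ (p ^ n) mod p = j mod p" by (metis mod_eq_dvd_iff of_nat_eq_iff of_nat_mod)
  then have "a [^] (j ^ (p ^ n)) = a [^] j" using pow_mod[OF a] by metis
  moreover have "a [^] (j ^ (p ^ n)) = a" using it[of "p ^ n"] pow_order[OF fin g] order a by simp
  ultimately show ?thesis using j by simp
qed

lemma centralizer_subgroup: "S \<subseteq> carrier G \<Longrightarrow> subgroup (centralizer G S) G"
proof (rule subgroupI)
  assume S: "S \<subseteq> carrier G"
  show "centralizer G S \<subseteq> carrier G" by (auto simp: centralizer_def)
  have "\<one> \<in> centralizer G S" using S by (auto simp: centralizer_def)
  then show "centralizer G S \<noteq> {}" by blast
  fix a assume a: "a \<in> centralizer G S"
  show "inv a \<in> centralizer G S"
    unfolding centralizer_def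
  proof (intro CollectI conjI ballI)
    fix s assume s: "s \<in> S"
    have aG: "a \<in> carrier G" "s \<in> carrier G" "a \<otimes> s = s \<otimes> a" using a s S by (auto simp: centralizer_def)
    have "inv a \<otimes> s = inv a \<otimes> (s \<otimes> a) \<otimes> inv a" using aG(1,2) by (simp add: m_assoc)
    also have "\<dots> = inv a \<otimes> (a \<otimes> s) \<otimes> inv a" by (simp only: aG(3))
    also have "\<dots> = s \<otimes> inv a" using aG(1,2) by (simp add: m_assoc[symmetric])
    finally show "inv a \<otimes> s = s \<otimes> inv a" .
  qed (use a in \<open>auto simp: centralizer_def\<close>)
  fix b assume b: "b \<in> centralizer G S"
  show "a \<otimes> b \<in> centralizer G S"
    unfolding centralizer_def
  proof (intro CollectI conjI ballI)
    fix s assume s: "s \<in> S"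
    have c: "a \<in> carrier G" "b \<in> carrier G" "s \<in> carrier G" "a \<otimes> s = s \<otimes> a" "b \<otimes> s = s \<otimes> b"
      using a b s S by (auto simp: centralizer_def)
    have "a \<otimes> b \<otimes> s = a \<otimes> s \<otimes> b" using c(1,2,3,5) by (simp add: m_assoc)
    also have "\<dots> = s \<otimes> (a \<otimes> b)" using c(1,2,3) unfolding c(4) by (simp add: m_assoc)
    finally show "a \<otimes> b \<otimes> s = s \<otimes> (a \<otimes> b)" .
  qed (use a b in \<open>auto simp: centralizer_def\<close>)
qed

text \<open>The hypothesis \<open>max\<close> serves both halves. It makes the class vanish on
  subgroups of exponent p, and it forces a conjugate of V inside C to be V itself, so that the
  cosets fixed by V act on V.\<close>

theorem undetected_cocycle:
  fixes p n :: nat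
  assumes fin: "finite (carrier G)" and p: "Factorial_Ring.prime p" and order: "Coset.order G = p ^ n"
    and V: "subgroup V G" and V_comm: "\<And>v w. v \<in> V \<Longrightarrow> w \<in> V \<Longrightarrow> v \<otimes> w = w \<otimes> v"
    and V_pow: "\<And>v. v \<in> V \<Longrightarrow> v [^] p = \<one>"
    and max: "\<And>d. d \<in> centralizer G V \<Longrightarrow> d [^] p = \<one> \<Longrightarrow> d \<in> V" and ne: "centralizer G V \<noteq> V"
  obtains m f where "inv_on p (carrier G) (Suc (Suc m)) f" "cocyc p (Suc (Suc m)) f"
    "\<And>E. subgroup E G \<Longrightarrow> (\<And>e. e \<in> E \<Longrightarrow> e [^] p = \<one>) \<Longrightarrow> cobdry p E (Suc m) f"
    "\<not> cobdry p (carrier G) (Suc m) f"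
proof -
  define C where "C = centralizer G V"
  have VG: "v \<in> carrier G" if "v \<in> V" for v using subgroup.mem_carrier[OF V that] .
  have finV: "finite V" using finite_subset[OF subgroup.subset[OF V] fin] .
  have C: "subgroup C G" unfolding C_def by (rule centralizer_subgroup[OF subgroup.subset[OF V]])
  have CG: "c \<in> carrier G" if "c \<in> C" for c using subgroup.mem_carrier[OF C that] .
  have VC: "V \<subseteq> C" using VG V_comm by (auto simp: C_def centralizer_def)
  have cen: "c \<otimes> v = v \<otimes> c" if "c \<in> C" "v \<in> V" for c v using that by (auto simp: C_def centralizer_def)
  define H where "H = G\<lparr>carrier := C\<rparr>"
  have Hs: "carrier H = C" "monoid.mult H = (\<otimes>)" "\<one>\<^bsub>H\<^esub> = \<one>" by (simp_all add: H_def)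
  have Hpow: "x [^]\<^bsub>H\<^esub> (j::nat) = x [^] j" for x j unfolding H_def by (rule nat_pow_consistent[symmetric])
  have Hinv: "inv\<^bsub>H\<^esub> x = inv x" if "x \<in> C" for x unfolding H_def by (rule m_inv_consistent[OF C that])
  have "card C dvd p ^ n" using lagrange[OF C] order by (metis dvd_triv_right)
  then obtain k where k: "card C = p ^ k" using divides_primepow_nat[OF p] by auto
  interpret H: central_elementary H p k V
  proof (intro central_elementary.intro central_elementary_axioms.intro)
    show "group H" unfolding H_def by (rule subgroup_imp_group[OF C])
    show "finite (carrier H)" unfolding Hs using finite_subset[OF subgroup.subset[OF C] fin] .
    show "Coset.order H = p ^ k" using k by (simp add: Coset.order_def Hs)
    show "subgroup V H" unfolding H_def by (rule subgroup_incl[OF V C VC])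
    show "v \<otimes>\<^bsub>H\<^esub> g = g \<otimes>\<^bsub>H\<^esub> v" if "v \<in> V" "g \<in> carrier H" for v g
      using cen[of g v] that by (simp add: Hs)
    show "v [^]\<^bsub>H\<^esub> p = \<one>\<^bsub>H\<^esub>" if "v \<in> V" for v using V_pow[OF that] by (simp add: Hpow Hs)
    show "V \<noteq> carrier H" using ne by (simp add: Hs C_def)
  qed (rule p)
  obtain X :: "'a \<Rightarrow> int" and c where X: "\<And>g h. g \<in> carrier H \<Longrightarrow> h \<in> carrier H \<Longrightarrow> eqm (int p) (X (g \<otimes>\<^bsub>H\<^esub> h)) (X g + X h)"
    and XV: "\<And>v. v \<in> V \<Longrightarrow> eqm (int p) (X v) 0" and c: "c \<in> carrier H" "\<not> int p dvd X c"
    by (rule H.character) (assumption | rule that)+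
  \<comment> \<open>The zero cocycle gives access to the cosets and their representatives before b
    exists; b is chosen only after the cosets in W and their conjugations are known.\<close>
  interpret Z: coset_family G p C 0 "\<lambda>_. 0"
    by (intro coset_family.intro coset_family_axioms.intro fin p C)
      (auto simp: inv_on_def cocyc_def cobd_zero is_group)
  \<comment> \<open>These are the cosets tC for which t^-1 V t lies in C.\<close>
  define W where "W = {S\<in>Z.Cos. \<forall>v\<in>V. v <#\<^bsub>G\<^esub> S = S}"
  have finW: "finite W" using Z.Cos_fin by (simp add: W_def)
  define \<tau> where "\<tau> S x = inv (Z.rp S) \<otimes> x \<otimes> Z.rp S" for S x
  have t: "Z.rp S \<in> carrier G" "S = Z.rp S <#\<^bsub>G\<^esub> C" if "S \<in> W" for S using Z.rp_Cos[of S] that by (auto simp: W_def)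
  have fixed_iff: "h <#\<^bsub>G\<^esub> S = S \<longleftrightarrow> \<tau> S h \<in> C" if S: "S \<in> W" and h: "h \<in> carrier G" for S h
  proof -
    have "h <#\<^bsub>G\<^esub> S = h <#\<^bsub>G\<^esub> (Z.rp S <#\<^bsub>G\<^esub> C)" using t(2)[OF S] by (rule arg_cong)
    also have "\<dots> = (h \<otimes> Z.rp S) <#\<^bsub>G\<^esub> C" using h t(1)[OF S] subgroup.subset[OF C] by (simp add: lcos_m_assoc)
    finally have e: "h <#\<^bsub>G\<^esub> S = (h \<otimes> Z.rp S) <#\<^bsub>G\<^esub> C" .
    have "h <#\<^bsub>G\<^esub> S = S \<longleftrightarrow> Z.rp S <#\<^bsub>G\<^esub> C = (h \<otimes> Z.rp S) <#\<^bsub>G\<^esub> C" unfolding e using t(2)[OF S] by auto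
    also have "\<dots> \<longleftrightarrow> inv (Z.rp S) \<otimes> (h \<otimes> Z.rp S) \<in> C" using h t(1)[OF S] by (intro Z.lcos_eq_iff) auto
    also have "inv (Z.rp S) \<otimes> (h \<otimes> Z.rp S) = \<tau> S h" using h t(1)[OF S] by (simp add: \<tau>_def m_assoc)
    finally show ?thesis .
  qed
  have \<tau>m: "\<tau> S (x \<otimes> y) = \<tau> S x \<otimes> \<tau> S y" if "S \<in> W" "x \<in> carrier G" "y \<in> carrier G" for S x y
    unfolding \<tau>_def using conj_mult[OF t(1)[OF that(1)] that(2,3)] .
  have \<tau>G: "\<tau> S x \<in> carrier G" if "S \<in> W" "x \<in> carrier G" for S x using t(1) that by (simp add: \<tau>_def)
  \<comment> \<open>A conjugate of V inside C has exponent p, hence lies in V by \<open>max\<close>;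
    finiteness gives equality.\<close>
  have \<tau>V: "\<tau> S ` V = V" if S: "S \<in> W" for S
  proof -
    have "\<tau> S v \<in> V" if v: "v \<in> V" for v
    proof -
      have "\<tau> S v \<in> C" using S v fixed_iff[OF S VG[OF v]] by (auto simp: W_def)
      moreover have "\<tau> S v [^] p = \<one>" unfolding \<tau>_def using conj_pow[OF t(1)[OF S] VG[OF v]] V_pow[OF v] t(1)[OF S] by simp
      ultimately show ?thesis using max by (simp add: C_def)
    qed
    then have "\<tau> S ` V \<subseteq> V" by blast
    moreover have "inj_on (\<tau> S) V"
    proof (rule inj_on_inverseI)
      fix v assume "v \<in> V"
      then have v: "v \<in> carrier G" by (rule VG)
      show "Z.rp S \<otimes> \<tau> S v \<otimes> inv (Z.rp S) = v" unfolding \<tau>_def by (rule conj_cancel[OF t(1)[OF S] v])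
    qed
    ultimately show ?thesis by (rule endo_inj_surj[OF finV])
  qed
  have \<tau>V_mem: "\<tau> S v \<in> V" if "S \<in> W" "v \<in> V" for S v
    using imageI[OF that(2), of "\<tau> S"] unfolding \<tau>V[OF that(1)] .
  have \<tau>V_ex: "\<exists>w\<in>V. v = \<tau> S w" if S: "S \<in> W" and v: "v \<in> V" for S v
  proof -
    have "v \<in> \<tau> S ` V" using v unfolding \<tau>V[OF S] .
    then show ?thesis unfolding image_iff .
  qed
  have \<tau>C: "\<tau> S x \<in> C" if S: "S \<in> W" and x: "x \<in> C" for S x
  proof -
    have "\<tau> S x \<otimes> v = v \<otimes> \<tau> S x" if vV: "v \<in> V" for v
    proof -
      obtain w where w: "w \<in> V" "v = \<tau> S w" using \<tau>V_ex[OF S vV] by (elim bexE)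
      have "\<tau> S x \<otimes> \<tau> S w = \<tau> S (x \<otimes> w)" using \<tau>m[OF S CG[OF x] VG[OF w(1)]] by (rule sym)
      also have "\<dots> = \<tau> S (w \<otimes> x)" using cen[OF x w(1)] by (rule arg_cong)
      also have "\<dots> = \<tau> S w \<otimes> \<tau> S x" by (rule \<tau>m[OF S VG[OF w(1)] CG[OF x]])
      finally show ?thesis unfolding w(2) .
    qed
    then show ?thesis using \<tau>G[OF S CG[OF x]] by (simp add: C_def centralizer_def)
  qed
  have \<tau>hom: "\<tau> S \<in> hom H H" if "S \<in> W" for S
    using \<tau>C[OF that] \<tau>m[OF that] CG by (auto simp: hom_def Hs)
  \<comment> \<open>For g = t^-1 t' outside C, some element of V does not commute with g. Were the
    corresponding g^-1 a g a power of a, it would equal a by \<open>p_group_conj_power\<close>, a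
    contradiction.\<close>
  have sep: "\<exists>v\<in>V. \<forall>j::nat. \<tau> S' v \<noteq> \<tau> S v [^]\<^bsub>H\<^esub> j" if S: "S \<in> W" "S' \<in> W" "S \<noteq> S'" for S S'
  proof -
    define g where "g = inv (Z.rp S) \<otimes> Z.rp S'"
    have gG: "g \<in> carrier G" using t(1) S by (simp add: g_def)
    have "g \<notin> C"
    proof
      assume "g \<in> C"
      then have "Z.rp S <#\<^bsub>G\<^esub> C = Z.rp S' <#\<^bsub>G\<^esub> C"
        unfolding g_def Z.lcos_eq_iff[OF t(1)[OF S(1)] t(1)[OF S(2)]] .
      then have "S = Z.rp S' <#\<^bsub>G\<^esub> C" using t(2)[OF S(1)] by (rule trans[rotated])
      also have "\<dots> = S'" using t(2)[OF S(2)] by (rule sym)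
      finally show False using S(3) by simp
    qed
    then obtain v where v: "v \<in> V" "g \<otimes> v \<noteq> v \<otimes> g" using gG by (auto simp: C_def centralizer_def)
    obtain w where w: "w \<in> V" "v = \<tau> S' w" using \<tau>V_ex[OF S(2) v(1)] by (elim bexE)
    define a where "a = \<tau> S w"
    have aV: "a \<in> V" unfolding a_def by (rule \<tau>V_mem[OF S(1) w(1)])
    have ig: "inv g = inv (Z.rp S') \<otimes> Z.rp S" unfolding g_def using t(1) S by (simp add: inv_mult_group)
    have va: "v = inv g \<otimes> a \<otimes> g"
    proof -
      have "(inv (Z.rp S') \<otimes> Z.rp S) \<otimes> a \<otimes> (inv (Z.rp S) \<otimes> Z.rp S') = v"
        unfolding a_def w(2) \<tau>_def by (rule conj_conj[OF t(1)[OF S(1)] t(1)[OF S(2)] VG[OF w(1)]])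
      then show ?thesis unfolding ig unfolding g_def by (rule sym)
    qed
    have "v \<noteq> a [^] j" for j :: nat
    proof
      assume "v = a [^] j"
      then have "inv g \<otimes> a \<otimes> g = a" using va by (intro p_group_conj_power[OF fin p order VG[OF aV] V_pow[OF aV] gG, of j]) simp
      then have "v = a" using va by simp
      moreover have "g \<otimes> v = a \<otimes> g" unfolding va by (rule conj_swap[OF gG VG[OF aV]])
      ultimately show False using v(2) by simp
    qed
    then show ?thesis using w by (auto simp: Hpow a_def)
  qed
  have W1: "C \<in> W"
  proof -
    have "C = \<one> <#\<^bsub>G\<^esub> C" using lcos_mult_one[OF subgroup.subset[OF C]] by simp
    then have "C \<in> Z.Cos" unfolding Z.Cos_def by blast
    moreover have "v <#\<^bsub>G\<^esub> C = C" if "v \<in> V" for v using coset_join3[OF VG[OF that] C] VC that by blast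
    ultimately show ?thesis by (simp add: W_def)
  qed
  \<comment> \<open>The coset C supplies a nonzero coefficient: its representative lies in C, and
    additivity makes X insensitive to conjugation within C.\<close>
  have "\<not> int p dvd X (\<tau> C c)"
  proof -
    have "Z.rp C \<otimes> \<one> \<in> Z.rp C <#\<^bsub>G\<^esub> C" unfolding l_coset_def using subgroup.one_closed[OF C] by blast
    then have t0: "Z.rp C \<in> C" using t[OF W1] by simp
    have cC: "c \<in> C" using c(1) by (simp add: Hs)
    have sw: "Z.rp C \<otimes> \<tau> C c = c \<otimes> Z.rp C" unfolding \<tau>_def by (rule conj_swap[OF CG[OF t0] CG[OF cC]])
    have "eqm (int p) (X (Z.rp C \<otimes> \<tau> C c)) (X (Z.rp C) + X (\<tau> C c))" "eqm (int p) (X (c \<otimes> Z.rp C)) (X c + X (Z.rp C))"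
      using X[of "Z.rp C" "\<tau> C c"] X[of c "Z.rp C"] t0 cC \<tau>C[OF W1 cC] unfolding Hs by blast+
    then have "eqm (int p) (X (Z.rp C) + X (\<tau> C c)) (X c + X (Z.rp C))"
      unfolding sw by (rule eqm_trans[OF eqm_sym])
    then have "int p dvd X (\<tau> C c) - X c" by (simp add: eqm_def)
    then show ?thesis using c(2) by (metis dvd_diff_right_iff)
  qed
  then have ex: "\<exists>S\<in>W. \<not> int p dvd X (\<tau> S c)" using W1 by blast
  obtain ds and \<beta> :: "'a \<Rightarrow> int poly" where
    ds: "\<forall>d\<in>set ds. H.inv_on p (carrier H) (Suc (2 * fst d)) (snd d) \<and> H.cocyc p (Suc (2 * fst d)) (snd d)"
    and \<beta>: "(\<Sum>v\<in>V. \<beta> v) = 0"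
    and nd: "\<not> of_nat p dvd (\<Sum>S\<in>W. of_int (X (\<tau> S c)) * EV (\<lambda>xs. of_int (prodc ds (map (\<tau> S) xs))) \<one>\<^bsub>H\<^esub> (H.mword \<beta> (deg ds)))"
    by (rule H.classes_independent[where x = "\<lambda>S. X (\<tau> S c)", OF finW \<tau>hom \<tau>V sep ex]) (assumption | rule that)+
  define L where "L = deg ds"
  have r: "H.inv_on p (carrier H) (Suc (2 * L)) (prodc ds)" unfolding L_def using ds by (intro H.prodc_inv) blast
  have rc: "H.cocyc p (Suc (2 * L)) (prodc ds)" unfolding L_def using ds by (intro H.prodc_coc) blast
  define b0 where "b0 = H.xcup X (prodc ds)"
  have b0i: "H.inv_on p (carrier H) (Suc (Suc (2 * L))) b0" unfolding b0_def by (rule H.xcup_inv[OF _ r]) simp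
  have b0c: "H.cocyc p (Suc (Suc (2 * L))) b0" unfolding b0_def by (rule H.xcup_coc[OF X rc])
  \<comment> \<open>b0 is a cochain on C, whereas the transfer starts from a C-invariant cochain on
    the whole group; composing with a retraction onto C provides it.\<close>
  obtain \<rho> where \<rho>: "\<And>x. x \<in> carrier G \<Longrightarrow> \<rho> x \<in> C" "\<And>h x. h \<in> C \<Longrightarrow> x \<in> carrier G \<Longrightarrow> \<rho> (h \<otimes> x) = h \<otimes> \<rho> x"
    "\<And>h. h \<in> C \<Longrightarrow> \<rho> h = h"
    by (rule subgroup_retraction[OF C]) (assumption | rule that)+
  define b where "b xs = b0 (map \<rho> xs)" for xs
  have \<rho>C: "map \<rho> xs = xs" if "set xs \<subseteq> C" for xs using that \<rho>(3) by (intro map_idI) auto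
  interpret B: coset_family G p C "Suc (2 * L)" b
  proof (intro coset_family.intro coset_family_axioms.intro fin p C is_group)
    show "inv_on p C (Suc (Suc (2 * L))) b"
      unfolding inv_on_def b_def
    proof (intro ballI allI impI)
      fix h xs assume h: "h \<in> C" and xs: "set xs \<subseteq> carrier G" "length xs = Suc (Suc (2 * L))"
      have "map \<rho> (map (\<lambda>x. h \<otimes> x) xs) = map (\<lambda>x. h \<otimes>\<^bsub>H\<^esub> x) (map \<rho> xs)" using \<rho>(2)[OF h] xs by (auto simp: Hs)
      then show "eqm (int p) (b0 (map \<rho> (map (\<lambda>x. h \<otimes> x) xs))) (b0 (map \<rho> xs))"
        using H.inv_onD[OF b0i, of h "map \<rho> xs"] h \<rho>(1) xs by (auto simp: Hs simp del: map_map)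
    qed
    show "cocyc p (Suc (Suc (2 * L))) b"
      unfolding cocyc_def b_def[abs_def] cobd_map 
    proof (intro allI impI)
      fix xs assume xs: "set xs \<subseteq> carrier G" "length xs = Suc (Suc (Suc (2 * L)))"
      have "set (map \<rho> xs) \<subseteq> carrier H" using \<rho>(1) xs(1) by (auto simp: Hs subset_iff)
      then show "eqm (int p) (cobd b0 (map \<rho> xs)) 0" using xs(2) by (intro H.cocycD[OF b0c]) auto
    qed
  qed
  \<comment> \<open>After retracting all vertices to V, the factor X is evaluated inside V and
    vanishes.\<close>
  have bV: "cobdry p V (Suc (2 * L)) b"
  proof -
    obtain \<sigma> where \<sigma>: "\<And>x. x \<in> carrier G \<Longrightarrow> \<sigma> x \<in> V" "\<And>h x. h \<in> V \<Longrightarrow> x \<in> carrier G \<Longrightarrow> \<sigma> (h \<otimes> x) = h \<otimes> \<sigma> x"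
      by (rule subgroup_retraction[OF V]) (assumption | rule that)+
    have "cobdry p V (Suc (2 * L)) (\<lambda>xs. b (map \<sigma> xs) - b xs)"
      by (rule cobdry_retract[OF VG[OF \<sigma>(1)] \<sigma>(2) inv_on_mono[OF B.b_inv VC] B.b_coc subgroup.subset[OF V]])
    from cobdry_minus[OF this] show ?thesis
    proof (rule cobdry_cong)
      fix xs assume xs: "set xs \<subseteq> carrier G" "length xs = Suc (Suc (2 * L))"
      then obtain x y zs where e: "xs = x # y # zs" by (auto simp: length_Suc_conv)
      have s: "\<sigma> x \<in> V" "\<sigma> y \<in> V" "set (map \<sigma> xs) \<subseteq> C" using \<sigma>(1) xs e VC by auto
      have "b (map \<sigma> xs) = b0 (map \<sigma> xs)" unfolding b_def \<rho>C[OF s(3)] ..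
      also have "\<dots> = X (inv (\<sigma> x) \<otimes> \<sigma> y) * prodc ds (\<sigma> y # map \<sigma> zs)"
        using Hinv[of "\<sigma> x"] s e by (simp add: b0_def H.xcup_simp Hs)
      finally have "int p dvd b (map \<sigma> xs)"
        using XV[of "inv (\<sigma> x) \<otimes> \<sigma> y"] s subgroup.m_inv_closed[OF V] subgroup.m_closed[OF V] by (simp add: eqm_0_iff)
      then show "eqm (int p) (b xs) (- (b (map \<sigma> xs) - b xs))" by (simp add: eqm_def)
    qed
  qed
  show thesis
  proof (rule that[of "2 * L" B.trf])
    show "inv_on p (carrier G) (Suc (Suc (2 * L))) B.trf" by (rule B.trf_inv)
    show "cocyc p (Suc (Suc (2 * L))) B.trf" by (rule B.trf_coc)
    show "cobdry p E (Suc (2 * L)) B.trf" if E: "subgroup E G" "\<And>e. e \<in> E \<Longrightarrow> e [^] p = \<one>" for E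
    proof (rule B.trf_restrict_cobdry[OF E(1) V VC bV])
      fix t e assume te: "t \<in> carrier G" "e \<in> E" "inv t \<otimes> e \<otimes> t \<in> C"
      have "(inv t \<otimes> e \<otimes> t) [^] p = \<one>"
        using conj_pow[OF te(1) subgroup.mem_carrier[OF E(1) te(2)], of p] E(2)[OF te(2)] te(1) by simp
      then show "inv t \<otimes> e \<otimes> t \<in> V" using max te(3) by (simp add: C_def)
    qed
    show "\<not> cobdry p (carrier G) (Suc (2 * L)) B.trf"
    proof
      assume "cobdry p (carrier G) (Suc (2 * L)) B.trf"
      then have 1: "cobdry p C (Suc (2 * L)) B.trf" by (rule cobdry_mono[OF _ subgroup.subset[OF C]])
      let ?M = "{S\<in>B.Cos. \<exists>v\<in>V. v <#\<^bsub>G\<^esub> S \<noteq> S}"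
      have 2: "cobdry p C (Suc (2 * L)) (\<lambda>xs. \<Sum>S\<in>?M. B.fam S xs)"
        by (rule B.moved_part_cobdry[OF finV VC V_pow cen[symmetric]])
      \<comment> \<open>Right multiplication by the representative t commutes with C. It changes
        \<open>fam S\<close> within its class into b0 composed with x |-> t^-1 x t, which depends on
        elements of C only.\<close>
      have 3: "cobdry p C (Suc (2 * L)) (\<lambda>xs. B.fam S (map (\<lambda>x. x \<otimes> Z.rp S) xs) - B.fam S xs)" if S: "S \<in> W" for S
      proof (rule cobdry_retract)
        have SC: "S \<in> B.Cos" using S by (simp add: W_def)
        show "cocyc p (Suc (Suc (2 * L))) (B.fam S)" by (rule B.fam_coc[OF SC])
        have "{h\<in>C. h <#\<^bsub>G\<^esub> S = S} = C" using fixed_iff[OF S] \<tau>C[OF S] CG by auto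
        then show "inv_on p C (Suc (Suc (2 * L))) (B.fam S)" using B.fam_inv[OF SC subgroup.subset[OF C]] by simp
        show "C \<subseteq> carrier G" by (rule subgroup.subset[OF C])
        show "x \<otimes> Z.rp S \<in> carrier G" if "x \<in> carrier G" for x using that t(1)[OF S] by simp
        show "h \<otimes> x \<otimes> Z.rp S = h \<otimes> (x \<otimes> Z.rp S)" if "h \<in> C" "x \<in> carrier G" for h x
          using that CG t(1)[OF S] by (simp add: m_assoc)
      qed
      have "cobdry p C (Suc (2 * L)) (\<lambda>xs. \<Sum>S\<in>W. B.fam S (map (\<lambda>x. x \<otimes> Z.rp S) xs) - B.fam S xs)"
        by (rule cobdry_sum[OF 3])
      from cobdry_add[OF cobdry_add[OF this 1] cobdry_minus[OF 2]]
      have 4: "cobdry p C (Suc (2 * L)) (\<lambda>xs. \<Sum>S\<in>W. B.fam S (map (\<lambda>x. x \<otimes> Z.rp S) xs))"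
      proof (rule cobdry_cong)
        fix xs :: "'a list"
        have un: "B.Cos = W \<union> ?M" and dis: "W \<inter> ?M = {}" by (auto simp: W_def)
        have finM: "finite ?M" using B.Cos_fin by simp
        have "B.trf xs = (\<Sum>S\<in>W \<union> ?M. B.fam S xs)" unfolding B.trf_def by (rule arg_cong[OF un])
        also have "\<dots> = (\<Sum>S\<in>W. B.fam S xs) + (\<Sum>S\<in>?M. B.fam S xs)"
          by (rule sum.union_disjoint[OF finW finM dis])
        finally have "B.trf xs = (\<Sum>S\<in>W. B.fam S xs) + (\<Sum>S\<in>?M. B.fam S xs)" .
        then show "eqm (int p) (\<Sum>S\<in>W. B.fam S (map (\<lambda>x. x \<otimes> Z.rp S) xs))
            ((\<Sum>S\<in>W. B.fam S (map (\<lambda>x. x \<otimes> Z.rp S) xs) - B.fam S xs) + B.trf xs + - (\<Sum>S\<in>?M. B.fam S xs))"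
          by (simp add: sum_subtractf)
      qed
      then obtain u where u: "inv_on p C (Suc (2 * L)) u"
        "\<And>xs. set xs \<subseteq> carrier G \<Longrightarrow> length xs = Suc (Suc (2 * L)) \<Longrightarrow>
          eqm (int p) (\<Sum>S\<in>W. B.fam S (map (\<lambda>x. x \<otimes> Z.rp S) xs)) (cobd u xs)"
        unfolding cobdry_def by blast
      have fb: "B.fam S (map (\<lambda>x. x \<otimes> Z.rp S) xs) = b0 (map (\<tau> S) xs)" if S: "S \<in> W" and xs: "set xs \<subseteq> C" for S xs
      proof -
        have "map (\<lambda>x. inv (Z.rp S) \<otimes> x) (map (\<lambda>x. x \<otimes> Z.rp S) xs) = map (\<tau> S) xs"
          using t(1)[OF S] xs CG by (auto simp: \<tau>_def m_assoc subset_iff)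
        moreover have "set (map (\<tau> S) xs) \<subseteq> C" using \<tau>C[OF S] xs by auto
        ultimately show ?thesis unfolding B.fam_def b_def using \<rho>C by (simp del: map_map)
      qed
      have "H.cobdry p (carrier H) (Suc (2 * L)) (\<lambda>xs. \<Sum>S\<in>W. H.xcup X (prodc ds) (map (\<tau> S) xs))"
        unfolding H.cobdry_def
      proof (intro exI[of _ u] conjI allI impI)
        show "H.inv_on p (carrier H) (Suc (2 * L)) u" using u(1) CG unfolding H.inv_on_def inv_on_def Hs by blast
        fix xs assume xs: "set xs \<subseteq> carrier H" "length xs = Suc (Suc (2 * L))"
        have "(\<Sum>S\<in>W. H.xcup X (prodc ds) (map (\<tau> S) xs)) = (\<Sum>S\<in>W. B.fam S (map (\<lambda>x. x \<otimes> Z.rp S) xs))"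
          using fb xs(1) unfolding b0_def Hs by (intro sum.cong) simp_all
        then show "eqm (int p) (\<Sum>S\<in>W. H.xcup X (prodc ds) (map (\<tau> S) xs)) (cobd u xs)"
          using u(2)[of xs] xs CG by (auto simp: Hs subset_iff)
      qed
      from H.transfer_det[OF \<tau>hom eq_refl[OF \<tau>V] \<beta> c(1) XV r this]
      show False using nd unfolding L_def by blast
    qed
  qed
qed

end

section \<open>The inhomogeneous bar complex\<close>

text \<open>Partial products x, x g_1, x g_1 g_2, ...; the inverse passage is \<open>dif\<close>.
  They translate between inhomogeneous and homogeneous tuples.\<close>

fun run :: "('a \<Rightarrow> 'a \<Rightarrow> 'a) \<Rightarrow> 'a \<Rightarrow> 'a list \<Rightarrow> 'a list" where
  "run m x [] = [x]"
| "run m x (g # gs) = x # run m (m x g) gs"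

fun dif :: "('a \<Rightarrow> 'a \<Rightarrow> 'a) \<Rightarrow> 'a list \<Rightarrow> 'a list" where
  "dif d (x # y # zs) = d x y # dif d (y # zs)"
| "dif d _ = []"

lemma length_run [simp]: "length (run m x gs) = Suc (length gs)"
  by (induction gs arbitrary: x) auto

lemma length_dif [simp]: "length (dif d xs) = length xs - 1"
  by (induction d xs rule: dif.induct) auto

lemma run_butlast: "gs \<noteq> [] \<Longrightarrow> take (length gs) (run m x gs) = run m x (butlast gs)"
proof (induction gs arbitrary: x)
  case (Cons g gs)
  then show ?case by (cases gs) auto
qed simp

lemma run_Cons: obtains ys where "run m x gs = x # ys"
  by (cases gs) auto

section \<open>Comparison of homogeneous and inhomogeneous cochains\<close>

locale mod_bar = group G for G (structure) +
  fixes p :: nat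
  assumes p1: "p > 1"
begin

abbreviation R where "R \<equiv> residue_ring (int p)"

interpretation R: residues "int p" R
  using p1 by (simp add: residues_def)

lemma neg_one_pow: "(\<ominus>\<^bsub>R\<^esub> \<one>\<^bsub>R\<^esub>) [^]\<^bsub>R\<^esub> (k::nat) = (- 1) ^ k mod int p"
proof (induction k)
  case 0
  then show ?case using p1 by (simp add: R.res_one_eq)
next
  case (Suc k)
  have "\<ominus>\<^bsub>R\<^esub> \<one>\<^bsub>R\<^esub> = (- 1) mod int p" by (simp add: R.res_neg_eq R.res_one_eq)
  then show ?case using Suc R.mult_cong[of "(- 1) ^ k" "- 1"] by (simp add: mult.commute)
qed

lemma finsum_mod: "finite A \<Longrightarrow> (\<Oplus>\<^bsub>R\<^esub>i\<in>A. t i mod int p) = (\<Sum>i\<in>A. t i) mod int p"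
proof (induction A rule: finite_induct)
  case empty
  then show ?case by (simp add: R.res_zero_eq)
next
  case (insert i A)
  have "(\<Oplus>\<^bsub>R\<^esub>j\<in>Set.insert i A. t j mod int p) = (t i mod int p) \<oplus>\<^bsub>R\<^esub> (\<Oplus>\<^bsub>R\<^esub>j\<in>A. t j mod int p)"
    using insert.hyps by (intro R.finsum_insert) auto
  then show ?case using insert R.add_cong[of "t i" "\<Sum>i\<in>A. t i"] by simp
qed

text \<open>The inhomogeneous form of a homogeneous cochain, with values brought to their
  representatives in the residue ring.\<close>

definition bar :: "nat \<Rightarrow> ('a list \<Rightarrow> int) \<Rightarrow> 'a list \<Rightarrow> int" where
  "bar n u = (\<lambda>gs\<in>tuples G n. u (run (\<otimes>) \<one> gs) mod int p)"

lemma run_set: "x \<in> carrier G \<Longrightarrow> set gs \<subseteq> carrier G \<Longrightarrow> set (run (\<otimes>) x gs) \<subseteq> carrier G"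
  by (induction gs arbitrary: x) auto

lemma run_map:
  "h \<in> carrier G \<Longrightarrow> x \<in> carrier G \<Longrightarrow> set gs \<subseteq> carrier G \<Longrightarrow> run (\<otimes>) (h \<otimes> x) gs = map (\<lambda>y. h \<otimes> y) (run (\<otimes>) x gs)"
  by (induction gs arbitrary: x) (auto simp: m_assoc)

text \<open>Multiplying two neighbouring entries deletes the partial product between them.\<close>

lemma run_contract:
  "x \<in> carrier G \<Longrightarrow> set gs \<subseteq> carrier G \<Longrightarrow> Suc j < length gs \<Longrightarrow>
     take (Suc j) (run (\<otimes>) x gs) @ drop (Suc (Suc j)) (run (\<otimes>) x gs) = run (\<otimes>) x (contract G j gs)"
proof (induction gs arbitrary: x j)
  case (Cons g gs)
  show ?case
  proof (cases j)
    case 0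
    then obtain h r where gs: "gs = h # r" using Cons.prems by (cases gs) auto
    then show ?thesis using 0 Cons.prems by (simp add: contract_def m_assoc)
  next
    case (Suc i)
    have "contract G (Suc i) (g # gs) = g # contract G i gs" by (simp add: contract_def)
    then show ?thesis using Cons.IH[of "x \<otimes> g" i] Cons.prems Suc by simp
  qed
qed simp

lemma contract_tuples:
  assumes "gs \<in> tuples G (Suc n)" "i < n"
  shows "contract G i gs \<in> tuples G n"
proof -
  have gs: "length gs = Suc n" "set gs \<subseteq> carrier G" using assms(1) by (auto simp: tuples_def)
  have "gs ! i \<in> carrier G" "gs ! Suc i \<in> carrier G" using gs assms(2) nth_mem[of i gs] nth_mem[of "Suc i" gs] by auto
  then show ?thesis using gs assms(2) set_take_drop[OF gs(2)] by (auto simp: contract_def tuples_def)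
qed

lemma run_dif:
  "x \<in> carrier G \<Longrightarrow> set ys \<subseteq> carrier G \<Longrightarrow> run (\<otimes>) x (dif (\<lambda>x y. inv x \<otimes> y) (x # ys)) = x # ys"
  by (induction ys arbitrary: x) (auto simp: m_assoc[symmetric])

lemma dif_run: "x \<in> carrier G \<Longrightarrow> set gs \<subseteq> carrier G \<Longrightarrow> dif (\<lambda>x y. inv x \<otimes> y) (run (\<otimes>) x gs) = gs"
proof (induction gs arbitrary: x)
  case (Cons g gs)
  obtain ys where ys: "run (\<otimes>) (x \<otimes> g) gs = (x \<otimes> g) # ys" by (rule run_Cons)
  have "dif (\<lambda>x y. inv x \<otimes> y) (run (\<otimes>) x (g # gs)) = (inv x \<otimes> (x \<otimes> g)) # dif (\<lambda>x y. inv x \<otimes> y) (run (\<otimes>) (x \<otimes> g) gs)"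
    by (simp add: ys)
  also have "\<dots> = g # gs" using Cons by (simp add: m_assoc[symmetric])
  finally show ?case .
qed simp

lemma dif_set: "set xs \<subseteq> carrier G \<Longrightarrow> set (dif (\<lambda>x y. inv x \<otimes> y) xs) \<subseteq> carrier G"
  by (induction "\<lambda>x y. inv x \<otimes> y" xs rule: dif.induct) auto

lemma dif_map:
  "h \<in> carrier G \<Longrightarrow> set xs \<subseteq> carrier G \<Longrightarrow>
     dif (\<lambda>x y. inv x \<otimes> y) (map (\<lambda>y. h \<otimes> y) xs) = dif (\<lambda>x y. inv x \<otimes> y) xs"
proof (induction xs rule: induct_list012)
  case (3 x y zs)
  then show ?case by (simp add: inv_mult_cancel)
qed simp_all

lemma list_run:
  assumes "set xs \<subseteq> carrier G" "length xs = Suc n"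
  obtains x gs where "x \<in> carrier G" "gs \<in> tuples G n" "xs = map (\<lambda>y. x \<otimes> y) (run (\<otimes>) \<one> gs)"
proof -
  obtain x ys where xs: "xs = x # ys" using assms by (cases xs) auto
  let ?gs = "dif (\<lambda>x y. inv x \<otimes> y) xs"
  have x: "x \<in> carrier G" "set ys \<subseteq> carrier G" using assms xs by auto
  have gs: "set ?gs \<subseteq> carrier G" by (rule dif_set[OF assms(1)])
  have "xs = run (\<otimes>) (x \<otimes> \<one>) ?gs" using run_dif[OF x] x(1) xs by simp
  also have "\<dots> = map (\<lambda>y. x \<otimes> y) (run (\<otimes>) \<one> ?gs)" by (rule run_map[OF x(1) one_closed gs])
  finally show thesis using that[OF x(1), of ?gs] gs assms(2) by (simp add: tuples_def)
qed

lemma bar_carrier: "bar n u \<in> carrier (cochains G R n)"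
  by (auto simp: bar_def cochains_def)

lemma bar_cong:
  assumes "\<And>xs. set xs \<subseteq> carrier G \<Longrightarrow> length xs = Suc n \<Longrightarrow> eqm (int p) (u xs) (v xs)"
  shows "bar n u = bar n v"
  unfolding bar_def
proof (rule restrict_ext)
  fix gs assume "gs \<in> tuples G n"
  then have "eqm (int p) (u (run (\<otimes>) \<one> gs)) (v (run (\<otimes>) \<one> gs))" by (intro assms run_set) (auto simp: tuples_def)
  then show "u (run (\<otimes>) \<one> gs) mod int p = v (run (\<otimes>) \<one> gs) mod int p" by (simp add: eqm_def mod_eq_dvd_iff)
qed

text \<open>Every list of vertices is a translate of a list of partial products, so invariant
  cochains are determined modulo p by their inhomogeneous form.\<close>

lemma bar_eqD:
  assumes eq: "bar n u = bar n v" and u: "inv_on p (carrier G) (Suc n) u" and v: "inv_on p (carrier G) (Suc n) v"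
    and xs: "set xs \<subseteq> carrier G" "length xs = Suc n"
  shows "eqm (int p) (u xs) (v xs)"
proof -
  obtain x gs where x: "x \<in> carrier G" and gs: "gs \<in> tuples G n" and e: "xs = map (\<lambda>y. x \<otimes> y) (run (\<otimes>) \<one> gs)"
    by (rule list_run[OF xs])
  let ?ys = "run (\<otimes>) \<one> gs"
  have ys: "set ?ys \<subseteq> carrier G" "length ?ys = Suc n" using gs run_set[OF one_closed, of gs] by (auto simp: tuples_def)
  have "u ?ys mod int p = v ?ys mod int p" using fun_cong[OF eq, of gs] gs by (simp add: bar_def)
  then have "eqm (int p) (u ?ys) (v ?ys)" by (simp add: eqm_def mod_eq_dvd_iff)
  with inv_onD[OF u x ys] have "eqm (int p) (u xs) (v ?ys)" unfolding e by (rule eqm_trans)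
  then show ?thesis using eqm_sym[OF inv_onD[OF v x ys]] unfolding e by (rule eqm_trans)
qed

lemma bar_mult: "bar n u \<otimes>\<^bsub>cochains G R n\<^esub> bar n v = bar n (\<lambda>xs. u xs + v xs)"
  unfolding bar_def cochains_def by (auto simp: fun_eq_iff R.add_cong)

lemma bar_one: "\<one>\<^bsub>cochains G R n\<^esub> = bar n (\<lambda>_. 0)"
  unfolding bar_def cochains_def by (simp add: R.res_zero_eq)

lemma bar_surj:
  assumes w: "w \<in> carrier (cochains G R n)"
  obtains u where "inv_on p (carrier G) (Suc n) u" "w = bar n u"
proof (rule that[of "\<lambda>xs. w (dif (\<lambda>x y. inv x \<otimes> y) xs)"])
  show "inv_on p (carrier G) (Suc n) (\<lambda>xs. w (dif (\<lambda>x y. inv x \<otimes> y) xs))"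
    unfolding inv_on_def using dif_map by (simp del: dif.simps)
  show "w = bar n (\<lambda>xs. w (dif (\<lambda>x y. inv x \<otimes> y) xs))"
  proof
    fix gs
    show "w gs = bar n (\<lambda>xs. w (dif (\<lambda>x y. inv x \<otimes> y) xs)) gs"
    proof (cases "gs \<in> tuples G n")
      case True
      then have "w gs \<in> carrier R" using w by (auto simp: cochains_def)
      then have "w gs mod int p = w gs" by (simp add: R.res_carrier_eq)
      then show ?thesis using True dif_run[OF one_closed, of gs] by (simp add: bar_def tuples_def)
    next
      case False
      then show ?thesis using w PiE_arb[of w "tuples G n" _ gs] by (simp add: bar_def cochains_def)
    qed
  qed
qed

text \<open>All faces of a list of partial products are again such lists, except the one without the
  initial unit; invariance translates that face back.\<close>

lemma coboundary_bar:
  assumes u: "inv_on p (carrier G) (Suc n) u"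
  shows "coboundary G R n (bar n u) = bar (Suc n) (cobd u)"
  unfolding coboundary_def bar_def[of "Suc n"]
proof (rule restrict_ext)
  fix gs assume gs: "gs \<in> tuples G (Suc n)"
  then obtain g hs where e: "gs = g # hs" and g: "g \<in> carrier G" and hs: "set hs \<subseteq> carrier G" "length hs = n"
    by (auto simp: tuples_def length_Suc_conv)
  let ?u = "\<lambda>gs. u (run (\<otimes>) \<one> gs)" and ?xs = "run (\<otimes>) \<one> gs"
  have t: "tl gs \<in> tuples G n" using e hs by (simp add: tuples_def)
  have b: "butlast gs \<in> tuples G n" using gs by (auto simp: tuples_def dest: in_set_butlastD)
  have s: "(\<Oplus>\<^bsub>R\<^esub>i\<in>{..<n}. (\<ominus>\<^bsub>R\<^esub> \<one>\<^bsub>R\<^esub>) [^]\<^bsub>R\<^esub> Suc i \<otimes>\<^bsub>R\<^esub> bar n u (contract G i gs))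
      = (\<Sum>i<n. (- 1) ^ Suc i * ?u (contract G i gs)) mod int p"
    unfolding finsum_mod[OF finite_lessThan, symmetric]
  proof (rule R.finsum_cong')
    show "(\<ominus>\<^bsub>R\<^esub> \<one>\<^bsub>R\<^esub>) [^]\<^bsub>R\<^esub> Suc i \<otimes>\<^bsub>R\<^esub> bar n u (contract G i gs) = (- 1) ^ Suc i * ?u (contract G i gs) mod int p"
      if "i \<in> {..<n}" for i
      unfolding neg_one_pow using contract_tuples[OF gs, of i] that R.mult_cong by (simp add: bar_def)
  qed auto
  have l: "(\<ominus>\<^bsub>R\<^esub> \<one>\<^bsub>R\<^esub>) [^]\<^bsub>R\<^esub> Suc n \<otimes>\<^bsub>R\<^esub> bar n u (butlast gs) = (- 1) ^ Suc n * ?u (butlast gs) mod int p"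
    unfolding neg_one_pow using b R.mult_cong by (simp add: bar_def)
  have c: "cobd u ?xs = u (map (\<lambda>y. g \<otimes> y) (run (\<otimes>) \<one> hs))
      + ((\<Sum>i<n. (- 1) ^ Suc i * ?u (contract G i gs)) + (- 1) ^ Suc n * ?u (butlast gs))"
  proof -
    have len: "length ?xs = Suc (Suc n)" using e hs by simp
    have "cobd u ?xs = (\<Sum>i<Suc (Suc n). (- 1) ^ i * u (take i ?xs @ drop (Suc i) ?xs))"
      unfolding cobd_index len ..
    also have "\<dots> = u (drop 1 ?xs) + (\<Sum>i<Suc n. (- 1) ^ Suc i * u (take (Suc i) ?xs @ drop (Suc (Suc i)) ?xs))"
      by (subst sum.lessThan_Suc_shift) simp
    also have "drop 1 ?xs = map (\<lambda>y. g \<otimes> y) (run (\<otimes>) \<one> hs)" using e g hs run_map[OF g one_closed hs(1)] by simp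
    also have "(\<Sum>i<Suc n. (- 1) ^ Suc i * u (take (Suc i) ?xs @ drop (Suc (Suc i)) ?xs))
        = (\<Sum>i<n. (- 1) ^ Suc i * u (take (Suc i) ?xs @ drop (Suc (Suc i)) ?xs))
          + (- 1) ^ Suc n * u (take (Suc n) ?xs @ drop (Suc (Suc n)) ?xs)" by simp
    also have "take (Suc n) ?xs @ drop (Suc (Suc n)) ?xs = run (\<otimes>) \<one> (butlast gs)"
      using run_butlast[of gs "(\<otimes>)" \<one>] e hs len by simp
    also have "(\<Sum>i<n. (- 1) ^ Suc i * u (take (Suc i) ?xs @ drop (Suc (Suc i)) ?xs))
        = (\<Sum>i<n. (- 1) ^ Suc i * ?u (contract G i gs))"
    proof (intro sum.cong refl)
      fix i assume "i \<in> {..<n}"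
      then have "take (Suc i) ?xs @ drop (Suc (Suc i)) ?xs = run (\<otimes>) \<one> (contract G i gs)"
        using e g hs by (intro run_contract) auto
      then show "(- 1) ^ Suc i * u (take (Suc i) ?xs @ drop (Suc (Suc i)) ?xs) = (- 1) ^ Suc i * ?u (contract G i gs)"
        by (simp only:)
    qed
    finally show ?thesis .
  qed
  have "eqm (int p) (u (map (\<lambda>y. g \<otimes> y) (run (\<otimes>) \<one> hs))) (?u hs)"
    using run_set[OF one_closed hs(1)] hs(2) by (intro inv_onD[OF u g]) auto
  then have "eqm (int p) (cobd u ?xs) (?u hs + ((\<Sum>i<n. (- 1) ^ Suc i * ?u (contract G i gs)) + (- 1) ^ Suc n * ?u (butlast gs)))"
    unfolding c by (intro eqm_add eqm_refl)
  then have "cobd u ?xs mod int p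
      = (?u hs + (\<Sum>i<n. (- 1) ^ Suc i * ?u (contract G i gs)) + (- 1) ^ Suc n * ?u (butlast gs)) mod int p"
    by (simp only: eqm_def mod_eq_dvd_iff add.assoc)
  moreover have "bar n u (tl gs) = ?u hs mod int p" using t e by (simp add: bar_def)
  ultimately show "bar n u (tl gs) \<oplus>\<^bsub>R\<^esub> (\<Oplus>\<^bsub>R\<^esub>i\<in>{..<n}. (\<ominus>\<^bsub>R\<^esub> \<one>\<^bsub>R\<^esub>) [^]\<^bsub>R\<^esub> Suc i \<otimes>\<^bsub>R\<^esub> bar n u (contract G i gs))
      \<oplus>\<^bsub>R\<^esub> (\<ominus>\<^bsub>R\<^esub> \<one>\<^bsub>R\<^esub>) [^]\<^bsub>R\<^esub> Suc n \<otimes>\<^bsub>R\<^esub> bar n u (butlast gs) = cobd u ?xs mod int p"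
    unfolding s l by (simp only: R.add_cong)
qed

lemma cobd_inv: "inv_on p H n u \<Longrightarrow> H \<subseteq> carrier G \<Longrightarrow> inv_on p H (Suc n) (cobd u)"
  unfolding inv_on_def[of p H "Suc n"] cobd_map[symmetric]
  by (intro ballI allI impI cobd_cong[where A = "carrier G" and n = n]) (auto intro: inv_onD)

lemma coboundaries_Suc: "coboundaries G R (Suc k) = {bar (Suc k) (cobd u) |u. inv_on p (carrier G) (Suc k) u}"
proof -
  have "coboundary G R k ` carrier (cochains G R k) = {bar (Suc k) (cobd u) |u. inv_on p (carrier G) (Suc k) u}"
  proof (intro equalityI subsetI)
    fix x assume "x \<in> coboundary G R k ` carrier (cochains G R k)"
    then obtain w where w: "w \<in> carrier (cochains G R k)" "x = coboundary G R k w" by blast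
    obtain u where u: "inv_on p (carrier G) (Suc k) u" "w = bar k u" by (rule bar_surj[OF w(1)])
    then have "x = bar (Suc k) (cobd u)" using w(2) coboundary_bar[OF u(1)] by simp
    then show "x \<in> {bar (Suc k) (cobd u) |u. inv_on p (carrier G) (Suc k) u}" using u(1) by blast
  next
    fix x assume "x \<in> {bar (Suc k) (cobd u) |u. inv_on p (carrier G) (Suc k) u}"
    then obtain u where u: "inv_on p (carrier G) (Suc k) u" "x = bar (Suc k) (cobd u)" by blast
    then have "x = coboundary G R k (bar k u)" using coboundary_bar[OF u(1)] by simp
    then show "x \<in> coboundary G R k ` carrier (cochains G R k)" using bar_carrier by blast
  qed
  then show ?thesis by (simp add: coboundaries_def)
qed

lemma cocycles_simps: "\<one>\<^bsub>cocycles G R n\<^esub> = bar n (\<lambda>_. 0)" "x \<otimes>\<^bsub>cocycles G R n\<^esub> y = x \<otimes>\<^bsub>cochains G R n\<^esub> y"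
  by (simp_all add: cocycles_def bar_one)

lemma coset_coboundary:
  assumes v: "inv_on p (carrier G) (Suc k) v"
  shows "coboundaries G R (Suc k) #>\<^bsub>cocycles G R (Suc k)\<^esub> bar (Suc k) (cobd v) = coboundaries G R (Suc k)"
proof -
  have sum: "bar (Suc k) (cobd u) \<otimes>\<^bsub>cochains G R (Suc k)\<^esub> bar (Suc k) (cobd v) = bar (Suc k) (cobd (\<lambda>xs. u xs + v xs))" for u
    unfolding bar_mult by (rule arg_cong[where f = "bar (Suc k)"]) (simp add: fun_eq_iff cobd_add)
  show ?thesis
  proof (intro equalityI subsetI)
    fix x assume "x \<in> coboundaries G R (Suc k) #>\<^bsub>cocycles G R (Suc k)\<^esub> bar (Suc k) (cobd v)"
    then obtain u where u: "inv_on p (carrier G) (Suc k) u" "x = bar (Suc k) (cobd (\<lambda>xs. u xs + v xs))"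
      unfolding r_coset_def coboundaries_Suc cocycles_simps using sum by auto
    have "inv_on p (carrier G) (Suc k) (\<lambda>xs. u xs + v xs)"
      using u(1) v unfolding inv_on_def by (auto intro: eqm_add)
    then show "x \<in> coboundaries G R (Suc k)" unfolding coboundaries_Suc u(2) by blast
  next
    fix x assume "x \<in> coboundaries G R (Suc k)"
    then obtain w where w: "inv_on p (carrier G) (Suc k) w" "x = bar (Suc k) (cobd w)" unfolding coboundaries_Suc by blast
    have d: "inv_on p (carrier G) (Suc k) (\<lambda>xs. w xs - v xs)"
      using w(1) v unfolding inv_on_def by (auto intro: eqm_diff)
    have "x = bar (Suc k) (cobd (\<lambda>xs. w xs - v xs)) \<otimes>\<^bsub>cochains G R (Suc k)\<^esub> bar (Suc k) (cobd v)"
      unfolding sum w(2) by simp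
    then show "x \<in> coboundaries G R (Suc k) #>\<^bsub>cocycles G R (Suc k)\<^esub> bar (Suc k) (cobd v)"
      unfolding r_coset_def coboundaries_Suc cocycles_simps using d by blast
  qed
qed

lemma coset_one: "coboundaries G R n #>\<^bsub>cocycles G R n\<^esub> \<one>\<^bsub>cocycles G R n\<^esub> = coboundaries G R n"
proof (cases n)
  case 0
  then show ?thesis unfolding r_coset_def cocycles_simps by (simp add: coboundaries_def bar_one bar_mult)
next
  case (Suc k)
  have "bar n (\<lambda>_. 0) = bar (Suc k) (cobd (\<lambda>_. 0))" unfolding Suc by (intro bar_cong) (simp add: cobd_zero)
  moreover have "inv_on p (carrier G) (Suc k) (\<lambda>_. 0)" by (simp add: inv_on_def)
  ultimately show ?thesis using coset_coboundary unfolding Suc cocycles_simps by simp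
qed

lemma bar_cocycle:
  assumes "inv_on p (carrier G) (Suc n) u" "cocyc p (Suc n) u"
  shows "bar n u \<in> carrier (cocycles G R n)"
proof -
  have "coboundary G R n (bar n u) = bar (Suc n) (\<lambda>_. 0)"
    unfolding coboundary_bar[OF assms(1)] by (intro bar_cong cocycD[OF assms(2)])
  then show ?thesis using bar_carrier[of n u] by (simp add: cocycles_def kernel_def bar_one)
qed

lemma class_cohomology:
  "z \<in> carrier (cocycles G R n) \<Longrightarrow> coboundaries G R n #>\<^bsub>cocycles G R n\<^esub> z \<in> carrier (cohomology G R n)"
  by (auto simp: cohomology_def carrier_FactGroup)

lemma one_cohomology: "coboundaries G R n \<in> carrier (cohomology G R n)"
proof -
  have "bar n (\<lambda>_. 0) \<in> carrier (cocycles G R n)"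
    by (intro bar_cocycle) (auto simp: inv_on_def cocyc_def cobd_zero)
  from class_cohomology[OF this] show ?thesis using coset_one[of n] unfolding cocycles_simps by simp
qed

text \<open>Every representative of c restricts to a coboundary, so the set whose element
  \<open>restriction\<close> extracts is the singleton of the zero class.\<close>

lemma restriction_trivial:
  assumes H: "subgroup H G" and c: "c \<noteq> {}"
    and r: "\<And>g. g \<in> c \<Longrightarrow> \<exists>z. g = bar (Suc k) z \<and> cobdry p H (Suc k) z"
  shows "restriction G R H (Suc k) c = coboundaries (G\<lparr>carrier := H\<rparr>) R (Suc k)"
proof -
  let ?E = "G\<lparr>carrier := H\<rparr>"
  interpret E: mod_bar ?E p
    using subgroup_imp_group[OF H] p1 by (simp add: mod_bar_def mod_bar_axioms_def)
  have HG: "H \<subseteq> carrier G" by (rule subgroup.subset[OF H])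
  have "cohomology_class ?E R (Suc k) (restrict g (tuples ?E (Suc k))) = coboundaries ?E R (Suc k)" if g: "g \<in> c" for g
  proof -
    obtain z where z: "g = bar (Suc k) z" "cobdry p H (Suc k) z" using r[OF g] by blast
    obtain u where u: "inv_on p H (Suc k) u"
      "\<And>xs. set xs \<subseteq> carrier G \<Longrightarrow> length xs = Suc (Suc k) \<Longrightarrow> eqm (int p) (z xs) (cobd u xs)"
      using z(2) unfolding cobdry_def by blast
    have "restrict g (tuples ?E (Suc k)) = E.bar (Suc k) z"
      unfolding z(1) bar_def E.bar_def using HG by (auto simp: fun_eq_iff tuples_def)
    also have "\<dots> = E.bar (Suc k) (cobd u)" using HG by (intro E.bar_cong u(2)) auto
    finally have e: "restrict g (tuples ?E (Suc k)) = E.bar (Suc k) (cobd u)" .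
    have "E.inv_on p (carrier ?E) (Suc k) u" unfolding E.inv_on_def using inv_onD[OF u(1)] HG by auto
    from E.coset_coboundary[OF this] show ?thesis unfolding cohomology_class_def e .
  qed
  then have "(\<lambda>g. cohomology_class ?E R (Suc k) (restrict g (tuples ?E (Suc k)))) ` c = {coboundaries ?E R (Suc k)}"
    using c by (simp add: image_constant_conv cong: image_cong_simp)
  then show ?thesis unfolding restriction_def by simp
qed

lemma mod_cohomologyI:
  assumes "\<And>n. x n \<in> carrier (cohomology G R n)" "finite {n. x n \<noteq> coboundaries G R n}"
  shows "x \<in> carrier (mod_cohomology p G)"
  unfolding mod_cohomology_def sum_group_def carrier_subgroup_generated
  using assms by (intro generate.incl) (auto simp: cohomology_def PiE_iff)

text \<open>Two elements of the direct sum share all restrictions: zero, and the element whose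
  component in degree \<open>Suc k\<close> is the class of f.\<close>

lemma not_reduced:
  assumes inv: "inv_on p (carrier G) (Suc (Suc k)) f" and coc: "cocyc p (Suc (Suc k)) f"
    and E: "\<And>E. E \<in> elementary_abelian_subgroups p G \<Longrightarrow> cobdry p E (Suc k) f"
    and n: "\<not> cobdry p (carrier G) (Suc k) f"
  shows "\<not> reduced_mod_cohomology p G"
proof
  assume red: "reduced_mod_cohomology p G"
  let ?N = "Suc k"
  define y0 where "y0 = (\<lambda>n. coboundaries G R n)"
  define c1 where "c1 = coboundaries G R ?N #>\<^bsub>cocycles G R ?N\<^esub> bar ?N f"
  define y1 where "y1 = y0(?N := c1)"
  have z: "inv_on p H n (\<lambda>_. 0)" for H n by (simp add: inv_on_def)
  have F: "bar ?N f \<in> carrier (cocycles G R ?N)" by (rule bar_cocycle[OF inv coc])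
  have y0: "y0 \<in> carrier (mod_cohomology p G)"
    by (rule mod_cohomologyI) (simp_all add: y0_def one_cohomology)
  have "{n. y1 n \<noteq> coboundaries G R n} \<subseteq> {?N}" by (auto simp: y1_def y0_def)
  then have "finite {n. y1 n \<noteq> coboundaries G R n}" by (rule finite_subset) simp
  then have y1: "y1 \<in> carrier (mod_cohomology p G)"
    using class_cohomology[OF F] by (intro mod_cohomologyI) (auto simp: y1_def y0_def c1_def one_cohomology)
  have c1_mem: "\<exists>w. inv_on p (carrier G) (Suc k) w \<and> g = bar ?N (\<lambda>xs. cobd w xs + f xs)" if "g \<in> c1" for g
    using that unfolding c1_def r_coset_def coboundaries_Suc cocycles_simps by (auto simp: bar_mult)
  have F1: "bar ?N f \<in> c1"
  proof -
    have "bar ?N (cobd (\<lambda>_. 0)) \<in> coboundaries G R ?N" unfolding coboundaries_Suc using z by blast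
    moreover have "bar ?N f = bar ?N (cobd (\<lambda>_. 0)) \<otimes>\<^bsub>cochains G R ?N\<^esub> bar ?N f"
      unfolding bar_mult by (simp add: cobd_zero)
    ultimately show ?thesis unfolding c1_def r_coset_def cocycles_simps by blast
  qed
  have "mod_restriction p G E y1 = mod_restriction p G E y0" if EE: "E \<in> elementary_abelian_subgroups p G" for E
  proof
    fix m
    have sub: "subgroup E G" using EE by (simp add: elementary_abelian_subgroups_def)
    have EG: "E \<subseteq> carrier G" by (rule subgroup.subset[OF sub])
    have cb: "cobdry p E ?N (cobd w)" if "inv_on p (carrier G) (Suc k) w" for w
      unfolding cobdry_def using inv_on_mono[OF that EG] by blast
    have "restriction G R E ?N c1 = coboundaries (G\<lparr>carrier := E\<rparr>) R ?N"
    proof (rule restriction_trivial[OF sub])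
      show "c1 \<noteq> {}" using F1 by blast
      fix g assume "g \<in> c1"
      then obtain w where w: "inv_on p (carrier G) (Suc k) w" "g = bar ?N (\<lambda>xs. cobd w xs + f xs)" using c1_mem by blast
      show "\<exists>u. g = bar ?N u \<and> cobdry p E ?N u"
        by (rule exI[of _ "\<lambda>xs. cobd w xs + f xs"], rule conjI[OF w(2) cobdry_add[OF cb[OF w(1)] E[OF EE]]])
    qed
    moreover have "restriction G R E ?N (y0 ?N) = coboundaries (G\<lparr>carrier := E\<rparr>) R ?N"
      unfolding y0_def
    proof (rule restriction_trivial[OF sub])
      show "coboundaries G R ?N \<noteq> {}" unfolding coboundaries_Suc using z by blast
      fix g assume "g \<in> coboundaries G R ?N"
      then obtain w where w: "inv_on p (carrier G) (Suc k) w" "g = bar ?N (cobd w)" unfolding coboundaries_Suc by blast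
      show "\<exists>u. g = bar ?N u \<and> cobdry p E ?N u" by (rule exI[of _ "cobd w"], rule conjI[OF w(2) cb[OF w(1)]])
    qed
    ultimately show "mod_restriction p G E y1 m = mod_restriction p G E y0 m"
      by (simp add: mod_restriction_def y1_def)
  qed
  then have "(\<lambda>E\<in>elementary_abelian_subgroups p G. mod_restriction p G E y1)
      = (\<lambda>E\<in>elementary_abelian_subgroups p G. mod_restriction p G E y0)" by (intro restrict_ext)
  then have "y1 = y0" using red y0 y1 unfolding reduced_mod_cohomology_def by (auto dest: inj_onD)
  then have "c1 = coboundaries G R ?N" by (metis fun_upd_same y0_def y1_def)
  then have "bar ?N f \<in> coboundaries G R ?N" using F1 by simp
  then obtain u where u: "inv_on p (carrier G) (Suc k) u" "bar ?N f = bar ?N (cobd u)"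
    unfolding coboundaries_Suc by blast
  have "eqm (int p) (f xs) (cobd u xs)" if "set xs \<subseteq> carrier G" "length xs = Suc ?N" for xs
    by (rule bar_eqD[OF u(2) inv cobd_inv[OF u(1)] that]) simp
  then show False using n u(1) unfolding cobdry_def by blast
qed

end

section \<open>Outer automorphisms of an abelian group, and maximality of V\<close>

lemma (in comm_group) Out0_self_trivial: "trivial_group (Out0 G (carrier G))"
proof -
  define i where "i = (\<lambda>x\<in>carrier G. x)"
  have "Inn G = {i}"
  proof -
    have "(\<lambda>x\<in>carrier G. g \<otimes> x \<otimes> inv g) = i" if "g \<in> carrier G" for g
      unfolding i_def
    proof (rule restrict_ext)
      fix x assume x: "x \<in> carrier G"
      have "g \<otimes> x \<otimes> inv g = x \<otimes> (g \<otimes> inv g)" using that x by (simp only: m_comm[of g x] m_assoc inv_closed)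
      then show "g \<otimes> x \<otimes> inv g = x" using that x by simp
    qed
    then show ?thesis unfolding Inn_def using one_closed by (auto simp: image_iff)
  qed
  note Inn = this
  have iB: "i \<in> Bij (carrier G)" unfolding i_def by (rule id_Bij)
  have m: "i \<otimes>\<^bsub>AutoGroup G\<^esub> i = i"
    using iB by (simp add: AutoGroup_def BijGroup_def) (auto simp: i_def compose_def fun_eq_iff)
  have fix_eq: "{f \<in> carrier (AutoGroup G). \<forall>v\<in>carrier G. f v = v} = {i}"
  proof (intro equalityI subsetI)
    fix f assume f: "f \<in> {f \<in> carrier (AutoGroup G). \<forall>v\<in>carrier G. f v = v}"
    then have "f \<in> extensional (carrier G)" by (simp add: AutoGroup_def auto_def Bij_def)
    then have "f = i" using f by (intro extensionalityI[of _ "carrier G"]) (auto simp: i_def)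
    then show "f \<in> {i}" by simp
  qed (use id_in_auto in \<open>auto simp: i_def AutoGroup_def\<close>)
  have car: "carrier (Out0 G (carrier G)) = {{i}}"
    unfolding Out0_def fix_eq Inn by (simp add: r_coset_def m)
  have one: "\<one>\<^bsub>Out0 G (carrier G)\<^esub> = {i}" by (simp add: Out0_def Out_def Inn)
  have mult: "{i} \<otimes>\<^bsub>Out0 G (carrier G)\<^esub> {i} = {i}" by (simp add: Out0_def Out_def set_mult_def m)
  have "group (Out0 G (carrier G))" by (rule groupI) (auto simp: car one mult)
  then show ?thesis unfolding trivial_group_def car one by simp
qed

text \<open>V together with d generates an elementary abelian subgroup, which by maximality is
  V.\<close>

lemma (in group) centralizer_exponent_p:
  assumes p: "p > 0" and V: "maximal_elementary_abelian p G V" and d: "d \<in> centralizer G V" "d [^] (p::nat) = \<one>"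
  shows "d \<in> V"
proof -
  have Vel: "subgroup V G" "comm_group (G\<lparr>carrier := V\<rparr>)" "\<And>v. v \<in> V \<Longrightarrow> v [^] p = \<one>"
    using V by (auto simp: maximal_elementary_abelian_def elementary_abelian_subgroups_def)
  have VG: "v \<in> carrier G" if "v \<in> V" for v using subgroup.mem_carrier[OF Vel(1) that] .
  have Vc: "v \<otimes> w = w \<otimes> v" if "v \<in> V" "w \<in> V" for v w
    using comm_monoid.m_comm[OF comm_group.axioms(1)[OF Vel(2)], of v w] that by simp
  have dG: "d \<in> carrier G" and dc: "\<And>v. v \<in> V \<Longrightarrow> d \<otimes> v = v \<otimes> d" using d(1) by (auto simp: centralizer_def)
  let ?D = "{u \<otimes> d [^] i |u i::nat. u \<in> V}"
  have D: "subgroup ?D G"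
    using d(2) subgroup.one_closed[OF Vel(1)] by (intro powers_subgroup[OF Vel(1) dG _ p dc[symmetric]]) auto
  have dcp: "d [^] i \<otimes> w = w \<otimes> d [^] i" if w: "w \<in> V" for w and i :: nat
  proof (induction i)
    case (Suc i)
    have "d [^] Suc i \<otimes> w = d [^] i \<otimes> (w \<otimes> d)" using dc[OF w] VG[OF w] dG by (simp add: m_assoc)
    also have "\<dots> = w \<otimes> d [^] Suc i" using Suc VG[OF w] dG by (simp add: m_assoc[symmetric])
    finally show ?case .
  qed (use VG[OF w] in simp)
  have "?D \<in> elementary_abelian_subgroups p G"
    unfolding elementary_abelian_subgroups_def
  proof (intro CollectI conjI ballI)
    show "comm_group (G\<lparr>carrier := ?D\<rparr>)"
    proof (rule group.group_comm_groupI[OF subgroup_imp_group[OF D]])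
      fix x y assume "x \<in> carrier (G\<lparr>carrier := ?D\<rparr>)" "y \<in> carrier (G\<lparr>carrier := ?D\<rparr>)"
      then obtain u w and i j :: nat where u: "u \<in> V" "x = u \<otimes> d [^] i" and w: "w \<in> V" "y = w \<otimes> d [^] j" by auto
      have 1: "(a \<otimes> d [^] i) \<otimes> (b \<otimes> d [^] j) = (a \<otimes> b) \<otimes> d [^] (i + j)" if "a \<in> V" "b \<in> V" for a b and i j :: nat
      proof -
        have "(a \<otimes> d [^] i) \<otimes> (b \<otimes> d [^] j) = a \<otimes> (d [^] i \<otimes> b) \<otimes> d [^] j" using VG that dG by (simp add: m_assoc)
        also have "\<dots> = (a \<otimes> b) \<otimes> d [^] (i + j)" unfolding dcp[OF that(2)] using VG that dG by (simp add: m_assoc nat_pow_mult)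
        finally show ?thesis .
      qed
      have "x \<otimes> y = y \<otimes> x" unfolding u(2) w(2) 1[OF u(1) w(1)] 1[OF w(1) u(1)] Vc[OF u(1) w(1)] by (simp only: add.commute)
      then show "x \<otimes>\<^bsub>G\<lparr>carrier := ?D\<rparr>\<^esub> y = y \<otimes>\<^bsub>G\<lparr>carrier := ?D\<rparr>\<^esub> x" by simp
    qed
    fix x assume "x \<in> ?D"
    then obtain u and i :: nat where u: "u \<in> V" "x = u \<otimes> d [^] i" by blast
    have "x [^] p = u [^] p \<otimes> (d [^] i) [^] p" unfolding u(2) using dcp[OF u(1), of i] VG[OF u(1)] dG by (intro pow_mult_distrib) auto
    also have "(d [^] i) [^] p = (d [^] p) [^] i" using dG by (simp add: nat_pow_pow mult.commute)
    finally show "x [^] p = \<one>" using Vel(3)[OF u(1)] d(2) by simp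
  qed (rule D)
  moreover have "V \<subseteq> ?D"
  proof
    fix v assume v: "v \<in> V"
    then have "v = v \<otimes> d [^] (0::nat)" using VG by simp
    then show "v \<in> ?D" using v by blast
  qed
  ultimately have "?D = V" using V unfolding maximal_elementary_abelian_def by blast
  moreover have "d \<in> ?D"
  proof -
    have "d = \<one> \<otimes> d [^] (1::nat)" using dG by simp
    then show ?thesis using subgroup.one_closed[OF Vel(1)] by blast
  qed
  ultimately show ?thesis by simp
qed

theorem proposition2p5:
  fixes p :: nat and P :: "('a, 'b) monoid_scheme" and V :: "'a set"
  assumes "Factorial_Ring.prime p"
    and "finite_p_group p P"
    and "reduced_mod_cohomology p P"
    and "maximal_elementary_abelian p P V"
  shows "centralizer P V = V \<and> trivial_group (Out0 (P\<lparr>carrier := centralizer P V\<rparr>) V)"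
proof -
  obtain n where P: "group P" "finite (carrier P)" "Coset.order P = p ^ n"
    using assms(2) by (auto simp: finite_p_group_def)
  interpret group P by (rule P(1))
  have V: "subgroup V P" "comm_group (P\<lparr>carrier := V\<rparr>)" "\<And>v. v \<in> V \<Longrightarrow> v [^]\<^bsub>P\<^esub> p = \<one>\<^bsub>P\<^esub>"
    using assms(4) by (auto simp: maximal_elementary_abelian_def elementary_abelian_subgroups_def)
  have V_comm: "v \<otimes>\<^bsub>P\<^esub> w = w \<otimes>\<^bsub>P\<^esub> v" if "v \<in> V" "w \<in> V" for v w
    using comm_monoid.m_comm[OF comm_group.axioms(1)[OF V(2)], of v w] that by simp
  interpret bar: mod_bar P p
    using P(1) prime_gt_1_nat[OF assms(1)] by (simp add: mod_bar_def mod_bar_axioms_def)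
  have C: "centralizer P V = V"
  proof (rule ccontr)
    assume ne: "centralizer P V \<noteq> V"
    show False
    proof (rule undetected_cocycle[OF P(2) assms(1) P(3) V(1) V_comm V(3)
          centralizer_exponent_p[OF prime_gt_0_nat[OF assms(1)] assms(4)] ne])
      fix k f
      assume f: "inv_on p (carrier P) (Suc (Suc k)) f" "cocyc p (Suc (Suc k)) f"
        "\<And>E. subgroup E P \<Longrightarrow> (\<And>e. e \<in> E \<Longrightarrow> e [^]\<^bsub>P\<^esub> p = \<one>\<^bsub>P\<^esub>) \<Longrightarrow> cobdry p E (Suc k) f"
        "\<not> cobdry p (carrier P) (Suc k) f"
      have "\<not> reduced_mod_cohomology p P"
        by (rule bar.not_reduced[OF f(1,2) f(3) f(4)]) (auto simp: elementary_abelian_subgroups_def)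
      then show False using assms(3) by simp
    qed
  qed
  have "trivial_group (Out0 (P\<lparr>carrier := V\<rparr>) (carrier (P\<lparr>carrier := V\<rparr>)))"
    by (rule comm_group.Out0_self_trivial[OF V(2)])
  then show ?thesis unfolding C by simp
qed

end
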